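(* Let $h$ be a normal operator in a von Neumann algebra $\mathcal{M}$. (1) If $\mathcal{M}$ is finite, then the norm closure $\overline{\mathcal{U}(h)}^{\|\cdot\|}$ is strong-closed. (2) If $\mathcal{M}$ is properly infinite, the following conditions are equivalent: (a) $\overline{\mathcal{U}(h)}^{\|\cdot\|}$ meets the center of $\mathcal{M}$; (b) $h$ belongs to the center of $\mathcal{M}$; (c) $\overline{\mathcal{U}(h)}^{\|\cdot\|}=\overline{\mathcal{U}(h)}^{s}$; (d) $\overline{\mathcal{U}(h)}^{\|\cdot\|}=\overline{\mathcal{U}(h)}^{s^*}$.
   Context: $\mathcal{U}(h)=\{uhu^*\mid u\in\mathcal{M}\text{ unitary}\}$; superscripts $\|\cdot\|$, $s^*$, $s$ denote closure in the norm, strong* and strong operator topologies (representation-independent on bounded sets). $\mathcal{M}$ is properly infinite if $\mathcal{M}\neq0$ and every nonzero central projection of $\mathcal{M}$ is infinite. *)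

theory Defs
  imports "HOL-Analysis.Analysis"
begin

text \<open>
  A complex Hilbert space is a real one with a compatible complex structure. The real inner product
  is the real part of the complex one, so both induce the same norm; definiteness of the
  complex inner product follows from that of the real one. The inner product is linear in its
  first argument.
\<close>

class complex_hilbert_space = real_inner + complete_space +
  fixes scaleC :: "complex \<Rightarrow> 'a \<Rightarrow> 'a"  (infixr "*\<^sub>C" 75)
    and cinner :: "'a \<Rightarrow> 'a \<Rightarrow> complex"
  assumes scaleC_add_right: "c *\<^sub>C (x + y) = c *\<^sub>C x + c *\<^sub>C y"
    and scaleC_add_left: "(c + d) *\<^sub>C x = c *\<^sub>C x + d *\<^sub>C x"
    and scaleC_scaleC: "c *\<^sub>C (d *\<^sub>C x) = (c * d) *\<^sub>C x"
    and scaleC_of_real: "complex_of_real r *\<^sub>C x = r *\<^sub>R x"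
    and cinner_commute: "cinner x y = cnj (cinner y x)"
    and cinner_add_left: "cinner (x + y) z = cinner x z + cinner y z"
    and cinner_scaleC_left: "cinner (c *\<^sub>C x) y = c * cinner x y"
    and inner_eq_Re_cinner: "x \<bullet> y = Re (cinner x y)"

text \<open>
  The algebra \<open>B(H)\<close> is the set of complex-linear elements of the library type of bounded
  real-linear maps. On it, the norm of that type is the usual operator norm.
\<close>

definition bounded_operators :: "('a::complex_hilbert_space \<Rightarrow>\<^sub>L 'a) set" where
  "bounded_operators = {T. \<forall>c x. blinfun_apply T (c *\<^sub>C x) = c *\<^sub>C blinfun_apply T x}"

text \<open>Meaningful for \<open>T \<in> bounded_operators\<close>, where the adjoint exists and is unique.\<close>

definition adj :: "('a::complex_hilbert_space \<Rightarrow>\<^sub>L 'a) \<Rightarrow> ('a \<Rightarrow>\<^sub>L 'a)" where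
  "adj T = (THE S. \<forall>x y. cinner (blinfun_apply T x) y = cinner x (blinfun_apply S y))"

text \<open>
  The strong operator topology is the library constant \<open>strong_operator_topology\<close>. Its underlying
  set is the whole type, in which \<open>bounded_operators\<close> is closed, so that closures and
  closedness of sets of complex-linear operators are the same as in \<open>B(H)\<close>.
  The strong* topology is the coarsest topology on \<open>B(H)\<close> for which all the maps
  \<open>T \<mapsto> T x\<close> and \<open>T \<mapsto> adj T x\<close> are continuous (the function spaces below carry
  the topology of pointwise norm convergence).
\<close>

definition strong_star_topology :: "('a::complex_hilbert_space \<Rightarrow>\<^sub>L 'a) topology" where
  "strong_star_topology =
     pullback_topology bounded_operators (\<lambda>T. (blinfun_apply T, blinfun_apply (adj T))) euclidean"

definition commutant :: "('a::complex_hilbert_space \<Rightarrow>\<^sub>L 'a) set \<Rightarrow> ('a \<Rightarrow>\<^sub>L 'a) set" where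
  "commutant M = {T \<in> bounded_operators. \<forall>S\<in>M. T o\<^sub>L S = S o\<^sub>L T}"

text \<open>
  A self-adjoint set of operators equal to its bicommutant; it is then automatically a
  subalgebra of \<open>B(H)\<close> containing the identity.
\<close>

definition von_neumann_algebra :: "('a::complex_hilbert_space \<Rightarrow>\<^sub>L 'a) set \<Rightarrow> bool" where
  "von_neumann_algebra M \<longleftrightarrow>
     M \<subseteq> bounded_operators \<and> (\<forall>T\<in>M. adj T \<in> M) \<and> commutant (commutant M) = M"

definition center :: "('a::complex_hilbert_space \<Rightarrow>\<^sub>L 'a) set \<Rightarrow> ('a \<Rightarrow>\<^sub>L 'a) set" where
  "center M = M \<inter> commutant M"

definition normal_operator :: "('a::complex_hilbert_space \<Rightarrow>\<^sub>L 'a) \<Rightarrow> bool" where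
  "normal_operator h \<longleftrightarrow> h \<in> bounded_operators \<and> adj h o\<^sub>L h = h o\<^sub>L adj h"

definition unitaries :: "('a::complex_hilbert_space \<Rightarrow>\<^sub>L 'a) set \<Rightarrow> ('a \<Rightarrow>\<^sub>L 'a) set" where
  "unitaries M = {u \<in> M. adj u o\<^sub>L u = id_blinfun \<and> u o\<^sub>L adj u = id_blinfun}"

definition unitary_orbit ::
  "('a::complex_hilbert_space \<Rightarrow>\<^sub>L 'a) set \<Rightarrow> ('a \<Rightarrow>\<^sub>L 'a) \<Rightarrow> ('a \<Rightarrow>\<^sub>L 'a) set" where
  "unitary_orbit M h = {u o\<^sub>L h o\<^sub>L adj u | u. u \<in> unitaries M}"

definition projections :: "('a::complex_hilbert_space \<Rightarrow>\<^sub>L 'a) set \<Rightarrow> ('a \<Rightarrow>\<^sub>L 'a) set" where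
  "projections M = {p \<in> M. p o\<^sub>L p = p \<and> adj p = p}"

definition mvn_equivalent ::
  "('a::complex_hilbert_space \<Rightarrow>\<^sub>L 'a) set \<Rightarrow> ('a \<Rightarrow>\<^sub>L 'a) \<Rightarrow> ('a \<Rightarrow>\<^sub>L 'a) \<Rightarrow> bool" where
  "mvn_equivalent M p q \<longleftrightarrow> (\<exists>v\<in>M. adj v o\<^sub>L v = p \<and> v o\<^sub>L adj v = q)"

text \<open>The condition \<open>p o\<^sub>L q = q\<close> says \<open>q \<le> p\<close>.\<close>

definition finite_projection ::
  "('a::complex_hilbert_space \<Rightarrow>\<^sub>L 'a) set \<Rightarrow> ('a \<Rightarrow>\<^sub>L 'a) \<Rightarrow> bool" where
  "finite_projection M p \<longleftrightarrow> p \<in> projections M \<and>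
     (\<forall>q\<in>projections M. p o\<^sub>L q = q \<longrightarrow> mvn_equivalent M q p \<longrightarrow> q = p)"

definition infinite_projection ::
  "('a::complex_hilbert_space \<Rightarrow>\<^sub>L 'a) set \<Rightarrow> ('a \<Rightarrow>\<^sub>L 'a) \<Rightarrow> bool" where
  "infinite_projection M p \<longleftrightarrow> p \<in> projections M \<and> \<not> finite_projection M p"

definition finite_algebra :: "('a::complex_hilbert_space \<Rightarrow>\<^sub>L 'a) set \<Rightarrow> bool" where
  "finite_algebra M \<longleftrightarrow> finite_projection M id_blinfun"

definition properly_infinite_algebra :: "('a::complex_hilbert_space \<Rightarrow>\<^sub>L 'a) set \<Rightarrow> bool" where
  "properly_infinite_algebra M \<longleftrightarrow> M \<noteq> {0} \<and>
     (\<forall>p \<in> projections M \<inter> center M. p \<noteq> 0 \<longrightarrow> infinite_projection M p)"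

end

theory Submission imports Defs
begin

text \<open>
  The proof works with real Hilbert spaces and real adjoints; multiplication by \<open>\<i>\<close> is then just one
  more operator of the algebra, and the commutant stays the same.

  Finite case: an exhaustion argument gives, below every projection, a vector functional that is tracial
  up to a factor 2 on some corner. Hence the adjoint is strongly continuous on bounded sets. If a bounded
  net of unitary conjugates of \<open>h\<close> converges strongly to \<open>x\<close>, then products of positive parts of the
  real and imaginary parts converge too, so corresponding spectral projections of \<open>h\<close> and \<open>x\<close>
  dominate each other. By finiteness they are equivalent, and so are their differences, the cells of a fine
  grid in the plane. Partial isometries between the cells add up to a unitary that carries \<open>h\<close> to within
  any \<open>\<epsilon>\<close> of \<open>x\<close> in norm.

  Properly infinite case: bisecting the real and imaginary parts by central cuts yields projections,
  each equivalent to \<open>1\<close>, on which \<open>h\<close> is arbitrarily close to a central element. Unitaries that compress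
  almost everything into these projections conjugate \<open>h\<close> strong* to a central limit, so the strong*
  closure always meets the center. The norm closure meets it only if \<open>h\<close> is central.
\<close>

text \<open>The obstacle in the finite case is that neither the adjoint nor spectral projections are
  strongly continuous: a strong limit of conjugates of a normal operator need not be normal, and the
  spectral projections of the conjugates need not converge. Finiteness repairs the adjoint without a
  trace: a maximal family of partial isometries that violate the factor 2 cannot exhaust a cyclic
  projection, since summing the violations would make twice a positive number at most itself; below
  the rest the bound holds. The projections themselves are never passed to the limit. Only positive
  parts are, being norm limits of polynomials at a uniform rate, and conjugates of \<open>k\<close>
  that tend to \<open>k'\<close> already force equivalent supports. The part of a quadrant outside
  its corner cell is a join; as the support of a sum of two squares it falls under the same
  argument. In the properly infinite case the norm, strong* and strong closures increase in this
  order, so equality of the outer two includes the middle one. A central \<open>h\<close> has a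
  one-point orbit, for which all three agree.\<close>

notation blinfun_compose (infixl "\<odot>" 70)

instance complex_hilbert_space \<subseteq> banach ..

lemma blinfun_compose_algebra:
  fixes A B :: "'b::real_normed_vector \<Rightarrow>\<^sub>L 'c::real_normed_vector"
    and C D :: "'a::real_normed_vector \<Rightarrow>\<^sub>L 'b"
  shows "(A + B) \<odot> C = A \<odot> C + B \<odot> C" "A \<odot> (C + D) = A \<odot> C + A \<odot> D"
    "(A - B) \<odot> C = A \<odot> C - B \<odot> C" "A \<odot> (C - D) = A \<odot> C - A \<odot> D"
    "(- A) \<odot> C = - (A \<odot> C)" "A \<odot> (- C) = - (A \<odot> C)"
    "(r *\<^sub>R A) \<odot> C = r *\<^sub>R (A \<odot> C)" "A \<odot> (r *\<^sub>R C) = r *\<^sub>R (A \<odot> C)"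
    "A \<odot> 0 = (0 :: 'a \<Rightarrow>\<^sub>L 'c)" "0 \<odot> C = (0 :: 'a \<Rightarrow>\<^sub>L 'c)"
    "id_blinfun \<odot> C = C" "C \<odot> id_blinfun = C"
  by (auto intro!: blinfun_eqI simp: blinfun.bilinear_simps)

lemma blinfun_compose_assoc:
  fixes A :: "'c::real_normed_vector \<Rightarrow>\<^sub>L 'd::real_normed_vector"
    and B :: "'b::real_normed_vector \<Rightarrow>\<^sub>L 'c" and C :: "'a::real_normed_vector \<Rightarrow>\<^sub>L 'b"
  shows "A \<odot> B \<odot> C = A \<odot> (B \<odot> C)"
  by (auto intro!: blinfun_eqI)

lemmas op_simps = blinfun_compose_assoc blinfun_compose_algebra

section \<open>Real Hilbert spaces: orthogonal projection, Riesz representation, adjoint\<close>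

lemma inner_eqI:
  fixes x y :: "'a::real_inner"
  shows "(\<And>z. x \<bullet> z = y \<bullet> z) \<Longrightarrow> x = y" "(\<And>z. z \<bullet> x = z \<bullet> y) \<Longrightarrow> x = y"
proof -
  show r: "x = y" if "\<And>z. x \<bullet> z = y \<bullet> z"
    using that[of "x - y"] by (metis inner_diff_left inner_eq_zero_iff right_minus_eq)
  show "x = y" if "\<And>z. z \<bullet> x = z \<bullet> y"
    using that by (intro r) (simp add: inner_commute)
qed

lemma norm_le_if_inner_eq:
  fixes x y :: "'a::real_inner"
  assumes "y \<bullet> y = x \<bullet> y" shows "norm y \<le> norm x"
proof -
  have "(norm y)\<^sup>2 \<le> norm x * norm y"
    using norm_cauchy_schwarz[of x y] assms by (simp add: power2_norm_eq_inner)
  thus ?thesis by (cases "norm y = 0") (auto simp: power2_eq_square)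
qed

text \<open>By the parallelogram law a minimising sequence for the distance from \<open>x\<close> to
  \<open>S\<close> is Cauchy; minimality along the line through its limit in direction
  \<open>z\<close> gives orthogonality.\<close>

lemma ex_orthogonal_point:
  fixes S :: "'a::{real_inner,banach} set"
  assumes S: "closed S" "subspace S"
  shows "\<exists>y\<in>S. \<forall>z\<in>S. (x - y) \<bullet> z = 0"
proof -
  define d where "d = Inf ((\<lambda>z. (norm (x - z))\<^sup>2) ` S)"
  have ne: "S \<noteq> {}" using S(2) subspace_0 by blast
  have bdd: "bdd_below ((\<lambda>z. (norm (x - z))\<^sup>2) ` S)" by (rule bdd_belowI[of _ 0]) auto
  have dle: "d \<le> (norm (x - z))\<^sup>2" if "z \<in> S" for z
    unfolding d_def using that by (intro cInf_lower[OF _ bdd]) auto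
  have "\<exists>z\<in>S. (norm (x - z))\<^sup>2 < d + 1 / real (Suc n)" for n
  proof -
    have "Inf ((\<lambda>z. (norm (x - z))\<^sup>2) ` S) < d + 1 / real (Suc n)"
      unfolding d_def[symmetric] by simp
    thus ?thesis using cInf_less_iff[of "(\<lambda>z. (norm (x - z))\<^sup>2) ` S"] ne bdd by auto
  qed
  then obtain f where f: "\<And>n. f n \<in> S" "\<And>n. (norm (x - f n))\<^sup>2 < d + 1 / real (Suc n)" by metis
  \<comment> \<open>The midpoint of \<open>a\<close> and \<open>b\<close> lies in \<open>S\<close>,
    so its squared distance from \<open>x\<close> is at least \<open>d\<close>.\<close>
  have par: "(norm (a - b))\<^sup>2 \<le> 2 * (norm (x - a))\<^sup>2 + 2 * (norm (x - b))\<^sup>2 - 4 * d"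
    if "a \<in> S" "b \<in> S" for a b
  proof -
    have "(1/2) *\<^sub>R (a + b) \<in> S" using that S(2) by (simp add: subspace_add subspace_scale)
    from dle[OF this] have "d \<le> (norm (x - (1/2) *\<^sub>R (a + b)))\<^sup>2" .
    moreover have "(norm (a - b))\<^sup>2 = 2 * (norm (x - a))\<^sup>2 + 2 * (norm (x - b))\<^sup>2
        - 4 * (norm (x - (1/2) *\<^sub>R (a + b)))\<^sup>2"
      by (simp add: power2_norm_eq_inner algebra_simps inner_commute)
    ultimately show ?thesis by linarith
  qed
  have "Cauchy f"
  proof (rule CauchyI)
    fix e :: real assume "0 < e"
    obtain N :: nat where N: "4 / e\<^sup>2 < real N" using reals_Archimedean2 by blast
    show "\<exists>K. \<forall>m\<ge>K. \<forall>n\<ge>K. norm (f m - f n) < e"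
    proof (intro exI[of _ N] allI impI)
      fix m n assume mn: "N \<le> m" "N \<le> n"
      have N0: "0 < real N" using N \<open>0 < e\<close> by (smt (verit) divide_pos_pos zero_less_power)
      have "1 / real (Suc m) \<le> 1 / real N" "1 / real (Suc n) \<le> 1 / real N"
        using mn N0 by (simp_all add: frac_le)
      hence "(norm (f m - f n))\<^sup>2 < 4 / real N"
        using par[OF f(1)[of m] f(1)[of n]] f(2)[of m] f(2)[of n] by simp
      also have "\<dots> < e\<^sup>2" using N N0 \<open>0 < e\<close> by (simp add: field_simps)
      finally show "norm (f m - f n) < e" using \<open>0 < e\<close> by (simp add: power2_less_imp_less)
    qed
  qed
  then obtain y where y: "f \<longlonglongrightarrow> y" using Cauchy_convergent convergent_def by blast
  have yS: "y \<in> S" using closed_sequentially[OF S(1) _ y] f(1) by blast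
  have "(norm (x - y))\<^sup>2 \<le> d"
  proof (rule LIMSEQ_le)
    show "(\<lambda>n. (norm (x - f n))\<^sup>2) \<longlonglongrightarrow> (norm (x - y))\<^sup>2" by (intro tendsto_intros y)
    show "(\<lambda>n. d + 1 / real (Suc n)) \<longlonglongrightarrow> d"
      using tendsto_add[OF tendsto_const LIMSEQ_inverse_real_of_nat, of d] by (simp add: inverse_eq_divide)
    show "\<exists>N. \<forall>n\<ge>N. (norm (x - f n))\<^sup>2 \<le> d + 1 / real (Suc n)" using f(2) less_imp_le by blast
  qed
  have "(x - y) \<bullet> z = 0" if z: "z \<in> S" for z
  proof (cases "z = 0")
    case False
    \<comment> \<open>The parameter at which the squared norm of
      \<open>x - (y + t *\<^sub>R z)\<close> is smallest.\<close>
    define t where "t = (x - y) \<bullet> z / (z \<bullet> z)"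
    have zz: "z \<bullet> z > 0" using False by simp
    have "y + t *\<^sub>R z \<in> S" using z yS S(2) by (simp add: subspace_add subspace_scale)
    from dle[OF this] \<open>(norm (x - y))\<^sup>2 \<le> d\<close>
    have "(norm (x - y))\<^sup>2 \<le> (norm (x - (y + t *\<^sub>R z)))\<^sup>2" by linarith
    also have "\<dots> = (norm (x - y))\<^sup>2 - 2 * t * ((x - y) \<bullet> z) + t * t * (z \<bullet> z)"
      by (simp add: power2_norm_eq_inner algebra_simps inner_commute)
    also have "t * t * (z \<bullet> z) = t * ((x - y) \<bullet> z)" using zz by (simp add: t_def)
    finally have "t * ((x - y) \<bullet> z) \<le> 0" by simp
    hence "((x - y) \<bullet> z)\<^sup>2 / (z \<bullet> z) \<le> 0" by (simp add: t_def power2_eq_square)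
    thus ?thesis using zz by (simp add: divide_le_0_iff)
  qed simp
  with yS show ?thesis by blast
qed

text \<open>\<open>SOME\<close> keeps the definition total; for a closed subspace the point that it
  picks exists and is unique.\<close>

definition proj_on :: "'a::{real_inner,banach} set \<Rightarrow> 'a \<Rightarrow>\<^sub>L 'a" where
  "proj_on S = Blinfun (\<lambda>x. SOME y. y \<in> S \<and> (\<forall>z\<in>S. (x - y) \<bullet> z = 0))"

lemma
  fixes S :: "'a::{real_inner,banach} set"
  assumes S: "closed S" "subspace S"
  shows proj_on_in: "proj_on S x \<in> S"
    and proj_on_orth: "z \<in> S \<Longrightarrow> (x - proj_on S x) \<bullet> z = 0"
    and proj_on_unique: "y \<in> S \<Longrightarrow> (\<And>z. z \<in> S \<Longrightarrow> (x - y) \<bullet> z = 0) \<Longrightarrow> proj_on S x = y"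
proof -
  define f where "f = (\<lambda>x. SOME y. y \<in> S \<and> (\<forall>z\<in>S. (x - y) \<bullet> z = 0))"
  have f: "f x \<in> S \<and> (\<forall>z\<in>S. (x - f x) \<bullet> z = 0)" for x
    unfolding f_def by (rule someI_ex) (use ex_orthogonal_point[OF S] in blast)
  have uniq: "f x = y" if "y \<in> S" "\<And>z. z \<in> S \<Longrightarrow> (x - y) \<bullet> z = 0" for x y
  proof -
    have d: "f x - y \<in> S" using that f S(2) by (simp add: subspace_diff)
    have "(x - y) \<bullet> (f x - y) - (x - f x) \<bullet> (f x - y) = 0" using that(2)[OF d] f d by simp
    hence "(f x - y) \<bullet> (f x - y) = 0" by (simp add: algebra_simps)
    thus ?thesis by simp
  qed
  have bl: "bounded_linear f"
  proof (rule bounded_linear_intro)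
    fix a b show "f (a + b) = f a + f b"
    proof (rule uniq)
      show "f a + f b \<in> S" using f S(2) by (simp add: subspace_add)
      fix z assume "z \<in> S"
      hence "(a - f a) \<bullet> z = 0" "(b - f b) \<bullet> z = 0" using f by auto
      thus "(a + b - (f a + f b)) \<bullet> z = 0" by (simp add: inner_diff_left inner_add_left)
    qed
  next
    fix r a show "f (r *\<^sub>R a) = r *\<^sub>R f a"
      by (rule uniq) (use f S(2) in \<open>auto simp: subspace_scale simp flip: scaleR_right_diff_distrib\<close>)
  next
    fix a
    have "(a - f a) \<bullet> f a = 0" using f by blast
    hence "norm (f a) \<le> norm a" by (intro norm_le_if_inner_eq) (simp add: algebra_simps)
    thus "norm (f a) \<le> norm a * 1" by simp
  qed
  have ap: "blinfun_apply (proj_on S) = f"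
    unfolding proj_on_def f_def[symmetric] by (rule bounded_linear_Blinfun_apply[OF bl])
  show "proj_on S x \<in> S" using f ap by simp
  show "z \<in> S \<Longrightarrow> (x - proj_on S x) \<bullet> z = 0" using f ap by simp
  show "y \<in> S \<Longrightarrow> (\<And>z. z \<in> S \<Longrightarrow> (x - y) \<bullet> z = 0) \<Longrightarrow> proj_on S x = y" using uniq ap by simp
qed

text \<open>The kernel of a nonzero \<open>f\<close> has codimension one, so a vector orthogonal to
  it represents \<open>f\<close> up to a scalar.\<close>

lemma riesz_representation:
  fixes f :: "'a::{real_inner,banach} \<Rightarrow> real"
  assumes f: "bounded_linear f"
  shows "\<exists>y. \<forall>x. f x = x \<bullet> y"
proof (cases "\<forall>x. f x = 0")
  case True thus ?thesis by (intro exI[of _ 0]) simp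
next
  case False
  then obtain x0 where x0: "f x0 \<noteq> 0" by blast
  interpret f: bounded_linear f by fact
  define N where "N = {x. f x = 0}"
  have N: "closed N" "subspace N"
    unfolding N_def subspace_def
    by (auto simp: f.add f.scaleR intro!: closed_Collect_eq continuous_intros f.continuous_on)
  define w where "w = x0 - proj_on N x0"
  have fw: "f w \<noteq> 0" using proj_on_in[OF N, of x0] x0 by (simp add: w_def f.diff N_def)
  hence w0: "w \<bullet> w \<noteq> 0" using f.zero by auto
  have orth: "w \<bullet> z = 0" if "z \<in> N" for z unfolding w_def by (rule proj_on_orth[OF N that])
  show ?thesis
  proof (intro exI[of _ "(f w / (w \<bullet> w)) *\<^sub>R w"] allI)
    fix x
    have "x - (f x / f w) *\<^sub>R w \<in> N" using fw by (simp add: N_def f.diff f.scaleR)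
    from orth[OF this] have "x \<bullet> w = f x / f w * (w \<bullet> w)" by (simp add: inner_diff_right inner_commute)
    thus "f x = x \<bullet> (f w / (w \<bullet> w)) *\<^sub>R w" using fw w0 by simp
  qed
qed

text \<open>Defined for every bounded real-linear map, so that the theory can be developed without
  the complex structure; \<open>adj_eq_hadj\<close> identifies it with \<open>adj\<close> on
  complex-linear operators.\<close>

definition hadj :: "('a::{real_inner,banach} \<Rightarrow>\<^sub>L 'a) \<Rightarrow> 'a \<Rightarrow>\<^sub>L 'a" ("_\<^sup>\<dagger>" [1000] 1000) where
  "hadj T = Blinfun (\<lambda>y. SOME z. \<forall>x. T x \<bullet> y = x \<bullet> z)"

lemma inner_hadj: fixes T :: "'a::{real_inner,banach} \<Rightarrow>\<^sub>L 'a" shows "T x \<bullet> y = x \<bullet> T\<^sup>\<dagger> y"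
proof -
  define g where "g = (\<lambda>y. SOME z. \<forall>x. T x \<bullet> y = x \<bullet> z)"
  have g: "\<forall>x. T x \<bullet> y = x \<bullet> g y" for y
    unfolding g_def
    by (rule someI_ex) (rule riesz_representation, intro bounded_linear_intros)
  have uniq: "a = b" if "\<And>x. x \<bullet> a = x \<bullet> b" for a b :: 'a
    using that[of "a - b"] by (metis inner_diff_right inner_eq_zero_iff right_minus_eq)
  have "bounded_linear g"
  proof (rule bounded_linear_intro)
    show "g (a + b) = g a + g b" for a b
      by (rule uniq) (metis g inner_add_right)
    show "g (r *\<^sub>R a) = r *\<^sub>R g a" for r a
      by (rule uniq) (metis g inner_scaleR_right)
    show "norm (g a) \<le> norm a * norm T" for a
    proof (cases "g a = 0")
      case False
      have "(norm (g a))\<^sup>2 = T (g a) \<bullet> a" using g by (simp add: power2_norm_eq_inner)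
      also have "\<dots> \<le> norm (T (g a)) * norm a" by (rule norm_cauchy_schwarz)
      also have "\<dots> \<le> norm T * norm (g a) * norm a" by (intro mult_right_mono norm_blinfun) auto
      finally show ?thesis using False by (simp add: power2_eq_square mult_ac)
    qed simp
  qed
  hence "blinfun_apply (T\<^sup>\<dagger>) = g"
    unfolding hadj_def g_def[symmetric] by (rule bounded_linear_Blinfun_apply)
  thus ?thesis using g by simp
qed

lemma inner_hadj': fixes T :: "'a::{real_inner,banach} \<Rightarrow>\<^sub>L 'a" shows "x \<bullet> T y = T\<^sup>\<dagger> x \<bullet> y"
  by (metis inner_hadj inner_commute)

lemma hadj_eqI: fixes T S :: "'a::{real_inner,banach} \<Rightarrow>\<^sub>L 'a" shows "(\<And>x y. T x \<bullet> y = x \<bullet> S y) \<Longrightarrow> T\<^sup>\<dagger> = S"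
proof (rule blinfun_eqI)
  fix y assume "\<And>x y. T x \<bullet> y = x \<bullet> S y"
  hence "x \<bullet> (T\<^sup>\<dagger> y - S y) = 0" for x by (simp add: inner_hadj inner_diff_right)
  thus "T\<^sup>\<dagger> y = S y" by (metis inner_eq_zero_iff right_minus_eq)
qed

lemma hadj_hadj [simp]: "(T\<^sup>\<dagger>)\<^sup>\<dagger> = T"
  by (rule hadj_eqI) (simp add: inner_hadj')

lemma hadj_simps [simp]:
  "(A \<odot> B)\<^sup>\<dagger> = B\<^sup>\<dagger> \<odot> A\<^sup>\<dagger>" "(A + B)\<^sup>\<dagger> = A\<^sup>\<dagger> + B\<^sup>\<dagger>" "(A - B)\<^sup>\<dagger> = A\<^sup>\<dagger> - B\<^sup>\<dagger>"
  "(- A)\<^sup>\<dagger> = - (A\<^sup>\<dagger>)" "(r *\<^sub>R A)\<^sup>\<dagger> = r *\<^sub>R A\<^sup>\<dagger>" "id_blinfun\<^sup>\<dagger> = id_blinfun" "0\<^sup>\<dagger> = 0"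
  by (rule hadj_eqI; simp add: inner_hadj blinfun.bilinear_simps inner_add_left inner_add_right
      inner_diff_left inner_diff_right)+

lemma norm_hadj [simp]: "norm (T\<^sup>\<dagger>) = norm T"
proof -
  have le: "norm (S\<^sup>\<dagger>) \<le> norm S" for S :: "'a \<Rightarrow>\<^sub>L 'a"
  proof (rule norm_blinfun_bound)
    fix x
    show "norm (S\<^sup>\<dagger> x) \<le> norm S * norm x"
    proof (cases "S\<^sup>\<dagger> x = 0")
      case False
      have "(norm (S\<^sup>\<dagger> x))\<^sup>2 = S (S\<^sup>\<dagger> x) \<bullet> x" by (simp add: power2_norm_eq_inner inner_hadj)
      also have "\<dots> \<le> norm (S (S\<^sup>\<dagger> x)) * norm x" by (rule norm_cauchy_schwarz)
      also have "\<dots> \<le> norm S * norm (S\<^sup>\<dagger> x) * norm x" by (intro mult_right_mono norm_blinfun) auto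
      finally show ?thesis using False by (simp add: power2_eq_square mult_ac)
    qed simp
  qed simp
  show ?thesis using le[of T] le[of "T\<^sup>\<dagger>"] by simp
qed

lemma hadj_compose_self_eq_0 [simp]: "T\<^sup>\<dagger> \<odot> T = 0 \<longleftrightarrow> T = 0"
proof
  assume "T\<^sup>\<dagger> \<odot> T = 0"
  hence "T x \<bullet> T x = 0" for x
    by (metis inner_hadj inner_zero_right blinfun_apply_blinfun_compose blinfun.zero_left)
  thus "T = 0" by (intro blinfun_eqI) simp
qed simp

lemma norm_apply_sq: fixes T :: "'a::{real_inner,banach} \<Rightarrow>\<^sub>L 'a" shows "(norm (T x))\<^sup>2 = x \<bullet> (T\<^sup>\<dagger> \<odot> T) x"
  by (simp add: power2_norm_eq_inner inner_hadj)

text \<open>Polarisation: equal norms at \<open>x\<close>, \<open>y\<close> and \<open>x + y\<close>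
  give equal inner products.\<close>

lemma hadj_compose_eqI:
  fixes A B :: "'a::{real_inner,banach} \<Rightarrow>\<^sub>L 'a"
  assumes "\<And>x. norm (A x) = norm (B x)" shows "A\<^sup>\<dagger> \<odot> A = B\<^sup>\<dagger> \<odot> B"
proof -
  have sq: "A x \<bullet> A x = B x \<bullet> B x" for x
    using assms[of x] by (metis power2_norm_eq_inner)
  have "A x \<bullet> A y = B x \<bullet> B y" for x y
    using sq[of "x + y"] sq[of x] sq[of y]
    by (simp add: blinfun.bilinear_simps algebra_simps inner_commute)
  hence "A\<^sup>\<dagger> (A x) = B\<^sup>\<dagger> (B x)" for x
    by (intro inner_eqI(1)[of "A\<^sup>\<dagger> (A x)"]) (simp flip: inner_hadj')
  thus ?thesis by (intro blinfun_eqI) simp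
qed

subsection \<open>Projections and partial isometries\<close>

definition is_proj :: "('a::{real_inner,banach} \<Rightarrow>\<^sub>L 'a) \<Rightarrow> bool" where
  "is_proj p \<longleftrightarrow> p \<odot> p = p \<and> p\<^sup>\<dagger> = p"

definition is_pisom :: "('a::{real_inner,banach} \<Rightarrow>\<^sub>L 'a) \<Rightarrow> bool" where
  "is_pisom v \<longleftrightarrow> v \<odot> v\<^sup>\<dagger> \<odot> v = v"

lemma is_projD: fixes p :: "'a::{real_inner,banach} \<Rightarrow>\<^sub>L 'a" shows "is_proj p \<Longrightarrow> p \<odot> p = p" "is_proj p \<Longrightarrow> p\<^sup>\<dagger> = p" "is_proj p \<Longrightarrow> p (p x) = p x"
  unfolding is_proj_def by (auto simp flip: blinfun_apply_blinfun_compose)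

lemma is_proj_assoc: "is_proj p \<Longrightarrow> p \<odot> (p \<odot> T) = p \<odot> T"
  by (metis blinfun_compose_assoc is_projD(1))

lemma is_proj_simps [simp]: "is_proj 0" "is_proj id_blinfun"
  by (auto simp: is_proj_def op_simps)

lemma is_proj_compl: "is_proj p \<Longrightarrow> is_proj (id_blinfun - p)"
  by (auto simp: is_proj_def op_simps)

lemma proj_le_sym: "is_proj p \<Longrightarrow> is_proj q \<Longrightarrow> q \<odot> p = p \<longleftrightarrow> p \<odot> q = p"
  by (metis hadj_simps(1) is_projD(2))

lemma proj_orth_sym: "is_proj p \<Longrightarrow> is_proj q \<Longrightarrow> q \<odot> p = 0 \<longleftrightarrow> p \<odot> q = 0"
  by (metis hadj_simps(1,7) is_projD(2))

lemma is_proj_diff: "is_proj p \<Longrightarrow> is_proj q \<Longrightarrow> q \<odot> p = p \<Longrightarrow> is_proj (q - p)"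
  using proj_le_sym[of p q] by (auto simp: is_proj_def op_simps)

lemma is_proj_add: "is_proj p \<Longrightarrow> is_proj q \<Longrightarrow> q \<odot> p = 0 \<Longrightarrow> is_proj (p + q)"
  using proj_orth_sym[of p q] by (auto simp: is_proj_def op_simps)

lemma is_proj_prod: "is_proj p \<Longrightarrow> is_proj q \<Longrightarrow> p \<odot> q = q \<odot> p \<Longrightarrow> is_proj (p \<odot> q)"
  unfolding is_proj_def by (metis blinfun_compose_assoc hadj_simps(1))

lemma proj_antisym: "is_proj p \<Longrightarrow> is_proj q \<Longrightarrow> q \<odot> p = p \<Longrightarrow> p \<odot> q = q \<Longrightarrow> p = q"
  by (metis proj_le_sym)

lemma inner_proj: fixes p :: "'a::{real_inner,banach} \<Rightarrow>\<^sub>L 'a" shows "is_proj p \<Longrightarrow> p x \<bullet> x = (norm (p x))\<^sup>2"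
  by (metis inner_commute inner_hadj' is_projD(2) is_projD(3) power2_norm_eq_inner)

lemma norm_proj_le: fixes p :: "'a::{real_inner,banach} \<Rightarrow>\<^sub>L 'a" shows "is_proj p \<Longrightarrow> norm (p x) \<le> norm x"
  by (rule norm_le_if_inner_eq) (metis inner_commute inner_proj power2_norm_eq_inner)

lemma norm_is_proj: "is_proj p \<Longrightarrow> norm p \<le> 1"
  by (rule norm_blinfun_bound) (use norm_proj_le in auto)

lemma proj_pythagoras: fixes p :: "'a::{real_inner,banach} \<Rightarrow>\<^sub>L 'a" shows "is_proj p \<Longrightarrow> (norm x)\<^sup>2 = (norm (p x))\<^sup>2 + (norm ((id_blinfun - p) x))\<^sup>2"
proof -
  assume p: "is_proj p"
  have "x \<bullet> p x = p x \<bullet> p x" using inner_proj[OF p, of x] by (simp add: inner_commute power2_norm_eq_inner)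
  thus ?thesis by (simp add: power2_norm_eq_inner blinfun.bilinear_simps inner_diff_left inner_diff_right inner_commute)
qed

text \<open>For the converse, the defect \<open>v \<odot> v\<^sup>\<dagger> \<odot> v - v\<close>
  composed with its adjoint expands to zero.\<close>

lemma is_pisom_iff: "is_pisom v \<longleftrightarrow> is_proj (v\<^sup>\<dagger> \<odot> v)"
proof
  show "is_pisom v \<Longrightarrow> is_proj (v\<^sup>\<dagger> \<odot> v)"
    by (simp add: is_pisom_def is_proj_def blinfun_compose_assoc)
  assume p: "is_proj (v\<^sup>\<dagger> \<odot> v)"
  have "(v \<odot> v\<^sup>\<dagger> \<odot> v - v)\<^sup>\<dagger> \<odot> (v \<odot> v\<^sup>\<dagger> \<odot> v - v) = 0"
    using is_projD(1)[OF p] by (simp add: op_simps)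
  thus "is_pisom v" unfolding hadj_compose_self_eq_0 is_pisom_def by simp
qed

lemma is_pisom_hadj: "is_pisom v \<Longrightarrow> is_pisom (v\<^sup>\<dagger>)"
  unfolding is_pisom_def by (metis blinfun_compose_assoc hadj_hadj hadj_simps(1))

lemma is_pisom_projs: "is_pisom v \<Longrightarrow> is_proj (v\<^sup>\<dagger> \<odot> v)" "is_pisom v \<Longrightarrow> is_proj (v \<odot> v\<^sup>\<dagger>)"
  using is_pisom_iff is_pisom_hadj[of v] is_pisom_iff[of "v\<^sup>\<dagger>"] by auto

lemma is_pisomD: "is_pisom v \<Longrightarrow> v \<odot> (v\<^sup>\<dagger> \<odot> v) = v" "is_pisom v \<Longrightarrow> v\<^sup>\<dagger> \<odot> (v \<odot> v\<^sup>\<dagger>) = v\<^sup>\<dagger>"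
  using is_pisom_hadj[of v] by (auto simp: is_pisom_def blinfun_compose_assoc)

lemma is_pisom_proj: "is_proj p \<Longrightarrow> is_pisom p"
  by (simp add: is_pisom_def is_proj_def)

lemma is_proj_proj_on:
  assumes S: "closed S" "subspace S" shows "is_proj (proj_on S)"
proof -
  have 1: "proj_on S (proj_on S x) = proj_on S x" for x
    by (rule proj_on_unique[OF S proj_on_in[OF S]]) simp
  have 2: "proj_on S x \<bullet> y = x \<bullet> proj_on S y" for x y
    using proj_on_orth[OF S proj_on_in[OF S, of y], of x] proj_on_orth[OF S proj_on_in[OF S, of x], of y]
    by (simp add: inner_diff_left inner_diff_right inner_commute)
  show ?thesis unfolding is_proj_def by (auto intro!: blinfun_eqI hadj_eqI simp: 1 2)
qed

lemma proj_on_fix: assumes "closed S" "subspace S" shows "proj_on S x = x \<longleftrightarrow> x \<in> S"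
  by (metis assms proj_on_in proj_on_unique diff_self inner_zero_left)

section \<open>Range projections\<close>

definition range_proj :: "('a::{real_inner,banach} \<Rightarrow>\<^sub>L 'a) \<Rightarrow> 'a \<Rightarrow>\<^sub>L 'a" where
  "range_proj A = proj_on (closure (range (blinfun_apply A)))"

lemma subspace_closure:
  fixes S :: "'a::real_normed_vector set"
  assumes "subspace S" shows "subspace (closure S)"
  unfolding subspace_def
proof (intro conjI ballI allI)
  show "0 \<in> closure S" using assms subspace_0 closure_subset by blast
  fix x y c assume x: "x \<in> closure S" and y: "y \<in> closure S"
  obtain f g where f: "\<And>n. f n \<in> S" "f \<longlonglongrightarrow> x" and g: "\<And>n. g n \<in> S" "g \<longlonglongrightarrow> y"
    using x y unfolding closure_sequential by blast
  show "x + y \<in> closure S" unfolding closure_sequential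
    by (rule exI[of _ "\<lambda>n. f n + g n"]) (use f g assms in \<open>auto intro: tendsto_intros subspace_add\<close>)
  show "c *\<^sub>R x \<in> closure S" unfolding closure_sequential
    by (rule exI[of _ "\<lambda>n. c *\<^sub>R f n"]) (use f assms in \<open>auto intro: tendsto_intros subspace_scale\<close>)
qed

lemma closed_subspace_closure_range:
  "closed (closure (range (blinfun_apply A)))" "subspace (closure (range (blinfun_apply A)))"
  by (auto intro!: subspace_closure linear_subspace_image bounded_linear.linear blinfun.bounded_linear_right
      simp: subspace_UNIV)

lemma is_proj_range_proj [simp]: "is_proj (range_proj A)"
  unfolding range_proj_def by (rule is_proj_proj_on[OF closed_subspace_closure_range])

lemma range_proj_compose [simp]: "range_proj A \<odot> A = A"
  unfolding range_proj_def
  by (rule blinfun_eqI) (auto simp: proj_on_fix[OF closed_subspace_closure_range] intro: closure_subset[THEN subsetD])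

lemma blinfun_eq_0_on_closure:
  fixes T :: "'a::real_normed_vector \<Rightarrow>\<^sub>L 'b::real_normed_vector"
  assumes "\<And>x. x \<in> S \<Longrightarrow> blinfun_apply T x = 0" "y \<in> closure S" shows "T y = 0"
proof -
  have "closed {x. T x = 0}" by (intro closed_Collect_eq continuous_intros)
  hence "closure S \<subseteq> {x. T x = 0}" using assms(1) by (intro closure_minimal) auto
  thus ?thesis using assms(2) by auto
qed

lemma range_proj_annihilate:
  fixes S :: "'a::{real_inner,banach} \<Rightarrow>\<^sub>L 'b::real_normed_vector"
  shows "S \<odot> A = 0 \<Longrightarrow> S \<odot> range_proj A = 0"
proof (rule blinfun_eqI)
  fix x assume "S \<odot> A = 0"
  hence "S y = 0" if "y \<in> range A" for y
    using that by (metis (no_types, lifting) blinfun.zero_left blinfun_apply_blinfun_compose imageE)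
  from blinfun_eq_0_on_closure[OF this proj_on_in[OF closed_subspace_closure_range]]
  show "(S \<odot> range_proj A) x = blinfun_apply 0 x" by (simp add: range_proj_def)
qed

lemma annihilate_range_proj_iff: "S \<odot> range_proj A = 0 \<longleftrightarrow> S \<odot> A = 0"
  by (metis range_proj_annihilate range_proj_compose blinfun_compose_assoc blinfun_compose_algebra(10))

text \<open>The range projection is determined by the left annihilator of \<open>A\<close>. This
  makes range projections computable by operator identities, without a look at closures of
  ranges.\<close>

lemma range_proj_unique:
  fixes A p :: "'a::{real_inner,banach} \<Rightarrow>\<^sub>L 'a"
  assumes "is_proj p" "p \<odot> A = A" "\<And>S :: 'a \<Rightarrow>\<^sub>L 'a. S \<odot> A = 0 \<Longrightarrow> S \<odot> p = 0"
  shows "range_proj A = p"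
proof (rule proj_antisym)
  have "(id_blinfun - range_proj A) \<odot> p = 0" by (intro assms(3)) (simp add: op_simps)
  thus "range_proj A \<odot> p = p" by (simp add: op_simps)
  have "(id_blinfun - p) \<odot> range_proj A = 0" by (rule range_proj_annihilate) (simp add: op_simps assms)
  thus "p \<odot> range_proj A = range_proj A" by (simp add: op_simps)
qed (use assms in auto)

lemma range_proj_cong:
  fixes A B :: "'a::{real_inner,banach} \<Rightarrow>\<^sub>L 'a"
  assumes "\<And>S :: 'a \<Rightarrow>\<^sub>L 'a. S \<odot> A = 0 \<longleftrightarrow> S \<odot> B = 0"
  shows "range_proj A = range_proj B"
proof (rule range_proj_unique)
  have "(id_blinfun - range_proj B) \<odot> A = 0" unfolding assms by (simp add: op_simps)
  thus "range_proj B \<odot> A = A" by (simp add: op_simps)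
qed (use assms in \<open>auto simp: annihilate_range_proj_iff\<close>)

lemma compose_range_proj_hadj: "A \<odot> range_proj (A\<^sup>\<dagger>) = A"
proof -
  have "(range_proj (A\<^sup>\<dagger>) \<odot> A\<^sup>\<dagger>)\<^sup>\<dagger> = (A\<^sup>\<dagger>)\<^sup>\<dagger>" by (simp only: range_proj_compose)
  thus ?thesis by (simp only: hadj_simps hadj_hadj is_projD(2)[OF is_proj_range_proj])
qed

lemma range_proj_pisom: "is_pisom v \<Longrightarrow> range_proj v = v \<odot> v\<^sup>\<dagger>"
proof (rule range_proj_unique)
  fix S assume "is_pisom v" "S \<odot> v = 0"
  thus "S \<odot> (v \<odot> v\<^sup>\<dagger>) = 0" by (simp add: op_simps flip: blinfun_compose_assoc)
qed (simp_all add: is_pisom_projs is_pisom_def)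

lemma range_proj_eq_0 [simp]: "range_proj A = 0 \<longleftrightarrow> A = 0"
  by (metis annihilate_range_proj_iff blinfun_compose_algebra(11))

subsection \<open>Orthogonal sums\<close>

lemma norm_sum_orth:
  fixes f :: "'i \<Rightarrow> 'a::real_inner"
  assumes "finite F" "\<And>i j. i \<in> F \<Longrightarrow> j \<in> F \<Longrightarrow> i \<noteq> j \<Longrightarrow> f i \<bullet> f j = 0"
  shows "(norm (sum f F))\<^sup>2 = (\<Sum>i\<in>F. (norm (f i))\<^sup>2)"
  using assms
proof (induction F)
  case (insert i F)
  have "f i \<bullet> sum f F = 0"
    unfolding inner_sum_right using insert by (intro sum.neutral) auto
  with insert show ?case
    by (simp add: power2_norm_eq_inner inner_add_left inner_add_right inner_commute)
qed simp

text \<open>By Pythagoras, differences of partial sums are governed by the convergent series of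
  squared norms. The index set is arbitrary, so convergence is that of the net of finite partial
  sums.\<close>

lemma orth_summable:
  fixes f :: "'i \<Rightarrow> 'a::{real_inner,banach}"
  assumes orth: "\<And>i j. i \<in> I \<Longrightarrow> j \<in> I \<Longrightarrow> i \<noteq> j \<Longrightarrow> f i \<bullet> f j = 0"
    and bd: "\<And>F. finite F \<Longrightarrow> F \<subseteq> I \<Longrightarrow> (\<Sum>i\<in>F. (norm (f i))\<^sup>2) \<le> K"
  obtains s where "(f has_sum s) I" "((\<lambda>i. (norm (f i))\<^sup>2) has_sum (norm s)\<^sup>2) I"
proof -
  define g where "g = (\<lambda>i. (norm (f i))\<^sup>2)"
  have "g summable_on I"
    unfolding g_def by (rule nonneg_bdd_above_summable_on) (auto intro!: bdd_aboveI2[where M=K] bd)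
  then obtain L where L: "(g has_sum L) I" by (auto simp: summable_on_def)
  have nF: "(norm (sum f F))\<^sup>2 = sum g F" if "finite F" "F \<subseteq> I" for F
    unfolding g_def by (rule norm_sum_orth[OF that(1)]) (use that orth in blast)
  have "\<exists>P. eventually P (finite_subsets_at_top I) \<and> (\<forall>F1 F2. P F1 \<and> P F2 \<longrightarrow> dist (sum f F1) (sum f F2) < e)"
    if e: "e > 0" for e
  proof -
    have "eventually (\<lambda>F. dist (sum g F) L < (e/2)\<^sup>2) (finite_subsets_at_top I)"
      using L e unfolding has_sum_def tendsto_iff by simp
    then obtain F0 where F0: "finite F0" "F0 \<subseteq> I" "dist (sum g F0) L < (e/2)\<^sup>2"
      unfolding eventually_finite_subsets_at_top by blast
    have close: "dist (sum f F) (sum f F0) < e/2" if F: "finite F" "F0 \<subseteq> F" "F \<subseteq> I" for F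
    proof -
      have "(norm (sum f F - sum f F0))\<^sup>2 = (norm (sum f (F - F0)))\<^sup>2"
        using F by (simp add: sum_diff)
      also have "\<dots> = sum g (F - F0)" by (rule nF) (use F in auto)
      also have "\<dots> = sum g F - sum g F0" using F by (simp add: sum_diff)
      also have "\<dots> \<le> L - sum g F0"
        using finite_sum_le_has_sum[OF L F(1,3)] by (simp add: g_def)
      also have "\<dots> < (e/2)\<^sup>2" using F0(3) by (simp add: dist_real_def)
      finally show ?thesis using e unfolding dist_norm by (intro power2_less_imp_less[of _ "e/2"]) auto
    qed
    show ?thesis
    proof (intro exI[of _ "\<lambda>F. finite F \<and> F0 \<subseteq> F \<and> F \<subseteq> I"] conjI allI impI)
      show "\<forall>\<^sub>F F in finite_subsets_at_top I. finite F \<and> F0 \<subseteq> F \<and> F \<subseteq> I"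
        using F0 by (auto simp: eventually_finite_subsets_at_top)
      fix F1 F2 assume *: "(finite F1 \<and> F0 \<subseteq> F1 \<and> F1 \<subseteq> I) \<and> finite F2 \<and> F0 \<subseteq> F2 \<and> F2 \<subseteq> I"
      have "dist (sum f F1) (sum f F0) < e/2" "dist (sum f F2) (sum f F0) < e/2"
        using * close[of F1] close[of F2] by auto
      thus "dist (sum f F1) (sum f F2) < e" by (rule dist_triangle_half_l)
    qed
  qed
  hence "cauchy_filter (filtermap (sum f) (finite_subsets_at_top I))"
    by (simp add: cauchy_filter_metric_filtermap)
  moreover have "complete (UNIV::'a set)"
    by (meson Cauchy_convergent UNIV_I complete_def convergent_def)
  ultimately obtain s where "(sum f \<longlongrightarrow> s) (finite_subsets_at_top I)"
    using complete_uniform[where S=UNIV] by (force simp add: filterlim_def)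
  hence s: "(f has_sum s) I" by (simp add: has_sum_def)
  have "((\<lambda>F. (norm (sum f F))\<^sup>2) \<longlongrightarrow> (norm s)\<^sup>2) (finite_subsets_at_top I)"
    using s unfolding has_sum_def by (intro tendsto_intros)
  moreover have "\<forall>\<^sub>F F in finite_subsets_at_top I. (norm (sum f F))\<^sup>2 = sum g F"
    by (rule eventually_finite_subsets_at_top_weakI) (rule nF)
  ultimately have "(g has_sum (norm s)\<^sup>2) I"
    unfolding has_sum_def using tendsto_cong[of "\<lambda>F. (norm (sum f F))\<^sup>2"] by force
  with s show ?thesis unfolding g_def by (rule that)
qed

text \<open>The third hypothesis holds when \<open>f i\<close> is the image of \<open>x\<close>
  under an orthogonal projection.\<close>

lemma bessel_orth:
  fixes f :: "'i \<Rightarrow> 'a::real_inner"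
  assumes "finite F" "\<And>i j. i \<in> F \<Longrightarrow> j \<in> F \<Longrightarrow> i \<noteq> j \<Longrightarrow> f i \<bullet> f j = 0"
    and "\<And>i. i \<in> F \<Longrightarrow> x \<bullet> f i = f i \<bullet> f i"
  shows "(\<Sum>i\<in>F. (norm (f i))\<^sup>2) \<le> (norm x)\<^sup>2"
proof -
  have "sum f F \<bullet> sum f F = (norm (sum f F))\<^sup>2" by (simp add: power2_norm_eq_inner)
  also have "\<dots> = (\<Sum>i\<in>F. (norm (f i))\<^sup>2)" by (rule norm_sum_orth[OF assms(1,2)])
  also have "\<dots> = x \<bullet> sum f F" by (simp add: inner_sum_right assms(3) power2_norm_eq_inner)
  finally have "norm (sum f F) \<le> norm x" by (rule norm_le_if_inner_eq)
  hence "(norm (sum f F))\<^sup>2 \<le> (norm x)\<^sup>2" by (simp add: power_mono)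
  thus ?thesis using norm_sum_orth[OF assms(1,2)] by simp
qed

text \<open>\<open>v\<^sup>\<dagger> \<odot> w = 0\<close> makes the ranges orthogonal,
  \<open>v \<odot> w\<^sup>\<dagger> = 0\<close> the initial spaces; together they make the sum of
  the family again a partial isometry.\<close>

definition orth_pisoms :: "('a::{real_inner,banach} \<Rightarrow>\<^sub>L 'a) set \<Rightarrow> bool" where
  "orth_pisoms W \<longleftrightarrow> (\<forall>v\<in>W. is_pisom v) \<and>
     (\<forall>v\<in>W. \<forall>w\<in>W. v \<noteq> w \<longrightarrow> v\<^sup>\<dagger> \<odot> w = 0 \<and> v \<odot> w\<^sup>\<dagger> = 0)"

text \<open>The sum is taken at each vector, since for infinite families it need not converge in
  norm.\<close>

definition osum :: "('a::{real_inner,banach} \<Rightarrow>\<^sub>L 'a) set \<Rightarrow> 'a \<Rightarrow>\<^sub>L 'a" where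
  "osum W = Blinfun (\<lambda>x. infsum (\<lambda>v. blinfun_apply v x) W)"

lemma orth_pisoms_hadj: "orth_pisoms W \<Longrightarrow> orth_pisoms (hadj ` W)"
  by (auto simp: orth_pisoms_def is_pisom_hadj)

text \<open>\<open>norm (v x)\<close> is the norm of the initial projection of \<open>v\<close> at
  \<open>x\<close>, so Bessel's inequality for these orthogonal projections bounds the squared
  norms.\<close>

lemma
  fixes W :: "('a::{real_inner,banach} \<Rightarrow>\<^sub>L 'a) set"
  assumes W: "orth_pisoms W"
  shows osum_has_sum: "((\<lambda>v. blinfun_apply v x) has_sum osum W x) W"
    and osum_norm_has_sum: "((\<lambda>v. (norm (blinfun_apply v x))\<^sup>2) has_sum (norm (osum W x))\<^sup>2) W"
proof -
  have "\<exists>s. ((\<lambda>v. blinfun_apply v x) has_sum s) W \<and> ((\<lambda>v. (norm (blinfun_apply v x))\<^sup>2) has_sum (norm s)\<^sup>2) W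
      \<and> norm s \<le> norm x" for x
  proof -
    have bd: "(\<Sum>v\<in>F. (norm (blinfun_apply v x))\<^sup>2) \<le> (norm x)\<^sup>2" if F: "finite F" "F \<subseteq> W" for F
    proof -
      have pv: "is_proj (v\<^sup>\<dagger> \<odot> v)" if "v \<in> F" for v
        using W F that by (auto simp: orth_pisoms_def is_pisom_projs)
      have n: "(norm (blinfun_apply v x))\<^sup>2 = (norm ((v\<^sup>\<dagger> \<odot> v) x))\<^sup>2" if "v \<in> F" for v
        using inner_proj[OF pv[OF that], of x] by (simp only: norm_apply_sq[of v] inner_commute)
      have "(\<Sum>v\<in>F. (norm ((v\<^sup>\<dagger> \<odot> v) x))\<^sup>2) \<le> (norm x)\<^sup>2"
      proof (rule bessel_orth[OF F(1)])
        fix v w assume vw: "v \<in> F" "w \<in> F" "v \<noteq> w"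
        hence "v \<odot> w\<^sup>\<dagger> = 0" using W F unfolding orth_pisoms_def by blast
        hence z: "blinfun_apply v (w\<^sup>\<dagger> y) = 0" for y
          by (metis blinfun_apply_blinfun_compose blinfun.zero_left)
        show "(v\<^sup>\<dagger> \<odot> v) x \<bullet> (w\<^sup>\<dagger> \<odot> w) x = 0" by (simp add: inner_hadj z)
      next
        fix v assume "v \<in> F"
        from inner_proj[OF pv[OF this], of x]
        show "x \<bullet> (v\<^sup>\<dagger> \<odot> v) x = (v\<^sup>\<dagger> \<odot> v) x \<bullet> (v\<^sup>\<dagger> \<odot> v) x"
          by (simp only: power2_norm_eq_inner inner_commute)
      qed
      thus ?thesis by (simp add: n del: blinfun_apply_blinfun_compose)
    qed
    obtain s where s: "((\<lambda>v. blinfun_apply v x) has_sum s) W"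
      "((\<lambda>v. (norm (blinfun_apply v x))\<^sup>2) has_sum (norm s)\<^sup>2) W"
    proof (rule orth_summable[of W "\<lambda>v. blinfun_apply v x" "(norm x)\<^sup>2"])
      fix v w assume "v \<in> W" "w \<in> W" "v \<noteq> w"
      hence "v\<^sup>\<dagger> \<odot> w = 0" using W unfolding orth_pisoms_def by blast
      hence "blinfun_apply (v\<^sup>\<dagger>) (blinfun_apply w x) = 0"
        by (metis blinfun_apply_blinfun_compose blinfun.zero_left)
      thus "blinfun_apply v x \<bullet> blinfun_apply w x = 0" by (simp add: inner_hadj)
    qed (use bd in auto)
    have "(norm s)\<^sup>2 \<le> (norm x)\<^sup>2" by (rule has_sum_le_finite_sums[OF s(2) bd])
    thus ?thesis using s by (auto intro: power2_le_imp_le)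
  qed
  then obtain g where g: "\<And>x. ((\<lambda>v. blinfun_apply v x) has_sum g x) W"
    "\<And>x. ((\<lambda>v. (norm (blinfun_apply v x))\<^sup>2) has_sum (norm (g x))\<^sup>2) W" "\<And>x. norm (g x) \<le> norm x"
    by metis
  have "bounded_linear g"
  proof (rule bounded_linear_intro)
    show "g (x + y) = g x + g y" for x y
      using has_sum_unique[OF g(1)[of "x + y"]] has_sum_add[OF g(1)[of x] g(1)[of y]]
      by (simp add: blinfun.add_right)
    show "g (r *\<^sub>R x) = r *\<^sub>R g x" for r x
      using has_sum_unique[OF g(1)[of "r *\<^sub>R x"]]
        has_sum_bounded_linear[OF bounded_linear_scaleR_right g(1)[of x], of r]
      by (simp add: blinfun.scaleR_right)
    show "norm (g x) \<le> norm x * 1" for x using g(3) by simp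
  qed
  moreover have "(\<lambda>x. infsum (\<lambda>v. blinfun_apply v x) W) = g" using g(1) infsumI by blast
  ultimately have "blinfun_apply (osum W) = g" unfolding osum_def by (simp add: bounded_linear_Blinfun_apply)
  thus "((\<lambda>v. blinfun_apply v x) has_sum osum W x) W"
    "((\<lambda>v. (norm (blinfun_apply v x))\<^sup>2) has_sum (norm (osum W x))\<^sup>2) W" using g by auto
qed

lemma osum_annihilate:
  assumes W: "orth_pisoms W" and "\<And>v. v \<in> W \<Longrightarrow> S \<odot> v = 0"
  shows "S \<odot> osum W = 0"
proof (rule blinfun_eqI)
  fix x
  have "((\<lambda>v. blinfun_apply S (blinfun_apply v x)) has_sum blinfun_apply S (osum W x)) W"
    by (rule has_sum_bounded_linear[OF blinfun.bounded_linear_right osum_has_sum[OF W]])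
  moreover have "blinfun_apply S (blinfun_apply v x) = 0" if "v \<in> W" for v
    using assms(2)[OF that] by (metis blinfun_apply_blinfun_compose blinfun.zero_left)
  ultimately show "(S \<odot> osum W) x = blinfun_apply 0 x"
    using has_sum_unique[OF _ has_sum_0] by fastforce
qed

lemma osum_commute:
  assumes W: "orth_pisoms W" and "\<And>v. v \<in> W \<Longrightarrow> S \<odot> v = v \<odot> S"
  shows "S \<odot> osum W = osum W \<odot> S"
proof (rule blinfun_eqI)
  fix x
  have 1: "((\<lambda>v. blinfun_apply S (blinfun_apply v x)) has_sum blinfun_apply S (osum W x)) W"
    by (rule has_sum_bounded_linear[OF blinfun.bounded_linear_right osum_has_sum[OF W]])
  have "blinfun_apply S (blinfun_apply v x) = blinfun_apply v (blinfun_apply S x)" if "v \<in> W" for v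
    using assms(2)[OF that] by (metis blinfun_apply_blinfun_compose)
  with 1 have "((\<lambda>v. blinfun_apply v (blinfun_apply S x)) has_sum blinfun_apply S (osum W x)) W"
    by (simp cong: has_sum_cong)
  from has_sum_unique[OF this osum_has_sum[OF W]]
  show "(S \<odot> osum W) x = (osum W \<odot> S) x" by simp
qed

lemma osum_hadj:
  assumes W: "orth_pisoms W" shows "(osum W)\<^sup>\<dagger> = osum (hadj ` W)"
proof (rule hadj_eqI)
  fix x y
  have inj: "inj_on hadj W" by (rule inj_onI) (metis hadj_hadj)
  have "((\<lambda>v. blinfun_apply v x \<bullet> y) has_sum (osum W x \<bullet> y)) W"
    by (rule has_sum_bounded_linear[OF bounded_linear_inner_left osum_has_sum[OF W]])
  moreover have "((\<lambda>v. x \<bullet> blinfun_apply v y) has_sum (x \<bullet> osum (hadj ` W) y)) (hadj ` W)"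
    by (rule has_sum_bounded_linear[OF bounded_linear_inner_right osum_has_sum[OF orth_pisoms_hadj[OF W]]])
  hence "((\<lambda>v. x \<bullet> blinfun_apply (v\<^sup>\<dagger>) y) has_sum (x \<bullet> osum (hadj ` W) y)) W"
    unfolding has_sum_reindex[OF inj] by (simp add: o_def)
  ultimately show "osum W x \<bullet> y = x \<bullet> osum (hadj ` W) y"
    unfolding inner_hadj by (rule has_sum_unique)
qed

lemma osum_compose_hadj:
  assumes W: "orth_pisoms W" and v: "v \<in> W"
  shows "osum W \<odot> v\<^sup>\<dagger> = v \<odot> v\<^sup>\<dagger>"
proof (rule blinfun_eqI)
  fix x
  have "((\<lambda>w. blinfun_apply w (v\<^sup>\<dagger> x)) has_sum blinfun_apply v (v\<^sup>\<dagger> x)) W"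
  proof (rule has_sum_finite_neutralI[of "{v}"])
    fix w assume "w \<in> W - {v}"
    hence "w \<odot> v\<^sup>\<dagger> = 0" using W v unfolding orth_pisoms_def by blast
    thus "blinfun_apply w (v\<^sup>\<dagger> x) = 0" by (metis blinfun_apply_blinfun_compose blinfun.zero_left)
  qed (use v in auto)
  from has_sum_unique[OF osum_has_sum[OF W] this]
  show "(osum W \<odot> v\<^sup>\<dagger>) x = (v \<odot> v\<^sup>\<dagger>) x" by simp
qed

lemma osum_hadj_compose:
  assumes W: "orth_pisoms W" and v: "v \<in> W"
  shows "(osum W)\<^sup>\<dagger> \<odot> v = v\<^sup>\<dagger> \<odot> v"
  using osum_compose_hadj[OF orth_pisoms_hadj[OF W], of "v\<^sup>\<dagger>"] v by (simp add: osum_hadj[OF W])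

text \<open>It suffices that \<open>?V \<odot> ?V\<^sup>\<dagger>\<close> fixes each member of the
  family, because an operator that annihilates all members annihilates their sum.\<close>

lemma is_pisom_osum:
  assumes W: "orth_pisoms W" shows "is_pisom (osum W)"
proof -
  let ?V = "osum W"
  have "(?V \<odot> ?V\<^sup>\<dagger> - id_blinfun) \<odot> v = 0" if v: "v \<in> W" for v
  proof -
    have "?V \<odot> (?V\<^sup>\<dagger> \<odot> v) = ?V \<odot> v\<^sup>\<dagger> \<odot> v" by (simp add: osum_hadj_compose[OF W v] op_simps)
    also have "\<dots> = v" using v W by (simp add: osum_compose_hadj[OF W v] orth_pisoms_def is_pisom_def)
    finally show ?thesis by (simp add: op_simps)
  qed
  from osum_annihilate[OF W this] show ?thesis by (simp add: is_pisom_def op_simps)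
qed

lemma osum_projs:
  assumes W: "orth_pisoms W" and v: "v \<in> W"
  shows "(osum W)\<^sup>\<dagger> \<odot> osum W \<odot> (v\<^sup>\<dagger> \<odot> v) = v\<^sup>\<dagger> \<odot> v" "osum W \<odot> (osum W)\<^sup>\<dagger> \<odot> (v \<odot> v\<^sup>\<dagger>) = v \<odot> v\<^sup>\<dagger>"
proof -
  have pv: "is_pisom v" using W v by (auto simp: orth_pisoms_def)
  have "(osum W)\<^sup>\<dagger> \<odot> osum W \<odot> (v\<^sup>\<dagger> \<odot> v) = (osum W)\<^sup>\<dagger> \<odot> (osum W \<odot> v\<^sup>\<dagger>) \<odot> v" by (simp add: op_simps)
  also have "\<dots> = (osum W)\<^sup>\<dagger> \<odot> v"
    unfolding osum_compose_hadj[OF W v] using is_pisomD(1)[OF pv] by (simp add: op_simps)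
  finally show "(osum W)\<^sup>\<dagger> \<odot> osum W \<odot> (v\<^sup>\<dagger> \<odot> v) = v\<^sup>\<dagger> \<odot> v" by (simp add: osum_hadj_compose[OF W v])
  have "osum W \<odot> (osum W)\<^sup>\<dagger> \<odot> (v \<odot> v\<^sup>\<dagger>) = osum W \<odot> ((osum W)\<^sup>\<dagger> \<odot> v) \<odot> v\<^sup>\<dagger>" by (simp add: op_simps)
  also have "\<dots> = osum W \<odot> v\<^sup>\<dagger>"
    unfolding osum_hadj_compose[OF W v] using is_pisomD(2)[OF pv] by (simp add: op_simps)
  finally show "osum W \<odot> (osum W)\<^sup>\<dagger> \<odot> (v \<odot> v\<^sup>\<dagger>) = v \<odot> v\<^sup>\<dagger>" by (simp add: osum_compose_hadj[OF W v])
qed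

lemma osum_annihilate_hadj:
  assumes W: "orth_pisoms W" and "\<And>v. v \<in> W \<Longrightarrow> S \<odot> v\<^sup>\<dagger> = 0"
  shows "S \<odot> (osum W)\<^sup>\<dagger> = 0"
  unfolding osum_hadj[OF W] by (rule osum_annihilate[OF orth_pisoms_hadj[OF W]]) (use assms in auto)

lemma osum_hadj_norm_has_sum:
  assumes W: "orth_pisoms W"
  shows "((\<lambda>v. (norm (v\<^sup>\<dagger> x))\<^sup>2) has_sum (norm ((osum W)\<^sup>\<dagger> x))\<^sup>2) W"
proof -
  have inj: "inj_on hadj W" by (rule inj_onI) (metis hadj_hadj)
  show ?thesis
    using osum_norm_has_sum[OF orth_pisoms_hadj[OF W], of x] unfolding has_sum_reindex[OF inj]
    by (simp add: o_def osum_hadj[OF W])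
qed

lemma norm_pisom_hadj:
  fixes v :: "'a::{real_inner,banach} \<Rightarrow>\<^sub>L 'a"
  assumes "is_pisom v" shows "norm ((v \<odot> v\<^sup>\<dagger>) x) = norm (v\<^sup>\<dagger> x)" "norm ((v\<^sup>\<dagger> \<odot> v) x) = norm (v x)"
proof -
  have *: "norm ((w\<^sup>\<dagger> \<odot> w) x) = norm (w x)" if "is_pisom w" for w :: "'a \<Rightarrow>\<^sub>L 'a"
  proof -
    have "(norm (w x))\<^sup>2 = (norm ((w\<^sup>\<dagger> \<odot> w) x))\<^sup>2"
      using inner_proj[OF is_pisom_projs(1)[OF that], of x] by (simp only: norm_apply_sq[of w] inner_commute)
    thus ?thesis by simp
  qed
  show "norm ((v \<odot> v\<^sup>\<dagger>) x) = norm (v\<^sup>\<dagger> x)" "norm ((v\<^sup>\<dagger> \<odot> v) x) = norm (v x)"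
    using *[OF assms] *[OF is_pisom_hadj[OF assms]] by auto
qed

subsection \<open>Polar decomposition\<close>

text \<open>The first equation makes the range of \<open>A\<close> invariant under \<open>S\<close>,
  the second under \<open>S\<^sup>\<dagger>\<close>; the projection onto a reducing subspace
  commutes with \<open>S\<close>.\<close>

lemma range_proj_commute:
  assumes "S \<odot> A = A \<odot> T" "S\<^sup>\<dagger> \<odot> A = A \<odot> T'"
  shows "S \<odot> range_proj A = range_proj A \<odot> S"
proof -
  let ?p = "range_proj A"
  have *: "R \<odot> ?p = ?p \<odot> R \<odot> ?p" if "R \<odot> A = A \<odot> T" for R T
  proof -
    have "((id_blinfun - ?p) \<odot> R) \<odot> A = 0" using that
      by (simp add: op_simps) (simp flip: blinfun_compose_assoc)
    from range_proj_annihilate[OF this] show ?thesis by (simp add: op_simps)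
  qed
  have "S \<odot> ?p = ?p \<odot> S \<odot> ?p" by (rule *[OF assms(1)])
  moreover have "(S\<^sup>\<dagger> \<odot> ?p)\<^sup>\<dagger> = (?p \<odot> S\<^sup>\<dagger> \<odot> ?p)\<^sup>\<dagger>" by (rule arg_cong[OF *[OF assms(2)]])
  hence "?p \<odot> S = ?p \<odot> S \<odot> ?p" by (simp add: is_projD op_simps)
  ultimately show ?thesis by simp
qed

text \<open>The map from \<open>A x\<close> to \<open>B x\<close> is isometric and extends to the
  closure of the range of \<open>A\<close>. The commutation clause places \<open>v\<close> in the
  bicommutant of any self-adjoint set that contains \<open>A\<close> and \<open>B\<close>.\<close>

lemma ex_polar:
  fixes A B :: "'a::{real_inner,banach} \<Rightarrow>\<^sub>L 'a"
  assumes AB: "\<And>x. norm (A x) = norm (B x)"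
  obtains v where "v \<odot> A = B" "v\<^sup>\<dagger> \<odot> v = range_proj A" "v \<odot> v\<^sup>\<dagger> = range_proj B"
    "\<And>S. S \<odot> A = A \<odot> S \<Longrightarrow> S\<^sup>\<dagger> \<odot> A = A \<odot> S\<^sup>\<dagger> \<Longrightarrow> S \<odot> B = B \<odot> S \<Longrightarrow> S \<odot> v = v \<odot> S"
proof -
  \<comment> \<open>Extension by closing the graph: pairs in \<open>G\<close> have entries of equal
    norm, so \<open>G\<close> is still the graph of a function.\<close>
  define G where "G = closure (range (\<lambda>x. (A x, B x)))"
  define p where "p = range_proj A"
  have subG: "subspace G" unfolding G_def
    by (intro subspace_closure linear_subspace_image bounded_linear.linear)
      (auto intro!: bounded_linear_intros)
  have nG: "norm y = norm z" if "(y, z) \<in> G" for y z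
  proof -
    have "closed {w :: 'a \<times> 'a. norm (fst w) = norm (snd w)}"
      by (intro closed_Collect_eq continuous_intros)
    hence "G \<subseteq> {w. norm (fst w) = norm (snd w)}"
      unfolding G_def by (intro closure_minimal) (auto simp: AB)
    thus ?thesis using that by auto
  qed
  have ex: "\<exists>z. (p x, z) \<in> G" for x
  proof -
    have "p x \<in> closure (range A)"
      unfolding p_def range_proj_def by (rule proj_on_in[OF closed_subspace_closure_range])
    then obtain f where f: "\<forall>n. f n \<in> range A" "f \<longlonglongrightarrow> p x" unfolding closure_sequential by blast
    have "\<forall>n. \<exists>a. f n = A a" using f(1) by blast
    then obtain g where "\<And>n. f n = A (g n)" by metis
    hence "f = (\<lambda>n. A (g n))" by auto
    hence g: "(\<lambda>n. A (g n)) \<longlonglongrightarrow> p x" using f(2) by simp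
    have "Cauchy (\<lambda>n. A (g n))" using g LIMSEQ_imp_Cauchy by blast
    moreover have "dist (B (g m)) (B (g n)) = dist (A (g m)) (A (g n))" for m n
      using AB[of "g m - g n"] by (simp add: dist_norm blinfun.diff_right)
    ultimately have "Cauchy (\<lambda>n. B (g n))" unfolding Cauchy_def by simp
    then obtain z where "(\<lambda>n. B (g n)) \<longlonglongrightarrow> z" using Cauchy_convergent convergent_def by blast
    hence "(\<lambda>n. (A (g n), B (g n))) \<longlonglongrightarrow> (p x, z)" by (rule tendsto_Pair[OF g])
    thus ?thesis unfolding G_def closure_sequential
      by (intro exI[of _ z] exI[of _ "\<lambda>n. (A (g n), B (g n))"]) auto
  qed
  \<comment> \<open>Projecting first makes the extension vanish on the orthogonal complement of the
    range of \<open>A\<close>.\<close>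
  then obtain g where g: "\<And>x. (p x, g x) \<in> G" by metis
  have uniq: "z = z'" if "(y, z) \<in> G" "(y, z') \<in> G" for y z z'
    using nG[of 0 "z - z'"] subspace_diff[OF subG that] by simp
  have "bounded_linear g"
  proof (rule bounded_linear_intro)
    show "g (x + y) = g x + g y" for x y
      by (rule uniq[OF g]) (use subspace_add[OF subG g[of x] g[of y]] in \<open>simp add: blinfun.add_right\<close>)
    show "g (r *\<^sub>R x) = r *\<^sub>R g x" for r x
      by (rule uniq[OF g]) (use subspace_scale[OF subG g[of x], of r] in \<open>simp add: blinfun.scaleR_right\<close>)
    show "norm (g x) \<le> norm x * 1" for x
      using nG[OF g[of x]] norm_proj_le[of p x] by (simp add: p_def)
  qed
  then obtain v where v: "blinfun_apply v = g" by (metis bounded_linear_Blinfun_apply)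
  have vA: "v \<odot> A = B"
  proof (rule blinfun_eqI)
    fix x
    have "p (A x) = A x" unfolding p_def by (metis range_proj_compose blinfun_apply_blinfun_compose)
    moreover have "(A x, B x) \<in> G" unfolding G_def by (rule closure_subset[THEN subsetD]) blast
    ultimately show "(v \<odot> A) x = B x" using uniq g[of "A x"] by (simp add: v)
  qed
  have vv: "v\<^sup>\<dagger> \<odot> v = p"
  proof -
    have "v\<^sup>\<dagger> \<odot> v = p\<^sup>\<dagger> \<odot> p" by (rule hadj_compose_eqI) (use nG[OF g] v in simp)
    thus ?thesis by (simp add: p_def is_projD)
  qed
  have vp: "v \<odot> p = v"
    using is_pisomD(1)[of v] is_pisom_iff[of v] by (simp add: vv) (simp add: p_def)
  have "range_proj v = range_proj B"
  proof (rule range_proj_cong)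
    fix S :: "'a \<Rightarrow>\<^sub>L 'a"
    show "S \<odot> v = 0 \<longleftrightarrow> S \<odot> B = 0"
    proof
      assume "S \<odot> v = 0" thus "S \<odot> B = 0"
        by (metis vA blinfun_compose_assoc blinfun_compose_algebra(10))
    next
      assume "S \<odot> B = 0"
      hence "S \<odot> v \<odot> A = 0" by (simp add: vA blinfun_compose_assoc)
      from range_proj_annihilate[OF this] show "S \<odot> v = 0"
        by (simp add: vp blinfun_compose_assoc flip: p_def)
    qed
  qed
  moreover have "range_proj v = v \<odot> v\<^sup>\<dagger>"
    by (rule range_proj_pisom) (simp add: is_pisom_iff vv p_def)
  ultimately have vr: "v \<odot> v\<^sup>\<dagger> = range_proj B" by simp
  have comm: "S \<odot> v = v \<odot> S"
    if S: "S \<odot> A = A \<odot> S" "S\<^sup>\<dagger> \<odot> A = A \<odot> S\<^sup>\<dagger>" "S \<odot> B = B \<odot> S" for S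
  proof -
    have Sp: "S \<odot> p = p \<odot> S" unfolding p_def by (rule range_proj_commute[OF S(1,2)])
    have "v \<odot> S \<odot> A = v \<odot> A \<odot> S" by (simp add: op_simps S(1))
    hence "(S \<odot> v - v \<odot> S) \<odot> A = 0" by (simp add: op_simps vA S(3))
    from range_proj_annihilate[OF this]
    have "S \<odot> (v \<odot> p) = v \<odot> (S \<odot> p)" by (simp add: op_simps p_def)
    also have "\<dots> = v \<odot> p \<odot> S" by (simp add: Sp op_simps)
    finally show ?thesis by (simp add: vp)
  qed
  show ?thesis by (rule that[OF vA vv[unfolded p_def] vr comm])
qed

subsection \<open>Strong convergence\<close>

text \<open>A general filter is allowed because strong closures are not described by
  sequences.\<close>

definition stends :: "('i \<Rightarrow> 'a::real_normed_vector \<Rightarrow>\<^sub>L 'b::real_normed_vector) \<Rightarrow> ('a \<Rightarrow>\<^sub>L 'b) \<Rightarrow> 'i filter \<Rightarrow> bool" where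
  "stends f T F \<longleftrightarrow> (\<forall>x. ((\<lambda>i. blinfun_apply (f i) x) \<longlongrightarrow> blinfun_apply T x) F)"

lemma stends_const: "stends (\<lambda>_. T) T F"
  by (simp add: stends_def)

lemma stends_add: "stends f S F \<Longrightarrow> stends g T F \<Longrightarrow> stends (\<lambda>i. f i + g i) (S + T) F"
  unfolding stends_def by (auto simp: blinfun.add_left intro: tendsto_add)

lemma stends_diff: "stends f S F \<Longrightarrow> stends g T F \<Longrightarrow> stends (\<lambda>i. f i - g i) (S - T) F"
  unfolding stends_def by (auto simp: blinfun.diff_left intro: tendsto_diff)

lemma stends_scaleR: "stends f S F \<Longrightarrow> stends (\<lambda>i. r *\<^sub>R f i) (r *\<^sub>R S) F"
  unfolding stends_def by (auto simp: blinfun.scaleR_left intro: tendsto_scaleR)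

text \<open>The bound on the left factors controls their action on the error
  \<open>g i x - T x\<close>; the rest is the convergence of \<open>f\<close> at the fixed vector
  \<open>T x\<close>.\<close>

lemma stends_compose:
  assumes f: "stends f S F" and g: "stends g T F" and bd: "\<And>i. norm (f i) \<le> K"
  shows "stends (\<lambda>i. f i \<odot> g i) (S \<odot> T) F"
  unfolding stends_def
proof
  fix x
  have "((\<lambda>i. K * norm (g i x - T x) + norm (f i (T x) - S (T x))) \<longlongrightarrow> K * norm (T x - T x) + norm (S (T x) - S (T x))) F"
    using f g unfolding stends_def
    by (intro tendsto_add tendsto_mult tendsto_const tendsto_norm tendsto_diff) auto
  hence lim: "((\<lambda>i. K * norm (g i x - T x) + norm (f i (T x) - S (T x))) \<longlongrightarrow> 0) F" by simp
  have "((\<lambda>i. (f i \<odot> g i) x - (S \<odot> T) x) \<longlongrightarrow> 0) F"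
  proof (rule Lim_null_comparison[OF _ lim], rule always_eventually, rule allI)
    fix i
    have "(f i \<odot> g i) x - (S \<odot> T) x = f i (g i x - T x) + (f i (T x) - S (T x))"
      by (simp add: blinfun.diff_right)
    also have "norm \<dots> \<le> norm (f i (g i x - T x)) + norm (f i (T x) - S (T x))" by (rule norm_triangle_ineq)
    also have "norm (f i (g i x - T x)) \<le> K * norm (g i x - T x)"
      using norm_blinfun[of "f i"] bd[of i] by (meson mult_right_mono norm_ge_zero order_trans)
    finally show "norm ((f i \<odot> g i) x - (S \<odot> T) x) \<le> K * norm (g i x - T x) + norm (f i (T x) - S (T x))" by simp
  qed
  thus "((\<lambda>i. (f i \<odot> g i) x) \<longlongrightarrow> (S \<odot> T) x) F" by (rule LIM_zero_cancel)
qed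

lemma stends_norm_le:
  assumes "stends f T F" "F \<noteq> bot" "\<And>i. norm (f i) \<le> K" shows "norm T \<le> K"
proof (rule norm_blinfun_bound)
  show "0 \<le> K" using assms(3) norm_ge_zero order_trans by blast
  fix x
  have "((\<lambda>i. norm (f i x)) \<longlongrightarrow> norm (T x)) F"
    using assms(1) unfolding stends_def by (intro tendsto_norm) auto
  moreover have "norm (f i x) \<le> K * norm x" for i
    using norm_blinfun[of "f i" x] assms(3)[of i] by (meson mult_right_mono norm_ge_zero order_trans)
  ultimately show "norm (T x) \<le> K * norm x"
    by (intro tendsto_upperbound[OF _ _ assms(2)]) (auto intro: always_eventually)
qed

lemma stends_unique: "stends f S F \<Longrightarrow> stends f T F \<Longrightarrow> F \<noteq> bot \<Longrightarrow> S = T"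
  unfolding stends_def by (intro blinfun_eqI) (metis tendsto_unique)

text \<open>An epsilon/3 argument. It carries strong continuity from the polynomials
  \<open>sqrt_seq c n\<close> to their limit, as the rate \<open>e\<close> is uniform in
  \<open>i\<close>.\<close>

lemma stends_uniform:
  fixes f :: "'i \<Rightarrow> 'a::real_normed_vector \<Rightarrow>\<^sub>L 'b::real_normed_vector" and g :: "nat \<Rightarrow> 'i \<Rightarrow> 'a \<Rightarrow>\<^sub>L 'b"
  assumes g: "\<And>n. stends (\<lambda>i. g n i) (G n) F"
    and u: "\<And>n i. norm (f i - g n i) \<le> e n" "\<And>n. norm (T - G n) \<le> e n" and e: "e \<longlonglongrightarrow> 0"
  shows "stends f T F"
  unfolding stends_def tendsto_iff
proof (intro allI impI)
  fix x :: 'a and d :: real assume d: "d > 0"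
  have "(\<lambda>n. e n * norm x) \<longlonglongrightarrow> 0" using tendsto_mult[OF e tendsto_const, of "norm x"] by simp
  hence "eventually (\<lambda>n. e n * norm x < d / 3) sequentially" using d by (intro order_tendstoD(2)[of _ 0]) auto
  then obtain n where n: "e n * norm x < d / 3" unfolding eventually_sequentially by blast
  have "eventually (\<lambda>i. dist (g n i x) (G n x) < d / 3) F"
    using g[of n] d unfolding stends_def by (intro tendstoD) simp_all
  thus "eventually (\<lambda>i. dist (f i x) (T x) < d) F"
  proof (eventually_elim)
    case (elim i)
    have *: "norm (S x - S' x) \<le> e n * norm x" if "norm (S - S') \<le> e n" for S S' :: "'a \<Rightarrow>\<^sub>L 'b"
      using norm_blinfun[of "S - S'" x] that by (metis blinfun.diff_left mult_right_mono norm_ge_zero order_trans)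
    have "f i x - T x = (f i x - g n i x) + (g n i x - G n x) - (T x - G n x)" by simp
    also have "norm \<dots> \<le> norm (f i x - g n i x) + norm (g n i x - G n x) + norm (T x - G n x)"
      by (meson norm_triangle_ineq norm_triangle_ineq4 add_mono order_trans order_refl)
    also have "\<dots> < d" using *[OF u(1)[of i n]] *[OF u(2)[of n]] elim n by (simp add: dist_norm)
    finally show ?case by (simp add: dist_norm)
  qed
qed

subsection \<open>Square roots and the modulus\<close>

text \<open>The sequence is the classical one converging to \<open>1 - \<surd>(1 - c)\<close>.\<close>

primrec sqrt_seq :: "('a::real_normed_vector \<Rightarrow>\<^sub>L 'a) \<Rightarrow> nat \<Rightarrow> 'a \<Rightarrow>\<^sub>L 'a" where
  "sqrt_seq c 0 = 0"
| "sqrt_seq c (Suc n) = (1/2) *\<^sub>R (c + sqrt_seq c n \<odot> sqrt_seq c n)"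

text \<open>The scalar case \<open>c = 1\<close> of the iteration. Its increments dominate those of
  every \<open>c\<close> of norm at most 1, which gives a rate of convergence independent of
  \<open>c\<close>.\<close>

primrec sqrt_dom :: "nat \<Rightarrow> real" where
  "sqrt_dom 0 = 0"
| "sqrt_dom (Suc n) = (1 + sqrt_dom n * sqrt_dom n) / 2"

lemma sqrt_dom_bounds: "0 \<le> sqrt_dom n \<and> sqrt_dom n \<le> 1"
  by (induction n) (auto intro: mult_le_one)

lemma sqrt_dom_mono: "sqrt_dom n \<le> sqrt_dom (Suc n)"
proof -
  have "0 \<le> (sqrt_dom n - 1) * (sqrt_dom n - 1)" by simp
  thus ?thesis by (simp add: algebra_simps)
qed

lemma sqrt_dom_lim: "sqrt_dom \<longlonglongrightarrow> 1"
proof -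
  have inc: "incseq sqrt_dom" by (rule incseq_SucI) (rule sqrt_dom_mono)
  obtain L where L: "sqrt_dom \<longlonglongrightarrow> L"
    using incseq_convergent[OF inc] sqrt_dom_bounds by blast
  have "(\<lambda>n. sqrt_dom (Suc n)) \<longlonglongrightarrow> (1 + L * L) / 2"
    unfolding sqrt_dom.simps by (intro tendsto_intros L) auto
  hence "L = (1 + L * L) / 2" using LIMSEQ_unique LIMSEQ_Suc[OF L] by blast
  hence "(L - 1) * (L - 1) = 0" by (simp add: algebra_simps)
  thus ?thesis using L by simp
qed

text \<open>For consecutive iterates \<open>y\<close> and \<open>z\<close>, \<open>y \<odot> y - z
  \<odot> z = (y - z) \<odot> y + z \<odot> (y - z)\<close>; the induction compares this term by
  term with the same identity for \<open>sqrt_dom\<close>.\<close>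

lemma sqrt_seq_bounds:
  assumes c: "norm c \<le> 1"
  shows "norm (sqrt_seq c n) \<le> sqrt_dom n"
    and "norm (sqrt_seq c (Suc n) - sqrt_seq c n) \<le> sqrt_dom (Suc n) - sqrt_dom n"
proof -
  show b: "norm (sqrt_seq c n) \<le> sqrt_dom n" for n
  proof (induction n)
    case (Suc n)
    have "norm (c + sqrt_seq c n \<odot> sqrt_seq c n) \<le> norm c + norm (sqrt_seq c n) * norm (sqrt_seq c n)"
      by (meson norm_triangle_ineq norm_blinfun_compose add_left_mono order_trans)
    also have "\<dots> \<le> 1 + sqrt_dom n * sqrt_dom n"
      using c Suc sqrt_dom_bounds[of n] by (intro add_mono mult_mono) auto
    finally show ?case by simp
  qed simp
  show "norm (sqrt_seq c (Suc n) - sqrt_seq c n) \<le> sqrt_dom (Suc n) - sqrt_dom n"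
  proof (induction n)
    case 0
    show ?case using c by simp
  next
    case (Suc n)
    let ?y = "sqrt_seq c (Suc n)" and ?z = "sqrt_seq c n" and ?s = "sqrt_dom (Suc n)" and ?t = "sqrt_dom n"
    have "sqrt_seq c (Suc (Suc n)) - ?y = (1/2) *\<^sub>R ((?y - ?z) \<odot> ?y + ?z \<odot> (?y - ?z))"
      by (simp only: sqrt_seq.simps(2)[of c "Suc n"] sqrt_seq.simps(2)[of c n] blinfun_compose_algebra)
        (simp add: algebra_simps)
    also have "norm \<dots> \<le> (1/2) * (norm (?y - ?z) * norm ?y + norm ?z * norm (?y - ?z))"
      by (simp del: sqrt_seq.simps) (meson norm_triangle_ineq norm_blinfun_compose add_mono order_trans)
    also have "\<dots> \<le> (1/2) * ((?s - ?t) * ?s + ?t * (?s - ?t))"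
      using Suc b[of "Suc n"] b[of n] sqrt_dom_bounds[of n] sqrt_dom_mono[of n]
      by (intro mult_left_mono add_mono mult_mono) auto
    also have "\<dots> = sqrt_dom (Suc (Suc n)) - ?s"
      by (simp only: sqrt_dom.simps(2)[of "Suc n"] sqrt_dom.simps(2)[of n]) (simp add: field_simps)
    finally show ?case .
  qed
qed

definition sqrt_lim :: "('a::banach \<Rightarrow>\<^sub>L 'a) \<Rightarrow> 'a \<Rightarrow>\<^sub>L 'a" where
  "sqrt_lim c = lim (sqrt_seq c)"

lemma sqrt_seq_dist:
  assumes c: "norm c \<le> 1" and "n \<le> m"
  shows "norm (sqrt_seq c m - sqrt_seq c n) \<le> sqrt_dom m - sqrt_dom n"
  using assms(2)
proof (induction m rule: dec_induct)
  case (step m)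
  have "norm (sqrt_seq c (Suc m) - sqrt_seq c n)
      \<le> norm (sqrt_seq c (Suc m) - sqrt_seq c m) + norm (sqrt_seq c m - sqrt_seq c n)"
    by (metis diff_add_cancel add_diff_eq norm_triangle_ineq)
  thus ?case using step.IH sqrt_seq_bounds(2)[OF c, of m] by linarith
qed simp

lemma
  fixes c :: "'a::banach \<Rightarrow>\<^sub>L 'a"
  assumes c: "norm c \<le> 1"
  shows sqrt_seq_lim: "sqrt_seq c \<longlonglongrightarrow> sqrt_lim c"
    and sqrt_lim_dist: "norm (sqrt_lim c - sqrt_seq c n) \<le> 1 - sqrt_dom n"
    and norm_sqrt_lim: "norm (sqrt_lim c) \<le> 1"
    and sqrt_lim_eq: "(id_blinfun - sqrt_lim c) \<odot> (id_blinfun - sqrt_lim c) = id_blinfun - c"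
proof -
  have "Cauchy (sqrt_seq c)"
  proof (rule metric_CauchyI)
    fix e :: real assume "e > 0"
    then obtain N where N: "\<And>n. n \<ge> N \<Longrightarrow> 1 - e < sqrt_dom n"
      using order_tendstoD(1)[OF sqrt_dom_lim, of "1 - e"] unfolding eventually_sequentially by auto
    have le: "dist (sqrt_seq c m) (sqrt_seq c n) < e" if "n \<ge> N" "n \<le> m" for m n
      using sqrt_seq_dist[OF c that(2)] N[OF that(1)] sqrt_dom_bounds[of m] by (simp add: dist_norm)
    show "\<exists>K. \<forall>m\<ge>K. \<forall>n\<ge>K. dist (sqrt_seq c m) (sqrt_seq c n) < e"
      by (metis le dist_commute linear)
  qed
  thus lim: "sqrt_seq c \<longlonglongrightarrow> sqrt_lim c"
    unfolding sqrt_lim_def by (simp add: Cauchy_convergent convergent_LIMSEQ_iff[symmetric])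
  show "norm (sqrt_lim c - sqrt_seq c n) \<le> 1 - sqrt_dom n" for n
  proof (rule LIMSEQ_le)
    show "(\<lambda>m. norm (sqrt_seq c m - sqrt_seq c n)) \<longlonglongrightarrow> norm (sqrt_lim c - sqrt_seq c n)"
      by (intro tendsto_intros lim)
    show "(\<lambda>m. sqrt_dom m - sqrt_dom n) \<longlonglongrightarrow> 1 - sqrt_dom n" by (intro tendsto_intros sqrt_dom_lim)
    show "\<exists>N. \<forall>m\<ge>N. norm (sqrt_seq c m - sqrt_seq c n) \<le> sqrt_dom m - sqrt_dom n"
      using sqrt_seq_dist[OF c] by blast
  qed
  from this[of 0] show "norm (sqrt_lim c) \<le> 1" by simp
  have "(\<lambda>n. sqrt_seq c (Suc n)) \<longlonglongrightarrow> (1/2) *\<^sub>R (c + sqrt_lim c \<odot> sqrt_lim c)"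
    by (simp, intro tendsto_intros bounded_bilinear.tendsto[OF bounded_bilinear_blinfun_compose] lim)
  hence "sqrt_lim c = (1/2) *\<^sub>R (c + sqrt_lim c \<odot> sqrt_lim c)" using LIMSEQ_unique LIMSEQ_Suc[OF lim] by blast
  hence "2 *\<^sub>R sqrt_lim c = 2 *\<^sub>R ((1/2) *\<^sub>R (c + sqrt_lim c \<odot> sqrt_lim c))" by (rule arg_cong)
  hence "sqrt_lim c + sqrt_lim c = c + sqrt_lim c \<odot> sqrt_lim c" by (simp add: scaleR_2)
  thus "(id_blinfun - sqrt_lim c) \<odot> (id_blinfun - sqrt_lim c) = id_blinfun - c"
    by (simp add: op_simps algebra_simps)
qed

lemma sqrt_seq_commute: "S \<odot> c = c \<odot> S \<Longrightarrow> S \<odot> sqrt_seq c n = sqrt_seq c n \<odot> S"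
proof (induction n)
  case (Suc n)
  hence "S \<odot> (sqrt_seq c n \<odot> sqrt_seq c n) = sqrt_seq c n \<odot> sqrt_seq c n \<odot> S"
    by (metis blinfun_compose_assoc)
  with Suc show ?case by (simp add: op_simps)
qed simp

lemma sqrt_lim_commute:
  assumes "norm c \<le> 1" "S \<odot> c = c \<odot> S" shows "S \<odot> sqrt_lim c = sqrt_lim c \<odot> S"
proof -
  have "(\<lambda>n. S \<odot> sqrt_seq c n) \<longlonglongrightarrow> S \<odot> sqrt_lim c"
    by (intro bounded_bilinear.tendsto[OF bounded_bilinear_blinfun_compose] tendsto_const sqrt_seq_lim assms)
  moreover have "(\<lambda>n. sqrt_seq c n \<odot> S) \<longlonglongrightarrow> sqrt_lim c \<odot> S"
    by (intro bounded_bilinear.tendsto[OF bounded_bilinear_blinfun_compose] tendsto_const sqrt_seq_lim assms)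
  ultimately show ?thesis using LIMSEQ_unique by (simp add: sqrt_seq_commute[OF assms(2)])
qed

text \<open>The rate in \<open>sqrt_lim_dist\<close> is the same for all \<open>c i\<close>, so
  strong convergence of the polynomial iterates passes to their limits.\<close>

lemma sqrt_lim_stends:
  assumes c: "\<And>i. norm (c i) \<le> 1" "norm d \<le> 1" and "stends c d F"
  shows "stends (\<lambda>i. sqrt_lim (c i)) (sqrt_lim d) F"
proof (rule stends_uniform)
  show "stends (\<lambda>i. sqrt_seq (c i) n) (sqrt_seq d n) F" for n
  proof (induction n)
    case (Suc n)
    have "norm (sqrt_seq (c i) n) \<le> 1" for i
      using sqrt_seq_bounds(1)[OF c(1)] sqrt_dom_bounds[of n] order_trans by blast
    thus ?case by (simp, intro stends_scaleR stends_add assms stends_compose[where K=1] Suc)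
  qed (simp add: stends_const)
  show "(\<lambda>n. 1 - sqrt_dom n) \<longlonglongrightarrow> 0" using tendsto_diff[OF tendsto_const sqrt_dom_lim, of 1] by simp
qed (use sqrt_lim_dist c in auto)

lemma bounded_linear_hadj: "bounded_linear (hadj :: ('a::{real_inner,banach} \<Rightarrow>\<^sub>L 'a) \<Rightarrow> _)"
  by (rule bounded_linear_intro[where K=1]) auto

lemma sqrt_lim_hadj:
  assumes "norm c \<le> 1" "c\<^sup>\<dagger> = c" shows "(sqrt_lim c)\<^sup>\<dagger> = sqrt_lim c"
proof -
  have "(sqrt_seq c n)\<^sup>\<dagger> = sqrt_seq c n" for n by (induction n) (auto simp: assms)
  moreover have "(\<lambda>n. (sqrt_seq c n)\<^sup>\<dagger>) \<longlonglongrightarrow> (sqrt_lim c)\<^sup>\<dagger>"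
    by (intro bounded_linear.tendsto[OF bounded_linear_hadj] sqrt_seq_lim assms)
  ultimately have "sqrt_seq c \<longlonglongrightarrow> (sqrt_lim c)\<^sup>\<dagger>" by simp
  thus ?thesis by (rule LIMSEQ_unique[OF _ sqrt_seq_lim[OF assms(1)]])
qed

text \<open>The parameter only has to satisfy \<open>norm T \<le> r\<close>.
  Keeping it fixed along a bounded net makes the modulus strongly continuous.\<close>

definition modulus :: "real \<Rightarrow> ('a::{real_inner,banach} \<Rightarrow>\<^sub>L 'a) \<Rightarrow> 'a \<Rightarrow>\<^sub>L 'a" where
  "modulus r T = r *\<^sub>R (id_blinfun - sqrt_lim (id_blinfun - (1 / (r * r)) *\<^sub>R (T\<^sup>\<dagger> \<odot> T)))"

text \<open>After scaling \<open>T\<close> to a contraction \<open>S\<close>, expanding the square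
  shows \<open>norm (x - S\<^sup>\<dagger> (S x)) \<le> norm x\<close>.\<close>

lemma modulus_arg_norm:
  fixes T :: "'a::{real_inner,banach} \<Rightarrow>\<^sub>L 'a"
  assumes "norm T \<le> r" "r > 0"
  shows "norm (id_blinfun - (1 / (r * r)) *\<^sub>R (T\<^sup>\<dagger> \<odot> T)) \<le> 1"
proof -
  define S where "S = (1 / r) *\<^sub>R T"
  have S1: "norm (S y) \<le> norm y" for y
  proof -
    have "norm S \<le> 1" using assms by (simp add: S_def divide_le_eq)
    thus ?thesis using norm_blinfun[of S y] by (meson mult_left_le_one_le norm_ge_zero order_trans)
  qed
  have S2: "norm (S\<^sup>\<dagger> y) \<le> norm y" for y
  proof -
    have "norm (S\<^sup>\<dagger>) \<le> 1" using assms by (simp add: S_def divide_le_eq)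
    thus ?thesis using norm_blinfun[of "S\<^sup>\<dagger>" y] by (meson mult_left_le_one_le norm_ge_zero order_trans)
  qed
  have "norm (id_blinfun - S\<^sup>\<dagger> \<odot> S) \<le> 1"
  proof (rule norm_blinfun_bound)
    fix x
    have "x \<bullet> S\<^sup>\<dagger> (S x) = (norm (S x))\<^sup>2" by (simp add: power2_norm_eq_inner inner_hadj)
    moreover have "(norm (x - z))\<^sup>2 = (norm x)\<^sup>2 - 2 * (x \<bullet> z) + (norm z)\<^sup>2" for z
      by (simp add: power2_norm_eq_inner inner_diff_left inner_diff_right inner_commute)
    ultimately have "(norm (x - S\<^sup>\<dagger> (S x)))\<^sup>2 = (norm x)\<^sup>2 - 2 * (norm (S x))\<^sup>2 + (norm (S\<^sup>\<dagger> (S x)))\<^sup>2"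
      by simp
    also have "\<dots> \<le> (norm x)\<^sup>2"
    proof -
      have "(norm (S\<^sup>\<dagger> (S x)))\<^sup>2 \<le> (norm (S x))\<^sup>2" by (rule power_mono[OF S2]) simp
      moreover have "0 \<le> (norm (S x))\<^sup>2" by simp
      ultimately show ?thesis by linarith
    qed
    finally have "norm (x - S\<^sup>\<dagger> (S x)) \<le> norm x" by (rule power2_le_imp_le) simp
    thus "norm ((id_blinfun - S\<^sup>\<dagger> \<odot> S) x) \<le> 1 * norm x" by (simp add: blinfun.diff_left)
  qed simp
  thus ?thesis by (simp add: S_def op_simps)
qed

lemma
  fixes T :: "'a::{real_inner,banach} \<Rightarrow>\<^sub>L 'a"
  assumes T: "norm T \<le> r" "r > 0"
  shows modulus_sq: "modulus r T \<odot> modulus r T = T\<^sup>\<dagger> \<odot> T"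
    and modulus_hadj: "(modulus r T)\<^sup>\<dagger> = modulus r T"
    and modulus_nonneg: "modulus r T x \<bullet> x \<ge> 0"
    and modulus_commute: "S \<odot> (T\<^sup>\<dagger> \<odot> T) = T\<^sup>\<dagger> \<odot> T \<odot> S \<Longrightarrow> S \<odot> modulus r T = modulus r T \<odot> S"
proof -
  note c = modulus_arg_norm[OF T]
  show "modulus r T \<odot> modulus r T = T\<^sup>\<dagger> \<odot> T"
    unfolding modulus_def blinfun_compose_algebra(7,8) sqrt_lim_eq[OF c] using T by simp
  show "(modulus r T)\<^sup>\<dagger> = modulus r T"
    unfolding modulus_def by (simp add: sqrt_lim_hadj[OF c])
  define Y where "Y = sqrt_lim (id_blinfun - (1 / (r * r)) *\<^sub>R (T\<^sup>\<dagger> \<odot> T))"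
  have "Y x \<bullet> x \<le> norm (Y x) * norm x" by (rule norm_cauchy_schwarz)
  also have "\<dots> \<le> norm x * norm x"
    using norm_blinfun[of Y x] norm_sqrt_lim[OF c] unfolding Y_def[symmetric]
    by (intro mult_right_mono) (auto intro: order_trans[OF _ mult_left_le_one_le])
  finally have "Y x \<bullet> x \<le> x \<bullet> x" by (simp add: power2_norm_eq_inner flip: power2_eq_square)
  thus "modulus r T x \<bullet> x \<ge> 0"
    using T by (simp add: modulus_def Y_def[symmetric] blinfun.scaleR_left blinfun.diff_left inner_diff_left)
  assume S: "S \<odot> (T\<^sup>\<dagger> \<odot> T) = T\<^sup>\<dagger> \<odot> T \<odot> S"
  have "S \<odot> Y = Y \<odot> S" unfolding Y_def
    by (rule sqrt_lim_commute[OF c]) (simp add: blinfun_compose_algebra S)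
  thus "S \<odot> modulus r T = modulus r T \<odot> S" by (simp add: modulus_def Y_def[symmetric] op_simps)
qed

lemma norm_modulus_apply:
  fixes T :: "'a::{real_inner,banach} \<Rightarrow>\<^sub>L 'a"
  assumes T: "norm T \<le> r" "r > 0" shows "norm (modulus r T x) = norm (T x)"
proof -
  have "(norm (modulus r T x))\<^sup>2 = (norm (T x))\<^sup>2"
    unfolding norm_apply_sq[of "modulus r T"] norm_apply_sq[of T] modulus_hadj[OF T] modulus_sq[OF T] ..
  thus ?thesis by simp
qed

text \<open>Convergence is asked of \<open>(f i)\<^sup>\<dagger> \<odot> f i\<close>, since strong
  convergence of \<open>f\<close> alone says nothing about the adjoints.\<close>

lemma modulus_stends:
  assumes "\<And>i. norm (f i) \<le> r" "norm T \<le> r" "r > 0" "stends (\<lambda>i. (f i)\<^sup>\<dagger> \<odot> f i) (T\<^sup>\<dagger> \<odot> T) F"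
  shows "stends (\<lambda>i. modulus r (f i)) (modulus r T) F"
  unfolding modulus_def
  by (intro stends_scaleR stends_diff stends_const sqrt_lim_stends modulus_arg_norm assms)

subsection \<open>Spectral projections of self-adjoint operators\<close>

definition pos_part :: "real \<Rightarrow> ('a::{real_inner,banach} \<Rightarrow>\<^sub>L 'a) \<Rightarrow> 'a \<Rightarrow>\<^sub>L 'a" where
  "pos_part r a = (1/2) *\<^sub>R (modulus r a + a)"

text \<open>For self-adjoint \<open>a\<close>, the spectral projection of the open half-line of
  positive numbers.\<close>

definition pos_proj :: "real \<Rightarrow> ('a::{real_inner,banach} \<Rightarrow>\<^sub>L 'a) \<Rightarrow> 'a \<Rightarrow>\<^sub>L 'a" where
  "pos_proj r a = range_proj (pos_part r a)"

lemma
  fixes a :: "'a::{real_inner,banach} \<Rightarrow>\<^sub>L 'a"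
  assumes a: "a\<^sup>\<dagger> = a" "norm a \<le> r" "r > 0"
  shows is_proj_pos_proj: "is_proj (pos_proj r a)"
    and pos_part_hadj: "(pos_part r a)\<^sup>\<dagger> = pos_part r a"
    and pos_part_commute: "S \<odot> a = a \<odot> S \<Longrightarrow> S \<odot> pos_part r a = pos_part r a \<odot> S"
    and pos_proj_commute: "S \<odot> a = a \<odot> S \<Longrightarrow> S \<odot> pos_proj r a = pos_proj r a \<odot> S"
    and pos_proj_nonneg: "a (pos_proj r a x) \<bullet> pos_proj r a x \<ge> 0"
    and pos_proj_nonpos: "pos_proj r a x = 0 \<Longrightarrow> a x \<bullet> x \<le> 0"
proof -
  let ?p = "pos_proj r a" and ?P = "pos_part r a" and ?b = "modulus r a"
  note T = a(2,3)
  show p: "is_proj ?p" by (simp add: pos_proj_def)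
  show P: "?P\<^sup>\<dagger> = ?P" by (simp add: pos_part_def modulus_hadj[OF T] a)
  have comm: "S \<odot> ?P = ?P \<odot> S" if "S \<odot> a = a \<odot> S" for S
  proof -
    have "S \<odot> (a\<^sup>\<dagger> \<odot> a) = a\<^sup>\<dagger> \<odot> a \<odot> S" using that by (metis a(1) blinfun_compose_assoc)
    from modulus_commute[OF T this] show ?thesis by (simp add: pos_part_def op_simps that)
  qed
  thus "S \<odot> a = a \<odot> S \<Longrightarrow> S \<odot> ?P = ?P \<odot> S" .
  assume "S \<odot> a = a \<odot> S"
  moreover from this have "S\<^sup>\<dagger> \<odot> a = a \<odot> S\<^sup>\<dagger>" by (metis a(1) hadj_simps(1))
  ultimately show "S \<odot> ?p = ?p \<odot> S"
    unfolding pos_proj_def by (intro range_proj_commute) (rule comm, assumption)+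
next
  let ?p = "pos_proj r a" and ?P = "pos_part r a" and ?b = "modulus r a"
  note T = a(2,3)
  have p: "is_proj ?p" by (simp add: pos_proj_def)
  have P: "?P\<^sup>\<dagger> = ?P" by (simp add: pos_part_def modulus_hadj[OF T] a)
  have ab: "a \<odot> ?b = ?b \<odot> a" by (rule modulus_commute[OF T]) (simp add: a op_simps)
  have bb: "?b \<odot> ?b = a \<odot> a" using modulus_sq[OF T] a by simp
  \<comment> \<open>\<open>a\<close> and its modulus \<open>?b\<close> commute and have the same
    square, so \<open>?b - a\<close> annihilates \<open>?b + a\<close>: on the range of the positive
    part, \<open>a\<close> agrees with its modulus.\<close>
  have "(?b - a) \<odot> ?P = 0" by (simp add: pos_part_def op_simps ab bb)
  from range_proj_annihilate[OF this] have bp: "a \<odot> ?p = ?b \<odot> ?p" by (simp add: pos_proj_def op_simps)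
  have "a (?p x) = ?b (?p x)" using bp by (metis blinfun_apply_blinfun_compose)
  thus "a (?p x) \<bullet> ?p x \<ge> 0" using modulus_nonneg[OF T] by simp
  assume x: "?p x = 0"
  have "(?p \<odot> ?P)\<^sup>\<dagger> = ?P\<^sup>\<dagger>" unfolding pos_proj_def by simp
  hence "?P \<odot> ?p = ?P" using p by (simp add: is_projD P)
  hence "?P x = 0" using x by (metis blinfun_apply_blinfun_compose blinfun.zero_right)
  hence "a x = - ?b x" by (simp add: pos_part_def blinfun.bilinear_simps eq_neg_iff_add_eq_0 add.commute)
  thus "a x \<bullet> x \<le> 0" using modulus_nonneg[OF T, of x] by simp
qed

text \<open>Nonnegativity of the form at \<open>x - (1/d) *\<^sub>R s x\<close>, combined with the
  upper bound at \<open>x\<close> and at \<open>s x\<close>.\<close>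

lemma norm_selfadj_le:
  fixes s :: "'a::{real_inner,banach} \<Rightarrow>\<^sub>L 'a"
  assumes s: "s\<^sup>\<dagger> = s" and d: "d > 0" and b: "\<And>x. 0 \<le> s x \<bullet> x" "\<And>x. s x \<bullet> x \<le> d * (norm x)\<^sup>2"
  shows "norm (s x) \<le> d * norm x"
proof -
  let ?y = "s x"
  have sy: "s u \<bullet> v = u \<bullet> s v" for u v by (metis inner_hadj s)
  have "0 \<le> s (x - (1/d) *\<^sub>R ?y) \<bullet> (x - (1/d) *\<^sub>R ?y)" by (rule b)
  also have "\<dots> = s x \<bullet> x - 2 / d * (?y \<bullet> ?y) + (1/d) * (1/d) * (s ?y \<bullet> ?y)"
    by (simp add: blinfun.bilinear_simps inner_diff_left inner_diff_right sy inner_commute[of _ x]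
        diff_divide_distrib)
  also have "\<dots> \<le> d * (norm x)\<^sup>2 - 2 / d * (norm ?y)\<^sup>2 + (1/d) * (1/d) * (d * (norm ?y)\<^sup>2)"
    using b(2)[of x] b(2)[of ?y] d by (intro add_mono diff_mono mult_left_mono) (auto simp: power2_norm_eq_inner)
  also have "\<dots> = d * (norm x)\<^sup>2 - (norm ?y)\<^sup>2 / d" using d by (simp add: field_simps)
  finally have "(norm ?y)\<^sup>2 / d \<le> d * (norm x)\<^sup>2" by simp
  hence "(norm ?y)\<^sup>2 \<le> d * (norm x)\<^sup>2 * d" using d by (simp only: pos_divide_le_eq)
  hence "(norm ?y)\<^sup>2 \<le> (d * norm x)\<^sup>2" by (simp add: power_mult_distrib power2_eq_square mult_ac)
  thus ?thesis by (rule power2_le_imp_le) (use d in simp)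
qed

text \<open>A grid of spectral projections: \<open>spec_proj r \<delta> a k\<close> is the projection for \<open>a > spec_pt r \<delta> k\<close>.
  It applies to \<open>norm a \<le> r\<close>; the grid has \<open>spec_num r \<delta>\<close> points.\<close>

definition spec_pt :: "real \<Rightarrow> real \<Rightarrow> nat \<Rightarrow> real" where
  "spec_pt r \<delta> k = - r - \<delta> + real k * \<delta>"

text \<open>Why two more than the ceiling: the grid starts \<open>\<delta>\<close> below
  \<open>- r\<close>, and its last point lies at least \<open>\<delta>\<close> above
  \<open>r\<close>. These margins make the first projection the identity and the last one 0.\<close>

definition spec_num :: "real \<Rightarrow> real \<Rightarrow> nat" where
  "spec_num r \<delta> = nat \<lceil>2 * r / \<delta>\<rceil> + 2"

text \<open>One radius for all positive parts: it bounds the norm of \<open>a\<close> minus any grid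
  value.\<close>

definition spec_rad :: "real \<Rightarrow> real \<Rightarrow> real" where
  "spec_rad r \<delta> = 2 * r + 3 * \<delta>"

text \<open>The value 0 beyond the grid makes \<open>Suc k\<close> harmless at the last
  point.\<close>

definition spec_proj :: "real \<Rightarrow> real \<Rightarrow> ('a::{real_inner,banach} \<Rightarrow>\<^sub>L 'a) \<Rightarrow> nat \<Rightarrow> 'a \<Rightarrow>\<^sub>L 'a" where
  "spec_proj r \<delta> a k = (if k \<le> spec_num r \<delta> then pos_proj (spec_rad r \<delta>) (a - spec_pt r \<delta> k *\<^sub>R id_blinfun) else 0)"

definition spec_cell :: "real \<Rightarrow> real \<Rightarrow> ('a::{real_inner,banach} \<Rightarrow>\<^sub>L 'a) \<Rightarrow> nat \<Rightarrow> 'a \<Rightarrow>\<^sub>L 'a" where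
  "spec_cell r \<delta> a k = spec_proj r \<delta> a k - spec_proj r \<delta> a (Suc k)"

context
  fixes r \<delta> :: real
  assumes r: "r \<ge> 0" and \<delta>: "\<delta> > 0"
begin

lemma spec_rad_pos: "spec_rad r \<delta> > 0"
  using r \<delta> by (simp add: spec_rad_def)

lemma spec_num_bounds: "2 * r + 2 * \<delta> \<le> real (spec_num r \<delta>) * \<delta>" "real (spec_num r \<delta>) * \<delta> \<le> 2 * r + 3 * \<delta>"
proof -
  have q: "0 \<le> 2 * r / \<delta>" using r \<delta> by simp
  have n: "real (spec_num r \<delta>) = of_int \<lceil>2 * r / \<delta>\<rceil> + 2" using q by (simp add: spec_num_def)
  have "2 * r / \<delta> \<le> of_int \<lceil>2 * r / \<delta>\<rceil>" "of_int \<lceil>2 * r / \<delta>\<rceil> \<le> 2 * r / \<delta> + 1" by linarith+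
  hence "2 * r / \<delta> + 2 \<le> real (spec_num r \<delta>)" "real (spec_num r \<delta>) \<le> 2 * r / \<delta> + 3" using n by linarith+
  hence "(2 * r / \<delta> + 2) * \<delta> \<le> real (spec_num r \<delta>) * \<delta>" "real (spec_num r \<delta>) * \<delta> \<le> (2 * r / \<delta> + 3) * \<delta>"
    using \<delta> by (auto intro: mult_right_mono)
  thus "2 * r + 2 * \<delta> \<le> real (spec_num r \<delta>) * \<delta>" "real (spec_num r \<delta>) * \<delta> \<le> 2 * r + 3 * \<delta>"
    using \<delta> by (simp_all add: distrib_right)
qed

context
  fixes a :: "'a::{real_inner,banach} \<Rightarrow>\<^sub>L 'a"
  assumes sa: "a\<^sup>\<dagger> = a" and na: "norm a \<le> r"
begin

lemma spec_shift:
  "(a - t *\<^sub>R id_blinfun)\<^sup>\<dagger> = a - t *\<^sub>R id_blinfun"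
  "k \<le> spec_num r \<delta> \<Longrightarrow> norm (a - spec_pt r \<delta> k *\<^sub>R id_blinfun) \<le> spec_rad r \<delta>"
proof -
  show "(a - t *\<^sub>R id_blinfun)\<^sup>\<dagger> = a - t *\<^sub>R id_blinfun" using sa by simp
  assume k: "k \<le> spec_num r \<delta>"
  have "real k * \<delta> \<le> real (spec_num r \<delta>) * \<delta>" using k \<delta> by (intro mult_right_mono) auto
  moreover have "0 \<le> real k * \<delta>" using \<delta> by simp
  ultimately have "\<bar>spec_pt r \<delta> k\<bar> \<le> r + 2 * \<delta>"
    using spec_num_bounds r \<delta> unfolding spec_pt_def abs_le_iff by linarith
  moreover have "norm (a - spec_pt r \<delta> k *\<^sub>R id_blinfun) \<le> norm a + \<bar>spec_pt r \<delta> k\<bar> * norm (id_blinfun :: 'a \<Rightarrow>\<^sub>L 'a)"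
    by (metis norm_scaleR norm_triangle_ineq4)
  moreover have "\<bar>spec_pt r \<delta> k\<bar> * norm (id_blinfun :: 'a \<Rightarrow>\<^sub>L 'a) \<le> \<bar>spec_pt r \<delta> k\<bar> * 1"
    by (intro mult_left_mono norm_blinfun_id_le) auto
  ultimately show "norm (a - spec_pt r \<delta> k *\<^sub>R id_blinfun) \<le> spec_rad r \<delta>"
    using na \<delta> by (simp add: spec_rad_def)
qed

lemma spec_proj_commute: "S \<odot> a = a \<odot> S \<Longrightarrow> S \<odot> spec_proj r \<delta> a k = spec_proj r \<delta> a k \<odot> S"
proof (cases "k \<le> spec_num r \<delta>")
  case True
  assume S: "S \<odot> a = a \<odot> S"
  show ?thesis
    unfolding spec_proj_def if_P[OF True]
    by (rule pos_proj_commute[OF spec_shift(1) spec_shift(2)[OF True] spec_rad_pos])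
      (simp add: op_simps S)
qed (simp add: spec_proj_def)

lemma is_proj_spec_proj: "is_proj (spec_proj r \<delta> a k)"
  unfolding spec_proj_def using is_proj_pos_proj[OF spec_shift(1) spec_shift(2) spec_rad_pos] by simp

lemma spec_proj_ge:
  assumes "spec_proj r \<delta> a k x = x" shows "spec_pt r \<delta> k * (norm x)\<^sup>2 \<le> a x \<bullet> x"
proof (cases "k \<le> spec_num r \<delta>")
  case True
  have "(a - spec_pt r \<delta> k *\<^sub>R id_blinfun) x \<bullet> x \<ge> 0"
    using pos_proj_nonneg[OF spec_shift(1) spec_shift(2)[OF True] spec_rad_pos, of x] assms True
    by (simp add: spec_proj_def)
  thus ?thesis by (simp add: blinfun.bilinear_simps inner_diff_left power2_norm_eq_inner)
qed (use assms in \<open>simp add: spec_proj_def\<close>)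

lemma inner_le_norm_sq: "\<bar>a x \<bullet> x\<bar> \<le> r * (norm x)\<^sup>2"
proof -
  have "\<bar>a x \<bullet> x\<bar> \<le> norm (a x) * norm x" by (rule Cauchy_Schwarz_ineq2)
  also have "\<dots> \<le> r * norm x * norm x"
    using norm_blinfun[of a x] na by (intro mult_right_mono order_trans[OF norm_blinfun] mult_right_mono) auto
  finally show ?thesis by (simp add: power2_eq_square mult.assoc)
qed

lemma spec_proj_le:
  assumes "spec_proj r \<delta> a k x = 0" shows "a x \<bullet> x \<le> spec_pt r \<delta> k * (norm x)\<^sup>2"
proof (cases "k \<le> spec_num r \<delta>")
  case True
  have "(a - spec_pt r \<delta> k *\<^sub>R id_blinfun) x \<bullet> x \<le> 0"
    by (rule pos_proj_nonpos[OF spec_shift(1) spec_shift(2)[OF True] spec_rad_pos])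
      (use assms True in \<open>simp add: spec_proj_def\<close>)
  thus ?thesis by (simp add: blinfun.bilinear_simps inner_diff_left power2_norm_eq_inner)
next
  case False
  hence "real (spec_num r \<delta>) * \<delta> \<le> real k * \<delta>" using \<delta> by (intro mult_right_mono) auto
  hence "r \<le> spec_pt r \<delta> k" using spec_num_bounds(1) \<delta> unfolding spec_pt_def by linarith
  hence "r * (norm x)\<^sup>2 \<le> spec_pt r \<delta> k * (norm x)\<^sup>2" by (intro mult_right_mono) auto
  thus ?thesis using inner_le_norm_sq[of x] by linarith
qed

text \<open>The first grid point lies \<open>\<delta>\<close> below the lower bound
  \<open>- r\<close> of the form of \<open>a\<close>, which leaves no room for a nonzero vector that
  the projection kills.\<close>

lemma spec_proj_0: "spec_proj r \<delta> a 0 = id_blinfun"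
proof -
  let ?p = "spec_proj r \<delta> a 0"
  have "x - ?p x = 0" for x
  proof -
    let ?y = "x - ?p x"
    have "?p ?y = 0" by (simp add: blinfun.diff_right is_projD(3)[OF is_proj_spec_proj])
    from spec_proj_le[OF this] have "a ?y \<bullet> ?y \<le> (- r - \<delta>) * (norm ?y)\<^sup>2" by (simp add: spec_pt_def)
    with inner_le_norm_sq[of ?y] have "\<delta> * (norm ?y)\<^sup>2 \<le> 0" by (simp add: algebra_simps)
    thus "?y = 0" using \<delta> by (simp add: mult_le_0_iff)
  qed
  thus ?thesis by (intro blinfun_eqI) simp
qed

lemma spec_proj_num: "k \<ge> spec_num r \<delta> \<Longrightarrow> spec_proj r \<delta> a k = 0"
proof (intro blinfun_eqI)
  fix x assume k: "k \<ge> spec_num r \<delta>"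
  let ?y = "spec_proj r \<delta> a k x"
  have "spec_proj r \<delta> a k ?y = ?y" by (simp add: is_projD(3)[OF is_proj_spec_proj])
  from spec_proj_ge[OF this] have 1: "spec_pt r \<delta> k * (norm ?y)\<^sup>2 \<le> r * (norm ?y)\<^sup>2"
    using inner_le_norm_sq[of ?y] by linarith
  have "real (spec_num r \<delta>) * \<delta> \<le> real k * \<delta>" using k \<delta> by (intro mult_right_mono) auto
  hence "r + \<delta> \<le> spec_pt r \<delta> k" using spec_num_bounds(1) unfolding spec_pt_def by linarith
  hence "(r + \<delta>) * (norm ?y)\<^sup>2 \<le> spec_pt r \<delta> k * (norm ?y)\<^sup>2" by (intro mult_right_mono) auto
  with 1 have "\<delta> * (norm ?y)\<^sup>2 \<le> 0" by (simp add: algebra_simps)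
  thus "?y = blinfun_apply 0 x" using \<delta> by (simp add: mult_le_0_iff)
qed

lemma spec_proj_comm2: "spec_proj r \<delta> a k \<odot> spec_proj r \<delta> a l = spec_proj r \<delta> a l \<odot> spec_proj r \<delta> a k"
  by (rule spec_proj_commute) (rule spec_proj_commute[OF refl, symmetric])

text \<open>A vector in the range of the second projection and in the kernel of the first would have
  a form of at least the larger and at most the smaller grid value.\<close>

lemma spec_proj_antimono: "spec_proj r \<delta> a k \<odot> spec_proj r \<delta> a (Suc k) = spec_proj r \<delta> a (Suc k)"
proof (rule blinfun_eqI)
  fix x
  let ?p = "spec_proj r \<delta> a k" and ?q = "spec_proj r \<delta> a (Suc k)"
  let ?y = "?q (x - ?p x)"
  have y: "?y = ?q x - ?p (?q x)"
    using spec_proj_comm2[of k "Suc k"] by (simp add: blinfun.diff_right flip: blinfun_apply_blinfun_compose)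
  have "?q ?y = ?y" by (simp add: is_projD(3)[OF is_proj_spec_proj])
  from spec_proj_ge[OF this] have 1: "spec_pt r \<delta> (Suc k) * (norm ?y)\<^sup>2 \<le> a ?y \<bullet> ?y" .
  have "?p ?y = 0" unfolding y by (simp add: blinfun.diff_right is_projD(3)[OF is_proj_spec_proj])
  from 1 spec_proj_le[OF this] have "\<delta> * (norm ?y)\<^sup>2 \<le> 0" by (simp add: spec_pt_def algebra_simps)
  hence "?y = 0" using \<delta> by (simp add: mult_le_0_iff)
  thus "(?p \<odot> ?q) x = ?q x" using y by simp
qed

lemma is_proj_spec_cell: "is_proj (spec_cell r \<delta> a k)"
  unfolding spec_cell_def by (intro is_proj_diff is_proj_spec_proj spec_proj_antimono)

lemma spec_cell_commute: "S \<odot> a = a \<odot> S \<Longrightarrow> S \<odot> spec_cell r \<delta> a k = spec_cell r \<delta> a k \<odot> S"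
  unfolding spec_cell_def by (simp add: op_simps spec_proj_commute)

lemma sum_spec_cell: "(\<Sum>k<spec_num r \<delta>. spec_cell r \<delta> a k) = id_blinfun"
  unfolding spec_cell_def sum_lessThan_telescope' by (simp add: spec_proj_0 spec_proj_num)

lemma spec_proj_antimono': "k \<le> l \<Longrightarrow> spec_proj r \<delta> a k \<odot> spec_proj r \<delta> a l = spec_proj r \<delta> a l"
  by (induction l rule: dec_induct)
    (simp add: is_projD(1)[OF is_proj_spec_proj], metis spec_proj_antimono blinfun_compose_assoc)

lemma spec_cell_orth: "k \<noteq> l \<Longrightarrow> spec_cell r \<delta> a k \<odot> spec_cell r \<delta> a l = 0"
proof -
  have *: "spec_cell r \<delta> a k \<odot> spec_cell r \<delta> a l = 0" if "k < l" for k l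
  proof -
    have "spec_proj r \<delta> a (Suc k) \<odot> spec_proj r \<delta> a l = spec_proj r \<delta> a l"
      "spec_proj r \<delta> a (Suc k) \<odot> spec_proj r \<delta> a (Suc l) = spec_proj r \<delta> a (Suc l)"
      "spec_proj r \<delta> a k \<odot> spec_proj r \<delta> a l = spec_proj r \<delta> a l"
      "spec_proj r \<delta> a k \<odot> spec_proj r \<delta> a (Suc l) = spec_proj r \<delta> a (Suc l)"
      by (rule spec_proj_antimono'; use that in simp)+
    thus ?thesis unfolding spec_cell_def by (simp add: blinfun_compose_algebra)
  qed
  assume "k \<noteq> l"
  thus ?thesis
    using *[of k l] *[of l k] spec_cell_commute[OF spec_cell_commute[OF refl, symmetric], of k l]
    by (cases "k < l") auto
qed

text \<open>On a cell the form of \<open>a\<close> minus the grid value lies between 0 and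
  \<open>\<delta>\<close>; for a self-adjoint operator this bounds the norm.\<close>

lemma spec_cell_approx:
  assumes x: "spec_cell r \<delta> a k x = x"
  shows "norm (a x - spec_pt r \<delta> k *\<^sub>R x) \<le> \<delta> * norm x"
proof -
  let ?d = "spec_cell r \<delta> a k" and ?t = "spec_pt r \<delta> k"
  define s where "s = (a - ?t *\<^sub>R id_blinfun) \<odot> ?d"
  have d: "is_proj ?d" by (rule is_proj_spec_cell)
  have ad: "a \<odot> ?d = ?d \<odot> a" by (rule spec_cell_commute[OF refl])
  have sh: "s\<^sup>\<dagger> = s" by (simp add: s_def is_projD(2)[OF d] sa op_simps ad)
  have form: "s y \<bullet> y = a (?d y) \<bullet> ?d y - ?t * (norm (?d y))\<^sup>2" for y
  proof -
    have "s = ?d \<odot> s" by (simp add: s_def op_simps ad is_proj_assoc[OF d])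
      (simp add: is_projD(1)[OF d] flip: ad blinfun_compose_assoc)
    hence "s y \<bullet> y = ?d (s y) \<bullet> y" by (metis blinfun_apply_blinfun_compose)
    also have "\<dots> = s y \<bullet> ?d y" by (metis inner_hadj is_projD(2)[OF d])
    finally show ?thesis by (simp add: s_def blinfun.bilinear_simps inner_diff_left power2_norm_eq_inner)
  qed
  have q1: "spec_proj r \<delta> a k (?d y) = ?d y" for y
    by (simp add: spec_cell_def blinfun.bilinear_simps is_projD(3)[OF is_proj_spec_proj])
      (metis spec_proj_antimono blinfun_apply_blinfun_compose)
  have q2: "spec_proj r \<delta> a (Suc k) (?d y) = 0" for y
    by (simp add: spec_cell_def blinfun.bilinear_simps is_projD(3)[OF is_proj_spec_proj])
      (metis spec_proj_antimono spec_proj_comm2 blinfun_apply_blinfun_compose)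
  have "norm (s x) \<le> \<delta> * norm x"
  proof (rule norm_selfadj_le[OF sh \<delta>])
    fix y
    show "0 \<le> s y \<bullet> y" unfolding form using spec_proj_ge[OF q1[of y]] by simp
    have "s y \<bullet> y \<le> \<delta> * (norm (?d y))\<^sup>2"
      unfolding form using spec_proj_le[OF q2[of y]] by (simp add: spec_pt_def algebra_simps)
    also have "\<dots> \<le> \<delta> * (norm y)\<^sup>2"
      using norm_proj_le[OF d, of y] \<delta> by (intro mult_left_mono power_mono) auto
    finally show "s y \<bullet> y \<le> \<delta> * (norm y)\<^sup>2" .
  qed
  moreover have "s x = a x - ?t *\<^sub>R x" by (simp add: s_def x blinfun.bilinear_simps)
  ultimately show ?thesis by simp
qed

end
end

subsection \<open>Von Neumann algebras on a real Hilbert space\<close>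

text \<open>Taken among all real-linear operators; since \<open>imul\<close> belongs to a von
  Neumann algebra, it still equals the \<open>commutant\<close> there
  (\<open>comm_eq_commutant\<close>).\<close>

definition comm :: "('a::{real_inner,banach} \<Rightarrow>\<^sub>L 'a) set \<Rightarrow> ('a \<Rightarrow>\<^sub>L 'a) set" where
  "comm M = {S. \<forall>T\<in>M. S \<odot> T = T \<odot> S}"

text \<open>The second assumption is the nontrivial half of the bicommutant property. It is also the
  tool for membership: whatever is built from \<open>M\<close> in a way that respects commutation
  lies in \<open>M\<close>.\<close>

locale vna =
  fixes M :: "('a::{real_inner,banach} \<Rightarrow>\<^sub>L 'a) set"
  assumes M_hadj: "T \<in> M \<Longrightarrow> T\<^sup>\<dagger> \<in> M"
    and M_bicomm: "(\<And>S. S \<in> comm M \<Longrightarrow> S \<odot> T = T \<odot> S) \<Longrightarrow> T \<in> M"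
begin

lemma commD: "S \<in> comm M \<Longrightarrow> T \<in> M \<Longrightarrow> S \<odot> T = T \<odot> S"
  by (simp add: comm_def)

lemma comm_hadj: "S \<in> comm M \<Longrightarrow> S\<^sup>\<dagger> \<in> comm M"
  unfolding comm_def by (auto dest!: bspec[OF _ M_hadj]) (metis hadj_hadj hadj_simps(1))

lemma M_0 [simp]: "0 \<in> M" and M_id [simp]: "id_blinfun \<in> M"
  by (rule M_bicomm, simp add: op_simps)+

lemma M_add: "S \<in> M \<Longrightarrow> T \<in> M \<Longrightarrow> S + T \<in> M"
  and M_diff: "S \<in> M \<Longrightarrow> T \<in> M \<Longrightarrow> S - T \<in> M"
  and M_scaleR: "S \<in> M \<Longrightarrow> r *\<^sub>R S \<in> M"
  by (rule M_bicomm, simp add: blinfun_compose_algebra commD[of _ S] commD[of _ T])+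

lemma M_compose: "S \<in> M \<Longrightarrow> T \<in> M \<Longrightarrow> S \<odot> T \<in> M"
  by (rule M_bicomm) (metis blinfun_compose_assoc commD)

lemmas M_intros = M_add M_diff M_scaleR M_compose M_hadj M_0 M_id

lemma M_stends:
  assumes "stends f T F" "F \<noteq> bot" "\<And>i. f i \<in> M" shows "T \<in> M"
proof (rule M_bicomm)
  fix S assume S: "S \<in> comm M"
  have c: "S (f i x) = f i (S x)" for i x
    using commD[OF S assms(3)] by (metis blinfun_apply_blinfun_compose)
  show "S \<odot> T = T \<odot> S"
  proof (rule blinfun_eqI)
    fix x
    have "((\<lambda>i. f i (S x)) \<longlongrightarrow> T (S x)) F" using assms(1) by (simp add: stends_def)
    moreover have "((\<lambda>i. S (f i x)) \<longlongrightarrow> S (T x)) F"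
      using assms(1) unfolding stends_def
      by (intro bounded_linear.tendsto[OF blinfun.bounded_linear_right]) auto
    ultimately show "(S \<odot> T) x = (T \<odot> S) x"
      using tendsto_unique[OF assms(2)] by (simp add: c)
  qed
qed

lemma M_range_proj: "T \<in> M \<Longrightarrow> range_proj T \<in> M"
  by (rule M_bicomm) (auto intro: range_proj_commute commD comm_hadj)

lemma M_osum: "orth_pisoms W \<Longrightarrow> W \<subseteq> M \<Longrightarrow> osum W \<in> M"
  by (rule M_bicomm) (auto intro: osum_commute commD)

lemma M_modulus: "T \<in> M \<Longrightarrow> norm T \<le> r \<Longrightarrow> r > 0 \<Longrightarrow> modulus r T \<in> M"
  by (rule M_bicomm, rule modulus_commute) (auto intro!: commD M_intros)

lemma M_pos_part: "T \<in> M \<Longrightarrow> norm T \<le> r \<Longrightarrow> r > 0 \<Longrightarrow> pos_part r T \<in> M"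
  unfolding pos_part_def by (intro M_intros M_modulus)

lemma M_pos_proj: "T \<in> M \<Longrightarrow> norm T \<le> r \<Longrightarrow> r > 0 \<Longrightarrow> pos_proj r T \<in> M"
  unfolding pos_proj_def by (intro M_range_proj M_pos_part)

lemma M_spec_cell:
  assumes "r \<ge> 0" "\<delta> > 0" "a\<^sup>\<dagger> = a" "norm a \<le> r" "a \<in> M"
  shows "spec_cell r \<delta> a k \<in> M" "spec_proj r \<delta> a k \<in> M"
  by (rule M_bicomm, rule spec_cell_commute[OF assms(1-4)] spec_proj_commute[OF assms(1-4)],
      rule commD, assumption, rule assms)+

lemma proj_on_commute:
  fixes T :: "'a \<Rightarrow>\<^sub>L 'a"
  assumes S: "closed S" "subspace S" and "\<And>x. x \<in> S \<Longrightarrow> T x \<in> S" "\<And>x. x \<in> S \<Longrightarrow> T\<^sup>\<dagger> x \<in> S"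
  shows "T \<odot> proj_on S = proj_on S \<odot> T"
proof (rule blinfun_eqI)
  fix x
  have "proj_on S (T x) = T (proj_on S x)"
  proof (rule proj_on_unique[OF S])
    show "T (proj_on S x) \<in> S" by (intro assms proj_on_in[OF S])
    fix z assume "z \<in> S"
    hence "(x - proj_on S x) \<bullet> T\<^sup>\<dagger> z = 0" by (intro proj_on_orth[OF S] assms)
    thus "(T x - T (proj_on S x)) \<bullet> z = 0" by (simp add: inner_diff_left inner_hadj)
  qed
  thus "(T \<odot> proj_on S) x = (proj_on S \<odot> T) x" by simp
qed

text \<open>The commutant is closed under adjoints, so a subspace invariant under it is reducing,
  and its projection lies in the bicommutant.\<close>

lemma M_proj_on:
  assumes "closed S" "subspace S" "\<And>T x. T \<in> comm M \<Longrightarrow> x \<in> S \<Longrightarrow> blinfun_apply T x \<in> S"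
  shows "proj_on S \<in> M"
  by (rule M_bicomm) (auto intro!: proj_on_commute assms comm_hadj)

definition pr :: "('a \<Rightarrow>\<^sub>L 'a) \<Rightarrow> bool" where
  "pr p \<longleftrightarrow> p \<in> M \<and> is_proj p"

definition central :: "('a \<Rightarrow>\<^sub>L 'a) \<Rightarrow> bool" where
  "central z \<longleftrightarrow> pr z \<and> (\<forall>T\<in>M. T \<odot> z = z \<odot> T)"

lemma prD: "pr p \<Longrightarrow> p \<in> M" "pr p \<Longrightarrow> is_proj p" "pr p \<Longrightarrow> p \<odot> p = p" "pr p \<Longrightarrow> p\<^sup>\<dagger> = p"
  "pr p \<Longrightarrow> p \<odot> (p \<odot> T) = p \<odot> T"
  by (auto simp: pr_def is_projD is_proj_assoc)

lemma centralD: "central z \<Longrightarrow> pr z" "central z \<Longrightarrow> T \<in> M \<Longrightarrow> T \<odot> z = z \<odot> T"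
  by (auto simp: central_def)

lemma central_left_commute: "central z \<Longrightarrow> T \<in> M \<Longrightarrow> T \<odot> (z \<odot> S) = z \<odot> (T \<odot> S)"
  by (metis blinfun_compose_assoc centralD(2))

lemma central_compl: "central z \<Longrightarrow> central (id_blinfun - z)"
  by (auto simp: central_def pr_def op_simps intro: M_intros is_proj_compl)

lemma pr_simps [simp]: "pr 0" "pr id_blinfun" "central id_blinfun" "central 0"
  by (auto simp: pr_def central_def op_simps)

lemma pr_compl: "pr p \<Longrightarrow> pr (id_blinfun - p)"
  by (auto simp: pr_def intro: M_intros is_proj_compl)

lemma pr_diff: "pr p \<Longrightarrow> pr q \<Longrightarrow> q \<odot> p = p \<Longrightarrow> pr (q - p)"
  by (auto simp: pr_def intro: M_intros is_proj_diff)

lemma pr_add: "pr p \<Longrightarrow> pr q \<Longrightarrow> q \<odot> p = 0 \<Longrightarrow> pr (p + q)"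
  by (auto simp: pr_def intro: M_intros is_proj_add)

lemma pr_central: "central z \<Longrightarrow> pr p \<Longrightarrow> pr (z \<odot> p)"
  by (auto simp: central_def pr_def intro: M_intros is_proj_prod)

lemma pr_range_proj: "T \<in> M \<Longrightarrow> pr (range_proj T)"
  by (auto simp: pr_def M_range_proj)

lemma pr_pisom: "v \<in> M \<Longrightarrow> is_pisom v \<Longrightarrow> pr (v\<^sup>\<dagger> \<odot> v) \<and> pr (v \<odot> v\<^sup>\<dagger>)"
  by (auto simp: pr_def is_pisom_projs intro!: M_intros)

lemma pr_le_sym: "pr p \<Longrightarrow> pr q \<Longrightarrow> q \<odot> p = p \<longleftrightarrow> p \<odot> q = p"
  by (rule proj_le_sym) (auto simp: pr_def)

lemma pr_orth_sym: "pr p \<Longrightarrow> pr q \<Longrightarrow> q \<odot> p = 0 \<longleftrightarrow> p \<odot> q = 0"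
  by (rule proj_orth_sym) (auto simp: pr_def)

text \<open>\<open>z\<close> is the central support of \<open>q\<close>: the closed span of the
  vectors \<open>T (q x)\<close> with \<open>T\<close> in \<open>M\<close> is invariant under
  \<open>M\<close> and under its commutant.\<close>

lemma ex_central_separating:
  assumes q: "pr q" and p: "pr p" and orth: "\<And>T. T \<in> M \<Longrightarrow> p \<odot> T \<odot> q = 0"
  obtains z where "central z" "z \<odot> q = q" "z \<odot> p = 0"
proof -
  define B where "B = {blinfun_apply T (q x) | T x. T \<in> M}"
  define S where "S = closure (span B)"
  have S: "closed S" "subspace S" by (auto simp: S_def subspace_closure)
  have inv: "blinfun_apply R x \<in> S" if R: "\<And>y. y \<in> B \<Longrightarrow> blinfun_apply R y \<in> span B" and x: "x \<in> S" for R x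
  proof -
    have "blinfun_apply R y \<in> span B" if "y \<in> span B" for y
      using that
      by (induction rule: span_induct)
        (auto simp: R subspace_def blinfun.bilinear_simps span_zero intro: span_add span_scale)
    hence "blinfun_apply R ` span B \<subseteq> span B" by blast
    hence "blinfun_apply R ` closure (span B) \<subseteq> closure (span B)"
      by (intro image_closure_subset continuous_intros closed_closure) (use closure_subset in blast)
    thus ?thesis using x by (auto simp: S_def)
  qed
  define z where "z = proj_on S"
  have "z \<in> M" unfolding z_def
  proof (rule M_proj_on[OF S inv])
    fix T y assume T: "T \<in> comm M" and "y \<in> B"
    then obtain R x where R: "y = blinfun_apply R (q x)" "R \<in> M" by (auto simp: B_def)
    have "blinfun_apply T y = blinfun_apply R (q (blinfun_apply T x))"
      using commD[OF T M_compose[OF R(2) prD(1)[OF q]]] unfolding R by (metis blinfun_apply_blinfun_compose)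
    hence "blinfun_apply T y \<in> B" using R(2) by (auto simp: B_def)
    thus "blinfun_apply T y \<in> span B" by (rule span_base)
  qed
  moreover have "T \<odot> z = z \<odot> T" if T: "T \<in> M" for T
  proof -
    have *: "blinfun_apply R y \<in> span B" if y: "y \<in> B" "R \<in> M" for R y
    proof -
      obtain R' x where R': "y = blinfun_apply R' (q x)" "R' \<in> M" using y by (auto simp: B_def)
      hence "blinfun_apply R y = blinfun_apply (R \<odot> R') (q x)" by simp
      hence "blinfun_apply R y \<in> B" using M_compose[OF y(2) R'(2)] unfolding B_def by blast
      thus ?thesis by (rule span_base)
    qed
    show ?thesis unfolding z_def
      by (rule proj_on_commute[OF S]; rule inv) (use * T M_hadj in auto)
  qed
  ultimately have "central z" by (simp add: central_def pr_def z_def is_proj_proj_on[OF S])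
  moreover have "z \<odot> q = q"
  proof (rule blinfun_eqI)
    fix x
    have "q x \<in> B" unfolding B_def by (rule CollectI, rule exI[of _ id_blinfun]) auto
    hence "q x \<in> S" unfolding S_def using closure_subset span_base by blast
    thus "(z \<odot> q) x = q x" by (simp add: z_def proj_on_fix[OF S])
  qed
  moreover have "p \<odot> z = 0"
  proof (rule blinfun_eqI)
    fix x
    have "p y = 0" if "y \<in> span B" for y
      using that
    proof (induction rule: span_induct)
      case (step y)
      then show ?case using orth
        by (auto simp: B_def) (metis blinfun_apply_blinfun_compose blinfun.zero_left)
    qed (auto simp: subspace_def blinfun.bilinear_simps)
    from blinfun_eq_0_on_closure[OF this proj_on_in[OF S, unfolded S_def]]
    show "(p \<odot> z) x = blinfun_apply 0 x" by (simp add: z_def S_def)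
  qed
  ultimately show ?thesis using that pr_orth_sym[of z p] p by (auto simp: central_def)
qed

subsection \<open>Equivalence of projections\<close>

definition eqv :: "('a \<Rightarrow>\<^sub>L 'a) \<Rightarrow> ('a \<Rightarrow>\<^sub>L 'a) \<Rightarrow> bool" (infix "\<asymp>" 50) where
  "p \<asymp> q \<longleftrightarrow> (\<exists>v\<in>M. v\<^sup>\<dagger> \<odot> v = p \<and> v \<odot> v\<^sup>\<dagger> = q)"

definition sube :: "('a \<Rightarrow>\<^sub>L 'a) \<Rightarrow> ('a \<Rightarrow>\<^sub>L 'a) \<Rightarrow> bool" (infix "\<preceq>" 50) where
  "p \<preceq> q \<longleftrightarrow> (\<exists>v\<in>M. v\<^sup>\<dagger> \<odot> v = p \<and> q \<odot> v = v)"

lemma eqvI: "v \<in> M \<Longrightarrow> v\<^sup>\<dagger> \<odot> v = p \<Longrightarrow> v \<odot> v\<^sup>\<dagger> = q \<Longrightarrow> p \<asymp> q"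
  by (auto simp: eqv_def)

lemma subeI: "v \<in> M \<Longrightarrow> v\<^sup>\<dagger> \<odot> v = p \<Longrightarrow> q \<odot> v = v \<Longrightarrow> p \<preceq> q"
  by (auto simp: sube_def)

lemma pisom_init: assumes "v\<^sup>\<dagger> \<odot> v = p" "is_proj p" shows "is_pisom v" "v \<odot> p = v"
proof -
  show v: "is_pisom v" by (simp add: is_pisom_iff assms)
  show "v \<odot> p = v" using is_pisomD(1)[OF v] assms(1) by simp
qed

lemma pisom_final: assumes "v\<^sup>\<dagger> \<odot> v = p" "v \<odot> v\<^sup>\<dagger> = q" "is_proj p"
  shows "q \<odot> v = v" "is_proj q" "v\<^sup>\<dagger> \<odot> q = v\<^sup>\<dagger>" "p \<odot> v\<^sup>\<dagger> = v\<^sup>\<dagger>"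
  using pisom_init[OF assms(1,3)] assms is_pisomD[of v] is_pisom_projs[of v]
  by (auto simp: is_pisom_def op_simps)

lemma eqv_refl: "pr p \<Longrightarrow> p \<asymp> p"
  by (rule eqvI[of p]) (auto simp: prD)

lemma eqv_sym: "p \<asymp> q \<Longrightarrow> q \<asymp> p"
  unfolding eqv_def by (metis M_hadj hadj_hadj)

lemma sube_refl: "pr p \<Longrightarrow> p \<preceq> p"
  by (rule subeI[of p]) (auto simp: prD)

lemma sube_trans: assumes "p \<preceq> q" "q \<preceq> r" shows "p \<preceq> r"
proof -
  obtain u v where u: "u \<in> M" "u\<^sup>\<dagger> \<odot> u = p" "q \<odot> u = u" and v: "v \<in> M" "v\<^sup>\<dagger> \<odot> v = q" "r \<odot> v = v"
    using assms by (auto simp: sube_def)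
  show ?thesis
  proof (rule subeI[of "v \<odot> u"])
    have "(v \<odot> u)\<^sup>\<dagger> \<odot> (v \<odot> u) = u\<^sup>\<dagger> \<odot> ((v\<^sup>\<dagger> \<odot> v) \<odot> u)" by (simp add: op_simps)
    thus "(v \<odot> u)\<^sup>\<dagger> \<odot> (v \<odot> u) = p" by (simp add: v u)
    show "r \<odot> (v \<odot> u) = v \<odot> u" using v(3) by (metis blinfun_compose_assoc)
  qed (auto intro: M_intros u v)
qed

lemma eqv_imp_sube: "p \<asymp> q \<Longrightarrow> is_proj p \<Longrightarrow> p \<preceq> q"
  unfolding eqv_def by (auto intro: subeI pisom_final(1))

lemma le_imp_sube: "pr p \<Longrightarrow> q \<odot> p = p \<Longrightarrow> p \<preceq> q"
  by (rule subeI[of p]) (auto simp: prD)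

lemma subeE:
  assumes "p \<preceq> q" "pr p"
  obtains r where "pr r" "q \<odot> r = r" "p \<asymp> r"
proof -
  obtain v where v: "v \<in> M" "v\<^sup>\<dagger> \<odot> v = p" "q \<odot> v = v" using assms by (auto simp: sube_def)
  show ?thesis
  proof (rule that[of "v \<odot> v\<^sup>\<dagger>"])
    show "pr (v \<odot> v\<^sup>\<dagger>)" using pr_pisom[OF v(1)] pisom_init[OF v(2)] assms(2) by (auto simp: pr_def)
    show "q \<odot> (v \<odot> v\<^sup>\<dagger>) = v \<odot> v\<^sup>\<dagger>" using v(3) by (metis blinfun_compose_assoc)
    show "p \<asymp> v \<odot> v\<^sup>\<dagger>" by (rule eqvI[OF v(1,2) refl])
  qed
qed

lemma sube_central:
  assumes "p \<preceq> q" "central z" shows "z \<odot> p \<preceq> z \<odot> q"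
proof -
  obtain v where v: "v \<in> M" "v\<^sup>\<dagger> \<odot> v = p" "q \<odot> v = v" using assms by (auto simp: sube_def)
  have z: "z \<odot> z = z" "z\<^sup>\<dagger> = z" "z \<in> M" using assms(2) by (auto simp: central_def prD)
  show ?thesis
  proof (rule subeI[of "z \<odot> v"])
    have "(z \<odot> v)\<^sup>\<dagger> \<odot> (z \<odot> v) = v\<^sup>\<dagger> \<odot> (z \<odot> z) \<odot> v" by (simp add: blinfun_compose_assoc z(2))
    also have "\<dots> = v\<^sup>\<dagger> \<odot> z \<odot> v" by (simp only: z)
    also have "\<dots> = z \<odot> v\<^sup>\<dagger> \<odot> v" using centralD(2)[OF assms(2) M_hadj[OF v(1)]] by simp
    finally show "(z \<odot> v)\<^sup>\<dagger> \<odot> (z \<odot> v) = z \<odot> p" by (simp add: op_simps v)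
    have "z \<odot> q \<odot> (z \<odot> v) = z \<odot> q \<odot> (v \<odot> z)" using centralD(2)[OF assms(2) v(1)] by simp
    also have "\<dots> = z \<odot> (q \<odot> v) \<odot> z" by (simp add: op_simps)
    also have "\<dots> = z \<odot> (v \<odot> z)" by (simp add: op_simps v)
    also have "\<dots> = z \<odot> z \<odot> v" using centralD(2)[OF assms(2) v(1)] by (simp add: op_simps)
    finally show "z \<odot> q \<odot> (z \<odot> v) = z \<odot> v" by (simp add: z)
  qed (auto intro: M_intros v z)
qed

lemma eqv_central:
  assumes "p \<asymp> q" "central z" shows "z \<odot> p \<asymp> z \<odot> q"
proof -
  obtain v where v: "v \<in> M" "v\<^sup>\<dagger> \<odot> v = p" "v \<odot> v\<^sup>\<dagger> = q" using assms by (auto simp: eqv_def)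
  have z: "z \<odot> (z \<odot> S) = z \<odot> S" "z\<^sup>\<dagger> = z" "z \<in> M" for S using assms(2) by (auto simp: central_def prD)
  show ?thesis
  proof (rule eqvI[of "z \<odot> v"])
    have zv: "v\<^sup>\<dagger> \<odot> z = z \<odot> v\<^sup>\<dagger>" using centralD(2)[OF assms(2) M_hadj[OF v(1)]] .
    have "(z \<odot> v)\<^sup>\<dagger> \<odot> (z \<odot> v) = v\<^sup>\<dagger> \<odot> z \<odot> v" by (simp add: op_simps z)
    thus "(z \<odot> v)\<^sup>\<dagger> \<odot> (z \<odot> v) = z \<odot> p" unfolding zv by (simp add: op_simps v)
    have "z \<odot> v \<odot> (z \<odot> v)\<^sup>\<dagger> = z \<odot> v \<odot> (v\<^sup>\<dagger> \<odot> z)" by (simp add: z)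
    thus "z \<odot> v \<odot> (z \<odot> v)\<^sup>\<dagger> = z \<odot> q"
      unfolding zv by (simp add: blinfun_compose_assoc central_left_commute[OF assms(2) v(1)] z v)
  qed (auto intro: M_intros v z)
qed

lemma eqv_add:
  assumes "p \<asymp> q" "p' \<asymp> q'" "pr p" "pr p'" "p \<odot> p' = 0" "q \<odot> q' = 0"
  shows "p + p' \<asymp> q + q'"
proof -
  obtain v w where v: "v \<in> M" "v\<^sup>\<dagger> \<odot> v = p" "v \<odot> v\<^sup>\<dagger> = q" and w: "w \<in> M" "w\<^sup>\<dagger> \<odot> w = p'" "w \<odot> w\<^sup>\<dagger> = q'"
    using assms by (auto simp: eqv_def)
  note v' = pisom_init[OF v(2) prD(2)[OF assms(3)]] pisom_final[OF v(2,3) prD(2)[OF assms(3)]]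
  note w' = pisom_init[OF w(2) prD(2)[OF assms(4)]] pisom_final[OF w(2,3) prD(2)[OF assms(4)]]
  have "v\<^sup>\<dagger> \<odot> w = v\<^sup>\<dagger> \<odot> (q \<odot> q') \<odot> w" using v' w' by (metis blinfun_compose_assoc)
  hence 1: "v\<^sup>\<dagger> \<odot> w = 0" by (simp add: assms)
  have "v \<odot> w\<^sup>\<dagger> = v \<odot> (p \<odot> p') \<odot> w\<^sup>\<dagger>" using v' w' by (metis blinfun_compose_assoc)
  hence 2: "v \<odot> w\<^sup>\<dagger> = 0" by (simp add: assms)
  have 3: "w\<^sup>\<dagger> \<odot> v = 0" "w \<odot> v\<^sup>\<dagger> = 0"
    using arg_cong[OF 1, of hadj] arg_cong[OF 2, of hadj] by auto
  show ?thesis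
    by (rule eqvI[of "v + w"]) (auto intro!: M_intros v w simp: op_simps v w 1 2 3)
qed

lemma sube_add:
  assumes "p \<preceq> q" "p' \<preceq> q'" "pr p" "pr p'" "pr q" "pr q'" "p \<odot> p' = 0" "q \<odot> q' = 0"
  shows "p + p' \<preceq> q + q'"
proof -
  obtain r r' where r: "pr r" "q \<odot> r = r" "p \<asymp> r" "pr r'" "q' \<odot> r' = r'" "p' \<asymp> r'"
    using subeE assms by metis
  have rq: "r \<odot> q = r" using pr_le_sym r(1,2) assms(5) by blast
  have "r \<odot> r' = r \<odot> (q \<odot> q') \<odot> r'" using rq r(5) by (metis blinfun_compose_assoc)
  hence "r \<odot> r' = 0" by (simp add: assms)
  hence e: "p + p' \<asymp> r + r'" by (intro eqv_add r assms)
  have "q' \<odot> r = q' \<odot> q \<odot> r" "q \<odot> r' = q \<odot> q' \<odot> r'" using r by (metis blinfun_compose_assoc)+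
  moreover have "q' \<odot> q = 0" using pr_orth_sym assms(5,6,8) by blast
  ultimately have "(q + q') \<odot> (r + r') = r + r'" using r assms by (simp add: op_simps)
  moreover obtain v where "v \<in> M" "v\<^sup>\<dagger> \<odot> v = p + p'" "v \<odot> v\<^sup>\<dagger> = r + r'" using e by (auto simp: eqv_def)
  moreover have "is_proj (p + p')"
    using pr_add[OF assms(3,4)] pr_orth_sym[OF assms(3,4)] assms(7) by (simp add: pr_def)
  ultimately show ?thesis using pisom_final(1)[of v "p + p'" "r + r'"]
    by (intro subeI[of v]) (auto, metis blinfun_compose_assoc)
qed

text \<open>The modulus replaces \<open>X\<close> by a self-adjoint element of \<open>M\<close> with
  the same norms at all vectors; the commutation clause of \<open>ex_polar\<close> then puts
  \<open>v\<close> into the bicommutant.\<close>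

lemma ex_polar_M:
  assumes X: "X \<in> M"
  obtains v where "v \<in> M" "is_pisom v" "v\<^sup>\<dagger> \<odot> v = range_proj (X\<^sup>\<dagger>)" "v \<odot> v\<^sup>\<dagger> = range_proj X"
    "v \<odot> (X\<^sup>\<dagger> \<odot> X) \<odot> v\<^sup>\<dagger> = X \<odot> X\<^sup>\<dagger>"
proof -
  define r where "r = norm X + 1"
  have r: "norm X \<le> r" "r > 0" by (auto simp: r_def add_nonneg_pos)
  define A where "A = modulus r X"
  have A: "A \<in> M" "A\<^sup>\<dagger> = A" "A \<odot> A = X\<^sup>\<dagger> \<odot> X"
    unfolding A_def by (auto intro: M_modulus[OF X r] modulus_hadj[OF r] modulus_sq[OF r])
  obtain v where v: "v \<odot> A = X" "v\<^sup>\<dagger> \<odot> v = range_proj A" "v \<odot> v\<^sup>\<dagger> = range_proj X"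
    "\<And>S. S \<odot> A = A \<odot> S \<Longrightarrow> S\<^sup>\<dagger> \<odot> A = A \<odot> S\<^sup>\<dagger> \<Longrightarrow> S \<odot> X = X \<odot> S \<Longrightarrow> S \<odot> v = v \<odot> S"
    using ex_polar[of A X] norm_modulus_apply[OF r] unfolding A_def by metis
  have 0: "Y \<odot> Y\<^sup>\<dagger> = 0 \<longleftrightarrow> Y = 0" for Y :: "'a \<Rightarrow>\<^sub>L 'a"
    using hadj_compose_self_eq_0[of "Y\<^sup>\<dagger>"] by (metis hadj_hadj hadj_simps(7))
  \<comment> \<open>Because \<open>A \<odot> A = X\<^sup>\<dagger> \<odot> X\<close>, the operators
    \<open>A\<close> and \<open>X\<^sup>\<dagger>\<close> have the same left annihilator and hence
    the same range projection.\<close>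
  have *: "S \<odot> A = 0 \<longleftrightarrow> S \<odot> X\<^sup>\<dagger> = 0" for S :: "'a \<Rightarrow>\<^sub>L 'a"
  proof -
    have "S \<odot> A \<odot> (S \<odot> A)\<^sup>\<dagger> = S \<odot> (A \<odot> A) \<odot> S\<^sup>\<dagger>" by (simp add: A(2) op_simps)
    also have "\<dots> = S \<odot> X\<^sup>\<dagger> \<odot> (S \<odot> X\<^sup>\<dagger>)\<^sup>\<dagger>" unfolding A(3) by (simp add: op_simps)
    finally show ?thesis using 0[of "S \<odot> A"] 0[of "S \<odot> X\<^sup>\<dagger>"] by simp
  qed
  show ?thesis
  proof (rule that[of v])
    show "v \<in> M" by (rule M_bicomm, rule v(4)) (auto intro!: commD comm_hadj A X)
    show "is_pisom v" by (simp add: is_pisom_iff v)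
    show "v\<^sup>\<dagger> \<odot> v = range_proj (X\<^sup>\<dagger>)" unfolding v(2) by (rule range_proj_cong[OF *])
    have "v \<odot> (X\<^sup>\<dagger> \<odot> X) \<odot> v\<^sup>\<dagger> = (v \<odot> A) \<odot> (v \<odot> A)\<^sup>\<dagger>" unfolding A(3)[symmetric] by (simp only: hadj_simps A(2) blinfun_compose_assoc)
    thus "v \<odot> (X\<^sup>\<dagger> \<odot> X) \<odot> v\<^sup>\<dagger> = X \<odot> X\<^sup>\<dagger>" by (simp add: v(1))
  qed (use v in auto)
qed

lemma range_proj_eqv: "X \<in> M \<Longrightarrow> range_proj (X\<^sup>\<dagger>) \<asymp> range_proj X"
  by (metis ex_polar_M eqvI)

lemma range_proj_le: "p \<odot> X = X \<Longrightarrow> p \<odot> range_proj X = range_proj X"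
  using range_proj_annihilate[of "id_blinfun - p" X] by (simp add: op_simps)

subsection \<open>Comparison of projections\<close>

text \<open>Zorn's lemma in the form that the exhaustion arguments use: an element compatible with
  all members already belongs to the family.\<close>

lemma ex_maximal_pairwise:
  obtains W where "W \<subseteq> A" "pairwise R W"
    "\<And>a. a \<in> A \<Longrightarrow> (\<And>w. w \<in> W \<Longrightarrow> R a w \<and> R w a) \<Longrightarrow> a \<in> W"
proof -
  have ex: "\<exists>W\<in>{W. W \<subseteq> A \<and> pairwise R W}. \<forall>X\<in>{W. W \<subseteq> A \<and> pairwise R W}. W \<subseteq> X \<longrightarrow> X = W"
  proof (rule subset_Zorn')
    fix C assume C: "subset.chain {W. W \<subseteq> A \<and> pairwise R W} C"
    have "pairwise R (\<Union> C)"
    proof (rule pairwiseI)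
      fix x y assume "x \<in> \<Union> C" "y \<in> \<Union> C" "x \<noteq> y"
      then obtain X Y where XY: "x \<in> X" "X \<in> C" "y \<in> Y" "Y \<in> C" by blast
      hence "X \<subseteq> Y \<or> Y \<subseteq> X" using C unfolding subset_chain_def by blast
      hence "\<exists>Z\<in>C. x \<in> Z \<and> y \<in> Z" using XY by blast
      thus "R x y" using C \<open>x \<noteq> y\<close> unfolding subset_chain_def pairwise_def by blast
    qed
    thus "\<Union> C \<in> {W. W \<subseteq> A \<and> pairwise R W}" using C unfolding subset_chain_def by blast
  qed
  from ex obtain W where "W \<in> {W. W \<subseteq> A \<and> pairwise R W}"
    "\<forall>X\<in>{W. W \<subseteq> A \<and> pairwise R W}. W \<subseteq> X \<longrightarrow> X = W" by (rule bexE)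
  hence W: "W \<subseteq> A" "pairwise R W" "\<And>X. X \<subseteq> A \<Longrightarrow> pairwise R X \<Longrightarrow> W \<subseteq> X \<Longrightarrow> X = W" by simp_all
  show ?thesis
  proof (rule that[OF W(1,2)])
    fix a assume "a \<in> A" "\<And>w. w \<in> W \<Longrightarrow> R a w \<and> R w a"
    hence "insert a W = W" using W by (intro W(3)) (auto simp: pairwise_insert)
    thus "a \<in> W" by blast
  qed
qed

text \<open>Exhaustion between \<open>p\<close> and \<open>q\<close> by orthogonal partial
  isometries with property \<open>Q\<close>: what remains of \<open>p\<close> and \<open>q\<close>
  admits no further nonzero one.\<close>

lemma ex_maximal_pisoms:
  assumes p: "pr p" and q: "pr q"
  obtains W where "orth_pisoms W" "W \<subseteq> M" "\<And>v. v \<in> W \<Longrightarrow> Q v"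
    "osum W \<odot> p = osum W" "q \<odot> osum W = osum W"
    "\<And>v. v \<in> M \<Longrightarrow> is_pisom v \<Longrightarrow> Q v \<Longrightarrow> v \<odot> (p - (osum W)\<^sup>\<dagger> \<odot> osum W) = v \<Longrightarrow>
      (q - osum W \<odot> (osum W)\<^sup>\<dagger>) \<odot> v = v \<Longrightarrow> v = 0"
proof -
  define R where "R = (\<lambda>v w :: 'a \<Rightarrow>\<^sub>L 'a. v\<^sup>\<dagger> \<odot> w = 0 \<and> v \<odot> w\<^sup>\<dagger> = 0)"
  obtain W where W: "W \<subseteq> {v\<in>M. is_pisom v \<and> Q v \<and> v \<odot> p = v \<and> q \<odot> v = v}" "pairwise R W"
    "\<And>a. a \<in> {v\<in>M. is_pisom v \<and> Q v \<and> v \<odot> p = v \<and> q \<odot> v = v} \<Longrightarrow>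
      (\<And>w. w \<in> W \<Longrightarrow> R a w \<and> R w a) \<Longrightarrow> a \<in> W"
    by (rule ex_maximal_pairwise[of "{v\<in>M. is_pisom v \<and> Q v \<and> v \<odot> p = v \<and> q \<odot> v = v}" R]) blast
  have oW: "orth_pisoms W"
    using W(1,2) unfolding orth_pisoms_def pairwise_def R_def by blast
  let ?V = "osum W"
  have pV: "?V \<odot> p = ?V"
  proof -
    have "v \<odot> (id_blinfun - p) = 0" if "v \<in> W" for v using W(1) that by (auto simp: op_simps)
    hence "(v \<odot> (id_blinfun - p))\<^sup>\<dagger> = 0" if "v \<in> W" for v using that by simp
    hence "(id_blinfun - p) \<odot> ?V\<^sup>\<dagger> = 0" by (intro osum_annihilate_hadj[OF oW]) (simp add: prD(4)[OF p])
    hence "((id_blinfun - p) \<odot> ?V\<^sup>\<dagger>)\<^sup>\<dagger> = 0" by simp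
    thus ?thesis by (simp add: op_simps prD(4)[OF p])
  qed
  have qV: "q \<odot> ?V = ?V"
  proof -
    have "(id_blinfun - q) \<odot> v = 0" if "v \<in> W" for v using W(1) that by (auto simp: op_simps)
    from osum_annihilate[OF oW this] show ?thesis by (simp add: op_simps)
  qed
  show ?thesis
  proof (rule that[OF oW _ _ pV qV])
    fix v assume v: "v \<in> M" "is_pisom v" "Q v" "v \<odot> (p - ?V\<^sup>\<dagger> \<odot> ?V) = v" "(q - ?V \<odot> ?V\<^sup>\<dagger>) \<odot> v = v"
    have VV: "?V \<odot> (?V\<^sup>\<dagger> \<odot> ?V) = ?V" "?V\<^sup>\<dagger> \<odot> (?V \<odot> ?V\<^sup>\<dagger>) = ?V\<^sup>\<dagger>"
      using is_pisomD[OF is_pisom_osum[OF oW]] by auto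
    have pV': "p \<odot> ?V\<^sup>\<dagger> = ?V\<^sup>\<dagger>" using arg_cong[OF pV, of hadj] by (simp add: prD(4)[OF p])
    have vp: "v \<odot> p = v"
    proof -
      have "(p - ?V\<^sup>\<dagger> \<odot> ?V) \<odot> p = p - ?V\<^sup>\<dagger> \<odot> ?V" by (simp add: op_simps prD(3)[OF p] pV)
      thus ?thesis using v(4) by (metis blinfun_compose_assoc)
    qed
    have qv: "q \<odot> v = v"
    proof -
      have "q \<odot> (q - ?V \<odot> ?V\<^sup>\<dagger>) = q - ?V \<odot> ?V\<^sup>\<dagger>"
        by (simp add: op_simps prD(3)[OF q] flip: blinfun_compose_assoc) (simp add: qV)
      thus ?thesis using v(5) by (metis blinfun_compose_assoc)
    qed
    have "(q - ?V \<odot> ?V\<^sup>\<dagger>)\<^sup>\<dagger> \<odot> ?V = 0"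
      by (simp add: op_simps prD(4)[OF q] qV VV)
    hence Vv: "v\<^sup>\<dagger> \<odot> ?V = 0"
      using arg_cong[OF v(5), of hadj] by (metis blinfun_compose_algebra(9) blinfun_compose_assoc hadj_simps(1))
    have "(p - ?V\<^sup>\<dagger> \<odot> ?V) \<odot> ?V\<^sup>\<dagger> = 0" by (simp add: op_simps pV' VV)
    hence vV: "v \<odot> ?V\<^sup>\<dagger> = 0"
      using v(4) by (metis blinfun_compose_algebra(9) blinfun_compose_assoc)
    have RvW: "v\<^sup>\<dagger> \<odot> w = 0" "v \<odot> w\<^sup>\<dagger> = 0" if w: "w \<in> W" for w
    proof -
      have "w = ?V \<odot> (w\<^sup>\<dagger> \<odot> w)" "w\<^sup>\<dagger> = ?V\<^sup>\<dagger> \<odot> (w \<odot> w\<^sup>\<dagger>)"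
        using osum_compose_hadj[OF oW w] osum_hadj_compose[OF oW w] W(1) w is_pisomD[of w]
        by (auto simp: is_pisom_def simp flip: blinfun_compose_assoc)
      thus "v\<^sup>\<dagger> \<odot> w = 0" "v \<odot> w\<^sup>\<dagger> = 0"
        using Vv vV by (metis blinfun_compose_assoc blinfun_compose_algebra(10))+
    qed
    have "v \<in> W"
    proof (rule W(3))
      fix w assume w: "w \<in> W"
      have "w\<^sup>\<dagger> \<odot> v = 0" "w \<odot> v\<^sup>\<dagger> = 0"
        using arg_cong[OF RvW(1)[OF w], of hadj] arg_cong[OF RvW(2)[OF w], of hadj] by auto
      thus "R v w \<and> R w v" using RvW[OF w] by (simp add: R_def)
    qed (use v vp qv in auto)
    \<comment> \<open>\<open>v\<close> belongs to the family, yet is orthogonal to all its members,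
      itself included.\<close>
    from RvW(1)[OF this] show "v = 0" by simp
  qed (use W(1) in auto)
qed

text \<open>Exhaust \<open>p\<close> and \<open>q\<close> by a maximal partial isometry. Between the
  remainders every element of \<open>M\<close> is cut down to 0, since the polar decomposition of a
  nonzero one would enlarge the family; a central projection then separates the remainders.\<close>

theorem comparison:
  assumes p: "pr p" and q: "pr q"
  obtains z where "central z" "z \<odot> p \<preceq> z \<odot> q" "(id_blinfun - z) \<odot> q \<preceq> (id_blinfun - z) \<odot> p"
proof -
  obtain W where W: "orth_pisoms W" "W \<subseteq> M" "osum W \<odot> p = osum W" "q \<odot> osum W = osum W"
    "\<And>v. v \<in> M \<Longrightarrow> is_pisom v \<Longrightarrow> v \<odot> (p - (osum W)\<^sup>\<dagger> \<odot> osum W) = v \<Longrightarrow>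
      (q - osum W \<odot> (osum W)\<^sup>\<dagger>) \<odot> v = v \<Longrightarrow> v = 0"
    using ex_maximal_pisoms[OF p q, of "\<lambda>_. True"] by metis
  let ?V = "osum W"
  have V: "?V \<in> M" "is_pisom ?V" using M_osum[OF W(1,2)] is_pisom_osum[OF W(1)] by auto
  have pV: "p \<odot> ?V\<^sup>\<dagger> = ?V\<^sup>\<dagger>" using arg_cong[OF W(3), of hadj] by (simp add: prD(4)[OF p])
  have p0: "pr (p - ?V\<^sup>\<dagger> \<odot> ?V)" and q0: "pr (q - ?V \<odot> ?V\<^sup>\<dagger>)"
    using pr_pisom[OF V] by (auto intro!: pr_diff p q simp: W pV simp flip: blinfun_compose_assoc)
  have "(p - ?V\<^sup>\<dagger> \<odot> ?V) \<odot> T \<odot> (q - ?V \<odot> ?V\<^sup>\<dagger>) = 0" if T: "T \<in> M" for T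
  proof -
    define X where "X = (q - ?V \<odot> ?V\<^sup>\<dagger>) \<odot> T\<^sup>\<dagger> \<odot> (p - ?V\<^sup>\<dagger> \<odot> ?V)"
    have X: "X \<in> M" "(q - ?V \<odot> ?V\<^sup>\<dagger>) \<odot> X = X" "X \<odot> (p - ?V\<^sup>\<dagger> \<odot> ?V) = X"
      unfolding X_def using prD[OF p0] prD[OF q0] by (auto intro!: M_compose M_hadj[OF T] simp: blinfun_compose_assoc)
    obtain v where v: "v \<in> M" "is_pisom v" "v\<^sup>\<dagger> \<odot> v = range_proj (X\<^sup>\<dagger>)" "v \<odot> v\<^sup>\<dagger> = range_proj X"
      using ex_polar_M[OF X(1)] by metis
    have "(q - ?V \<odot> ?V\<^sup>\<dagger>) \<odot> (v \<odot> v\<^sup>\<dagger>) = v \<odot> v\<^sup>\<dagger>" unfolding v(4) by (rule range_proj_le[OF X(2)])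
    hence 1: "(q - ?V \<odot> ?V\<^sup>\<dagger>) \<odot> v = v" using v(2) unfolding is_pisom_def by (metis blinfun_compose_assoc)
    have "(p - ?V\<^sup>\<dagger> \<odot> ?V) \<odot> X\<^sup>\<dagger> = X\<^sup>\<dagger>" using arg_cong[OF X(3), of hadj] prD(4)[OF p0] by simp
    hence "(p - ?V\<^sup>\<dagger> \<odot> ?V) \<odot> (v\<^sup>\<dagger> \<odot> v) = v\<^sup>\<dagger> \<odot> v" unfolding v(3) by (rule range_proj_le)
    hence "(v\<^sup>\<dagger> \<odot> v) \<odot> (p - ?V\<^sup>\<dagger> \<odot> ?V) = v\<^sup>\<dagger> \<odot> v" using pr_le_sym p0 pr_pisom[OF v(1,2)] by blast
    hence 2: "v \<odot> (p - ?V\<^sup>\<dagger> \<odot> ?V) = v" using is_pisomD(1)[OF v(2)] by (metis blinfun_compose_assoc)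
    have "v = 0" by (rule W(5)[OF v(1,2) 2 1])
    hence "range_proj X = 0" using v(4) by simp
    hence "X\<^sup>\<dagger> = 0" by simp
    thus ?thesis unfolding X_def using prD(4)[OF p0] prD(4)[OF q0] by (simp add: blinfun_compose_assoc)
  qed
  then obtain z where z: "central z" "z \<odot> (q - ?V \<odot> ?V\<^sup>\<dagger>) = q - ?V \<odot> ?V\<^sup>\<dagger>" "z \<odot> (p - ?V\<^sup>\<dagger> \<odot> ?V) = 0"
    using ex_central_separating[OF q0 p0] by metis
  have eV: "?V\<^sup>\<dagger> \<odot> ?V \<asymp> ?V \<odot> ?V\<^sup>\<dagger>" by (rule eqvI[OF V(1)]) auto
  have prV: "pr (?V\<^sup>\<dagger> \<odot> ?V)" "pr (?V \<odot> ?V\<^sup>\<dagger>)" using pr_pisom[OF V] by auto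
  show ?thesis
  proof (rule that[OF z(1)])
    have 1: "z \<odot> p = z \<odot> (?V\<^sup>\<dagger> \<odot> ?V)" using z(3) by (simp add: op_simps)
    have "?V\<^sup>\<dagger> \<odot> ?V \<preceq> q" by (rule subeI[OF V(1) refl W(4)])
    from sube_central[OF this z(1)] show "z \<odot> p \<preceq> z \<odot> q" unfolding 1 .
    have 2: "(id_blinfun - z) \<odot> q = (id_blinfun - z) \<odot> (?V \<odot> ?V\<^sup>\<dagger>)" using z(2) by (simp add: op_simps algebra_simps)
    have "?V \<odot> ?V\<^sup>\<dagger> \<preceq> p" by (rule subeI[OF M_hadj[OF V(1)] _ pV]) simp
    from sube_central[OF this central_compl[OF z(1)]]
    show "(id_blinfun - z) \<odot> q \<preceq> (id_blinfun - z) \<odot> p" unfolding 2 .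
  qed
qed

end

subsection \<open>Finite algebras\<close>

locale finite_vna = vna +
  assumes isometry_unitary: "v \<in> M \<Longrightarrow> v\<^sup>\<dagger> \<odot> v = id_blinfun \<Longrightarrow> v \<odot> v\<^sup>\<dagger> = id_blinfun"
begin

lemma id_eqv_imp_eq: "id_blinfun \<asymp> q \<Longrightarrow> q = id_blinfun"
  using isometry_unitary by (auto simp: eqv_def)

text \<open>Comparing the complements splits the identity centrally. Where one complement embeds
  into the other, the embedding together with \<open>p \<asymp> q\<close> makes the identity
  equivalent to a subprojection, which finiteness forces to be everything.\<close>

lemma eqv_compl:
  assumes p: "pr p" and q: "pr q" and e: "p \<asymp> q"
  shows "id_blinfun - p \<asymp> id_blinfun - q"
proof -
  \<comment> \<open>The piece over which \<open>id_blinfun - p\<close> embeds into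
    \<open>id_blinfun - q\<close>; the other piece is the same with \<open>p\<close> and
    \<open>q\<close> exchanged.\<close>
  have half: "z \<odot> (id_blinfun - p) \<asymp> z \<odot> (id_blinfun - q)"
    if z: "central z" and p: "pr p" and q: "pr q" and e: "p \<asymp> q"
      and le: "z \<odot> (id_blinfun - p) \<preceq> z \<odot> (id_blinfun - q)" for p q z
  proof -
    have prz: "pr z" "pr (z \<odot> p)" "pr (z \<odot> q)" "pr (z \<odot> (id_blinfun - p))" "pr (z \<odot> (id_blinfun - q))"
      using z p q by (auto intro: pr_central pr_compl simp: central_def)
    note zz = prD(3,5)[OF prz(1)]
    note pz = centralD(2)[OF z prD(1)[OF p]] centralD(2)[OF z prD(1)[OF q]]
      central_left_commute[OF z prD(1)[OF p]] central_left_commute[OF z prD(1)[OF q]]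
    obtain r where r: "pr r" "z \<odot> (id_blinfun - q) \<odot> r = r" "z \<odot> (id_blinfun - p) \<asymp> r"
      by (rule subeE[OF le prz(4)])
    have zr: "z \<odot> r = r" and qr: "q \<odot> r = 0"
    proof -
      have "z \<odot> (z \<odot> (id_blinfun - q) \<odot> r) = z \<odot> (id_blinfun - q) \<odot> r" by (simp add: blinfun_compose_assoc zz)
      thus "z \<odot> r = r" by (simp add: r(2))
      have "q \<odot> (z \<odot> (id_blinfun - q) \<odot> r) = 0" by (simp add: op_simps pz prD[OF q])
      thus "q \<odot> r = 0" by (simp add: r(2))
    qed
    have 1: "z \<odot> p + z \<odot> (id_blinfun - p) \<asymp> z \<odot> q + r"
      by (rule eqv_add[OF eqv_central[OF e z] r(3) prz(2,4)])
        (simp_all add: op_simps pz zz prD[OF p], simp add: zr qr flip: pz)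
    hence 1: "z \<asymp> z \<odot> q + r" by (simp add: op_simps)
    have "z + (id_blinfun - z) \<asymp> (z \<odot> q + r) + (id_blinfun - z)"
    proof (rule eqv_add[OF 1 eqv_refl])
      have "(z \<odot> q + r) \<odot> z = z \<odot> q + r" using zr centralD(2)[OF z prD(1)[OF r(1)]]
        by (simp add: op_simps pz zz)
      thus "(z \<odot> q + r) \<odot> (id_blinfun - z) = 0" by (simp add: op_simps)
    qed (auto simp: op_simps zz prz pr_compl)
    hence "z \<odot> q + r + (id_blinfun - z) = id_blinfun" by (intro id_eqv_imp_eq) simp
    hence "r = z \<odot> (id_blinfun - q)" by (simp add: op_simps algebra_simps)
    thus ?thesis using r(3) by simp
  qed
  obtain z where z: "central z" "z \<odot> (id_blinfun - p) \<preceq> z \<odot> (id_blinfun - q)"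
    "(id_blinfun - z) \<odot> (id_blinfun - q) \<preceq> (id_blinfun - z) \<odot> (id_blinfun - p)"
    by (rule comparison[OF pr_compl[OF p] pr_compl[OF q]])
  have 1: "z \<odot> (id_blinfun - p) \<asymp> z \<odot> (id_blinfun - q)" by (rule half[OF z(1) p q e z(2)])
  have 2: "(id_blinfun - z) \<odot> (id_blinfun - p) \<asymp> (id_blinfun - z) \<odot> (id_blinfun - q)"
    by (rule eqv_sym, rule half[OF central_compl[OF z(1)] q p eqv_sym[OF e] z(3)])
  have *: "z \<odot> S \<odot> ((id_blinfun - z) \<odot> T) = 0" if "S \<in> M" for S T :: "'a \<Rightarrow>\<^sub>L 'a"
    by (simp add: op_simps central_left_commute[OF z(1) that] prD(5)[OF centralD(1)[OF z(1)]])
  have "z \<odot> (id_blinfun - p) + (id_blinfun - z) \<odot> (id_blinfun - p)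
      \<asymp> z \<odot> (id_blinfun - q) + (id_blinfun - z) \<odot> (id_blinfun - q)"
    by (rule eqv_add[OF 1 2])
      (auto intro!: pr_central central_compl z pr_compl p q * M_diff prD(1) simp: pr_simps)
  thus ?thesis by (simp add: op_simps)
qed

text \<open>\<open>p - p'\<close> is the complement of \<open>(id_blinfun - p) + p'\<close>, so the
  claim reduces to complements and orthogonal sums.\<close>

lemma eqv_diff:
  assumes pr: "pr p" "pr q" "pr p'" "pr q'" and le: "p \<odot> p' = p'" "q \<odot> q' = q'"
    and e: "p \<asymp> q" "p' \<asymp> q'"
  shows "p - p' \<asymp> q - q'"
proof -
  have le': "p' \<odot> p = p'" "q' \<odot> q = q'" using pr_le_sym pr le by blast+
  have "(id_blinfun - p) + p' \<asymp> (id_blinfun - q) + q'"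
    by (rule eqv_add[OF eqv_compl[OF pr(1,2) e(1)] e(2)]) (auto simp: pr pr_compl op_simps le)
  moreover have "pr ((id_blinfun - p) + p')" "pr ((id_blinfun - q) + q')"
    by (auto intro!: pr_add pr_compl pr simp: op_simps le')
  ultimately have "id_blinfun - ((id_blinfun - p) + p') \<asymp> id_blinfun - ((id_blinfun - q) + q')"
    by (intro eqv_compl)
  thus ?thesis by simp
qed

lemma eqv_0: "0 \<asymp> q \<Longrightarrow> q = 0" "p \<asymp> 0 \<Longrightarrow> p = 0"
proof -
  show "0 \<asymp> q \<Longrightarrow> q = 0" for q by (auto simp: eqv_def)
  thus "p \<asymp> 0 \<Longrightarrow> p = 0" using eqv_sym by blast
qed

lemma eqv_sub_eq:
  assumes "pr p" "pr q" "p \<odot> q = q" "p \<asymp> q" shows "q = p"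
  using eqv_0(1)[of "p - q"] eqv_diff[OF assms(1,1,1,2) _ assms(3) eqv_refl assms(4)] assms
  by (simp add: prD)

text \<open>\<open>q\<close> embeds into the copy \<open>r\<close> of \<open>p\<close> below
  \<open>q\<close>; by finiteness the image of \<open>q\<close> is all of \<open>q\<close>, so
  \<open>r = q\<close>.\<close>

lemma sube_antisym:
  assumes p: "pr p" and q: "pr q" and "p \<preceq> q" "q \<preceq> p" shows "p \<asymp> q"
proof -
  obtain r where r: "pr r" "q \<odot> r = r" "p \<asymp> r" by (rule subeE[OF assms(3) p])
  have "q \<preceq> r" by (rule sube_trans[OF assms(4) eqv_imp_sube[OF r(3) prD(2)[OF p]]])
  then obtain t where t: "pr t" "r \<odot> t = t" "q \<asymp> t" by (rule subeE[OF _ q])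
  have "q \<odot> t = t" using r(2) t(2) by (metis blinfun_compose_assoc)
  hence "t = q" using eqv_sub_eq q t by blast
  hence "r \<odot> q = q" using t(2) by simp
  hence "r = q" using r(1,2) q by (metis pr_le_sym)
  thus ?thesis using r(3) by simp
qed

text \<open>With infinitely many copies of \<open>F\<close>, the shift from \<open>f n\<close> to
  \<open>f (Suc n)\<close>, extended by the identity, would be an isometry that misses the range of
  \<open>f 0\<close>.\<close>

lemma finite_orth_copies:
  assumes F: "pr F" "F \<noteq> 0" and W: "W \<subseteq> M" "\<And>v. v \<in> W \<Longrightarrow> v\<^sup>\<dagger> \<odot> v = F"
    and orth: "\<And>v w. v \<in> W \<Longrightarrow> w \<in> W \<Longrightarrow> v \<noteq> w \<Longrightarrow> v\<^sup>\<dagger> \<odot> w = 0"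
  shows "finite W"
proof (rule ccontr)
  assume "infinite W"
  then obtain f :: "nat \<Rightarrow> _" where f: "inj f" "range f \<subseteq> W"
    using infinite_countable_subset by blast
  have fM: "f n \<in> M" and ff: "(f n)\<^sup>\<dagger> \<odot> f n = F" for n using f W by auto
  have fo: "m \<noteq> n \<Longrightarrow> (f m)\<^sup>\<dagger> \<odot> f n = 0" for m n
    using f by (intro orth) (auto simp: inj_eq)
  have fF: "f n \<odot> F = f n" "is_pisom (f n)" for n using pisom_init[OF ff prD(2)[OF F(1)]] by auto
  have ffa: "(f n)\<^sup>\<dagger> \<odot> (f n \<odot> T) = F \<odot> T" for n T by (metis ff blinfun_compose_assoc)
  have foa: "m \<noteq> n \<Longrightarrow> (f m)\<^sup>\<dagger> \<odot> (f n \<odot> T) = 0" for m n T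
    by (metis fo blinfun_compose_assoc blinfun_compose_algebra(10))
  have fFa: "f n \<odot> (F \<odot> T) = f n \<odot> T" for n T by (metis fF(1) blinfun_compose_assoc)
  define s where "s = (\<lambda>n. f (Suc n) \<odot> (f n)\<^sup>\<dagger>)"
  have ss: "(s n)\<^sup>\<dagger> \<odot> s n = f n \<odot> (f n)\<^sup>\<dagger>" for n by (simp add: s_def blinfun_compose_assoc ffa fFa)
  have so: "(s m)\<^sup>\<dagger> \<odot> s n = 0" "s m \<odot> (s n)\<^sup>\<dagger> = 0" if "m \<noteq> n" for m n
    using that by (simp_all add: s_def blinfun_compose_assoc foa)
  have oS: "orth_pisoms (range s)"
    unfolding orth_pisoms_def
  proof (intro conjI ballI impI)
    fix v assume "v \<in> range s"
    thus "is_pisom v" using is_pisom_projs(2)[OF fF(2)] by (auto simp: is_pisom_iff ss)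
  next
    fix v w assume "v \<in> range s" "w \<in> range s" "v \<noteq> w"
    then obtain m n where "v = s m" "w = s n" "m \<noteq> n" by blast
    thus "v\<^sup>\<dagger> \<odot> w = 0" "v \<odot> w\<^sup>\<dagger> = 0" using so by auto
  qed
  define V where "V = osum (range s)"
  define P where "P = V\<^sup>\<dagger> \<odot> V"
  have "s n \<in> M" for n unfolding s_def by (intro M_intros fM)
  hence V: "V \<in> M" "is_pisom V"
    unfolding V_def using M_osum[OF oS] is_pisom_osum[OF oS] by auto
  have P: "pr P" using pr_pisom[OF V] by (simp add: P_def)
  have Pf: "P \<odot> (f n \<odot> (f n)\<^sup>\<dagger>) = f n \<odot> (f n)\<^sup>\<dagger>" for n
    using osum_projs(1)[OF oS, of "s n"] by (simp add: ss P_def V_def)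
  have Pf': "P \<odot> f n = f n" for n
    using Pf[of n] fF(1)[of n] by (metis blinfun_compose_assoc ff)
  have PV: "P \<odot> V = V"
  proof -
    have "(id_blinfun - P) \<odot> s n = 0" for n
      by (simp add: s_def op_simps) (metis Pf' blinfun_compose_assoc)
    hence "(id_blinfun - P) \<odot> V = 0" unfolding V_def by (intro osum_annihilate[OF oS]) auto
    thus ?thesis by (simp add: op_simps)
  qed
  have VP: "V\<^sup>\<dagger> \<odot> P = V\<^sup>\<dagger>" using arg_cong[OF PV, of hadj] by (simp add: prD(4)[OF P])
  have VP2: "V \<odot> P = V" using is_pisomD(1)[OF V(2)] by (simp add: P_def)
  have PV2: "P \<odot> V\<^sup>\<dagger> = V\<^sup>\<dagger>" using arg_cong[OF VP2, of hadj] by (simp add: prD(4)[OF P])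
  define T where "T = V + (id_blinfun - P)"
  have T: "T \<in> M" unfolding T_def using V P by (auto intro!: M_intros simp: pr_def)
  have "T\<^sup>\<dagger> \<odot> T = id_blinfun"
    by (simp add: T_def op_simps prD[OF P] VP PV P_def[symmetric])
  from isometry_unitary[OF T this] have "V \<odot> V\<^sup>\<dagger> = P"
    by (simp add: T_def op_simps prD[OF P] VP2 PV2)
  moreover have "(f 0)\<^sup>\<dagger> \<odot> V = 0"
    unfolding V_def by (rule osum_annihilate[OF oS]) (auto simp: s_def foa)
  ultimately have "(f 0)\<^sup>\<dagger> \<odot> P = 0" by (metis blinfun_compose_assoc blinfun_compose_algebra(10))
  hence "(f 0)\<^sup>\<dagger> \<odot> (P \<odot> f 0) = 0" by (metis blinfun_compose_assoc blinfun_compose_algebra(10))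
  thus False using F(2) by (simp add: Pf' ff)
qed

text \<open>On a central piece \<open>z\<close> the identity splits into finitely many copies of
  \<open>F\<close> and a remainder that fits into \<open>F\<close>. Norms over \<open>z\<close> are
  thereby controlled by finitely many vectors in the range of \<open>F\<close>.\<close>

lemma central_division:
  assumes F: "pr F" "F \<noteq> 0"
  obtains z W v0 where "central z" "z \<odot> F \<noteq> 0" "finite W" "W \<subseteq> M" "v0 \<in> M"
    "\<And>v. v \<in> W \<Longrightarrow> v \<odot> F = v" "F \<odot> v0 = v0"
    "\<And>y. (norm (z y))\<^sup>2 \<le> (\<Sum>v\<in>W. (norm (v\<^sup>\<dagger> y))\<^sup>2) + (norm (v0 y))\<^sup>2"
proof -
  obtain W where W: "W \<subseteq> {v\<in>M. v\<^sup>\<dagger> \<odot> v = F}" "pairwise (\<lambda>v w. v\<^sup>\<dagger> \<odot> w = 0) W"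
    "\<And>a. a \<in> {v\<in>M. v\<^sup>\<dagger> \<odot> v = F} \<Longrightarrow> (\<And>w. w \<in> W \<Longrightarrow> a\<^sup>\<dagger> \<odot> w = 0 \<and> w\<^sup>\<dagger> \<odot> a = 0) \<Longrightarrow> a \<in> W"
    by (rule ex_maximal_pairwise[of "{v\<in>M. v\<^sup>\<dagger> \<odot> v = F}" "\<lambda>v w. v\<^sup>\<dagger> \<odot> w = 0"]) blast
  have fin: "finite W"
    by (rule finite_orth_copies[OF F]) (use W(1,2) in \<open>auto simp: pairwise_def\<close>)
  have orth: "w\<^sup>\<dagger> \<odot> v = 0" if "v \<in> W" "w \<in> W" "v \<noteq> w" for v w using W(2) that by (auto simp: pairwise_def)
  have WF: "v \<odot> F = v" "is_pisom v" if "v \<in> W" for v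
    using pisom_init[of v F] W(1) that prD(2)[OF F(1)] by auto
  define s where "s = (\<Sum>v\<in>W. v \<odot> v\<^sup>\<dagger>)"
  have sM: "s \<in> M" unfolding s_def using fin W(1)
    by (induction W) (auto intro: M_intros)
  have wsum: "w\<^sup>\<dagger> \<odot> s = w\<^sup>\<dagger>" if w: "w \<in> W" for w
  proof -
    have "w\<^sup>\<dagger> \<odot> s = (\<Sum>v\<in>W. w\<^sup>\<dagger> \<odot> (v \<odot> v\<^sup>\<dagger>))"
      unfolding s_def by (rule bounded_bilinear.sum_right[OF bounded_bilinear_blinfun_compose])
    also have "\<dots> = (\<Sum>v\<in>W. if v = w then w\<^sup>\<dagger> else 0)"
    proof (rule sum.cong[OF refl])
      fix v assume v: "v \<in> W"
      show "w\<^sup>\<dagger> \<odot> (v \<odot> v\<^sup>\<dagger>) = (if v = w then w\<^sup>\<dagger> else 0)"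
      proof (cases "v = w")
        case False
        from orth[OF v w False] show ?thesis using False by (simp flip: blinfun_compose_assoc)
      qed (simp add: is_pisomD(2)[OF WF(2)[OF w]])
    qed
    also have "\<dots> = w\<^sup>\<dagger>" using fin w by simp
    finally show ?thesis .
  qed
  have ssum: "A \<odot> s = (\<Sum>v\<in>W. A \<odot> (v \<odot> v\<^sup>\<dagger>))" "s \<odot> A = (\<Sum>v\<in>W. v \<odot> v\<^sup>\<dagger> \<odot> A)" for A
    unfolding s_def
    by (rule bounded_bilinear.sum_right[OF bounded_bilinear_blinfun_compose],
      rule bounded_bilinear.sum_left[OF bounded_bilinear_blinfun_compose])
  have s: "pr s"
  proof -
    have "s\<^sup>\<dagger> = (\<Sum>v\<in>W. (v \<odot> v\<^sup>\<dagger>)\<^sup>\<dagger>)" unfolding s_def by (rule linear_sum[OF bounded_linear.linear[OF bounded_linear_hadj]])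
    hence "s\<^sup>\<dagger> = s" by (simp add: s_def)
    moreover have "s \<odot> s = s" unfolding ssum(2)[of s] by (simp add: blinfun_compose_assoc wsum) (simp add: s_def)
    ultimately show ?thesis using sM by (simp add: pr_def is_proj_def)
  qed
  define r where "r = id_blinfun - s"
  have r: "pr r" unfolding r_def by (rule pr_compl[OF s])
  obtain z where z: "central z" "z \<odot> r \<preceq> z \<odot> F" "(id_blinfun - z) \<odot> F \<preceq> (id_blinfun - z) \<odot> r"
    by (rule comparison[OF r F(1)])
  \<comment> \<open>If \<open>z\<close> killed \<open>F\<close>, then \<open>F\<close> would embed
    into the uncovered part \<open>r\<close> and extend the maximal family \<open>W\<close>.\<close>
  have zF: "z \<odot> F \<noteq> 0"
  proof
    assume "z \<odot> F = 0"
    hence "(id_blinfun - z) \<odot> F = F" by (simp add: op_simps)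
    then obtain v where v: "v \<in> M" "v\<^sup>\<dagger> \<odot> v = F" "(id_blinfun - z) \<odot> r \<odot> v = v"
      using z(3) by (auto simp: sube_def)
    have "r \<odot> ((id_blinfun - z) \<odot> r \<odot> v) = (id_blinfun - z) \<odot> r \<odot> v"
      by (simp add: blinfun_compose_assoc central_left_commute[OF central_compl[OF z(1)] prD(1)[OF r]] prD[OF r])
    hence rv: "r \<odot> v = v" by (simp add: v(3))
    have wv: "w\<^sup>\<dagger> \<odot> v = 0" if "w \<in> W" for w
    proof -
      have "w\<^sup>\<dagger> \<odot> (r \<odot> v) = (w\<^sup>\<dagger> \<odot> r) \<odot> v" by (simp add: blinfun_compose_assoc)
      also have "w\<^sup>\<dagger> \<odot> r = 0" by (simp add: r_def op_simps wsum[OF that])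
      finally show ?thesis by (simp add: rv)
    qed
    have "v \<in> W"
    proof (rule W(3))
      fix w assume "w \<in> W"
      hence w: "w\<^sup>\<dagger> \<odot> v = 0" by (rule wv)
      moreover have "v\<^sup>\<dagger> \<odot> w = 0" using arg_cong[OF w, of hadj] by simp
      ultimately show "v\<^sup>\<dagger> \<odot> w = 0 \<and> w\<^sup>\<dagger> \<odot> v = 0" by simp
    qed (use v in auto)
    from wv[OF this] F(2) v(2) show False by simp
  qed
  obtain v0 where v0: "v0 \<in> M" "v0\<^sup>\<dagger> \<odot> v0 = z \<odot> r" "z \<odot> F \<odot> v0 = v0" using z(2) by (auto simp: sube_def)
  have Fv0: "F \<odot> v0 = v0"
  proof -
    have "F \<odot> (z \<odot> F \<odot> v0) = z \<odot> F \<odot> v0"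
      by (simp add: blinfun_compose_assoc central_left_commute[OF z(1) prD(1)[OF F(1)]] prD[OF F(1)])
    thus ?thesis by (simp add: v0(3))
  qed
  have bound: "(norm (z y))\<^sup>2 \<le> (\<Sum>v\<in>W. (norm (v\<^sup>\<dagger> y))\<^sup>2) + (norm (v0 y))\<^sup>2" for y
  proof -
    have pz: "pr z" "pr (z \<odot> s)" using z(1) s by (auto simp: central_def intro: pr_central z(1))
    have "z = z \<odot> s + v0\<^sup>\<dagger> \<odot> v0" by (simp add: v0 r_def op_simps)
    hence "z y \<bullet> y = (z \<odot> s) y \<bullet> y + (v0\<^sup>\<dagger> \<odot> v0) y \<bullet> y"
      by (metis blinfun.add_left inner_add_left)
    moreover have "z y \<bullet> y = (norm (z y))\<^sup>2" by (rule inner_proj[OF prD(2)[OF pz(1)]])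
    moreover have "(v0\<^sup>\<dagger> \<odot> v0) y \<bullet> y = (norm (v0 y))\<^sup>2" by (simp only: norm_apply_sq inner_commute)
    moreover have "(z \<odot> s) y \<bullet> y \<le> s y \<bullet> y"
    proof -
      have "(z \<odot> s) y \<bullet> y = (norm (z (s y)))\<^sup>2" using inner_proj[OF prD(2)[OF pz(2)], of y] by simp
      also have "\<dots> \<le> (norm (s y))\<^sup>2" by (intro power_mono norm_proj_le prD(2)[OF pz(1)]) simp
      also have "\<dots> = s y \<bullet> y" using inner_proj[OF prD(2)[OF s], of y] by simp
      finally show ?thesis .
    qed
    moreover have "s y \<bullet> y = (\<Sum>v\<in>W. (norm (v\<^sup>\<dagger> y))\<^sup>2)"
      unfolding s_def by (simp add: blinfun.sum_left inner_sum_left power2_norm_eq_inner inner_hadj)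
    ultimately show ?thesis by linarith
  qed
  show ?thesis
    by (rule that[OF z(1) zF fin _ v0(1) WF(1) Fv0 bound]) (use W(1) in auto)
qed

section \<open>Near-traces and strong continuity of the adjoint\<close>

lemma spec_cell_sums:
  fixes a :: "'a \<Rightarrow>\<^sub>L 'a"
  assumes "r \<ge> 0" "\<delta> > 0" "a\<^sup>\<dagger> = a" "norm a \<le> r"
  shows "(\<Sum>k<spec_num r \<delta>. (norm (spec_cell r \<delta> a k y))\<^sup>2) = (norm y)\<^sup>2"
    and "(\<Sum>k<spec_num r \<delta>. a (spec_cell r \<delta> a k y) \<bullet> spec_cell r \<delta> a k y) = a y \<bullet> y"
proof -
  note d = is_proj_spec_cell[OF assms]
  have y: "(\<Sum>k<spec_num r \<delta>. spec_cell r \<delta> a k x) = x" for x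
    using sum_spec_cell[OF assms] by (metis blinfun.sum_left blinfun_apply_id_blinfun)
  have "(norm y)\<^sup>2 = (\<Sum>k<spec_num r \<delta>. spec_cell r \<delta> a k y) \<bullet> y"
    by (simp add: y power2_norm_eq_inner)
  thus "(\<Sum>k<spec_num r \<delta>. (norm (spec_cell r \<delta> a k y))\<^sup>2) = (norm y)\<^sup>2"
    by (simp add: inner_sum_left inner_proj[OF d])
  have "a (spec_cell r \<delta> a k y) \<bullet> spec_cell r \<delta> a k y = spec_cell r \<delta> a k (a y) \<bullet> y" for k
  proof -
    have "a (spec_cell r \<delta> a k y) = spec_cell r \<delta> a k (a y)"
      using spec_cell_commute[OF assms, of a k] by (metis blinfun_apply_blinfun_compose)
    thus ?thesis using d[of k] by (metis inner_hadj is_projD(2) is_projD(3))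
  qed
  thus "(\<Sum>k<spec_num r \<delta>. a (spec_cell r \<delta> a k y) \<bullet> spec_cell r \<delta> a k y) = a y \<bullet> y"
    by (simp add: y flip: inner_sum_left)
qed

text \<open>The vector functional of \<open>\<xi>\<close> replaces a trace: it is tracial on \<open>F M E\<close> up to a factor 2.\<close>

lemma ex_near_trace:
  assumes f: "pr f" "f \<noteq> 0"
  obtains \<xi> E F where "pr E" "pr F" "E \<asymp> F" "E \<noteq> 0" "f \<odot> E = E"
    "\<And>z. central z \<Longrightarrow> z (E \<xi>) = 0 \<Longrightarrow> z \<odot> E = 0"
    "\<And>X. X \<in> M \<Longrightarrow> F \<odot> X = X \<Longrightarrow> X \<odot> E = X \<Longrightarrow> (norm (X \<xi>))\<^sup>2 \<le> 2 * (norm (X\<^sup>\<dagger> \<xi>))\<^sup>2"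
proof -
  obtain x where x: "f x \<noteq> 0" using f(2) by (metis blinfun_eqI blinfun.zero_left)
  define \<xi> where "\<xi> = f x"
  have \<xi>: "\<xi> \<noteq> 0" "f \<xi> = \<xi>" using x prD(2)[OF f(1)] by (auto simp: \<xi>_def is_projD)
  \<comment> \<open>The projection \<open>e\<close> onto the closure of \<open>B\<close> lies in
    \<open>M\<close>, and \<open>\<xi>\<close> is separating for it: an operator of \<open>M\<close>
    that kills \<open>\<xi>\<close> kills \<open>e\<close>.\<close>
  define B where "B = {blinfun_apply T \<xi> | T. T \<in> comm M}"
  define S where "S = closure B"
  have cM: "S + T \<in> comm M" "r *\<^sub>R S \<in> comm M" "S \<odot> T \<in> comm M" if "S \<in> comm M" "T \<in> comm M" for S T r
    using that unfolding comm_def by (auto simp: op_simps) (metis blinfun_compose_assoc)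
  have id: "id_blinfun \<in> comm M" "0 \<in> comm M" by (auto simp: comm_def op_simps)
  have subB: "subspace B"
    unfolding subspace_def B_def
  proof (intro conjI ballI allI)
    show "0 \<in> {blinfun_apply T \<xi> |T. T \<in> comm M}" using id(2) by (intro CollectI exI[of _ 0]) auto
    fix u v c assume "u \<in> {blinfun_apply T \<xi> |T. T \<in> comm M}" "v \<in> {blinfun_apply T \<xi> |T. T \<in> comm M}"
    then obtain R T where RT: "u = blinfun_apply R \<xi>" "R \<in> comm M" "v = blinfun_apply T \<xi>" "T \<in> comm M" by blast
    show "u + v \<in> {blinfun_apply T \<xi> |T. T \<in> comm M}"
      by (intro CollectI exI[of _ "R + T"]) (auto simp: RT cM blinfun.add_left)
    show "c *\<^sub>R u \<in> {blinfun_apply T \<xi> |T. T \<in> comm M}"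
      by (intro CollectI exI[of _ "c *\<^sub>R R"]) (auto simp: RT cM(2)[OF RT(2,2)] blinfun.scaleR_left)
  qed
  have S: "closed S" "subspace S" by (auto simp: S_def subspace_closure[OF subB])
  define e where "e = proj_on S"
  have e: "pr e" unfolding pr_def e_def
  proof (intro conjI is_proj_proj_on S M_proj_on)
    fix T y assume T: "T \<in> comm M" and y: "y \<in> S"
    have "blinfun_apply T ` B \<subseteq> B" unfolding B_def using cM(3)[OF T]
      by auto (metis blinfun_apply_blinfun_compose)
    hence "blinfun_apply T ` closure B \<subseteq> closure B"
      by (intro image_closure_subset continuous_intros closed_closure) (use closure_subset in blast)
    thus "blinfun_apply T y \<in> S" using y by (auto simp: S_def)
  qed
  have kill: "R \<odot> e = 0" if R: "R \<in> M" "R \<xi> = 0" for R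
  proof (rule blinfun_eqI)
    fix y
    have "R u = 0" if u: "u \<in> B" for u
    proof -
      obtain T where T: "u = blinfun_apply T \<xi>" "T \<in> comm M" using u by (auto simp: B_def)
      have "R u = blinfun_apply T (R \<xi>)" unfolding T using commD[OF T(2) R(1)] by (metis blinfun_apply_blinfun_compose)
      thus ?thesis using R(2) by simp
    qed
    from blinfun_eq_0_on_closure[OF this] proj_on_in[OF S]
    show "(R \<odot> e) y = blinfun_apply 0 y" by (simp add: e_def S_def)
  qed
  have "(id_blinfun - f) \<odot> e = 0" by (rule kill) (simp_all add: blinfun.diff_left \<xi> prD(1)[OF pr_compl[OF f(1)]])
  hence fe: "f \<odot> e = e" by (simp add: op_simps)
  have e\<xi>: "e \<xi> = \<xi>"
  proof -
    have "\<xi> \<in> B" unfolding B_def using id(1) by (intro CollectI exI[of _ id_blinfun]) auto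
    hence "\<xi> \<in> S" unfolding S_def using closure_subset by blast
    thus ?thesis by (simp add: e_def proj_on_fix[OF S])
  qed
  \<comment> \<open>\<open>Q\<close> singles out partial isometries that violate the tracial bound;
    a maximal orthogonal family of them is then removed from \<open>e\<close>.\<close>
  define Q where "Q = (\<lambda>v. 2 * (norm (v\<^sup>\<dagger> \<xi>))\<^sup>2 \<le> (norm (blinfun_apply v \<xi>))\<^sup>2)"
  obtain W where W: "orth_pisoms W" "W \<subseteq> M" "\<And>v. v \<in> W \<Longrightarrow> Q v"
    "osum W \<odot> e = osum W" "e \<odot> osum W = osum W"
    "\<And>v. v \<in> M \<Longrightarrow> is_pisom v \<Longrightarrow> Q v \<Longrightarrow> v \<odot> (e - (osum W)\<^sup>\<dagger> \<odot> osum W) = v \<Longrightarrow>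
      (e - osum W \<odot> (osum W)\<^sup>\<dagger>) \<odot> v = v \<Longrightarrow> v = 0"
    by (rule ex_maximal_pisoms[OF e e, of Q]) blast
  let ?V = "osum W"
  have V: "?V \<in> M" "is_pisom ?V" using M_osum[OF W(1,2)] is_pisom_osum[OF W(1)] by auto
  define P where "P = ?V\<^sup>\<dagger> \<odot> ?V"
  define P' where "P' = ?V \<odot> ?V\<^sup>\<dagger>"
  have P: "pr P" "pr P'" using pr_pisom[OF V] by (auto simp: P_def P'_def)
  have eV: "e \<odot> ?V\<^sup>\<dagger> = ?V\<^sup>\<dagger>" using arg_cong[OF W(4), of hadj] by (simp add: prD(4)[OF e])
  have eP: "e \<odot> P = P" "e \<odot> P' = P'" by (simp_all add: P_def P'_def eV W(5) flip: blinfun_compose_assoc)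
  have PP: "P \<asymp> P'" by (rule eqvI[OF V(1)]) (auto simp: P_def P'_def)
  define E where "E = e - P"
  define F where "F = e - P'"
  have EF: "pr E" "pr F" "E \<asymp> F" unfolding E_def F_def
    by (auto intro!: pr_diff eqv_diff e P PP eP eqv_refl)
  have Pe: "P \<odot> e = P" using pr_le_sym[OF P(1) e] eP by simp
  \<comment> \<open>If the family exhausted \<open>e\<close>, its sum and the adjoint of the sum
    would both preserve the norm of \<open>\<xi>\<close>, and adding up \<open>Q\<close> would give
    \<open>2 * (norm \<xi>)\<^sup>2 \<le> (norm \<xi>)\<^sup>2\<close>.\<close>
  have E0: "E \<noteq> 0"
  proof
    assume "E = 0"
    hence "F = 0" using EF(3) eqv_0 by simp
    hence "P = e" "P' = e" using \<open>E = 0\<close> by (auto simp: E_def F_def)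
    hence n: "norm (?V \<xi>) = norm \<xi>" "norm (?V\<^sup>\<dagger> \<xi>) = norm \<xi>"
      using norm_pisom_hadj[OF V(2), of \<xi>] e\<xi> unfolding P_def P'_def by simp_all
    have "2 * (norm (?V\<^sup>\<dagger> \<xi>))\<^sup>2 \<le> (norm (?V \<xi>))\<^sup>2"
    proof (rule has_sum_mono)
      show "((\<lambda>v. 2 * (norm (v\<^sup>\<dagger> \<xi>))\<^sup>2) has_sum 2 * (norm (?V\<^sup>\<dagger> \<xi>))\<^sup>2) W"
        by (rule has_sum_bounded_linear[OF bounded_linear_mult_right osum_hadj_norm_has_sum[OF W(1)]])
      show "((\<lambda>v. (norm (blinfun_apply v \<xi>))\<^sup>2) has_sum (norm (?V \<xi>))\<^sup>2) W" by (rule osum_norm_has_sum[OF W(1)])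
    qed (use W(3) Q_def in auto)
    thus False using \<xi>(1) by (simp add: n)
  qed
  have max: "(norm (v \<xi>))\<^sup>2 \<le> 2 * (norm (v\<^sup>\<dagger> \<xi>))\<^sup>2"
    if v: "v \<in> M" "is_pisom v" "v \<odot> E = v" "F \<odot> v = v" for v
  proof (rule ccontr)
    assume *: "\<not> ?thesis"
    have "v = 0" by (rule W(6)) (use v * in \<open>auto simp: Q_def E_def F_def P_def P'_def\<close>)
    thus False using * by simp
  qed
  \<comment> \<open>From partial isometries to general \<open>X\<close>: in the polar decomposition,
    cut \<open>X\<^sup>\<dagger> \<odot> X\<close> by spectral cells and apply \<open>max\<close> to
    \<open>v\<close> restricted to each cell.\<close>
  have main: "(norm (X \<xi>))\<^sup>2 \<le> 2 * (norm (X\<^sup>\<dagger> \<xi>))\<^sup>2" if X: "X \<in> M" "F \<odot> X = X" "X \<odot> E = X" for X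
  proof -
    obtain v where v: "v \<in> M" "is_pisom v" "v\<^sup>\<dagger> \<odot> v = range_proj (X\<^sup>\<dagger>)" "v \<odot> v\<^sup>\<dagger> = range_proj X"
      "v \<odot> (X\<^sup>\<dagger> \<odot> X) \<odot> v\<^sup>\<dagger> = X \<odot> X\<^sup>\<dagger>" by (rule ex_polar_M[OF X(1)])
    define a where "a = X\<^sup>\<dagger> \<odot> X"
    define q where "q = v\<^sup>\<dagger> \<odot> v"
    define r where "r = norm a"
    have a: "a\<^sup>\<dagger> = a" "a \<in> M" "norm a \<le> r" "r \<ge> 0" by (auto simp: a_def r_def intro: M_intros X)
    have ann: "a y \<bullet> y = (norm (X y))\<^sup>2" for y by (simp add: a_def power2_norm_eq_inner inner_hadj')
    have EX: "E \<odot> X\<^sup>\<dagger> = X\<^sup>\<dagger>" using arg_cong[OF X(3), of hadj] by (simp add: prD(4)[OF EF(1)])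
    have Ea: "E \<odot> a = a \<odot> E" by (simp add: a_def op_simps X(3)) (simp add: EX flip: blinfun_compose_assoc)
    have Eq: "E \<odot> q = q" unfolding q_def v(3) by (rule range_proj_le[OF EX])
    have prq: "pr q" using pr_pisom[OF v(1,2)] by (simp add: q_def)
    have vE: "v \<odot> E = v"
      using Eq pr_le_sym[OF prq EF(1)] is_pisomD(1)[OF v(2)] by (metis q_def blinfun_compose_assoc)
    have Fv: "F \<odot> v = v"
      using range_proj_le[OF X(2)] v(2) unfolding v(4)[symmetric] is_pisom_def by (metis blinfun_compose_assoc)
    have qa: "q \<odot> a = a" "a \<odot> q = a"
    proof -
      show 1: "q \<odot> a = a" by (simp add: q_def v(3) a_def flip: blinfun_compose_assoc)
      show "a \<odot> q = a" using arg_cong[OF 1, of hadj] by (simp add: a prD(4)[OF prq])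
    qed
    have vq: "v \<odot> q = v" using is_pisomD(1)[OF v(2)] by (simp add: q_def)
    have qv: "q \<odot> v\<^sup>\<dagger> = v\<^sup>\<dagger>" using arg_cong[OF vq, of hadj] by (simp add: prD(4)[OF prq])
    \<comment> \<open>The 3 adds one cell error for \<open>q \<xi>\<close> and, because of the
      factor 2, two for \<open>v\<^sup>\<dagger> \<xi>\<close>.\<close>
    have approx: "(norm (X \<xi>))\<^sup>2 \<le> 2 * (norm (X\<^sup>\<dagger> \<xi>))\<^sup>2 + \<delta> * (3 * (norm \<xi>)\<^sup>2)" if \<delta>: "\<delta> > 0" for \<delta>
    proof -
      let ?d = "spec_cell r \<delta> a" and ?n = "spec_num r \<delta>"
      \<comment> \<open>Cutting off negative grid values keeps the error bound, as \<open>a\<close>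
        is nonnegative, and gives coefficients by which the inequalities \<open>step\<close> can be
        multiplied.\<close>
      define t where "t = (\<lambda>k. max 0 (spec_pt r \<delta> k))"
      have d: "pr (?d k)" for k
        unfolding pr_def using M_spec_cell(1)[OF a(4) \<delta> a(1,3,2)] is_proj_spec_cell[OF a(4) \<delta> a(1,3)] by auto
      have ap: "\<bar>a (?d k y) \<bullet> ?d k y - t k * (norm (?d k y))\<^sup>2\<bar> \<le> \<delta> * (norm (?d k y))\<^sup>2" for k y
      proof -
        let ?y = "?d k y" and ?t = "spec_pt r \<delta> k"
        have "norm (a ?y - ?t *\<^sub>R ?y) \<le> \<delta> * norm ?y"
          by (rule spec_cell_approx[OF a(4) \<delta> a(1,3)]) (simp add: is_projD(3)[OF prD(2)[OF d]])
        hence "norm (a ?y - ?t *\<^sub>R ?y) * norm ?y \<le> \<delta> * norm ?y * norm ?y" by (rule mult_right_mono) simp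
        with Cauchy_Schwarz_ineq2[of "a ?y - ?t *\<^sub>R ?y" ?y]
        have *: "\<bar>a ?y \<bullet> ?y - ?t * (norm ?y)\<^sup>2\<bar> \<le> \<delta> * (norm ?y)\<^sup>2"
          by (simp add: inner_diff_left power2_norm_eq_inner) (simp add: dot_square_norm power2_eq_square)
        show ?thesis
        proof (cases "?t \<ge> 0")
          case False
          hence "?t * (norm ?y)\<^sup>2 \<le> 0" by (simp add: mult_nonpos_nonneg)
          moreover have "a ?y \<bullet> ?y \<ge> 0" by (simp add: ann)
          ultimately show ?thesis using * False by (simp add: t_def)
        qed (use * in \<open>simp add: t_def\<close>)
      qed
      have step: "(norm (?d k (q \<xi>)))\<^sup>2 \<le> 2 * (norm (?d k (v\<^sup>\<dagger> \<xi>)))\<^sup>2" for k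
      proof -
        have dq: "?d k \<odot> q = q \<odot> ?d k"
          by (rule sym, rule spec_cell_commute[OF a(4) \<delta> a(1,3)]) (simp add: qa)
        have dE: "?d k \<odot> E = E \<odot> ?d k"
          by (rule sym, rule spec_cell_commute[OF a(4) \<delta> a(1,3)]) (rule Ea)
        let ?w = "v \<odot> ?d k"
        have "?w\<^sup>\<dagger> \<odot> ?w = ?d k \<odot> (q \<odot> ?d k)" by (simp add: prD(4)[OF d] blinfun_compose_assoc q_def)
        also have "\<dots> = ?d k \<odot> (?d k \<odot> q)" by (simp only: dq)
        finally have ww: "?w\<^sup>\<dagger> \<odot> ?w = ?d k \<odot> q" by (simp only: prD(5)[OF d])
        have w: "?w \<in> M" "is_pisom ?w" "?w \<odot> E = ?w" "F \<odot> ?w = ?w"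
          subgoal by (intro M_intros v prD(1)[OF d])
          subgoal unfolding is_pisom_iff ww by (rule is_proj_prod[OF prD(2)[OF d] prD(2)[OF prq] dq])
          subgoal using dE vE by (metis blinfun_compose_assoc)
          subgoal using Fv by (metis blinfun_compose_assoc)
          done
        have "norm (?d k (q \<xi>)) = norm ((?w\<^sup>\<dagger> \<odot> ?w) \<xi>)" unfolding ww by simp
        also have "\<dots> = norm (?w \<xi>)" by (rule norm_pisom_hadj(2)[OF w(2)])
        finally have 1: "norm (?d k (q \<xi>)) = norm (?w \<xi>)" .
        have 2: "?w\<^sup>\<dagger> \<xi> = ?d k (v\<^sup>\<dagger> \<xi>)" by (simp add: prD(4)[OF d])
        show ?thesis using max[OF w] by (simp only: 1 2)
      qed
      have Xq: "(norm (X \<xi>))\<^sup>2 = a (q \<xi>) \<bullet> q \<xi>"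
      proof -
        have "a (q \<xi>) \<bullet> q \<xi> = q (a (q \<xi>)) \<bullet> \<xi>" by (metis inner_hadj prD(4)[OF prq])
        also have "q (a (q \<xi>)) = a \<xi>" using qa by (metis blinfun_apply_blinfun_compose)
        finally show ?thesis by (simp add: ann)
      qed
      have Xv: "(norm (X\<^sup>\<dagger> \<xi>))\<^sup>2 = a (v\<^sup>\<dagger> \<xi>) \<bullet> v\<^sup>\<dagger> \<xi>"
      proof -
        have "(norm (X\<^sup>\<dagger> \<xi>))\<^sup>2 = \<xi> \<bullet> (X \<odot> X\<^sup>\<dagger>) \<xi>" using norm_apply_sq[of "X\<^sup>\<dagger>" \<xi>] by simp
        also have "\<dots> = \<xi> \<bullet> v (a (v\<^sup>\<dagger> \<xi>))" unfolding v(5)[symmetric] a_def by simp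
        also have "\<dots> = v\<^sup>\<dagger> \<xi> \<bullet> a (v\<^sup>\<dagger> \<xi>)" by (rule inner_hadj')
        also have "\<dots> = a (v\<^sup>\<dagger> \<xi>) \<bullet> v\<^sup>\<dagger> \<xi>" by (rule inner_commute)
        finally show ?thesis .
      qed
      have "(norm (X \<xi>))\<^sup>2 = (\<Sum>k<?n. a (?d k (q \<xi>)) \<bullet> ?d k (q \<xi>))"
        unfolding Xq spec_cell_sums(2)[OF a(4) \<delta> a(1,3)] ..
      also have "\<dots> \<le> (\<Sum>k<?n. t k * (norm (?d k (q \<xi>)))\<^sup>2 + \<delta> * (norm (?d k (q \<xi>)))\<^sup>2)"
        by (intro sum_mono) (use ap in \<open>simp add: abs_le_iff algebra_simps\<close>)
      also have "\<dots> \<le> (\<Sum>k<?n. t k * (2 * (norm (?d k (v\<^sup>\<dagger> \<xi>)))\<^sup>2) + \<delta> * (norm (?d k (q \<xi>)))\<^sup>2)"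
        by (intro sum_mono add_mono mult_left_mono step) (use \<delta> in \<open>auto simp: t_def\<close>)
      also have "\<dots> \<le> (\<Sum>k<?n. 2 * (a (?d k (v\<^sup>\<dagger> \<xi>)) \<bullet> ?d k (v\<^sup>\<dagger> \<xi>)) + 2 * \<delta> * (norm (?d k (v\<^sup>\<dagger> \<xi>)))\<^sup>2
          + \<delta> * (norm (?d k (q \<xi>)))\<^sup>2)"
      proof (intro sum_mono add_mono order_refl)
        fix k
        have "t k * (norm (?d k (v\<^sup>\<dagger> \<xi>)))\<^sup>2 \<le> a (?d k (v\<^sup>\<dagger> \<xi>)) \<bullet> ?d k (v\<^sup>\<dagger> \<xi>) + \<delta> * (norm (?d k (v\<^sup>\<dagger> \<xi>)))\<^sup>2"
          using ap[of k "v\<^sup>\<dagger> \<xi>"] by linarith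
        thus "t k * (2 * (norm (?d k (v\<^sup>\<dagger> \<xi>)))\<^sup>2)
          \<le> 2 * (a (?d k (v\<^sup>\<dagger> \<xi>)) \<bullet> ?d k (v\<^sup>\<dagger> \<xi>)) + 2 * \<delta> * (norm (?d k (v\<^sup>\<dagger> \<xi>)))\<^sup>2" by linarith
      qed
      also have "\<dots> = 2 * (norm (X\<^sup>\<dagger> \<xi>))\<^sup>2 + 2 * \<delta> * (norm (v\<^sup>\<dagger> \<xi>))\<^sup>2 + \<delta> * (norm (q \<xi>))\<^sup>2"
        unfolding Xv sum.distrib sum_distrib_left[symmetric] spec_cell_sums[OF a(4) \<delta> a(1,3)] ..
      also have "\<dots> \<le> 2 * (norm (X\<^sup>\<dagger> \<xi>))\<^sup>2 + 2 * \<delta> * (norm \<xi>)\<^sup>2 + \<delta> * (norm \<xi>)\<^sup>2"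
      proof -
        have n1: "norm (q \<xi>) \<le> norm \<xi>" by (rule norm_proj_le[OF prD(2)[OF prq]])
        have n2: "norm (v\<^sup>\<dagger> \<xi>) \<le> norm \<xi>"
          using norm_proj_le[of "v \<odot> v\<^sup>\<dagger>" \<xi>] norm_pisom_hadj(1)[OF v(2)] is_pisom_projs[OF v(2)] by simp
        show ?thesis using \<delta> n1 n2 by (intro add_mono mult_left_mono power_mono order_refl) auto
      qed
      finally show ?thesis by (simp add: algebra_simps)
    qed
    show ?thesis
    proof (rule field_le_epsilon)
      fix \<epsilon> :: real assume \<epsilon>: "\<epsilon> > 0"
      have n: "3 * (norm \<xi>)\<^sup>2 > 0" using \<xi> by simp
      show "(norm (X \<xi>))\<^sup>2 \<le> 2 * (norm (X\<^sup>\<dagger> \<xi>))\<^sup>2 + \<epsilon>"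
        using approx[of "\<epsilon> / (3 * (norm \<xi>)\<^sup>2)"] \<epsilon> n by simp
    qed
  qed
  show ?thesis
  proof (rule that[OF EF E0 _ _ main])
    show "f \<odot> E = E" by (simp add: E_def op_simps fe) (metis fe eP(1) blinfun_compose_assoc)
    fix z assume z: "central z" "z (E \<xi>) = 0"
    have "z \<odot> E \<odot> e = 0" by (rule kill) (use z EF in \<open>auto intro!: M_intros simp: central_def pr_def\<close>)
    moreover have "E \<odot> e = E" by (simp add: E_def op_simps prD[OF e] Pe)
    ultimately show "z \<odot> E = 0" by (simp add: blinfun_compose_assoc)
  qed
qed

text \<open>The vectors at which the adjoints tend to 0 form a closed subspace whose projection
  \<open>p\<close> lies in \<open>M\<close>. If \<open>p\<close> were not the identity,
  \<open>ex_near_trace\<close> below its complement would trade adjoints for the operators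
  themselves and produce a nonzero vector of the subspace that is orthogonal to it.\<close>

lemma stends_hadj_0:
  assumes a: "stends a 0 \<F>" "\<And>i. a i \<in> M" "\<And>i. norm (a i) \<le> K"
  shows "stends (\<lambda>i. (a i)\<^sup>\<dagger>) 0 \<F>"
proof -
  define N where "N = {y. ((\<lambda>i. (a i)\<^sup>\<dagger> y) \<longlongrightarrow> 0) \<F>}"
  have K: "norm ((a i)\<^sup>\<dagger> y) \<le> K * norm y" for i y
  proof -
    have "norm ((a i)\<^sup>\<dagger> y) \<le> norm (a i) * norm y" using norm_blinfun[of "(a i)\<^sup>\<dagger>" y] by simp
    also have "\<dots> \<le> K * norm y" by (intro mult_right_mono a) simp
    finally show ?thesis .
  qed
  have K0: "0 \<le> K" using a(3) norm_ge_zero order_trans by blast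
  have "closure N \<subseteq> N"
  proof (rule subsetI)
    fix y assume "y \<in> closure N"
    hence y: "\<forall>e>0. \<exists>y'\<in>N. dist y' y < e" by (simp add: closure_approachable)
    show "y \<in> N" unfolding N_def tendsto_iff
    proof (intro CollectI allI impI)
      fix e :: real assume e: "e > 0"
      have "e / (2 * (K + 1)) > 0" using e K0 by simp
      then obtain y' where y': "y' \<in> N" "dist y' y < e / (2 * (K + 1))" using y by blast
      have "K * norm (y - y') \<le> (K + 1) * norm (y - y')" by (intro mult_right_mono) auto
      also have "\<dots> < (K + 1) * (e / (2 * (K + 1)))"
        using y'(2) K0 by (intro mult_strict_left_mono) (auto simp: dist_norm norm_minus_commute)
      also have "\<dots> = e / 2" using K0 by (simp add: field_simps)
      finally have small: "K * norm (y - y') < e / 2" .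
      have "eventually (\<lambda>i. dist ((a i)\<^sup>\<dagger> y') 0 < e / 2) \<F>"
        using y'(1) e unfolding N_def by (intro tendstoD) auto
      thus "eventually (\<lambda>i. dist ((a i)\<^sup>\<dagger> y) 0 < e) \<F>"
      proof eventually_elim
        case (elim i)
        have "(a i)\<^sup>\<dagger> y = (a i)\<^sup>\<dagger> (y - y') + (a i)\<^sup>\<dagger> y'" by (simp add: blinfun.diff_right)
        also have "norm \<dots> \<le> K * norm (y - y') + norm ((a i)\<^sup>\<dagger> y')"
          by (meson norm_triangle_ineq K add_right_mono order_trans)
        finally show ?case using elim small by simp
      qed
    qed
  qed
  hence N: "closed N" by (simp add: closure_subset_eq)
  have N': "subspace N"
  proof (rule subspaceI)
    show "0 \<in> N" by (simp add: N_def)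
    show "c *\<^sub>R x \<in> N" if "x \<in> N" for c x
      using tendsto_scaleR[OF tendsto_const, of "\<lambda>i. (a i)\<^sup>\<dagger> x" 0 \<F> c] that
      by (simp add: N_def blinfun.scaleR_right)
    show "x + y \<in> N" if "x \<in> N" "y \<in> N" for x y
      using tendsto_add[of "\<lambda>i. (a i)\<^sup>\<dagger> x" 0 \<F> "\<lambda>i. (a i)\<^sup>\<dagger> y" 0] that
      by (simp add: N_def blinfun.add_right)
  qed
  define p where "p = proj_on N"
  have p: "pr p" unfolding pr_def p_def
  proof (intro conjI is_proj_proj_on N N' M_proj_on)
    fix T y assume T: "T \<in> comm M" and "y \<in> N"
    hence "((\<lambda>i. blinfun_apply T ((a i)\<^sup>\<dagger> y)) \<longlongrightarrow> T 0) \<F>"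
      unfolding N_def by (intro bounded_linear.tendsto[OF blinfun.bounded_linear_right]) auto
    moreover have "blinfun_apply T ((a i)\<^sup>\<dagger> y) = (a i)\<^sup>\<dagger> (blinfun_apply T y)" for i
      using commD[OF T M_hadj[OF a(2)]] by (metis blinfun_apply_blinfun_compose)
    ultimately show "blinfun_apply T y \<in> N" by (simp add: N_def)
  qed
  have "p = id_blinfun"
  proof (rule ccontr)
    assume "p \<noteq> id_blinfun"
    hence f: "pr (id_blinfun - p)" "id_blinfun - p \<noteq> 0" using pr_compl[OF p] by auto
    obtain \<xi> E F where EF: "pr E" "pr F" "E \<asymp> F" "E \<noteq> 0" "(id_blinfun - p) \<odot> E = E"
      "\<And>z. central z \<Longrightarrow> z (E \<xi>) = 0 \<Longrightarrow> z \<odot> E = 0"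
      "\<And>X. X \<in> M \<Longrightarrow> F \<odot> X = X \<Longrightarrow> X \<odot> E = X \<Longrightarrow> (norm (X \<xi>))\<^sup>2 \<le> 2 * (norm (X\<^sup>\<dagger> \<xi>))\<^sup>2"
      by (rule ex_near_trace[OF f]) blast
    have "F \<noteq> 0" using EF(3,4) eqv_0 by blast
    then obtain z W v0 where z: "central z" "z \<odot> F \<noteq> 0" and W: "finite W" "W \<subseteq> M" "v0 \<in> M"
      "\<And>v. v \<in> W \<Longrightarrow> v \<odot> F = v" "F \<odot> v0 = v0"
      "\<And>y. (norm (z y))\<^sup>2 \<le> (\<Sum>v\<in>W. (norm (v\<^sup>\<dagger> y))\<^sup>2) + (norm (v0 y))\<^sup>2"
      by (rule central_division[OF EF(2)]) blast
    \<comment> \<open>The near-trace bound is applied to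
      \<open>v \<odot> (a i)\<^sup>\<dagger> \<odot> E\<close>. The adjoint of this operator sends
      \<open>\<xi>\<close> to \<open>E\<close> applied to
      \<open>a i (v\<^sup>\<dagger> \<xi>)\<close>, which tends to 0.\<close>
    have one: "(norm (v ((a i)\<^sup>\<dagger> (E \<xi>))))\<^sup>2 \<le> 2 * (norm (a i (v\<^sup>\<dagger> \<xi>)))\<^sup>2"
      if v: "v \<in> M" "F \<odot> v = v" for v i
    proof -
      let ?X = "v \<odot> (a i)\<^sup>\<dagger> \<odot> E"
      have "(norm (?X \<xi>))\<^sup>2 \<le> 2 * (norm (?X\<^sup>\<dagger> \<xi>))\<^sup>2"
      proof (rule EF(7))
        show "?X \<in> M" by (intro M_intros v a prD(1)[OF EF(1)])
        show "F \<odot> ?X = ?X" by (simp only: blinfun_compose_assoc[symmetric] v(2))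
        show "?X \<odot> E = ?X" by (simp only: blinfun_compose_assoc prD(3)[OF EF(1)])
      qed
      also have "norm (?X\<^sup>\<dagger> \<xi>) = norm (E (a i (v\<^sup>\<dagger> \<xi>)))" by (simp add: prD(4)[OF EF(1)])
      also have "2 * (norm (E (a i (v\<^sup>\<dagger> \<xi>))))\<^sup>2 \<le> 2 * (norm (a i (v\<^sup>\<dagger> \<xi>)))\<^sup>2"
        by (intro mult_left_mono power_mono norm_proj_le prD(2)[OF EF(1)]) auto
      finally show ?thesis by simp
    qed
    define g where "g = (\<lambda>i. (\<Sum>v\<in>W. 2 * (norm (a i (blinfun_apply v \<xi>)))\<^sup>2) + 2 * (norm (a i (v0\<^sup>\<dagger> \<xi>)))\<^sup>2)"
    have a0: "((\<lambda>i. a i y) \<longlongrightarrow> 0) \<F>" for y using a(1) by (simp add: stends_def)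
    have "(g \<longlongrightarrow> (\<Sum>v\<in>W. 2 * (norm (0::'a))\<^sup>2) + 2 * (norm (0::'a))\<^sup>2) \<F>"
      unfolding g_def
      by (intro tendsto_add tendsto_sum tendsto_mult tendsto_const tendsto_power tendsto_norm a0)
    hence g0: "(g \<longlongrightarrow> 0) \<F>" by simp
    have gb: "(norm (z ((a i)\<^sup>\<dagger> (E \<xi>))))\<^sup>2 \<le> g i" for i
    proof -
      have "(norm (z ((a i)\<^sup>\<dagger> (E \<xi>))))\<^sup>2 \<le> (\<Sum>v\<in>W. (norm (v\<^sup>\<dagger> ((a i)\<^sup>\<dagger> (E \<xi>))))\<^sup>2) + (norm (v0 ((a i)\<^sup>\<dagger> (E \<xi>))))\<^sup>2"
        by (rule W(6))
      also have "\<dots> \<le> g i" unfolding g_def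
      proof (intro add_mono sum_mono one W)
        fix v assume v: "v \<in> W"
        have "F \<odot> v\<^sup>\<dagger> = v\<^sup>\<dagger>" using arg_cong[OF W(4)[OF v], of hadj] by (simp add: prD(4)[OF EF(2)])
        from one[OF M_hadj this, of i] v W(2)
        show "(norm (v\<^sup>\<dagger> ((a i)\<^sup>\<dagger> (E \<xi>))))\<^sup>2 \<le> 2 * (norm (a i (blinfun_apply v \<xi>)))\<^sup>2" by auto
      qed
      finally show ?thesis .
    qed
    have "((\<lambda>i. (norm (z ((a i)\<^sup>\<dagger> (E \<xi>))))\<^sup>2) \<longlongrightarrow> 0) \<F>"
      by (rule tendsto_sandwich[OF _ _ tendsto_const g0]) (auto simp: gb)
    hence "((\<lambda>i. sqrt ((norm (z ((a i)\<^sup>\<dagger> (E \<xi>))))\<^sup>2)) \<longlongrightarrow> sqrt 0) \<F>" by (rule tendsto_real_sqrt)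
    hence "((\<lambda>i. norm (z ((a i)\<^sup>\<dagger> (E \<xi>)))) \<longlongrightarrow> 0) \<F>" by simp
    hence "((\<lambda>i. z ((a i)\<^sup>\<dagger> (E \<xi>))) \<longlongrightarrow> 0) \<F>" by (rule tendsto_norm_zero_cancel)
    moreover have "z ((a i)\<^sup>\<dagger> (E \<xi>)) = (a i)\<^sup>\<dagger> (z (E \<xi>))" for i
      using centralD(2)[OF z(1) M_hadj[OF a(2)]] by (metis blinfun_apply_blinfun_compose)
    ultimately have "z (E \<xi>) \<in> N" by (simp add: N_def)
    hence "p (z (E \<xi>)) = z (E \<xi>)" by (simp add: p_def proj_on_fix[OF N N'])
    \<comment> \<open>\<open>E\<close> lies below \<open>id_blinfun - p\<close>, so the vector just
      placed in the subspace is also orthogonal to it.\<close>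
    moreover have "p \<odot> E = 0" using EF(5) prD(3,5)[OF p]
      by (metis blinfun_compose_algebra(3,11) blinfun_compose_assoc blinfun_compose_algebra(4) diff_self blinfun_compose_algebra(12))
    hence "p \<odot> (z \<odot> E) = 0" using central_left_commute[OF z(1) prD(1)[OF p], of E] by simp
    hence "p (z (E \<xi>)) = 0" by (metis blinfun_apply_blinfun_compose blinfun.zero_left)
    ultimately have "z \<odot> E = 0" using EF(6)[OF z(1)] by simp
    hence "z \<odot> F = 0" using eqv_central[OF EF(3) z(1)] eqv_0(1) by simp
    thus False using z(2) by simp
  qed
  hence "y \<in> N" for y using proj_on_in[OF N N', of y] by (simp add: p_def)
  thus ?thesis by (simp add: stends_def N_def)
qed

lemma stends_hadj:
  assumes a: "stends a T \<F>" "\<And>i. a i \<in> M" "\<And>i. norm (a i) \<le> K" and T: "T \<in> M"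
  shows "stends (\<lambda>i. (a i)\<^sup>\<dagger>) (T\<^sup>\<dagger>) \<F>"
proof -
  have "stends (\<lambda>i. a i - T) 0 \<F>" using stends_diff[OF a(1) stends_const, of T] by simp
  hence "stends (\<lambda>i. (a i - T)\<^sup>\<dagger>) 0 \<F>"
    by (rule stends_hadj_0[where K = "K + norm T"])
      (auto intro!: M_intros a T order_trans[OF norm_triangle_ineq4] add_right_mono)
  from stends_add[OF this stends_const, of "T\<^sup>\<dagger>"] show ?thesis by simp
qed

text \<open>Taking adjoints turns right multiplication by a bounded net into left multiplication,
  which is harmless; strong continuity of the adjoint is used on the way there and back.\<close>

lemma stends_compose_bounded_right:
  assumes a: "stends a 0 \<F>" "\<And>i. a i \<in> M" "\<And>i. norm (a i) \<le> K"
    and b: "\<And>i. b i \<in> M" "\<And>i. norm (b i) \<le> L"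
  shows "stends (\<lambda>i. a i \<odot> b i) 0 \<F>"
proof -
  have nb: "norm (a i \<odot> b i) \<le> K * L" for i
  proof -
    have "norm (a i \<odot> b i) \<le> norm (a i) * norm (b i)" by (rule norm_blinfun_compose)
    also have "\<dots> \<le> K * L" using a(3) b(2) by (intro mult_mono) (auto intro: order_trans[OF norm_ge_zero])
    finally show ?thesis .
  qed
  have "stends (\<lambda>i. (b i)\<^sup>\<dagger> \<odot> (a i)\<^sup>\<dagger>) 0 \<F>"
    unfolding stends_def
  proof
    fix y
    have "((\<lambda>i. (a i)\<^sup>\<dagger> y) \<longlongrightarrow> 0) \<F>" using stends_hadj_0[OF a] by (simp add: stends_def)
    hence lim: "((\<lambda>i. L * norm ((a i)\<^sup>\<dagger> y)) \<longlongrightarrow> 0) \<F>" by (intro tendsto_mult_right_zero tendsto_norm_zero)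
    have bd: "norm (((b i)\<^sup>\<dagger> \<odot> (a i)\<^sup>\<dagger>) y) \<le> L * norm ((a i)\<^sup>\<dagger> y)" for i
    proof -
      have "norm (((b i)\<^sup>\<dagger> \<odot> (a i)\<^sup>\<dagger>) y) \<le> norm (b i) * norm ((a i)\<^sup>\<dagger> y)"
        using norm_blinfun[of "(b i)\<^sup>\<dagger>" "(a i)\<^sup>\<dagger> y"] by simp
      also have "\<dots> \<le> L * norm ((a i)\<^sup>\<dagger> y)" by (intro mult_right_mono b) simp
      finally show ?thesis .
    qed
    have "((\<lambda>i. ((b i)\<^sup>\<dagger> \<odot> (a i)\<^sup>\<dagger>) y) \<longlongrightarrow> 0) \<F>"
      by (rule Lim_null_comparison[OF always_eventually lim]) (rule allI, rule bd)
    thus "((\<lambda>i. ((b i)\<^sup>\<dagger> \<odot> (a i)\<^sup>\<dagger>) y) \<longlongrightarrow> blinfun_apply 0 y) \<F>" by (simp only: blinfun.zero_left)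
  qed
  hence "stends (\<lambda>i. ((b i)\<^sup>\<dagger> \<odot> (a i)\<^sup>\<dagger>)\<^sup>\<dagger>) 0 \<F>"
    by (rule stends_hadj_0[where K = "K * L"]) (auto intro!: M_intros a b simp: nb simp flip: hadj_simps(1))
  thus ?thesis by simp
qed

end

subsection \<open>Unitary conjugation\<close>

definition is_uni :: "('a::{real_inner,banach} \<Rightarrow>\<^sub>L 'a) \<Rightarrow> bool" where
  "is_uni u \<longleftrightarrow> u\<^sup>\<dagger> \<odot> u = id_blinfun \<and> u \<odot> u\<^sup>\<dagger> = id_blinfun"

lemma is_uniD:
  assumes "is_uni u"
  shows "u\<^sup>\<dagger> \<odot> u = id_blinfun" "u \<odot> u\<^sup>\<dagger> = id_blinfun" "u\<^sup>\<dagger> \<odot> (u \<odot> T) = T" "u \<odot> (u\<^sup>\<dagger> \<odot> T) = T"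
proof -
  show u: "u\<^sup>\<dagger> \<odot> u = id_blinfun" "u \<odot> u\<^sup>\<dagger> = id_blinfun" using assms by (auto simp: is_uni_def)
  show "u\<^sup>\<dagger> \<odot> (u \<odot> T) = T" "u \<odot> (u\<^sup>\<dagger> \<odot> T) = T"
    by (simp_all add: u op_simps flip: blinfun_compose_assoc)
qed

lemma is_uni_hadj: "is_uni u \<Longrightarrow> is_uni (u\<^sup>\<dagger>)"
  by (simp add: is_uni_def)

lemma norm_uni_apply:
  fixes u :: "'a::{real_inner,banach} \<Rightarrow>\<^sub>L 'a"
  assumes "is_uni u" shows "norm (u x) = norm x"
proof -
  have "(norm (u x))\<^sup>2 = (norm x)\<^sup>2" by (simp only: norm_apply_sq is_uniD(1)[OF assms]) (simp add: power2_norm_eq_inner)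
  thus ?thesis by simp
qed

lemma norm_uni_le: "is_uni u \<Longrightarrow> norm u \<le> 1"
  by (rule norm_blinfun_bound) (auto simp: norm_uni_apply)

lemma norm_uni_conj_le: assumes "is_uni u" shows "norm (u \<odot> k \<odot> u\<^sup>\<dagger>) \<le> norm k"
proof (rule norm_blinfun_bound)
  fix x
  have "norm (k (u\<^sup>\<dagger> x)) \<le> norm k * norm (u\<^sup>\<dagger> x)" by (rule norm_blinfun)
  thus "norm ((u \<odot> k \<odot> u\<^sup>\<dagger>) x) \<le> norm k * norm x"
    by (simp add: norm_uni_apply assms is_uni_hadj)
qed simp

text \<open>Conjugation by a unitary commutes with each polynomial iterate, hence with the
  limit.\<close>

lemma sqrt_lim_conj:
  assumes u: "is_uni u" and c: "norm c \<le> 1"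
  shows "sqrt_lim (u \<odot> c \<odot> u\<^sup>\<dagger>) = u \<odot> sqrt_lim c \<odot> u\<^sup>\<dagger>"
proof -
  have "sqrt_seq (u \<odot> c \<odot> u\<^sup>\<dagger>) n = u \<odot> sqrt_seq c n \<odot> u\<^sup>\<dagger>" for n
    by (induction n) (simp_all add: op_simps is_uniD[OF u])
  hence seq: "sqrt_seq (u \<odot> c \<odot> u\<^sup>\<dagger>) = (\<lambda>n. u \<odot> sqrt_seq c n \<odot> u\<^sup>\<dagger>)" by (rule ext)
  have 1: "(\<lambda>n. u \<odot> sqrt_seq c n \<odot> u\<^sup>\<dagger>) \<longlonglongrightarrow> sqrt_lim (u \<odot> c \<odot> u\<^sup>\<dagger>)"
    using sqrt_seq_lim[OF order_trans[OF norm_uni_conj_le[OF u] c]] by (simp only: seq)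
  have 2: "(\<lambda>n. u \<odot> sqrt_seq c n \<odot> u\<^sup>\<dagger>) \<longlonglongrightarrow> u \<odot> sqrt_lim c \<odot> u\<^sup>\<dagger>"
    by (intro bounded_bilinear.tendsto[OF bounded_bilinear_blinfun_compose] tendsto_const sqrt_seq_lim c)
  show ?thesis by (rule LIMSEQ_unique[OF 1 2])
qed

lemma modulus_conj:
  assumes u: "is_uni u" and T: "norm T \<le> r" "r > 0"
  shows "modulus r (u \<odot> T \<odot> u\<^sup>\<dagger>) = u \<odot> modulus r T \<odot> u\<^sup>\<dagger>"
proof -
  define c where "c = id_blinfun - (1 / (r * r)) *\<^sub>R (T\<^sup>\<dagger> \<odot> T)"
  have 1: "id_blinfun - (1 / (r * r)) *\<^sub>R ((u \<odot> T \<odot> u\<^sup>\<dagger>)\<^sup>\<dagger> \<odot> (u \<odot> T \<odot> u\<^sup>\<dagger>)) = u \<odot> c \<odot> u\<^sup>\<dagger>"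
    by (simp add: c_def op_simps is_uniD[OF u])
  have "sqrt_lim (u \<odot> c \<odot> u\<^sup>\<dagger>) = u \<odot> sqrt_lim c \<odot> u\<^sup>\<dagger>"
    by (rule sqrt_lim_conj[OF u]) (unfold c_def, rule modulus_arg_norm[OF T])
  thus ?thesis unfolding modulus_def 1 unfolding c_def[symmetric]
    by (simp add: op_simps is_uniD[OF u])
qed

lemma pos_part_conj:
  assumes u: "is_uni u" and T: "norm T \<le> r" "r > 0"
  shows "pos_part r (u \<odot> T \<odot> u\<^sup>\<dagger>) = u \<odot> pos_part r T \<odot> u\<^sup>\<dagger>"
  unfolding pos_part_def modulus_conj[OF assms] by (simp add: op_simps)

lemma pos_part_stends:
  assumes a: "stends a b \<F>" "\<And>i. (a i)\<^sup>\<dagger> = a i" "\<And>i. norm (a i) \<le> r" "r > 0" and b: "b\<^sup>\<dagger> = b" "norm b \<le> r"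
  shows "stends (\<lambda>i. pos_part r (a i)) (pos_part r b) \<F>"
  unfolding pos_part_def
proof (intro stends_scaleR stends_add modulus_stends a b)
  show "stends (\<lambda>i. (a i)\<^sup>\<dagger> \<odot> a i) (b\<^sup>\<dagger> \<odot> b) \<F>"
    unfolding a(2) b(1) by (rule stends_compose[OF a(1) a(1) a(3)])
qed

lemma range_proj_compose_selfadj:
  assumes "A\<^sup>\<dagger> = A" shows "A \<odot> range_proj A = A"
  using compose_range_proj_hadj[of A] assms by simp

context finite_vna
begin

subsection \<open>Comparison of supports in a finite algebra\<close>

text \<open>Otherwise \<open>z \<odot> p\<close> contains, beside a copy of
  \<open>z \<odot> e\<close>, a nonzero \<open>f\<close>. For each \<open>i\<close> the conjugate of
  \<open>e\<close> is too small to reach all of \<open>z \<odot> p\<close>, which leaves there a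
  copy of \<open>f\<close> that the conjugate of \<open>k\<close> kills. In the limit
  \<open>k'\<close> annihilates these copies asymptotically although they lie below its support;
  hence they tend to 0 strongly, and so does the constant \<open>f\<close>.\<close>

lemma support_sube:
  assumes u: "\<And>i. u i \<in> M" "\<And>i. is_uni (u i)" and k: "k \<in> M" "k\<^sup>\<dagger> = k" and k': "k' \<in> M" "k'\<^sup>\<dagger> = k'"
    and lim: "stends (\<lambda>i. u i \<odot> k \<odot> (u i)\<^sup>\<dagger>) k' \<F>" and F: "\<F> \<noteq> bot"
  shows "range_proj k' \<preceq> range_proj k"
proof -
  define p where "p = range_proj k'"
  define e where "e = range_proj k"
  have p: "pr p" and e: "pr e" using k k' by (auto simp: p_def e_def pr_range_proj)
  obtain z where z: "central z" "z \<odot> e \<preceq> z \<odot> p" "(id_blinfun - z) \<odot> p \<preceq> (id_blinfun - z) \<odot> e"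
    by (rule comparison[OF e p])
  have zp: "pr (z \<odot> p)" and ze: "pr (z \<odot> e)" using z p e by (auto intro: pr_central)
  obtain e' where e': "pr e'" "z \<odot> p \<odot> e' = e'" "z \<odot> e \<asymp> e'" by (rule subeE[OF z(2) ze])
  define f where "f = z \<odot> p - e'"
  have f: "pr f" unfolding f_def by (rule pr_diff[OF e'(1) zp e'(2)])
  have "f = 0"
  proof -
    have ex: "\<exists>v. v \<in> M \<and> v\<^sup>\<dagger> \<odot> v = f \<and> z \<odot> p \<odot> v = v \<and> u i \<odot> e \<odot> (u i)\<^sup>\<dagger> \<odot> v = 0" for i
    proof -
      define ei where "ei = u i \<odot> e \<odot> (u i)\<^sup>\<dagger>"
      have ei: "pr ei"
        unfolding pr_def ei_def is_proj_def
        by (auto intro!: M_intros u prD(1)[OF e] simp: op_simps is_uniD[OF u(2)] prD[OF e])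
      \<comment> \<open>The range projection of \<open>X\<close> is the part of
        \<open>z \<odot> p\<close> that \<open>ei\<close> reaches; being subequivalent to
        \<open>e'\<close>, it leaves room for a copy of \<open>f\<close>.\<close>
      define X where "X = z \<odot> p \<odot> ei"
      have X: "X \<in> M" unfolding X_def by (intro M_intros prD(1) ei zp)
      have Xh: "X\<^sup>\<dagger> = ei \<odot> (z \<odot> p)" by (simp only: X_def hadj_simps(1)[of "z \<odot> p" ei] prD(4)[OF ei] prD(4)[OF zp])
      let ?R = "range_proj X" and ?L = "range_proj (X\<^sup>\<dagger>)"
      have R: "pr ?R" and L: "pr ?L" using X by (auto intro!: pr_range_proj M_intros)
      have Rle: "z \<odot> p \<odot> ?R = ?R" by (rule range_proj_le) (simp add: X_def prD(5)[OF zp] blinfun_compose_assoc[of "z \<odot> p"])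
      have zei: "pr (z \<odot> ei)" by (rule pr_central[OF z(1) ei])
      have Lle: "z \<odot> ei \<odot> ?L = ?L"
      proof (rule range_proj_le)
        have "z \<odot> ei \<odot> (ei \<odot> (z \<odot> p)) = z \<odot> (ei \<odot> (z \<odot> p))" by (simp add: blinfun_compose_assoc prD[OF ei])
        also have "\<dots> = ei \<odot> (z \<odot> (z \<odot> p))" using central_left_commute[OF z(1) prD(1)[OF ei], of "z \<odot> p"] by simp
        also have "\<dots> = ei \<odot> (z \<odot> p)" using prD(5)[OF centralD(1)[OF z(1)], of p] by simp
        finally show "z \<odot> ei \<odot> X\<^sup>\<dagger> = X\<^sup>\<dagger>" unfolding Xh .
      qed
      have "e \<asymp> ei"
        by (rule eqvI[of "u i \<odot> e"])
          (auto intro!: M_intros u prD(1)[OF e] simp: ei_def op_simps is_uniD[OF u(2)] prD[OF e])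
      hence "z \<odot> e \<asymp> z \<odot> ei" by (rule eqv_central[OF _ z(1)])
      have "?R \<preceq> ?L" by (rule eqv_imp_sube[OF eqv_sym[OF range_proj_eqv[OF X]] prD(2)[OF R]])
      also have "?L \<preceq> z \<odot> ei" by (rule le_imp_sube[OF L Lle])
      also (sube_trans) have "z \<odot> ei \<preceq> z \<odot> e"
        by (rule eqv_imp_sube[OF eqv_sym[OF \<open>z \<odot> e \<asymp> z \<odot> ei\<close>] prD(2)[OF zei]])
      also (sube_trans) have "z \<odot> e \<preceq> e'" by (rule eqv_imp_sube[OF e'(3) prD(2)[OF ze]])
      finally (sube_trans) obtain R' where R': "pr R'" "e' \<odot> R' = R'" "?R \<asymp> R'" by (rule subeE[OF _ R])
      have R'le: "z \<odot> p \<odot> R' = R'" using e'(2) R'(2) by (metis blinfun_compose_assoc)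
      have "z \<odot> p - ?R \<asymp> z \<odot> p - R'"
        by (rule eqv_diff[OF zp zp R R'(1) Rle R'le eqv_refl[OF zp] R'(3)])
      moreover have "f \<preceq> z \<odot> p - R'"
      proof (rule le_imp_sube[OF f])
        have "R' \<odot> (z \<odot> p) = R'" "R' \<odot> e' = R'" using pr_le_sym R' R'le zp e' by blast+
        thus "(z \<odot> p - R') \<odot> f = f"
          by (simp add: f_def blinfun_compose_algebra prD(3)[OF zp] e'(2))
      qed
      ultimately have "f \<preceq> z \<odot> p - ?R"
        using sube_trans eqv_imp_sube eqv_sym prD(2)[OF pr_diff[OF R'(1) zp R'le]] by blast
      then obtain v where v: "v \<in> M" "v\<^sup>\<dagger> \<odot> v = f" "(z \<odot> p - ?R) \<odot> v = v" by (auto simp: sube_def)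
      have 1: "z \<odot> p \<odot> v = v"
      proof -
        have a: "z \<odot> p \<odot> (z \<odot> p - ?R) = z \<odot> p - ?R"
          by (simp add: blinfun_compose_algebra prD(3)[OF zp] Rle)
        have "z \<odot> p \<odot> v = z \<odot> p \<odot> ((z \<odot> p - ?R) \<odot> v)" by (simp only: v(3))
        also have "\<dots> = z \<odot> p \<odot> (z \<odot> p - ?R) \<odot> v" by (rule blinfun_compose_assoc[symmetric])
        finally show ?thesis by (simp only: a v(3))
      qed
      have "X\<^sup>\<dagger> \<odot> ?R = X\<^sup>\<dagger>" using compose_range_proj_hadj[of "X\<^sup>\<dagger>"] by simp
      hence "ei \<odot> (z \<odot> p) \<odot> (z \<odot> p - ?R) = 0"
        by (simp add: Xh blinfun_compose_algebra blinfun_compose_assoc[of _ "z \<odot> p"] prD(3)[OF zp])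
      hence "ei \<odot> (z \<odot> p) \<odot> ((z \<odot> p - ?R) \<odot> v) = 0"
        by (metis blinfun_compose_assoc blinfun_compose_algebra(10))
      hence "ei \<odot> v = 0" using 1 by (simp only: v(3)) (metis blinfun_compose_assoc)
      thus ?thesis using v 1 unfolding ei_def by blast
    qed
    then obtain v where v: "\<And>i. v i \<in> M" "\<And>i. (v i)\<^sup>\<dagger> \<odot> v i = f" "\<And>i. z \<odot> p \<odot> v i = v i"
      "\<And>i. u i \<odot> e \<odot> (u i)\<^sup>\<dagger> \<odot> v i = 0" by metis
    define F where "F = (\<lambda>i. v i \<odot> (v i)\<^sup>\<dagger>)"
    have vp: "is_pisom (v i)" for i using pisom_init(1)[OF v(2) prD(2)[OF f]] .
    have Fp: "pr (F i)" for i using pr_pisom[OF v(1) vp] by (simp add: F_def)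
    let ?k = "\<lambda>i. u i \<odot> k \<odot> (u i)\<^sup>\<dagger>"
    have kF: "?k i \<odot> F i = 0" for i
    proof -
      have "?k i = ?k i \<odot> (u i \<odot> e \<odot> (u i)\<^sup>\<dagger>)"
        using range_proj_compose_selfadj[OF k(2)]
        by (simp add: e_def blinfun_compose_assoc is_uniD[OF u(2)]) (metis blinfun_compose_assoc)
      hence "?k i \<odot> F i = ?k i \<odot> (u i \<odot> e \<odot> (u i)\<^sup>\<dagger> \<odot> v i) \<odot> (v i)\<^sup>\<dagger>"
        unfolding F_def by (metis blinfun_compose_assoc)
      thus ?thesis by (simp add: v(4))
    qed
    \<comment> \<open>Strong continuity of the adjoint enters through the bounded right factor
      \<open>F i\<close>, and again below to turn \<open>k' \<odot> F i\<close> into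
      \<open>F i \<odot> k'\<close>.\<close>
    have "stends (\<lambda>i. (k' - ?k i) \<odot> F i) 0 \<F>"
    proof (rule stends_compose_bounded_right)
      show "stends (\<lambda>i. k' - ?k i) 0 \<F>" using stends_diff[OF stends_const lim, of k'] by simp
      show "k' - ?k i \<in> M" for i by (intro M_intros k' u k)
      show "norm (k' - ?k i) \<le> norm k' + norm k" for i
        using norm_triangle_ineq4[of k' "?k i"] norm_uni_conj_le[OF u(2), of i k] by linarith
      show "F i \<in> M" for i by (rule prD(1)[OF Fp])
      show "norm (F i) \<le> 1" for i by (rule norm_is_proj[OF prD(2)[OF Fp]])
    qed
    hence kF0: "stends (\<lambda>i. k' \<odot> F i) 0 \<F>" by (simp add: blinfun_compose_algebra kF)
    have "stends (\<lambda>i. (k' \<odot> F i)\<^sup>\<dagger>) 0 \<F>"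
    proof (rule stends_hadj_0[OF kF0])
      show "k' \<odot> F i \<in> M" for i by (intro M_intros k' prD(1)[OF Fp])
      show "norm (k' \<odot> F i) \<le> norm k' * 1" for i
        using norm_blinfun_compose[of k' "F i"] norm_is_proj[OF prD(2)[OF Fp], of i]
        by (meson mult_left_mono norm_ge_zero order_trans)
    qed
    hence Fk: "stends (\<lambda>i. F i \<odot> k') 0 \<F>" by (simp add: k' prD(4)[OF Fp])
    \<comment> \<open>\<open>F i\<close> lives below \<open>p\<close>, in whose range the vectors
      \<open>k' y\<close> are dense.\<close>
    have Fx: "((\<lambda>i. F i x) \<longlongrightarrow> 0) \<F>" for x
      unfolding tendsto_iff
    proof (intro allI impI)
      fix d :: real assume d: "d > 0"
      have "p x \<in> closure (range k')" unfolding p_def range_proj_def by (rule proj_on_in[OF closed_subspace_closure_range])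
      then obtain y where y: "dist (k' y) (p x) < d / 2"
        using d unfolding closure_approachable by (metis half_gt_zero rangeE)
      have "eventually (\<lambda>i. dist ((F i \<odot> k') y) 0 < d / 2) \<F>"
        using Fk d unfolding stends_def by (intro tendstoD) auto
      thus "eventually (\<lambda>i. dist (F i x) 0 < d) \<F>"
      proof eventually_elim
        case (elim i)
        have "p \<odot> F i = F i"
        proof -
          have "p \<odot> (z \<odot> p \<odot> v i) = z \<odot> p \<odot> v i"
            by (simp add: blinfun_compose_assoc central_left_commute[OF z(1) prD(1)[OF p]] prD[OF p])
          hence "p \<odot> v i = v i" by (simp only: v(3))
          thus ?thesis unfolding F_def by (metis blinfun_compose_assoc)
        qed
        hence "F i \<odot> p = F i" using pr_le_sym[OF Fp p] by blast
        hence "F i x = F i (p x - k' y) + F i (k' y)" by (metis blinfun_apply_blinfun_compose blinfun.add_right diff_add_cancel)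
        also have "norm \<dots> \<le> norm (p x - k' y) + norm (F i (k' y))"
          by (meson norm_triangle_ineq norm_proj_le[OF prD(2)[OF Fp]] add_right_mono order_trans)
        also have "\<dots> < d" using y elim by (simp add: dist_norm norm_minus_commute)
        finally show ?case by simp
      qed
    qed
    have va: "stends (\<lambda>i. (v i)\<^sup>\<dagger>) 0 \<F>"
      unfolding stends_def
    proof
      fix x
      have "((\<lambda>i. norm (F i x)) \<longlongrightarrow> 0) \<F>" by (rule tendsto_norm_zero[OF Fx])
      hence "((\<lambda>i. norm ((v i)\<^sup>\<dagger> x)) \<longlongrightarrow> 0) \<F>" unfolding F_def norm_pisom_hadj(1)[OF vp] .
      thus "((\<lambda>i. (v i)\<^sup>\<dagger> x) \<longlongrightarrow> blinfun_apply 0 x) \<F>" by (simp add: tendsto_norm_zero_iff)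
    qed
    have nv: "norm (v i) \<le> 1" for i
    proof (rule norm_blinfun_bound)
      show "norm (v i x) \<le> 1 * norm x" for x
        using norm_pisom_hadj(2)[OF vp, of i x] norm_proj_le[OF prD(2)[OF f], of x] v(2)[of i] by simp
    qed simp
    \<comment> \<open>With \<open>(v i)\<^sup>\<dagger>\<close> also its adjoint \<open>v i\<close>
      tends to 0, while their product is constantly \<open>f\<close>.\<close>
    have "stends (\<lambda>i. ((v i)\<^sup>\<dagger>)\<^sup>\<dagger>) 0 \<F>"
      by (rule stends_hadj_0[OF va, where K=1]) (simp_all add: M_hadj v nv)
    hence "stends v 0 \<F>" by simp
    from stends_compose[OF va this, of 1] nv have "stends (\<lambda>i. f) 0 \<F>" by (simp add: v(2))
    from stends_unique[OF stends_const this F] show "f = 0" .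
  qed
  hence "z \<odot> p = e'" by (simp add: f_def)
  hence "z \<odot> p \<preceq> z \<odot> e" using e'(3) ze eqv_sym eqv_imp_sube prD(2)[OF e'(1)] by blast
  hence "z \<odot> p + (id_blinfun - z) \<odot> p \<preceq> z \<odot> e + (id_blinfun - z) \<odot> e"
  proof (rule sube_add[OF _ z(3)])
    have *: "z \<odot> S \<odot> ((id_blinfun - z) \<odot> T) = 0" if "S \<in> M" for S T :: "'a \<Rightarrow>\<^sub>L 'a"
      by (simp add: op_simps central_left_commute[OF z(1) that] prD(5)[OF centralD(1)[OF z(1)]])
    show "z \<odot> p \<odot> ((id_blinfun - z) \<odot> p) = 0" "z \<odot> e \<odot> ((id_blinfun - z) \<odot> e) = 0"
      by (intro * prD(1) p e)+
  qed (intro pr_central central_compl z p e)+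
  thus ?thesis by (simp add: p_def e_def op_simps)
qed

text \<open>The opposite domination comes from conjugating back: as \<open>u i\<close> is isometric,
  convergence of \<open>u i \<odot> k - k' \<odot> u i\<close> to 0 means that the conjugates of
  \<open>k'\<close> by \<open>(u i)\<^sup>\<dagger>\<close> tend to \<open>k\<close>.\<close>

lemma support_eqv:
  assumes u: "\<And>i. u i \<in> M" "\<And>i. is_uni (u i)" and k: "k \<in> M" "k\<^sup>\<dagger> = k" and k': "k' \<in> M" "k'\<^sup>\<dagger> = k'"
    and lim: "stends (\<lambda>i. u i \<odot> k \<odot> (u i)\<^sup>\<dagger>) k' \<F>" and F: "\<F> \<noteq> bot"
  shows "range_proj k \<asymp> range_proj k'"
proof (rule sube_antisym)
  show "pr (range_proj k)" "pr (range_proj k')" using k k' by (auto intro: pr_range_proj)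
  show "range_proj k' \<preceq> range_proj k" by (rule support_sube[OF u k k' lim F])
  let ?w = "\<lambda>i. (u i)\<^sup>\<dagger>"
  have "stends (\<lambda>i. (u i \<odot> k \<odot> (u i)\<^sup>\<dagger> - k') \<odot> u i) 0 \<F>"
  proof (rule stends_compose_bounded_right)
    show "stends (\<lambda>i. u i \<odot> k \<odot> (u i)\<^sup>\<dagger> - k') 0 \<F>" using stends_diff[OF lim stends_const, of k'] by simp
    show "u i \<odot> k \<odot> (u i)\<^sup>\<dagger> - k' \<in> M" for i by (intro M_intros k' u k)
    show "norm (u i \<odot> k \<odot> (u i)\<^sup>\<dagger> - k') \<le> norm k + norm k'" for i
      using norm_triangle_ineq4[of "u i \<odot> k \<odot> (u i)\<^sup>\<dagger>" k'] norm_uni_conj_le[OF u(2), of i k] by linarith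
  qed (auto intro: u norm_uni_le)
  hence 1: "stends (\<lambda>i. u i \<odot> k - k' \<odot> u i) 0 \<F>" by (simp add: op_simps is_uniD[OF u(2)])
  have "stends (\<lambda>i. k - (u i)\<^sup>\<dagger> \<odot> k' \<odot> u i) 0 \<F>"
    unfolding stends_def
  proof
    fix x
    have "((\<lambda>i. norm ((u i \<odot> k - k' \<odot> u i) x)) \<longlongrightarrow> 0) \<F>"
      using 1 unfolding stends_def by (intro tendsto_norm_zero) simp
    moreover have "norm ((k - (u i)\<^sup>\<dagger> \<odot> k' \<odot> u i) x) = norm ((u i \<odot> k - k' \<odot> u i) x)" for i
    proof -
      have "u i \<odot> (k - (u i)\<^sup>\<dagger> \<odot> k' \<odot> u i) = u i \<odot> k - k' \<odot> u i" by (simp add: op_simps is_uniD[OF u(2)])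
      thus ?thesis using norm_uni_apply[OF u(2)] by (metis blinfun_apply_blinfun_compose)
    qed
    ultimately have "((\<lambda>i. norm ((k - (u i)\<^sup>\<dagger> \<odot> k' \<odot> u i) x)) \<longlongrightarrow> 0) \<F>" by simp
    thus "((\<lambda>i. (k - (u i)\<^sup>\<dagger> \<odot> k' \<odot> u i) x) \<longlongrightarrow> blinfun_apply 0 x) \<F>"
      unfolding tendsto_norm_zero_iff by (simp only: blinfun.zero_left)
  qed
  from stends_diff[OF stends_const[of k] this]
  have "stends (\<lambda>i. ?w i \<odot> k' \<odot> (?w i)\<^sup>\<dagger>) k \<F>" by simp
  from support_sube[OF M_hadj[OF u(1)] is_uni_hadj[OF u(2)] k' k this F]
  show "range_proj k \<preceq> range_proj k'" .
qed

end

section \<open>Supports of products and of sums of squares\<close>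

lemma range_proj_prod:
  assumes A: "A\<^sup>\<dagger> = A" and B: "B\<^sup>\<dagger> = B" and AB: "A \<odot> B = B \<odot> A"
  shows "range_proj (A \<odot> B) = range_proj A \<odot> range_proj B"
    and "range_proj A \<odot> range_proj B = range_proj B \<odot> range_proj A"
proof -
  let ?p = "range_proj A" and ?q = "range_proj B"
  have pB: "B \<odot> ?p = ?p \<odot> B" by (rule range_proj_commute[where T=B and T'=B]) (simp_all add: AB B)
  have qA: "A \<odot> ?q = ?q \<odot> A" by (rule range_proj_commute[where T=A and T'=A]) (simp_all add: AB A)
  show pq: "?p \<odot> ?q = ?q \<odot> ?p"
    by (rule range_proj_commute[where T="?p" and T'="?p"]) (simp_all add: pB is_projD(2)[OF is_proj_range_proj])
  show "range_proj (A \<odot> B) = ?p \<odot> ?q"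
  proof (rule range_proj_unique)
    show "is_proj (?p \<odot> ?q)" by (rule is_proj_prod[OF is_proj_range_proj is_proj_range_proj pq])
    have "?p \<odot> ?q \<odot> (A \<odot> B) = ?p \<odot> (?q \<odot> A) \<odot> B" by (simp only: blinfun_compose_assoc)
    also have "\<dots> = ?p \<odot> A \<odot> (?q \<odot> B)" unfolding qA[symmetric] by (simp only: blinfun_compose_assoc)
    finally show "?p \<odot> ?q \<odot> (A \<odot> B) = A \<odot> B" by simp
    fix S :: "'a \<Rightarrow>\<^sub>L 'a" assume "S \<odot> (A \<odot> B) = 0"
    hence "S \<odot> A \<odot> ?q = 0" by (subst annihilate_range_proj_iff) (simp only: blinfun_compose_assoc)
    hence "S \<odot> ?q \<odot> A = 0" by (simp only: blinfun_compose_assoc qA)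
    hence "S \<odot> ?q \<odot> ?p = 0" by (subst annihilate_range_proj_iff)
    thus "S \<odot> (?p \<odot> ?q) = 0" by (simp only: blinfun_compose_assoc pq)
  qed
qed

text \<open>The support of a sum of squares is the join of the supports, here in closed form because
  they commute. Unlike the join, the sum of squares passes to strong limits of bounded nets.\<close>

lemma range_proj_sum_sq:
  assumes X: "X\<^sup>\<dagger> = X" and Y: "Y\<^sup>\<dagger> = Y"
    and c: "range_proj X \<odot> range_proj Y = range_proj Y \<odot> range_proj X"
  shows "range_proj (X \<odot> X + Y \<odot> Y) = range_proj X + range_proj Y - range_proj X \<odot> range_proj Y"
proof (rule range_proj_unique)
  let ?p = "range_proj X" and ?q = "range_proj Y"
  have p: "?p \<odot> ?p = ?p" "?p\<^sup>\<dagger> = ?p" "?p \<odot> (?p \<odot> T) = ?p \<odot> T"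
    and q: "?q \<odot> ?q = ?q" "?q\<^sup>\<dagger> = ?q" "?q \<odot> (?q \<odot> T) = ?q \<odot> T" for T
    using is_projD[OF is_proj_range_proj[of X]] is_projD[OF is_proj_range_proj[of Y]]
      is_proj_assoc[OF is_proj_range_proj[of X]] is_proj_assoc[OF is_proj_range_proj[of Y]] by auto
  have c': "?q \<odot> (?p \<odot> T) = ?p \<odot> (?q \<odot> T)" for T by (metis c blinfun_compose_assoc)
  have pX: "?p \<odot> (X \<odot> T) = X \<odot> T" "?q \<odot> (Y \<odot> T) = Y \<odot> T" for T by (simp_all flip: blinfun_compose_assoc)
  show "is_proj (?p + ?q - ?p \<odot> ?q)"
    unfolding is_proj_def by (simp add: op_simps p q c' flip: c)
  have qX: "?p \<odot> (?q \<odot> (X \<odot> T)) = ?q \<odot> (X \<odot> T)" for T by (simp add: pX flip: c')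
  show "(?p + ?q - ?p \<odot> ?q) \<odot> (X \<odot> X + Y \<odot> Y) = X \<odot> X + Y \<odot> Y"
    by (simp add: op_simps pX qX)
  fix S :: "'a \<Rightarrow>\<^sub>L 'a" assume S: "S \<odot> (X \<odot> X + Y \<odot> Y) = 0"
  have "S \<odot> X = 0 \<and> S \<odot> Y = 0"
  proof -
    have 0: "S \<odot> (X \<odot> X + Y \<odot> Y) \<odot> S\<^sup>\<dagger> = 0" by (simp add: S)
    have "(norm (X (S\<^sup>\<dagger> y)))\<^sup>2 + (norm (Y (S\<^sup>\<dagger> y)))\<^sup>2 = 0" for y
    proof -
      have n: "(norm (Z (S\<^sup>\<dagger> y)))\<^sup>2 = (S \<odot> (Z \<odot> Z) \<odot> S\<^sup>\<dagger>) y \<bullet> y" if "Z\<^sup>\<dagger> = Z" for Z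
        using that by (simp add: power2_norm_eq_inner inner_hadj)
      have "(S \<odot> (X \<odot> X) \<odot> S\<^sup>\<dagger>) y \<bullet> y + (S \<odot> (Y \<odot> Y) \<odot> S\<^sup>\<dagger>) y \<bullet> y
          = (S \<odot> (X \<odot> X + Y \<odot> Y) \<odot> S\<^sup>\<dagger>) y \<bullet> y"
        by (simp add: blinfun.bilinear_simps inner_add_left)
      thus ?thesis unfolding 0 n[OF X] n[OF Y] by simp
    qed
    hence "X (S\<^sup>\<dagger> y) = 0" "Y (S\<^sup>\<dagger> y) = 0" for y by (simp_all add: add_nonneg_eq_0_iff)
    hence "X \<odot> S\<^sup>\<dagger> = 0" "Y \<odot> S\<^sup>\<dagger> = 0" by (auto intro: blinfun_eqI)
    from arg_cong[OF this(1), of hadj] arg_cong[OF this(2), of hadj] show ?thesis by (simp add: X Y)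
  qed
  hence Sp: "S \<odot> ?p = 0" "S \<odot> ?q = 0" by (simp_all add: annihilate_range_proj_iff)
  hence "S \<odot> (?p \<odot> ?q) = 0" by (simp flip: blinfun_compose_assoc)
  thus "S \<odot> (?p + ?q - ?p \<odot> ?q) = 0" by (simp add: op_simps Sp)
qed

section \<open>Partitions of unity and approximate unitary equivalence\<close>

definition partition_of_unity :: "'i set \<Rightarrow> ('i \<Rightarrow> 'a::{real_inner,banach} \<Rightarrow>\<^sub>L 'a) \<Rightarrow> bool" where
  "partition_of_unity I D \<longleftrightarrow> finite I \<and> (\<forall>i\<in>I. is_proj (D i)) \<and>
     (\<forall>i\<in>I. \<forall>j\<in>I. i \<noteq> j \<longrightarrow> D i \<odot> D j = 0) \<and> (\<Sum>i\<in>I. D i) = id_blinfun"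

lemma partition_of_unity_prod:
  assumes D: "partition_of_unity I D" and E: "partition_of_unity J E"
    and comm: "\<And>i j. i \<in> I \<Longrightarrow> j \<in> J \<Longrightarrow> D i \<odot> E j = E j \<odot> D i"
  shows "partition_of_unity (I \<times> J) (\<lambda>(i, j). D i \<odot> E j)"
  unfolding partition_of_unity_def
proof (intro conjI ballI impI)
  show "finite (I \<times> J)" using D E by (auto simp: partition_of_unity_def)
  have "(\<Sum>(i, j)\<in>I \<times> J. D i \<odot> E j) = (\<Sum>i\<in>I. \<Sum>j\<in>J. D i \<odot> E j)" by (simp add: sum.cartesian_product)
  also have "\<dots> = (\<Sum>i\<in>I. D i) \<odot> (\<Sum>j\<in>J. E j)"
    by (subst bounded_bilinear.sum_left[OF bounded_bilinear_blinfun_compose])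
      (simp only: bounded_bilinear.sum_right[OF bounded_bilinear_blinfun_compose])
  finally show "(\<Sum>x\<in>I \<times> J. case x of (i, j) \<Rightarrow> D i \<odot> E j) = id_blinfun"
    using D E by (simp add: partition_of_unity_def op_simps)
  fix x assume "x \<in> I \<times> J"
  then obtain i j where x: "x = (i, j)" "i \<in> I" "j \<in> J" by blast
  thus "is_proj (case x of (i, j) \<Rightarrow> D i \<odot> E j)"
    using D E comm by (auto simp: partition_of_unity_def intro: is_proj_prod)
  fix y assume "y \<in> I \<times> J" and ne: "x \<noteq> y"
  then obtain k l where y: "y = (k, l)" "k \<in> I" "l \<in> J" by blast
  have "D i \<odot> E j \<odot> (D k \<odot> E l) = D i \<odot> (E j \<odot> D k) \<odot> E l" by (simp only: blinfun_compose_assoc)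
  also have "\<dots> = (D i \<odot> D k) \<odot> (E j \<odot> E l)"
    unfolding comm[OF y(2) x(3), symmetric] by (simp only: blinfun_compose_assoc)
  also have "\<dots> = 0" using D E x y ne by (cases "i = k") (auto simp: partition_of_unity_def)
  finally show "(case x of (i, j) \<Rightarrow> D i \<odot> E j) \<odot> (case y of (i, j) \<Rightarrow> D i \<odot> E j) = 0"
    by (simp add: x y)
qed

lemma partition_spec_cell:
  assumes "r \<ge> 0" "\<delta> > 0" "a\<^sup>\<dagger> = a" "norm a \<le> r"
  shows "partition_of_unity {..<spec_num r \<delta>} (spec_cell r \<delta> a)"
  unfolding partition_of_unity_def
  using is_proj_spec_cell[OF assms] spec_cell_orth[OF assms] sum_spec_cell[OF assms] by auto

text \<open>\<open>T\<close> carries the orthogonal pieces \<open>D i\<close> into the orthogonal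
  pieces \<open>E i\<close>, so by Pythagoras a common bound on the pieces bounds
  \<open>T\<close>.\<close>

lemma norm_le_on_partition:
  fixes T :: "'a::{real_inner,banach} \<Rightarrow>\<^sub>L 'a"
  assumes D: "partition_of_unity I D" and E: "partition_of_unity I E"
    and T: "\<And>i. i \<in> I \<Longrightarrow> T \<odot> D i = E i \<odot> T" and K: "K \<ge> 0"
    and b: "\<And>i y. i \<in> I \<Longrightarrow> norm (T (D i y)) \<le> K * norm (D i y)"
  shows "norm T \<le> K"
proof (rule norm_blinfun_bound[OF K])
  fix y
  have fin: "finite I" using D by (simp add: partition_of_unity_def)
  have orth: "blinfun_apply (P i) x \<bullet> P j x = 0"
    if "partition_of_unity I P" "i \<in> I" "j \<in> I" "i \<noteq> j" for P i j and x :: 'a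
  proof -
    have "P j \<odot> P i = 0" "(P j)\<^sup>\<dagger> = P j" using that by (auto simp: partition_of_unity_def is_projD)
    hence "P i x \<bullet> P j x = P j (P i x) \<bullet> x" by (metis inner_hadj)
    thus ?thesis using \<open>P j \<odot> P i = 0\<close> by (metis blinfun_apply_blinfun_compose blinfun.zero_left inner_zero_left)
  qed
  have y: "y = (\<Sum>i\<in>I. D i y)"
    using D unfolding partition_of_unity_def by (metis blinfun.sum_left blinfun_apply_id_blinfun)
  have TD: "T (D i y) = E i (T y)" if "i \<in> I" for i using T[OF that] by (metis blinfun_apply_blinfun_compose)
  have "T y = (\<Sum>i\<in>I. T (D i y))" by (subst y) (simp only: blinfun.sum_right)
  hence "(norm (T y))\<^sup>2 = (\<Sum>i\<in>I. (norm (T (D i y)))\<^sup>2)"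
    using norm_sum_orth[OF fin, of "\<lambda>i. T (D i y)"] orth[OF E] TD by simp
  also have "\<dots> \<le> (\<Sum>i\<in>I. K\<^sup>2 * (norm (D i y))\<^sup>2)"
    by (intro sum_mono) (metis b norm_ge_zero power_mono power_mult_distrib)
  also have "\<dots> = K\<^sup>2 * (norm (\<Sum>i\<in>I. D i y))\<^sup>2"
    using norm_sum_orth[OF fin, of "\<lambda>i. D i y"] orth[OF D] by (simp add: sum_distrib_left)
  also have "\<dots> = (K * norm y)\<^sup>2" by (simp add: power_mult_distrib flip: y)
  finally show "norm (T y) \<le> K * norm y" by (rule power2_le_imp_le) (use K in simp)
qed

lemma (in vna) ex_unitary_partition:
  assumes D: "partition_of_unity I D" and E: "partition_of_unity I E"
    and eq: "\<And>i. i \<in> I \<Longrightarrow> D i \<asymp> E i"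
  obtains w where "w \<in> M" "is_uni w" "\<And>i. i \<in> I \<Longrightarrow> w \<odot> D i = E i \<odot> w"
proof -
  have fin: "finite I" using D by (simp add: partition_of_unity_def)
  have "\<forall>i\<in>I. \<exists>v. v \<in> M \<and> v\<^sup>\<dagger> \<odot> v = D i \<and> v \<odot> v\<^sup>\<dagger> = E i" using eq by (auto simp: eqv_def)
  then obtain v where v: "\<And>i. i \<in> I \<Longrightarrow> v i \<in> M" "\<And>i. i \<in> I \<Longrightarrow> (v i)\<^sup>\<dagger> \<odot> v i = D i"
    "\<And>i. i \<in> I \<Longrightarrow> v i \<odot> (v i)\<^sup>\<dagger> = E i" by metis
  have prj: "is_proj (D i)" "is_proj (E i)" if "i \<in> I" for i
    using D E that by (auto simp: partition_of_unity_def)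
  have orth: "D i \<odot> D j = 0" "E i \<odot> E j = 0" if "i \<in> I" "j \<in> I" "i \<noteq> j" for i j
    using D E that by (auto simp: partition_of_unity_def)
  have vD: "v i \<odot> D i = v i" and Ev: "E i \<odot> v i = v i" and Dv: "D i \<odot> (v i)\<^sup>\<dagger> = (v i)\<^sup>\<dagger>" if "i \<in> I" for i
    using pisom_init(2)[OF v(2) prj(1)] pisom_final[OF v(2,3) prj(1)] that by auto
  define w where "w = (\<Sum>i\<in>I. v i)"
  have wD: "w \<odot> D j = v j" if j: "j \<in> I" for j
  proof -
    have "w \<odot> D j = (\<Sum>i\<in>I. v i \<odot> D j)"
      unfolding w_def by (rule bounded_bilinear.sum_left[OF bounded_bilinear_blinfun_compose])
    also have "\<dots> = (\<Sum>i\<in>I. if i = j then v j else 0)"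
    proof (rule sum.cong[OF refl])
      fix i assume i: "i \<in> I"
      show "v i \<odot> D j = (if i = j then v j else 0)"
      proof (cases "i = j")
        case False
        have "v i \<odot> D j = v i \<odot> (D i \<odot> D j)" using vD[OF i] by (simp flip: blinfun_compose_assoc)
        thus ?thesis using False orth[OF i j False] by simp
      qed (simp add: vD[OF j])
    qed
    finally show ?thesis using fin j by simp
  qed
  have Ew: "E j \<odot> w = v j" if j: "j \<in> I" for j
  proof -
    have "E j \<odot> w = (\<Sum>i\<in>I. E j \<odot> v i)"
      unfolding w_def by (rule bounded_bilinear.sum_right[OF bounded_bilinear_blinfun_compose])
    also have "\<dots> = (\<Sum>i\<in>I. if i = j then v j else 0)"
    proof (rule sum.cong[OF refl])
      fix i assume i: "i \<in> I"
      show "E j \<odot> v i = (if i = j then v j else 0)"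
      proof (cases "i = j")
        case False
        have "E j \<odot> v i = E j \<odot> E i \<odot> v i" using Ev[OF i] by (simp add: blinfun_compose_assoc)
        thus ?thesis using False orth[OF j i] by simp
      qed (simp add: Ev[OF j])
    qed
    finally show ?thesis using fin j by simp
  qed
  have wM: "w \<in> M" unfolding w_def using fin v(1)
    by (induction I) (auto intro: M_intros)
  have wE: "w\<^sup>\<dagger> \<odot> E j = (v j)\<^sup>\<dagger>" if "j \<in> I" for j
    using arg_cong[OF Ew[OF that], of hadj] is_projD(2)[OF prj(2)[OF that]] by simp
  have "w\<^sup>\<dagger> \<odot> w = (\<Sum>i\<in>I. w\<^sup>\<dagger> \<odot> v i)"
    unfolding w_def by (rule bounded_bilinear.sum_right[OF bounded_bilinear_blinfun_compose])
  also have "\<dots> = (\<Sum>i\<in>I. D i)"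
  proof (rule sum.cong[OF refl])
    fix i assume i: "i \<in> I"
    have "w\<^sup>\<dagger> \<odot> v i = w\<^sup>\<dagger> \<odot> E i \<odot> v i" using Ev[OF i] by (simp add: blinfun_compose_assoc)
    thus "w\<^sup>\<dagger> \<odot> v i = D i" by (simp add: wE[OF i] v(2)[OF i])
  qed
  finally have 1: "w\<^sup>\<dagger> \<odot> w = id_blinfun" using D by (simp add: partition_of_unity_def)
  have "w\<^sup>\<dagger> = (\<Sum>i\<in>I. (v i)\<^sup>\<dagger>)" unfolding w_def by (rule linear_sum[OF bounded_linear.linear[OF bounded_linear_hadj]])
  hence "w \<odot> w\<^sup>\<dagger> = (\<Sum>i\<in>I. w \<odot> (v i)\<^sup>\<dagger>)"
    by (simp only: bounded_bilinear.sum_right[OF bounded_bilinear_blinfun_compose])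
  also have "\<dots> = (\<Sum>i\<in>I. E i)"
  proof (rule sum.cong[OF refl])
    fix i assume i: "i \<in> I"
    have "w \<odot> (v i)\<^sup>\<dagger> = w \<odot> D i \<odot> (v i)\<^sup>\<dagger>" using Dv[OF i] by (simp add: blinfun_compose_assoc)
    thus "w \<odot> (v i)\<^sup>\<dagger> = E i" by (simp add: wD[OF i] v(3)[OF i])
  qed
  finally have 2: "w \<odot> w\<^sup>\<dagger> = id_blinfun" using E by (simp add: partition_of_unity_def)
  show ?thesis by (rule that[of w]) (simp_all add: wM is_uni_def 1 2 wD Ew)
qed

text \<open>An operator with support \<open>spec_proj\<close> which, unlike that projection, depends
  strongly continuously on \<open>a\<close> over bounded sets of self-adjoint operators.\<close>

definition spec_pos :: "real \<Rightarrow> real \<Rightarrow> ('a::{real_inner,banach} \<Rightarrow>\<^sub>L 'a) \<Rightarrow> nat \<Rightarrow> 'a \<Rightarrow>\<^sub>L 'a" where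
  "spec_pos r \<delta> a k =
     (if k \<le> spec_num r \<delta> then pos_part (spec_rad r \<delta>) (a - spec_pt r \<delta> k *\<^sub>R id_blinfun) else 0)"

lemma range_proj_spec_pos: "range_proj (spec_pos r \<delta> a k) = spec_proj r \<delta> a k"
  by (simp add: spec_pos_def spec_proj_def pos_proj_def)

context
  fixes r \<delta> :: real and a :: "'a::{real_inner,banach} \<Rightarrow>\<^sub>L 'a"
  assumes r: "r \<ge> 0" and \<delta>: "\<delta> > 0" and sa: "a\<^sup>\<dagger> = a" and na: "norm a \<le> r"
begin

lemma spec_pos_hadj: "(spec_pos r \<delta> a k)\<^sup>\<dagger> = spec_pos r \<delta> a k"
  unfolding spec_pos_def
  using pos_part_hadj[OF spec_shift[OF r \<delta> sa na] spec_rad_pos[OF r \<delta>]] by simp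

lemma spec_pos_commute: "S \<odot> a = a \<odot> S \<Longrightarrow> S \<odot> spec_pos r \<delta> a k = spec_pos r \<delta> a k \<odot> S"
proof (cases "k \<le> spec_num r \<delta>")
  case True
  assume S: "S \<odot> a = a \<odot> S"
  show ?thesis
    unfolding spec_pos_def if_P[OF True]
    by (rule pos_part_commute[OF spec_shift(1)[OF r \<delta> sa na] spec_shift(2)[OF r \<delta> sa na True] spec_rad_pos[OF r \<delta>]])
      (simp add: op_simps S)
qed (simp add: spec_pos_def)

lemma spec_pos_stends:
  assumes u: "\<And>i. is_uni (u i)" and lim: "stends (\<lambda>i. u i \<odot> a \<odot> (u i)\<^sup>\<dagger>) b \<F>"
    and b: "b\<^sup>\<dagger> = b" "norm b \<le> r"
  shows "stends (\<lambda>i. u i \<odot> spec_pos r \<delta> a k \<odot> (u i)\<^sup>\<dagger>) (spec_pos r \<delta> b k) \<F>"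
proof (cases "k \<le> spec_num r \<delta>")
  case True
  let ?R = "spec_rad r \<delta>" and ?t = "spec_pt r \<delta> k"
  note sh = spec_shift(1)[OF r \<delta> sa na] spec_shift(2)[OF r \<delta> sa na True] spec_rad_pos[OF r \<delta>]
  note shb = spec_shift(1)[OF r \<delta> b] spec_shift(2)[OF r \<delta> b True]
  have "stends (\<lambda>i. pos_part ?R (u i \<odot> (a - ?t *\<^sub>R id_blinfun) \<odot> (u i)\<^sup>\<dagger>)) (pos_part ?R (b - ?t *\<^sub>R id_blinfun)) \<F>"
  proof (rule pos_part_stends[OF _ _ _ sh(3) shb])
    show "stends (\<lambda>i. u i \<odot> (a - ?t *\<^sub>R id_blinfun) \<odot> (u i)\<^sup>\<dagger>) (b - ?t *\<^sub>R id_blinfun) \<F>"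
      using stends_diff[OF lim stends_const, of "?t *\<^sub>R id_blinfun"] by (simp add: op_simps is_uniD[OF u])
    show "(u i \<odot> (a - ?t *\<^sub>R id_blinfun) \<odot> (u i)\<^sup>\<dagger>)\<^sup>\<dagger> = u i \<odot> (a - ?t *\<^sub>R id_blinfun) \<odot> (u i)\<^sup>\<dagger>" for i
      by (simp add: sa op_simps)
    show "norm (u i \<odot> (a - ?t *\<^sub>R id_blinfun) \<odot> (u i)\<^sup>\<dagger>) \<le> ?R" for i
      using norm_uni_conj_le[OF u] sh(2) order_trans by blast
  qed
  thus ?thesis using True by (simp add: spec_pos_def pos_part_conj[OF u sh(2,3)])
qed (simp add: spec_pos_def stends_const)

end

context finite_vna
begin

lemma finite_unitary_approx:
  assumes u: "\<And>i. u i \<in> M" "\<And>i. is_uni (u i)"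
    and a: "a \<in> M" "a\<^sup>\<dagger> = a" and b: "b \<in> M" "b\<^sup>\<dagger> = b" and ab: "a \<odot> b = b \<odot> a"
    and a': "a' \<in> M" "a'\<^sup>\<dagger> = a'" and b': "b' \<in> M" "b'\<^sup>\<dagger> = b'"
    and la: "stends (\<lambda>i. u i \<odot> a \<odot> (u i)\<^sup>\<dagger>) a' \<F>" and lb: "stends (\<lambda>i. u i \<odot> b \<odot> (u i)\<^sup>\<dagger>) b' \<F>"
    and F: "\<F> \<noteq> bot" and \<epsilon>: "\<epsilon> > 0"
  obtains w where "w \<in> M" "is_uni w" "norm (w \<odot> a - a' \<odot> w) \<le> \<epsilon>" "norm (w \<odot> b - b' \<odot> w) \<le> \<epsilon>"
proof -
  define r where "r = norm a + norm b"
  \<comment> \<open>Half of the error is spent on the cells of \<open>a\<close> and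
    \<open>b\<close>, half on those of \<open>a'\<close> and \<open>b'\<close>.\<close>
  define \<delta> where "\<delta> = \<epsilon> / 2"
  define n where "n = spec_num r \<delta>"
  have r: "r \<ge> 0" and \<delta>: "\<delta> > 0" using \<epsilon> by (auto simp: r_def \<delta>_def)
  have na: "norm a \<le> r" and nb: "norm b \<le> r" by (auto simp: r_def)
  have bd: "norm (u i \<odot> a \<odot> (u i)\<^sup>\<dagger>) \<le> norm a" "norm (u i \<odot> b \<odot> (u i)\<^sup>\<dagger>) \<le> norm b" for i
    using norm_uni_conj_le[OF u(2)] by auto
  have na': "norm a' \<le> r" using stends_norm_le[OF la F bd(1)] na by linarith
  have nb': "norm b' \<le> r" using stends_norm_le[OF lb F bd(2)] nb by linarith
  \<comment> \<open>Commutation survives the limit because products of bounded strongly convergent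
    nets converge.\<close>
  have ab': "a' \<odot> b' = b' \<odot> a'"
  proof (rule stends_unique[OF stends_compose[OF la lb bd(1)] _ F])
    have "u i \<odot> a \<odot> (u i)\<^sup>\<dagger> \<odot> (u i \<odot> b \<odot> (u i)\<^sup>\<dagger>) = u i \<odot> b \<odot> (u i)\<^sup>\<dagger> \<odot> (u i \<odot> a \<odot> (u i)\<^sup>\<dagger>)" for i
    proof -
      have "u i \<odot> a \<odot> (u i)\<^sup>\<dagger> \<odot> (u i \<odot> b \<odot> (u i)\<^sup>\<dagger>) = u i \<odot> (a \<odot> b) \<odot> (u i)\<^sup>\<dagger>"
        by (simp add: blinfun_compose_assoc is_uniD[OF u(2)])
      also have "\<dots> = u i \<odot> b \<odot> (u i)\<^sup>\<dagger> \<odot> (u i \<odot> a \<odot> (u i)\<^sup>\<dagger>)"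
        unfolding ab by (simp add: blinfun_compose_assoc is_uniD[OF u(2)])
      finally show ?thesis .
    qed
    thus "stends (\<lambda>i. u i \<odot> a \<odot> (u i)\<^sup>\<dagger> \<odot> (u i \<odot> b \<odot> (u i)\<^sup>\<dagger>)) (b' \<odot> a') \<F>"
      using stends_compose[OF lb la bd(2)] by simp
  qed
  define A where "A = spec_pos r \<delta> a"
  define B where "B = spec_pos r \<delta> b"
  define A' where "A' = spec_pos r \<delta> a'"
  define B' where "B' = spec_pos r \<delta> b'"
  have inM: "spec_pos r \<delta> x k \<in> M" if "x \<in> M" "x\<^sup>\<dagger> = x" "norm x \<le> r" for x k
    by (rule M_bicomm) (rule spec_pos_commute[OF r \<delta> that(2,3)], rule commD[OF _ that(1)])
  have AM: "A j \<in> M" "B j \<in> M" "A' j \<in> M" "B' j \<in> M" for j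
    unfolding A_def B_def A'_def B'_def by (intro inM a b a' b' na nb na' nb')+
  have Ah: "(A j)\<^sup>\<dagger> = A j" "(B j)\<^sup>\<dagger> = B j" "(A' j)\<^sup>\<dagger> = A' j" "(B' j)\<^sup>\<dagger> = B' j" for j
    unfolding A_def B_def A'_def B'_def
    by (intro spec_pos_hadj[OF r \<delta>] a b a' b' na nb na' nb')+
  have AB: "A j \<odot> B k = B k \<odot> A j" for j k unfolding A_def B_def
    by (rule spec_pos_commute[OF r \<delta> b(2) nb], rule sym, rule spec_pos_commute[OF r \<delta> a(2) na]) (rule ab[symmetric])
  have AB': "A' j \<odot> B' k = B' k \<odot> A' j" for j k unfolding A'_def B'_def
    by (rule spec_pos_commute[OF r \<delta> b'(2) nb'], rule sym, rule spec_pos_commute[OF r \<delta> a'(2) na']) (rule ab'[symmetric])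
  have lA: "stends (\<lambda>i. u i \<odot> A j \<odot> (u i)\<^sup>\<dagger>) (A' j) \<F>" for j
    unfolding A_def A'_def by (rule spec_pos_stends[OF r \<delta> a(2) na u(2) la a'(2) na'])
  have lB: "stends (\<lambda>i. u i \<odot> B j \<odot> (u i)\<^sup>\<dagger>) (B' j) \<F>" for j
    unfolding B_def B'_def by (rule spec_pos_stends[OF r \<delta> b(2) nb u(2) lb b'(2) nb'])
  have lprod: "stends (\<lambda>i. u i \<odot> (S \<odot> T) \<odot> (u i)\<^sup>\<dagger>) (S' \<odot> T') \<F>"
    if S: "stends (\<lambda>i. u i \<odot> S \<odot> (u i)\<^sup>\<dagger>) S' \<F>" and T: "stends (\<lambda>i. u i \<odot> T \<odot> (u i)\<^sup>\<dagger>) T' \<F>" for S T S' T'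
  proof -
    have "u i \<odot> S \<odot> (u i)\<^sup>\<dagger> \<odot> (u i \<odot> T \<odot> (u i)\<^sup>\<dagger>) = u i \<odot> (S \<odot> T) \<odot> (u i)\<^sup>\<dagger>" for i
      by (simp add: blinfun_compose_assoc is_uniD[OF u(2)])
    thus ?thesis using stends_compose[OF S T norm_uni_conj_le[OF u(2)]] by simp
  qed
  \<comment> \<open>The support of \<open>X j k\<close> is the quadrant in which \<open>a\<close>
    exceeds grid point \<open>j\<close> and \<open>b\<close> exceeds grid point
    \<open>k\<close>.\<close>
  define X where "X = (\<lambda>j k. A j \<odot> B k)"
  define X' where "X' = (\<lambda>j k. A' j \<odot> B' k)"
  have XM: "X j k \<in> M" "X' j k \<in> M" and Xh: "(X j k)\<^sup>\<dagger> = X j k" "(X' j k)\<^sup>\<dagger> = X' j k" for j k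
    unfolding X_def X'_def by (auto intro!: M_intros AM simp: Ah AB AB')
  have lX: "stends (\<lambda>i. u i \<odot> X j k \<odot> (u i)\<^sup>\<dagger>) (X' j k) \<F>" for j k
    unfolding X_def X'_def by (rule lprod[OF lA lB])
  have up: "range_proj (X j k) \<asymp> range_proj (X' j k)" for j k
    by (rule support_eqv[OF u XM(1) Xh(1) XM(2) Xh(2) lX F])
  \<comment> \<open>The support of \<open>Y j k\<close> is the union of the two quadrants obtained
    by raising one index; removing it from that of \<open>X j k\<close> leaves the cell
    \<open>(j, k)\<close>.\<close>
  define Y where "Y = (\<lambda>j k. X (Suc j) k \<odot> X (Suc j) k + X j (Suc k) \<odot> X j (Suc k))"
  define Y' where "Y' = (\<lambda>j k. X' (Suc j) k \<odot> X' (Suc j) k + X' j (Suc k) \<odot> X' j (Suc k))"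
  have lo: "range_proj (Y j k) \<asymp> range_proj (Y' j k)" for j k
  proof (rule support_eqv[OF u])
    show "Y j k \<in> M" "Y' j k \<in> M" by (auto simp: Y_def Y'_def intro!: M_intros XM)
    show "(Y j k)\<^sup>\<dagger> = Y j k" "(Y' j k)\<^sup>\<dagger> = Y' j k" by (auto simp: Y_def Y'_def Xh)
    show "stends (\<lambda>i. u i \<odot> Y j k \<odot> (u i)\<^sup>\<dagger>) (Y' j k) \<F>"
      using stends_add[OF lprod[OF lX[of "Suc j" k] lX[of "Suc j" k]] lprod[OF lX[of j "Suc k"] lX[of j "Suc k"]]]
      by (simp add: Y_def Y'_def blinfun_compose_algebra)
  qed (rule F)
  \<comment> \<open>Inclusion and exclusion for two commuting decreasing families of projections,
    stated once for both pairs of operators.\<close>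
  have cell: "range_proj (x j \<odot> y k) - range_proj ((x (Suc j) \<odot> y k) \<odot> (x (Suc j) \<odot> y k) + (x j \<odot> y (Suc k)) \<odot> (x j \<odot> y (Suc k)))
      = (range_proj (x j) - range_proj (x (Suc j))) \<odot> (range_proj (y k) - range_proj (y (Suc k)))"
    and cell_le: "range_proj (x j \<odot> y k) \<odot> range_proj ((x (Suc j) \<odot> y k) \<odot> (x (Suc j) \<odot> y k) + (x j \<odot> y (Suc k)) \<odot> (x j \<odot> y (Suc k)))
      = range_proj ((x (Suc j) \<odot> y k) \<odot> (x (Suc j) \<odot> y k) + (x j \<odot> y (Suc k)) \<odot> (x j \<odot> y (Suc k)))"
    if h: "\<And>j. (x j)\<^sup>\<dagger> = x j" "\<And>j. (y j)\<^sup>\<dagger> = y j" and c: "\<And>j k. x j \<odot> y k = y k \<odot> x j"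
      and dec: "\<And>j. range_proj (x j) \<odot> range_proj (x (Suc j)) = range_proj (x (Suc j))"
        "\<And>j. range_proj (y j) \<odot> range_proj (y (Suc j)) = range_proj (y (Suc j))"
    for x y :: "nat \<Rightarrow> 'a \<Rightarrow>\<^sub>L 'a" and j k
  proof -
    define p where "p = (\<lambda>j. range_proj (x j))"
    define q where "q = (\<lambda>j. range_proj (y j))"
    have pq: "range_proj (x j \<odot> y k) = p j \<odot> q k" "p j \<odot> q k = q k \<odot> p j" for j k
      unfolding p_def q_def by (rule range_proj_prod[OF h c])+
    have P: "p j \<odot> p j = p j" "p j \<odot> (p j \<odot> T) = p j \<odot> T" "q j \<odot> q j = q j" "q j \<odot> (q j \<odot> T) = q j \<odot> T"
      "p j \<odot> p (Suc j) = p (Suc j)" "q j \<odot> q (Suc j) = q (Suc j)"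
      "p (Suc j) \<odot> p j = p (Suc j)" "q (Suc j) \<odot> q j = q (Suc j)" for j T
      using dec[of j] proj_le_sym[OF is_proj_range_proj is_proj_range_proj]
      by (auto simp: p_def q_def is_projD is_proj_assoc)
    have P2: "p j \<odot> (p (Suc j) \<odot> T) = p (Suc j) \<odot> T" "q j \<odot> (q (Suc j) \<odot> T) = q (Suc j) \<odot> T"
      "p (Suc j) \<odot> (p j \<odot> T) = p (Suc j) \<odot> T" "q (Suc j) \<odot> (q j \<odot> T) = q (Suc j) \<odot> T"
      "q k \<odot> (p j \<odot> T) = p j \<odot> (q k \<odot> T)" for j k T
      by (simp_all only: P(5-8) pq(2) flip: blinfun_compose_assoc)
    have qp: "q k \<odot> p j = p j \<odot> q k" for j k using pq(2) by simp
    have xy: "(x j \<odot> y k)\<^sup>\<dagger> = x j \<odot> y k" for j k by (simp add: h c)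
    have low: "range_proj ((x (Suc j) \<odot> y k) \<odot> (x (Suc j) \<odot> y k) + (x j \<odot> y (Suc k)) \<odot> (x j \<odot> y (Suc k)))
      = p (Suc j) \<odot> q k + p j \<odot> q (Suc k) - p (Suc j) \<odot> q (Suc k)"
      by (subst range_proj_sum_sq[OF xy xy]) (simp_all add: pq(1) blinfun_compose_assoc P P2 qp)
    show "range_proj (x j \<odot> y k) - range_proj ((x (Suc j) \<odot> y k) \<odot> (x (Suc j) \<odot> y k) + (x j \<odot> y (Suc k)) \<odot> (x j \<odot> y (Suc k)))
      = (range_proj (x j) - range_proj (x (Suc j))) \<odot> (range_proj (y k) - range_proj (y (Suc k)))"
      unfolding low pq(1) by (simp add: blinfun_compose_algebra p_def q_def)
    show "range_proj (x j \<odot> y k) \<odot> range_proj ((x (Suc j) \<odot> y k) \<odot> (x (Suc j) \<odot> y k) + (x j \<odot> y (Suc k)) \<odot> (x j \<odot> y (Suc k)))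
      = range_proj ((x (Suc j) \<odot> y k) \<odot> (x (Suc j) \<odot> y k) + (x j \<odot> y (Suc k)) \<odot> (x j \<odot> y (Suc k)))"
      unfolding low pq(1) by (simp add: op_simps P P2 qp)
  qed
  have dec: "range_proj (A j) \<odot> range_proj (A (Suc j)) = range_proj (A (Suc j))"
    "range_proj (B j) \<odot> range_proj (B (Suc j)) = range_proj (B (Suc j))"
    "range_proj (A' j) \<odot> range_proj (A' (Suc j)) = range_proj (A' (Suc j))"
    "range_proj (B' j) \<odot> range_proj (B' (Suc j)) = range_proj (B' (Suc j))" for j
    unfolding A_def B_def A'_def B'_def range_proj_spec_pos
    by (rule spec_proj_antimono[OF r \<delta> a(2) na] spec_proj_antimono[OF r \<delta> b(2) nb]
        spec_proj_antimono[OF r \<delta> a'(2) na'] spec_proj_antimono[OF r \<delta> b'(2) nb'])+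
  define D where "D = (\<lambda>(j, k). spec_cell r \<delta> a j \<odot> spec_cell r \<delta> b k)"
  define D' where "D' = (\<lambda>(j, k). spec_cell r \<delta> a' j \<odot> spec_cell r \<delta> b' k)"
  let ?I = "{..<n} \<times> {..<n}"
  have eq: "D i \<asymp> D' i" for i
  proof -
    obtain j k where i: "i = (j, k)" by (cases i)
    have "range_proj (X j k) - range_proj (Y j k) \<asymp> range_proj (X' j k) - range_proj (Y' j k)"
    proof (rule eqv_diff)
      show "pr (range_proj (X j k))" "pr (range_proj (X' j k))" "pr (range_proj (Y j k))" "pr (range_proj (Y' j k))"
        by (auto intro!: pr_range_proj XM M_intros simp: Y_def Y'_def)
      show "range_proj (X j k) \<odot> range_proj (Y j k) = range_proj (Y j k)"
        unfolding X_def Y_def by (rule cell_le[of A B, OF Ah(1,2) AB dec(1,2)])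
      show "range_proj (X' j k) \<odot> range_proj (Y' j k) = range_proj (Y' j k)"
        unfolding X'_def Y'_def by (rule cell_le[of A' B', OF Ah(3,4) AB' dec(3,4)])
    qed (rule up lo)+
    moreover have "range_proj (X j k) - range_proj (Y j k) = D (j, k)"
      unfolding X_def Y_def cell[of A B, OF Ah(1,2) AB dec(1,2)]
      by (simp add: D_def spec_cell_def A_def B_def range_proj_spec_pos)
    moreover have "range_proj (X' j k) - range_proj (Y' j k) = D' (j, k)"
      unfolding X'_def Y'_def cell[of A' B', OF Ah(3,4) AB' dec(3,4)]
      by (simp add: D'_def spec_cell_def A'_def B'_def range_proj_spec_pos)
    ultimately show ?thesis by (simp add: i)
  qed
  have cc: "spec_cell r \<delta> a j \<odot> spec_cell r \<delta> b k = spec_cell r \<delta> b k \<odot> spec_cell r \<delta> a j" for j k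
    by (rule spec_cell_commute[OF r \<delta> b(2) nb], rule sym, rule spec_cell_commute[OF r \<delta> a(2) na]) (rule ab[symmetric])
  have cc': "spec_cell r \<delta> a' j \<odot> spec_cell r \<delta> b' k = spec_cell r \<delta> b' k \<odot> spec_cell r \<delta> a' j" for j k
    by (rule spec_cell_commute[OF r \<delta> b'(2) nb'], rule sym, rule spec_cell_commute[OF r \<delta> a'(2) na']) (rule ab'[symmetric])
  have PD: "partition_of_unity ?I D" unfolding D_def n_def
    by (rule partition_of_unity_prod[OF partition_spec_cell[OF r \<delta> a(2) na] partition_spec_cell[OF r \<delta> b(2) nb] cc])
  have PD': "partition_of_unity ?I D'" unfolding D'_def n_def
    by (rule partition_of_unity_prod[OF partition_spec_cell[OF r \<delta> a'(2) na'] partition_spec_cell[OF r \<delta> b'(2) nb'] cc'])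
  obtain w where w: "w \<in> M" "is_uni w" "\<And>i. i \<in> ?I \<Longrightarrow> w \<odot> D i = D' i \<odot> w"
    by (rule ex_unitary_partition[OF PD PD' eq]) blast
  have comm: "x \<odot> spec_cell r \<delta> x j = spec_cell r \<delta> x j \<odot> x" if "x\<^sup>\<dagger> = x" "norm x \<le> r" for x j
    by (rule spec_cell_commute[OF r \<delta> that refl])
  \<comment> \<open>\<open>w\<close> carries cell to cell, and on corresponding cells
    \<open>x\<close> and \<open>x'\<close> are within \<open>\<delta>\<close> of the same scalar
    \<open>t i\<close>.\<close>
  have bound: "norm (w \<odot> x - x' \<odot> w) \<le> \<epsilon>"
    if xD: "\<And>i. x \<odot> D i = D i \<odot> x" "\<And>i. x' \<odot> D' i = D' i \<odot> x'"
      and ap: "\<And>i y. norm (x (D i y) - t i *\<^sub>R D i y) \<le> \<delta> * norm (D i y)"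
        "\<And>i y. norm (x' (D' i y) - t i *\<^sub>R D' i y) \<le> \<delta> * norm (D' i y)" for x x' t
  proof (rule norm_le_on_partition[OF PD PD'])
    fix i assume i: "i \<in> ?I"
    have "w \<odot> (x \<odot> D i) = D' i \<odot> (w \<odot> x)" using w(3)[OF i] by (simp only: xD) (metis blinfun_compose_assoc)
    moreover have "x' \<odot> (w \<odot> D i) = D' i \<odot> (x' \<odot> w)" using w(3)[OF i] xD(2) by (metis blinfun_compose_assoc)
    ultimately show "(w \<odot> x - x' \<odot> w) \<odot> D i = D' i \<odot> (w \<odot> x - x' \<odot> w)" by (simp add: op_simps)
    fix y
    have wD: "w (D i y) = D' i (w y)" using w(3)[OF i] by (metis blinfun_apply_blinfun_compose)
    have "(w \<odot> x - x' \<odot> w) (D i y) = w (x (D i y) - t i *\<^sub>R D i y) - (x' (D' i (w y)) - t i *\<^sub>R D' i (w y))"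
      by (simp add: blinfun.bilinear_simps wD)
    also have "norm \<dots> \<le> norm (w (x (D i y) - t i *\<^sub>R D i y)) + norm (x' (D' i (w y)) - t i *\<^sub>R D' i (w y))"
      by (rule norm_triangle_ineq4)
    also have "\<dots> \<le> \<delta> * norm (D i y) + \<delta> * norm (D' i (w y))"
      using ap(1)[of i y] ap(2)[of i "w y"] by (intro add_mono) (simp_all add: norm_uni_apply[OF w(2)])
    also have "norm (D' i (w y)) = norm (D i y)" unfolding wD[symmetric] by (rule norm_uni_apply[OF w(2)])
    finally show "norm ((w \<odot> x - x' \<odot> w) (D i y)) \<le> \<epsilon> * norm (D i y)" by (simp add: \<delta>_def)
  qed (use \<epsilon> in simp)
  have fix_cell: "spec_cell r \<delta> x j (spec_cell r \<delta> x j y) = spec_cell r \<delta> x j y" if "x\<^sup>\<dagger> = x" "norm x \<le> r" for x j y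
    by (rule is_projD(3)[OF is_proj_spec_cell[OF r \<delta> that]])
  have Dal: "D (j, k) y = spec_cell r \<delta> a j (spec_cell r \<delta> b k y)" "D (j, k) y = spec_cell r \<delta> b k (spec_cell r \<delta> a j y)"
    "D' (j, k) y = spec_cell r \<delta> a' j (spec_cell r \<delta> b' k y)" "D' (j, k) y = spec_cell r \<delta> b' k (spec_cell r \<delta> a' j y)" for j k y
    unfolding D_def D'_def using cc cc' by (simp_all, (metis blinfun_apply_blinfun_compose)+)
  show ?thesis
  proof (rule that[OF w(1,2)])
    show "norm (w \<odot> a - a' \<odot> w) \<le> \<epsilon>"
    proof (rule bound[of a a' "\<lambda>(j, k). spec_pt r \<delta> j"])
      fix i :: "nat \<times> nat" and y
      obtain j k where i: "i = (j, k)" by (cases i)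
      have "a \<odot> spec_cell r \<delta> b k = spec_cell r \<delta> b k \<odot> a" by (rule spec_cell_commute[OF r \<delta> b(2) nb ab])
      thus "a \<odot> D i = D i \<odot> a" unfolding i D_def using comm[OF a(2) na, of j]
        by simp (metis blinfun_compose_assoc)
      have "a' \<odot> spec_cell r \<delta> b' k = spec_cell r \<delta> b' k \<odot> a'" by (rule spec_cell_commute[OF r \<delta> b'(2) nb' ab'])
      thus "a' \<odot> D' i = D' i \<odot> a'" unfolding i D'_def using comm[OF a'(2) na', of j]
        by simp (metis blinfun_compose_assoc)
      show "norm (a (D i y) - (case i of (j, k) \<Rightarrow> spec_pt r \<delta> j) *\<^sub>R D i y) \<le> \<delta> * norm (D i y)"
        unfolding i prod.case Dal(1) by (rule spec_cell_approx[OF r \<delta> a(2) na fix_cell[OF a(2) na]])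
      show "norm (a' (D' i y) - (case i of (j, k) \<Rightarrow> spec_pt r \<delta> j) *\<^sub>R D' i y) \<le> \<delta> * norm (D' i y)"
        unfolding i prod.case Dal(3) by (rule spec_cell_approx[OF r \<delta> a'(2) na' fix_cell[OF a'(2) na']])
    qed
    show "norm (w \<odot> b - b' \<odot> w) \<le> \<epsilon>"
    proof (rule bound[of b b' "\<lambda>(j, k). spec_pt r \<delta> k"])
      fix i :: "nat \<times> nat" and y
      obtain j k where i: "i = (j, k)" by (cases i)
      have "b \<odot> spec_cell r \<delta> a j = spec_cell r \<delta> a j \<odot> b" by (rule spec_cell_commute[OF r \<delta> a(2) na ab[symmetric]])
      thus "b \<odot> D i = D i \<odot> b" unfolding i D_def using comm[OF b(2) nb, of k]
        by simp (metis blinfun_compose_assoc)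
      have "b' \<odot> spec_cell r \<delta> a' j = spec_cell r \<delta> a' j \<odot> b'" by (rule spec_cell_commute[OF r \<delta> a'(2) na' ab'[symmetric]])
      thus "b' \<odot> D' i = D' i \<odot> b'" unfolding i D'_def using comm[OF b'(2) nb', of k]
        by simp (metis blinfun_compose_assoc)
      show "norm (b (D i y) - (case i of (j, k) \<Rightarrow> spec_pt r \<delta> k) *\<^sub>R D i y) \<le> \<delta> * norm (D i y)"
        unfolding i prod.case Dal(2) by (rule spec_cell_approx[OF r \<delta> b(2) nb fix_cell[OF b(2) nb]])
      show "norm (b' (D' i y) - (case i of (j, k) \<Rightarrow> spec_pt r \<delta> k) *\<^sub>R D' i y) \<le> \<delta> * norm (D' i y)"
        unfolding i prod.case Dal(4) by (rule spec_cell_approx[OF r \<delta> b'(2) nb' fix_cell[OF b'(2) nb']])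
    qed
  qed
qed

end

section \<open>Infinite index sets, shifts and the numerical radius\<close>

lemma ex_inj_option_bool:
  assumes "infinite W"
  obtains g :: "'a option \<Rightarrow> bool \<Rightarrow> 'a" where "\<And>x b. x \<in> insert None (Some ` W) \<Longrightarrow> g x b \<in> W"
    "\<And>x b y c. x \<in> insert None (Some ` W) \<Longrightarrow> y \<in> insert None (Some ` W) \<Longrightarrow> g x b = g y c \<Longrightarrow> x = y \<and> b = c"
proof -
  include cardinal_syntax
  have "infinite (Some ` W)" using assms by (simp add: finite_image_iff)
  then obtain k where k: "inj_on k (insert None (Some ` W))" "k ` insert None (Some ` W) \<subseteq> Some ` W"
    using infinite_insert_lepoll[of "Some ` W" None] unfolding lepoll_def by blast
  have kW: "the (k x) \<in> W" "k x = Some (the (k x))" if "x \<in> insert None (Some ` W)" for x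
    using k(2) that by fastforce+
  \<comment> \<open>The square of \<open>W\<close> leaves a second coordinate free to record the
    \<open>bool\<close>.\<close>
  have "|W \<times> W| =o |W|" by (rule card_of_Times_same_infinite[OF assms])
  then obtain h where h: "bij_betw h (W \<times> W) W" unfolding card_of_ordIso[symmetric] by blast
  obtain w0 w1 where w: "w0 \<in> W" "w1 \<in> W" "w0 \<noteq> w1"
    using assms by (metis finite.simps infinite_imp_nonempty insertCI is_singletonI' is_singleton_def)
  define g where "g = (\<lambda>x b. h (the (k x), if b then w1 else w0))"
  show ?thesis
  proof (rule that[of g])
    fix x b assume "x \<in> insert None (Some ` W)"
    thus "g x b \<in> W" using kW w h unfolding g_def bij_betw_def by auto
  next
    fix x b y c assume xy: "x \<in> insert None (Some ` W)" "y \<in> insert None (Some ` W)" "g x b = g y c"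
    have "(the (k x), if b then w1 else w0) = (the (k y), if c then w1 else w0)"
      using xy(3) kW[OF xy(1)] kW[OF xy(2)] w h unfolding g_def bij_betw_def
      by (intro inj_onD[of h "W \<times> W"]) auto
    moreover from this have "k x = k y" using kW[OF xy(1)] kW[OF xy(2)] by (metis prod.inject)
    ultimately show "x = y \<and> b = c" using k(1) xy(1,2) w(3) by (auto simp: inj_on_def split: if_splits)
  qed
qed

primrec shift_seq :: "('a::real_normed_vector \<Rightarrow>\<^sub>L 'a) \<Rightarrow> ('a \<Rightarrow>\<^sub>L 'a) \<Rightarrow> nat \<Rightarrow> 'a \<Rightarrow>\<^sub>L 'a" where
  "shift_seq v x 0 = x"
| "shift_seq v x (Suc n) = v \<odot> shift_seq v x n"

text \<open>As \<open>x\<close> is orthogonal to the range of \<open>v\<close>, the powers of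
  \<open>v\<close> move it to mutually orthogonal places (a wandering subspace).\<close>

lemma shift_seq:
  assumes v: "v\<^sup>\<dagger> \<odot> v = w" "w \<odot> v = v" "w \<odot> x = x" "v\<^sup>\<dagger> \<odot> x = 0"
  shows "w \<odot> shift_seq v x n = shift_seq v x n"
    and "(shift_seq v x n)\<^sup>\<dagger> \<odot> shift_seq v x n = x\<^sup>\<dagger> \<odot> x"
    and "m \<noteq> n \<Longrightarrow> (shift_seq v x m)\<^sup>\<dagger> \<odot> shift_seq v x n = 0"
proof -
  let ?f = "shift_seq v x"
  show w: "w \<odot> ?f n = ?f n" for n by (cases n) (simp_all add: v flip: blinfun_compose_assoc)
  have vv: "v\<^sup>\<dagger> \<odot> (v \<odot> ?f n) = ?f n" for n by (simp add: v w flip: blinfun_compose_assoc)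
  show "(?f n)\<^sup>\<dagger> \<odot> ?f n = x\<^sup>\<dagger> \<odot> x" for n by (induction n) (simp_all add: blinfun_compose_assoc vv)
  have lt: "(?f m)\<^sup>\<dagger> \<odot> ?f n = 0" if "m < n" for m n
    using that
  proof (induction m arbitrary: n)
    case 0
    then obtain k where k: "n = Suc k" using gr0_implies_Suc by blast
    have "x\<^sup>\<dagger> \<odot> v = 0" using arg_cong[OF v(4), of hadj] by simp
    thus ?case by (simp add: k flip: blinfun_compose_assoc)
  next
    case (Suc m)
    then obtain k where k: "n = Suc k" "m < k" by (metis Suc_lessE)
    thus ?case using Suc.IH[OF k(2)] by (simp add: blinfun_compose_assoc vv)
  qed
  assume "m \<noteq> n"
  thus "(?f m)\<^sup>\<dagger> \<odot> ?f n = 0"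
    using lt[of m n] arg_cong[OF lt[of n m], of hadj] by (cases "m < n") auto
qed

text \<open>By Bessel's inequality the squared norms are summable, so they tend to 0.\<close>

lemma orth_ranges_tendsto_0:
  fixes f :: "nat \<Rightarrow> 'a::{real_inner,banach} \<Rightarrow>\<^sub>L 'a"
  assumes iso: "\<And>n. is_pisom (f n)" and orth: "\<And>m n. m \<noteq> n \<Longrightarrow> (f m)\<^sup>\<dagger> \<odot> f n = 0"
  shows "(\<lambda>n. norm ((f n \<odot> (f n)\<^sup>\<dagger>) x)) \<longlonglongrightarrow> 0"
proof -
  let ?g = "\<lambda>n. (f n \<odot> (f n)\<^sup>\<dagger>) x"
  have "summable (\<lambda>n. (norm (?g n))\<^sup>2)"
  proof (rule summableI_nonneg_bounded)
    show "(\<Sum>i<n. (norm (?g i))\<^sup>2) \<le> (norm x)\<^sup>2" for n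
    proof (rule bessel_orth)
      show "x \<bullet> ?g i = ?g i \<bullet> ?g i" for i
        using inner_proj[OF is_pisom_projs(2)[OF iso[of i]], of x]
        by (simp only: power2_norm_eq_inner inner_commute)
      fix i j assume "i \<in> {..<n}" "j \<in> {..<n}" "i \<noteq> j"
      hence "(f j)\<^sup>\<dagger> \<odot> f i = 0" using orth by auto
      hence "(f j)\<^sup>\<dagger> (f i y) = 0" for y by (metis blinfun_apply_blinfun_compose blinfun.zero_left)
      thus "?g i \<bullet> ?g j = 0" by (simp add: inner_hadj')
    qed simp
  qed simp
  hence "(\<lambda>n. (norm (?g n))\<^sup>2) \<longlonglongrightarrow> 0" by (rule summable_LIMSEQ_zero)
  from tendsto_real_sqrt[OF this] show ?thesis by simp
qed

text \<open>Polarisation in the direction of \<open>s x\<close>, scaled to the norm of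
  \<open>x\<close>, and the parallelogram law: the numerical radius of a self-adjoint operator
  bounds its norm.\<close>

lemma norm_selfadj_le_form:
  fixes s :: "'a::{real_inner,banach} \<Rightarrow>\<^sub>L 'a"
  assumes s: "s\<^sup>\<dagger> = s" and b: "\<And>x. \<bar>s x \<bullet> x\<bar> \<le> d * (norm x)\<^sup>2" and d: "d \<ge> 0"
  shows "norm s \<le> d"
proof (rule norm_blinfun_bound[OF d])
  fix x
  show "norm (s x) \<le> d * norm x"
  proof (cases "s x = 0 \<or> x = 0")
    case False
    define y where "y = (norm x / norm (s x)) *\<^sub>R s x"
    have ny: "norm y = norm x" using False by (simp add: y_def)
    have sy: "s u \<bullet> v = u \<bullet> s v" for u v by (metis inner_hadj s)
    have "s (x + y) \<bullet> (x + y) - s (x - y) \<bullet> (x - y) = 4 * (s x \<bullet> y)"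
      using sy[of x y] by (simp add: blinfun.bilinear_simps inner_add_left inner_add_right
          inner_diff_left inner_diff_right inner_commute)
    moreover have "s (x + y) \<bullet> (x + y) \<le> d * (norm (x + y))\<^sup>2" "- (s (x - y) \<bullet> (x - y)) \<le> d * (norm (x - y))\<^sup>2"
      using b[of "x + y"] b[of "x - y"] by linarith+
    ultimately have "4 * (s x \<bullet> y) \<le> d * ((norm (x + y))\<^sup>2 + (norm (x - y))\<^sup>2)"
      by (simp add: distrib_left)
    also have "(norm (x + y))\<^sup>2 + (norm (x - y))\<^sup>2 = 4 * (norm x)\<^sup>2"
      using ny by (simp add: power2_norm_eq_inner inner_add_left inner_add_right inner_diff_left
          inner_diff_right inner_commute norm_eq)
    finally have "s x \<bullet> y \<le> d * (norm x)\<^sup>2" by simp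
    moreover have "s x \<bullet> y = norm x * norm (s x)"
      using False by (simp add: y_def power2_eq_square flip: power2_norm_eq_inner)
    ultimately have "norm x * norm (s x) \<le> norm x * (d * norm x)" by (simp add: power2_eq_square mult_ac)
    thus ?thesis using False by simp
  qed (use d in auto)
qed

context vna
begin

subsection \<open>Meets and a Schroeder--Bernstein argument\<close>

text \<open>The projection \<open>s\<close> gathers the defect \<open>r\<close> and all its images
  under powers of \<open>v\<close>; let \<open>w\<close> act as \<open>v\<close> on \<open>s\<close>
  and as the identity elsewhere.\<close>

lemma eqv_id_of_sube:
  assumes e: "pr e" and le: "id_blinfun \<preceq> e"
  obtains w where "w \<in> M" "w\<^sup>\<dagger> \<odot> w = id_blinfun" "w \<odot> w\<^sup>\<dagger> = e"
proof -
  obtain v where v: "v \<in> M" "v\<^sup>\<dagger> \<odot> v = id_blinfun" "e \<odot> v = v" using le by (auto simp: sube_def)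
  define r where "r = id_blinfun - e"
  have r: "pr r" unfolding r_def by (rule pr_compl[OF e])
  have ve: "v\<^sup>\<dagger> \<odot> e = v\<^sup>\<dagger>" using arg_cong[OF v(3), of hadj] by (simp add: prD(4)[OF e])
  have vr: "v\<^sup>\<dagger> \<odot> r = 0" by (simp add: r_def op_simps ve)
  define f where "f = shift_seq v r"
  have f: "(f n)\<^sup>\<dagger> \<odot> f n = r" "m \<noteq> n \<Longrightarrow> (f m)\<^sup>\<dagger> \<odot> f n = 0" for m n
    unfolding f_def using shift_seq[of v id_blinfun r, OF v(2) _ _ vr] prD[OF r] by (auto simp: op_simps)
  have fM: "f n \<in> M" for n unfolding f_def by (induction n) (auto intro: M_intros v prD(1)[OF r])
  have fp: "is_pisom (f n)" for n by (rule pisom_init(1)[OF f(1) prD(2)[OF r]])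
  define g where "g = (\<lambda>n. f n \<odot> (f n)\<^sup>\<dagger>)"
  have gp: "is_proj (g n)" for n unfolding g_def by (rule is_pisom_projs(2)[OF fp])
  have go: "g m \<odot> g n = 0" if "m \<noteq> n" for m n
  proof -
    have "g m \<odot> g n = f m \<odot> ((f m)\<^sup>\<dagger> \<odot> f n) \<odot> (f n)\<^sup>\<dagger>" by (simp add: g_def blinfun_compose_assoc)
    thus ?thesis using f(2)[OF that] by simp
  qed
  have oG: "orth_pisoms (range g)"
    unfolding orth_pisoms_def
  proof (intro conjI ballI impI)
    fix x y assume "x \<in> range g" "y \<in> range g" "x \<noteq> y"
    then obtain m n where "x = g m" "y = g n" "m \<noteq> n" by blast
    thus "x\<^sup>\<dagger> \<odot> y = 0" "x \<odot> y\<^sup>\<dagger> = 0" using go gp by (auto simp: is_projD)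
  qed (use gp is_pisom_proj in auto)
  define s where "s = osum (range g)"
  have sM: "s \<in> M" unfolding s_def by (rule M_osum[OF oG]) (auto simp: g_def intro: M_intros fM)
  have sh: "s\<^sup>\<dagger> = s"
  proof -
    have "hadj ` range g = range g" using gp by (force simp: is_projD image_iff)
    thus ?thesis unfolding s_def osum_hadj[OF oG] by simp
  qed
  have sg: "s \<odot> g n = g n" for n
    using osum_hadj_compose[OF oG, of "g n"] sh is_projD[OF gp[of n]] by (simp add: s_def)
  have ss: "s \<odot> s = s"
  proof -
    have "(s - id_blinfun) \<odot> s = 0" unfolding s_def
      by (rule osum_annihilate[OF oG]) (use sg in \<open>auto simp: op_simps s_def\<close>)
    thus ?thesis by (simp add: op_simps)
  qed
  have s: "pr s" using sM sh ss by (simp add: pr_def is_proj_def)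
  have g0: "g 0 = r" by (simp add: g_def f_def prD[OF r])
  have gS: "v \<odot> g n \<odot> v\<^sup>\<dagger> = g (Suc n)" for n by (simp add: g_def f_def blinfun_compose_assoc)
  text \<open>\<open>s\<close> absorbs its own image under the shift, and only \<open>r\<close> is lost.\<close>
  have key: "s = r + v \<odot> s \<odot> v\<^sup>\<dagger>"
  proof -
    let ?t = "r + v \<odot> s \<odot> v\<^sup>\<dagger>"
    have rv: "r \<odot> v = 0" using arg_cong[OF vr, of hadj] by (simp add: prD(4)[OF r])
    have vv: "v\<^sup>\<dagger> \<odot> (v \<odot> T) = T" for T using v(2) by (simp add: op_simps flip: blinfun_compose_assoc)
    have t: "is_proj ?t"
      unfolding is_proj_def by (simp add: op_simps prD[OF r] sh vr vv ss prD(5)[OF s])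
        (simp add: rv flip: blinfun_compose_assoc)
    have tg: "?t \<odot> g n = g n" for n
    proof (cases n)
      case 0
      thus ?thesis by (simp add: g0 op_simps prD[OF r] vr)
    next
      case (Suc k)
      have "v \<odot> s \<odot> v\<^sup>\<dagger> \<odot> (v \<odot> g k \<odot> v\<^sup>\<dagger>) = v \<odot> (s \<odot> g k) \<odot> v\<^sup>\<dagger>" by (simp add: blinfun_compose_assoc vv)
      also have "\<dots> = g n" by (simp add: sg gS Suc)
      finally have 1: "v \<odot> s \<odot> v\<^sup>\<dagger> \<odot> g n = g n" by (simp add: gS Suc)
      have "r \<odot> g n = (r \<odot> v) \<odot> g k \<odot> v\<^sup>\<dagger>" by (simp add: Suc blinfun_compose_assoc flip: gS)
      thus ?thesis using 1 by (simp add: rv blinfun_compose_algebra)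
    qed
    have "(?t - id_blinfun) \<odot> s = 0" unfolding s_def
      by (rule osum_annihilate[OF oG]) (use tg in \<open>auto simp: blinfun_compose_algebra s_def\<close>)
    hence ts: "?t \<odot> s = s" by (simp add: blinfun_compose_algebra)
    have sr: "s \<odot> r = r" using sg[of 0] by (simp add: g0)
    have "(s - id_blinfun) \<odot> v \<odot> s = 0"
      unfolding s_def
    proof (rule osum_annihilate[OF oG])
      fix x assume "x \<in> range g"
      then obtain n where x: "x = g n" by blast
      have "s \<odot> (v \<odot> g n \<odot> v\<^sup>\<dagger>) = v \<odot> g n \<odot> v\<^sup>\<dagger>" by (simp add: gS sg)
      hence "s \<odot> (v \<odot> g n \<odot> v\<^sup>\<dagger>) \<odot> v = v \<odot> g n \<odot> v\<^sup>\<dagger> \<odot> v" by simp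
      hence "s \<odot> (v \<odot> g n) = v \<odot> g n" by (simp add: blinfun_compose_assoc v(2) op_simps)
      thus "(osum (range g) - id_blinfun) \<odot> v \<odot> x = 0" by (simp add: op_simps x s_def)
    qed
    hence "s \<odot> (v \<odot> s) = v \<odot> s" by (simp add: op_simps)
    hence "s \<odot> (v \<odot> s \<odot> v\<^sup>\<dagger>) = v \<odot> s \<odot> v\<^sup>\<dagger>" by (metis blinfun_compose_assoc)
    hence "s \<odot> ?t = ?t" by (simp only: blinfun_compose_algebra(2) sr)
    thus ?thesis by (intro proj_antisym[OF prD(2)[OF s] t ts])
  qed
  define w where "w = v \<odot> s + (id_blinfun - s)"
  have sv: "(id_blinfun - s) \<odot> (v \<odot> s) = 0"
  proof -
    have "s \<odot> (v \<odot> s \<odot> v\<^sup>\<dagger>) = v \<odot> s \<odot> v\<^sup>\<dagger>"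
    proof -
      have "v \<odot> s \<odot> v\<^sup>\<dagger> = s - r" using key by (metis add_diff_cancel_left')
      thus ?thesis using sg[of 0] by (simp add: g0 blinfun_compose_algebra ss)
    qed
    hence "s \<odot> (v \<odot> s \<odot> v\<^sup>\<dagger>) \<odot> v = v \<odot> s \<odot> v\<^sup>\<dagger> \<odot> v" by simp
    thus ?thesis by (simp add: op_simps v(2))
  qed
  have sv': "s \<odot> (v\<^sup>\<dagger> \<odot> (id_blinfun - s)) = 0"
    using arg_cong[OF sv, of hadj] by (simp add: sh blinfun_compose_assoc)
  show ?thesis
  proof (rule that[of w])
    show "w \<in> M" unfolding w_def by (intro M_intros v sM)
    have "v\<^sup>\<dagger> \<odot> (v \<odot> s) = s" using v(2) by (simp add: op_simps flip: blinfun_compose_assoc)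
    hence a: "s \<odot> (v\<^sup>\<dagger> \<odot> (v \<odot> s)) = s" by (simp add: ss)
    have "w\<^sup>\<dagger> \<odot> w = s \<odot> (v\<^sup>\<dagger> \<odot> (v \<odot> s)) + s \<odot> (v\<^sup>\<dagger> \<odot> (id_blinfun - s))
        + (id_blinfun - s) \<odot> (v \<odot> s) + (id_blinfun - s) \<odot> (id_blinfun - s)"
      by (simp only: w_def hadj_simps sh blinfun_compose_algebra(1,2) blinfun_compose_assoc add_ac)
    thus "w\<^sup>\<dagger> \<odot> w = id_blinfun" by (simp only: a sv sv') (simp add: op_simps ss)
    have s0: "s \<odot> (id_blinfun - s) = 0" "(id_blinfun - s) \<odot> s = 0" by (simp_all add: op_simps ss)
    have "w \<odot> w\<^sup>\<dagger> = v \<odot> (s \<odot> s) \<odot> v\<^sup>\<dagger> + v \<odot> (s \<odot> (id_blinfun - s))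
        + (id_blinfun - s) \<odot> s \<odot> v\<^sup>\<dagger> + (id_blinfun - s) \<odot> (id_blinfun - s)"
      by (simp only: w_def hadj_simps sh blinfun_compose_algebra(1,2) blinfun_compose_assoc add_ac)
    hence "w \<odot> w\<^sup>\<dagger> = v \<odot> s \<odot> v\<^sup>\<dagger> + (id_blinfun - s)" by (simp only: s0 ss) (simp add: op_simps ss)
    also have "\<dots> = id_blinfun - r" using key by (simp add: algebra_simps)
    finally show "w \<odot> w\<^sup>\<dagger> = e" by (simp add: r_def)
  qed
qed

text \<open>A vector of \<open>p\<close> lies in \<open>q\<close> exactly when it is orthogonal to
  the range of \<open>p \<odot> (id_blinfun - q)\<close>.\<close>

definition pmeet :: "('a \<Rightarrow>\<^sub>L 'a) \<Rightarrow> ('a \<Rightarrow>\<^sub>L 'a) \<Rightarrow> 'a \<Rightarrow>\<^sub>L 'a" where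
  "pmeet p q = p - range_proj (p \<odot> (id_blinfun - q))"

lemma pmeet:
  fixes T :: "'a \<Rightarrow>\<^sub>L 'a"
  assumes p: "pr p" and q: "pr q"
  shows "pr (pmeet p q)" "p \<odot> pmeet p q = pmeet p q" "q \<odot> pmeet p q = pmeet p q"
    and "p \<odot> T = T \<Longrightarrow> q \<odot> T = T \<Longrightarrow> pmeet p q \<odot> T = T"
proof -
  let ?A = "(id_blinfun - q) \<odot> p"
  define R where "R = range_proj (p \<odot> (id_blinfun - q))"
  have m: "pmeet p q = p - R" by (simp only: pmeet_def R_def)
  have Ah: "?A\<^sup>\<dagger> = p \<odot> (id_blinfun - q)" by (simp add: prD(4)[OF p] prD(4)[OF q])
  have AM: "?A \<in> M" "p \<odot> (id_blinfun - q) \<in> M" by (intro M_intros prD(1) p q)+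
  have R: "pr R" unfolding R_def by (rule pr_range_proj[OF AM(2)])
  have pR: "p \<odot> R = R" unfolding R_def by (rule range_proj_le) (simp only: prD(5)[OF p])
  show "pr (pmeet p q)" unfolding m by (rule pr_diff[OF R p pR])
  show pm: "p \<odot> pmeet p q = pmeet p q" by (simp add: m op_simps prD[OF p] pR)
  have "?A \<odot> R = ?A" using compose_range_proj_hadj[of ?A] unfolding Ah R_def .
  hence "?A \<odot> pmeet p q = 0"
    by (simp only: m blinfun_compose_algebra(4)) (simp only: blinfun_compose_assoc prD(3)[OF p] diff_self)
  hence "(id_blinfun - q) \<odot> pmeet p q = 0" by (simp add: blinfun_compose_assoc pm)
  thus "q \<odot> pmeet p q = pmeet p q" by (simp add: op_simps)
  assume T: "p \<odot> T = T" "q \<odot> T = T"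
  have Th: "T\<^sup>\<dagger> \<odot> p = T\<^sup>\<dagger>" "T\<^sup>\<dagger> \<odot> q = T\<^sup>\<dagger>"
    using arg_cong[OF T(1), of hadj] arg_cong[OF T(2), of hadj] by (simp_all add: prD(4)[OF p] prD(4)[OF q])
  have "T\<^sup>\<dagger> \<odot> (p \<odot> (id_blinfun - q)) = (T\<^sup>\<dagger> \<odot> p) \<odot> (id_blinfun - q)" by (simp only: blinfun_compose_assoc)
  also have "\<dots> = 0" by (simp add: Th blinfun_compose_algebra)
  finally have "T\<^sup>\<dagger> \<odot> R = 0" unfolding R_def by (rule range_proj_annihilate)
  from arg_cong[OF this, of hadj] have "R \<odot> T = 0" by (simp add: prD(4)[OF R])
  thus "pmeet p q \<odot> T = T" by (simp add: m blinfun_compose_algebra T(1))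
qed

lemma pmeet_commute: "pr p \<Longrightarrow> pr q \<Longrightarrow> pmeet p q = pmeet q p"
  by (rule proj_antisym) (use pmeet[of p q] pmeet[of q p] in \<open>auto intro: pmeet(4) prD(2)\<close>)

text \<open>The two sides are the range projections of the adjoint of
  \<open>(id_blinfun - q) \<odot> p\<close> and of this operator itself.\<close>

lemma parallelogram:
  assumes p: "pr p" and q: "pr q"
  shows "p - pmeet p q \<asymp> (id_blinfun - q) - pmeet (id_blinfun - p) (id_blinfun - q)"
proof -
  let ?A = "(id_blinfun - q) \<odot> p"
  have Ah: "?A\<^sup>\<dagger> = p \<odot> (id_blinfun - q)" by (simp add: prD(4)[OF p] prD(4)[OF q])
  have "?A \<in> M" by (intro M_intros prD(1) p q)
  from range_proj_eqv[OF this] have "p - pmeet p q \<asymp> (id_blinfun - q) - pmeet (id_blinfun - q) (id_blinfun - p)"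
    unfolding Ah by (simp add: pmeet_def)
  thus ?thesis using pmeet_commute[of "id_blinfun - p" "id_blinfun - q"] p q by (simp add: pr_compl)
qed

lemma central_orth:
  assumes "central z" "S \<in> M" shows "z \<odot> S \<odot> ((id_blinfun - z) \<odot> T) = 0"
  by (simp add: op_simps central_left_commute[OF assms] prD(5)[OF centralD(1)[OF assms(1)]])

text \<open>The central projection comes from comparing \<open>E \<and> g\<close> with \<open>(1 - E) \<and> (1 - g)\<close>.\<close>

lemma ex_central_split:
  assumes E: "pr E" and g: "pr g" and half: "id_blinfun \<preceq> g" "id_blinfun \<preceq> id_blinfun - g"
  obtains z where "central z" "id_blinfun \<preceq> z \<odot> E + (id_blinfun - z) \<odot> (id_blinfun - E)"
proof -
  define a where "a = pmeet g E"
  define b where "b = pmeet (id_blinfun - g) (id_blinfun - E)"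
  note cE = pr_compl[OF E] and cg = pr_compl[OF g]
  have a: "pr a" "g \<odot> a = a" "E \<odot> a = a" unfolding a_def by (rule pmeet[OF g E])+
  have b: "pr b" "(id_blinfun - g) \<odot> b = b" "(id_blinfun - E) \<odot> b = b" unfolding b_def by (rule pmeet[OF cg cE])+
  have ga: "g - a \<asymp> (id_blinfun - E) - b" unfolding a_def b_def by (rule parallelogram[OF g E])
  have gb: "(id_blinfun - g) - b \<asymp> E - a"
    using parallelogram[OF cg cE] by (simp add: a_def b_def)
  have d: "pr (g - a)" "pr (E - a)" "pr ((id_blinfun - g) - b)" "pr ((id_blinfun - E) - b)"
    by (intro pr_diff a b g E cE cg)+
  obtain z where z: "central z" "z \<odot> a \<preceq> z \<odot> b" "(id_blinfun - z) \<odot> b \<preceq> (id_blinfun - z) \<odot> a"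
    by (rule comparison[OF a(1) b(1)])
  \<comment> \<open>The parallelogram law handles what lies outside the meets; a subequivalence of
    the meets over \<open>y\<close> is added to it.\<close>
  have add: "y \<odot> p \<preceq> y \<odot> q"
    if y: "central y" and p: "pr p" "pr p'" "p \<odot> p' = p'" and q: "pr q" "pr q'" "q \<odot> q' = q'"
      and e: "p - p' \<asymp> q - q'" and s: "y \<odot> p' \<preceq> y \<odot> q'" for y p p' q q'
  proof -
    have *: "y \<odot> (x - x') \<odot> (y \<odot> x') = 0" if "pr x" "pr x'" "x \<odot> x' = x'" for x x'
      using that by (simp add: op_simps central_left_commute[OF y] prD)
    have d: "pr (p - p')" "pr (q - q')" by (intro pr_diff p q)+
    have "y \<odot> (p - p') + y \<odot> p' \<preceq> y \<odot> (q - q') + y \<odot> q'"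
      by (rule sube_add[OF eqv_imp_sube[OF eqv_central[OF e y]] s])
        (auto intro!: pr_central y d p q * prD(2))
    thus ?thesis by (simp add: op_simps)
  qed
  have 1: "z \<odot> g \<preceq> z \<odot> (id_blinfun - E)"
    by (rule add[OF z(1) g a(1,2) cE b(1,3) ga z(2)])
  have 2: "(id_blinfun - z) \<odot> (id_blinfun - g) \<preceq> (id_blinfun - z) \<odot> E"
    by (rule add[OF central_compl[OF z(1)] cg b(1,2) E a(1,3) gb z(3)])
  \<comment> \<open>Over \<open>z\<close> the identity fits into \<open>g\<close>, hence into
    \<open>id_blinfun - E\<close>; over the complement it fits into \<open>id_blinfun - g\<close>,
    hence into \<open>E\<close>.\<close>
  have 1: "z \<odot> id_blinfun \<preceq> z \<odot> (id_blinfun - E)"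
    by (rule sube_trans[OF sube_central[OF half(1) z(1)] 1])
  have 2: "(id_blinfun - z) \<odot> id_blinfun \<preceq> (id_blinfun - z) \<odot> E"
    by (rule sube_trans[OF sube_central[OF half(2) central_compl[OF z(1)]] 2])
  have "(id_blinfun - z) \<odot> id_blinfun + z \<odot> id_blinfun \<preceq> (id_blinfun - z) \<odot> E + z \<odot> (id_blinfun - E)"
  proof (rule sube_add[OF 2 1])
    have "(id_blinfun - z) \<odot> S \<odot> (z \<odot> T) = 0" if "S \<in> M" for S T :: "'a \<Rightarrow>\<^sub>L 'a"
      using central_orth[OF central_compl[OF z(1)] that, of T] by simp
    thus "(id_blinfun - z) \<odot> id_blinfun \<odot> (z \<odot> id_blinfun) = 0" "(id_blinfun - z) \<odot> E \<odot> (z \<odot> (id_blinfun - E)) = 0"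
      using prD(1)[OF E] by (auto simp del: blinfun_compose_algebra)
  qed (auto intro!: pr_central central_compl z E cE)
  hence "id_blinfun \<preceq> (id_blinfun - z) \<odot> E + (id_blinfun - (id_blinfun - z)) \<odot> (id_blinfun - E)"
    by (simp add: op_simps)
  \<comment> \<open>The cut returned is \<open>id_blinfun - z\<close>, as \<open>E\<close> is the
    large half over the complement of \<open>z\<close>.\<close>
  thus ?thesis by (rule that[OF central_compl[OF z(1)]])
qed

end

subsection \<open>Properly infinite algebras\<close>

locale properly_infinite_vna = vna +
  assumes central_infinite: "central z \<Longrightarrow> z \<noteq> 0 \<Longrightarrow>
    \<exists>v\<in>M. v\<^sup>\<dagger> \<odot> v = z \<and> z \<odot> v = v \<and> v \<odot> v\<^sup>\<dagger> \<noteq> z"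
begin

text \<open>\<open>w\<close> contains infinitely many orthogonal copies of a nonzero projection. In a maximal family
  the remainder is absorbed on a central piece, and the index set splits into two copies of itself.\<close>

lemma ex_halving_piece:
  assumes w: "central w" "w \<noteq> 0"
  obtains z s where "central z" "z \<noteq> 0" "w \<odot> z = z" "\<And>b :: bool. s b \<in> M"
    "\<And>b. (s b)\<^sup>\<dagger> \<odot> s b = z" "(s True)\<^sup>\<dagger> \<odot> s False = 0" "\<And>b. z \<odot> s b = s b"
proof -
  have prw: "pr w" using w(1) by (rule centralD)
  obtain v where v: "v \<in> M" "v\<^sup>\<dagger> \<odot> v = w" "w \<odot> v = v" "v \<odot> v\<^sup>\<dagger> \<noteq> w" using central_infinite[OF w] by blast
  have vp: "is_pisom v" by (rule pisom_init(1)[OF v(2) prD(2)[OF prw]])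
  \<comment> \<open>\<open>F\<close> is what \<open>v\<close> misses in \<open>w\<close>; powers of
    \<open>v\<close> turn it into infinitely many orthogonal copies.\<close>
  define F where "F = w - v \<odot> v\<^sup>\<dagger>"
  have wvv: "w \<odot> (v \<odot> v\<^sup>\<dagger>) = v \<odot> v\<^sup>\<dagger>" by (simp add: v(3) flip: blinfun_compose_assoc)
  have F: "pr F" "F \<noteq> 0" unfolding F_def using pr_pisom[OF v(1) vp] v(4) wvv
    by (auto intro: pr_diff prw)
  have wF: "w \<odot> F = F" by (simp add: F_def op_simps prD[OF prw] wvv)
  have "v\<^sup>\<dagger> \<odot> w = v\<^sup>\<dagger>" using arg_cong[OF v(3), of hadj] by (simp add: prD(4)[OF prw])
  hence vF: "v\<^sup>\<dagger> \<odot> F = 0" by (simp add: F_def op_simps is_pisomD(2)[OF vp])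
  define f where "f = shift_seq v F"
  have f: "w \<odot> f n = f n" "(f n)\<^sup>\<dagger> \<odot> f n = F" "m \<noteq> n \<Longrightarrow> (f m)\<^sup>\<dagger> \<odot> f n = 0" for m n
    unfolding f_def using shift_seq[OF v(2,3) wF vF] prD[OF F(1)] by auto
  have fM: "f n \<in> M" for n unfolding f_def by (induction n) (auto intro: M_intros v prD(1)[OF F(1)])
  \<comment> \<open>Members must be orthogonal to every \<open>f n\<close>, so that adding this
    sequence to a maximal family keeps it orthogonal and makes it infinite.\<close>
  define A where "A = {x\<in>M. x\<^sup>\<dagger> \<odot> x = F \<and> w \<odot> x = x \<and> (\<forall>n. (f n)\<^sup>\<dagger> \<odot> x = 0)}"
  obtain W0 where W0: "W0 \<subseteq> A" "pairwise (\<lambda>x y. x\<^sup>\<dagger> \<odot> y = 0) W0"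
    "\<And>a. a \<in> A \<Longrightarrow> (\<And>y. y \<in> W0 \<Longrightarrow> a\<^sup>\<dagger> \<odot> y = 0 \<and> y\<^sup>\<dagger> \<odot> a = 0) \<Longrightarrow> a \<in> W0"
    by (rule ex_maximal_pairwise[of A "\<lambda>x y. x\<^sup>\<dagger> \<odot> y = 0"]) blast
  define W where "W = W0 \<union> range f"
  have inj: "inj f"
  proof (rule injI, rule ccontr)
    fix m n assume "f m = f n" "m \<noteq> n"
    hence "F = 0" using f(2)[of n] f(3)[of m n] by simp
    thus False using F(2) by simp
  qed
  have infW: "infinite W" unfolding W_def using range_inj_infinite[OF inj] by simp
  have W: "x \<in> M" "x\<^sup>\<dagger> \<odot> x = F" "w \<odot> x = x" if "x \<in> W" for x
    using that W0(1) f fM by (auto simp: W_def A_def)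
  have orth: "x\<^sup>\<dagger> \<odot> y = 0" if "x \<in> W" "y \<in> W" "x \<noteq> y" for x y
  proof -
    have 1: "(f n)\<^sup>\<dagger> \<odot> x = 0" if "x \<in> W0" for x n using that W0(1) by (auto simp: A_def)
    have 2: "x\<^sup>\<dagger> \<odot> f n = 0" if "x \<in> W0" for x n using arg_cong[OF 1[OF that], of hadj] by simp
    have 3: "(f m)\<^sup>\<dagger> \<odot> f n = 0" if "f m \<noteq> f n" for m n using f(3)[of m n] that by (cases "m = n") auto
    show ?thesis using that W0(2) 1 2 3 unfolding W_def pairwise_def by auto
  qed
  have WF: "x \<odot> F = x" "is_pisom x" if "x \<in> W" for x
    using pisom_init[OF W(2)[OF that] prD(2)[OF F(1)]] by auto
  have Fx: "F \<odot> x\<^sup>\<dagger> = x\<^sup>\<dagger>" if "x \<in> W" for x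
    using arg_cong[OF WF(1)[OF that], of hadj] by (simp add: prD(4)[OF F(1)])
  define G where "G = (\<lambda>x. x \<odot> x\<^sup>\<dagger>) ` W"
  have oG: "orth_pisoms G"
    unfolding orth_pisoms_def
  proof (intro conjI ballI impI)
    fix p assume "p \<in> G"
    thus "is_pisom p" using is_pisom_proj is_pisom_projs(2) WF(2) by (auto simp: G_def)
  next
    fix p q assume "p \<in> G" "q \<in> G" "p \<noteq> q"
    then obtain x y where xy: "p = x \<odot> x\<^sup>\<dagger>" "q = y \<odot> y\<^sup>\<dagger>" "x \<in> W" "y \<in> W" "x \<noteq> y" by (auto simp: G_def)
    have "p\<^sup>\<dagger> \<odot> q = x \<odot> (x\<^sup>\<dagger> \<odot> y) \<odot> y\<^sup>\<dagger>" "p \<odot> q\<^sup>\<dagger> = x \<odot> (x\<^sup>\<dagger> \<odot> y) \<odot> y\<^sup>\<dagger>"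
      by (simp_all add: xy blinfun_compose_assoc)
    thus "p\<^sup>\<dagger> \<odot> q = 0" "p \<odot> q\<^sup>\<dagger> = 0" using orth[OF xy(3-5)] by simp_all
  qed
  define S where "S = osum G"
  have SM: "S \<in> M" unfolding S_def by (rule M_osum[OF oG]) (auto simp: G_def intro: M_intros W)
  have Sh: "S\<^sup>\<dagger> = S"
  proof -
    have "hadj ` G = G" by (force simp: G_def image_iff)
    thus ?thesis unfolding S_def osum_hadj[OF oG] by simp
  qed
  have Sx: "S \<odot> (x \<odot> x\<^sup>\<dagger>) = x \<odot> x\<^sup>\<dagger>" if "x \<in> W" for x
  proof -
    have "x \<odot> x\<^sup>\<dagger> \<in> G" using that by (simp add: G_def)
    from osum_hadj_compose[OF oG this] show ?thesis
      using is_projD[OF is_pisom_projs(2)[OF WF(2)[OF that]]] Sh by (simp add: S_def)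
  qed
  have Gann: "T \<odot> S = 0" if "\<And>x. x \<in> W \<Longrightarrow> T \<odot> (x \<odot> x\<^sup>\<dagger>) = 0" for T
    unfolding S_def by (rule osum_annihilate[OF oG]) (use that in \<open>auto simp: G_def\<close>)
  have "(S - id_blinfun) \<odot> S = 0" by (rule Gann) (use Sx in \<open>simp add: blinfun_compose_algebra\<close>)
  hence S: "pr S" using SM Sh by (simp add: pr_def is_proj_def op_simps)
  have "(w - id_blinfun) \<odot> S = 0"
  proof (rule Gann)
    fix x assume "x \<in> W"
    hence "w \<odot> (x \<odot> x\<^sup>\<dagger>) = x \<odot> x\<^sup>\<dagger>" using W(3) by (simp flip: blinfun_compose_assoc)
    thus "(w - id_blinfun) \<odot> (x \<odot> x\<^sup>\<dagger>) = 0" by (simp add: blinfun_compose_algebra)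
  qed
  hence wS: "w \<odot> S = S" by (simp add: op_simps)
  define r where "r = w - S"
  have r: "pr r" unfolding r_def by (rule pr_diff[OF S prw wS])
  have wr: "w \<odot> r = r" by (simp add: r_def op_simps prD[OF prw] wS)
  have Sw: "S \<odot> w = S" using centralD(2)[OF w(1) SM] wS by simp
  have rx: "x\<^sup>\<dagger> \<odot> r = 0" if x: "x \<in> W" for x
  proof -
    have "(S \<odot> (x \<odot> x\<^sup>\<dagger>))\<^sup>\<dagger> = (x \<odot> x\<^sup>\<dagger>)\<^sup>\<dagger>" using Sx[OF x] by simp
    hence "x \<odot> (x\<^sup>\<dagger> \<odot> S) = x \<odot> x\<^sup>\<dagger>" by (simp add: Sh blinfun_compose_assoc)
    hence "x\<^sup>\<dagger> \<odot> (x \<odot> (x\<^sup>\<dagger> \<odot> S)) = x\<^sup>\<dagger> \<odot> (x \<odot> x\<^sup>\<dagger>)" by simp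
    hence "F \<odot> (x\<^sup>\<dagger> \<odot> S) = F \<odot> x\<^sup>\<dagger>" by (simp add: W(2)[OF x] flip: blinfun_compose_assoc)
    hence 1: "x\<^sup>\<dagger> \<odot> S = x\<^sup>\<dagger>" using Fx[OF x] by (simp flip: blinfun_compose_assoc)
    have "x\<^sup>\<dagger> \<odot> w = x\<^sup>\<dagger>" using arg_cong[OF W(3)[OF x], of hadj] by (simp add: prD(4)[OF prw])
    thus ?thesis by (simp add: r_def blinfun_compose_algebra 1)
  qed
  obtain y where y: "central y" "y \<odot> r \<preceq> y \<odot> F" "(id_blinfun - y) \<odot> F \<preceq> (id_blinfun - y) \<odot> r"
    by (rule comparison[OF r F(1)])
  \<comment> \<open>Otherwise \<open>F\<close> would embed into the remainder \<open>r\<close> and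
    enlarge the maximal family.\<close>
  have yF: "y \<odot> F \<noteq> 0"
  proof
    assume "y \<odot> F = 0"
    hence "(id_blinfun - y) \<odot> F = F" by (simp add: op_simps)
    then obtain x where x: "x \<in> M" "x\<^sup>\<dagger> \<odot> x = F" "(id_blinfun - y) \<odot> r \<odot> x = x"
      using y(3) by (auto simp: sube_def)
    have "r \<odot> ((id_blinfun - y) \<odot> r \<odot> x) = (id_blinfun - y) \<odot> r \<odot> x"
      by (simp add: blinfun_compose_assoc central_left_commute[OF central_compl[OF y(1)] prD(1)[OF r]] prD[OF r])
    hence rx': "r \<odot> x = x" by (simp only: x(3))
    have ox: "a\<^sup>\<dagger> \<odot> x = 0" if "a \<in> W" for a
    proof -
      have "a\<^sup>\<dagger> \<odot> (r \<odot> x) = (a\<^sup>\<dagger> \<odot> r) \<odot> x" by (simp only: blinfun_compose_assoc)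
      thus ?thesis using rx[OF that] by (simp add: rx')
    qed
    have "x \<in> W0"
    proof (rule W0(3))
      have "w \<odot> x = x" using wr rx' by (metis blinfun_compose_assoc)
      thus "x \<in> A" using x ox by (auto simp: A_def W_def)
      fix a assume "a \<in> W0"
      hence 1: "a\<^sup>\<dagger> \<odot> x = 0" by (intro ox) (simp add: W_def)
      moreover have "x\<^sup>\<dagger> \<odot> a = 0" using arg_cong[OF 1, of hadj] by simp
      ultimately show "x\<^sup>\<dagger> \<odot> a = 0 \<and> a\<^sup>\<dagger> \<odot> x = 0" by simp
    qed
    hence "F = 0" using ox[of x] x(2) by (simp add: W_def)
    thus False using F(2) by simp
  qed
  define z where "z = y \<odot> w"
  have z: "central z"
  proof -
    have "T \<odot> z = z \<odot> T" if "T \<in> M" for T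
      by (simp add: z_def blinfun_compose_assoc central_left_commute[OF y(1) that] centralD(2)[OF w(1) that])
    thus ?thesis using pr_central[OF y(1) prw] by (simp add: central_def z_def)
  qed
  have prz: "pr z" using z by (rule centralD)
  have zF: "z \<odot> F = y \<odot> F" "z \<odot> r = y \<odot> r" by (simp_all add: z_def blinfun_compose_assoc wF wr)
  have z0: "z \<noteq> 0" using yF zF by auto
  have wz: "w \<odot> z = z" using centralD(2)[OF z prD(1)[OF prw]] by (simp add: z_def blinfun_compose_assoc prD[OF prw])
  obtain v0 where v0: "v0 \<in> M" "v0\<^sup>\<dagger> \<odot> v0 = z \<odot> r" "z \<odot> F \<odot> v0 = v0"
    using y(2) unfolding zF[symmetric] by (auto simp: sube_def)
  have Fv0: "F \<odot> v0 = v0"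
  proof -
    have "F \<odot> (z \<odot> F \<odot> v0) = z \<odot> F \<odot> v0"
      by (simp add: blinfun_compose_assoc central_left_commute[OF z prD(1)[OF F(1)]] prD[OF F(1)])
    thus ?thesis by (simp add: v0(3))
  qed
  have zv0: "z \<odot> v0 = v0"
  proof -
    have "z \<odot> (z \<odot> F \<odot> v0) = z \<odot> F \<odot> v0" by (simp add: blinfun_compose_assoc prD[OF prz])
    thus ?thesis by (simp add: v0(3))
  qed
  obtain g :: "('a \<Rightarrow>\<^sub>L 'a) option \<Rightarrow> bool \<Rightarrow> 'a \<Rightarrow>\<^sub>L 'a" where
    g: "\<And>x b. x \<in> insert None (Some ` W) \<Longrightarrow> g x b \<in> W"
      "\<And>x b y c. x \<in> insert None (Some ` W) \<Longrightarrow> y \<in> insert None (Some ` W) \<Longrightarrow> g x b = g y c \<Longrightarrow> x = y \<and> b = c"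
    by (rule ex_inj_option_bool[OF infW]) blast
  let ?I = "insert None (Some ` W)"
  \<comment> \<open>Index \<open>None\<close> stands for the remainder, moved into \<open>F\<close>
    by \<open>v0\<close>; index \<open>Some x\<close> for the copy \<open>x\<close>, moved back to
    \<open>F\<close>. Then \<open>g i b\<close> places the piece in the copy reserved for
    \<open>(i, b)\<close>.\<close>
  define q where "q = (\<lambda>i. case i of None \<Rightarrow> v0 | Some x \<Rightarrow> z \<odot> x\<^sup>\<dagger>)"
  have qM: "q i \<in> M" and zq: "z \<odot> q i = q i" and Fq: "F \<odot> q i = q i" if "i \<in> ?I" for i
  proof -
    show "q i \<in> M" using that by (auto simp: q_def intro!: v0(1) M_compose[OF prD(1)[OF prz] M_hadj[OF W(1)]])
    show "z \<odot> q i = q i" using that by (auto simp: q_def zv0 prD[OF prz])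
    show "F \<odot> q i = q i" using that
      by (auto simp: q_def Fv0 Fx central_left_commute[OF z prD(1)[OF F(1)]])
  qed
  have qq: "is_proj ((q i)\<^sup>\<dagger> \<odot> q i)" if "i \<in> ?I" for i
  proof (cases i)
    case None
    thus ?thesis using pr_central[OF z r] by (simp add: q_def v0 pr_def)
  next
    case (Some x)
    hence x: "x \<in> W" using that by auto
    have "(q i)\<^sup>\<dagger> \<odot> q i = x \<odot> z \<odot> x\<^sup>\<dagger>"
      by (simp add: q_def Some blinfun_compose_assoc prD[OF prz])
    also have "\<dots> = z \<odot> (x \<odot> x\<^sup>\<dagger>)" by (simp add: blinfun_compose_assoc central_left_commute[OF z W(1)[OF x]])
    finally show ?thesis using pr_central[OF z, of "x \<odot> x\<^sup>\<dagger>"] pr_pisom[OF W(1)[OF x] WF(2)[OF x]] by (simp add: pr_def)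
  qed
  have qo: "q i \<odot> (q j)\<^sup>\<dagger> = 0" if ij: "i \<in> ?I" "j \<in> ?I" "i \<noteq> j" for i j
  proof -
    have v0x: "v0 \<odot> x = 0" if "x \<in> W" for x
    proof -
      have "r \<odot> x = 0" using arg_cong[OF rx[OF that], of hadj] by (simp add: prD(4)[OF r])
      hence "v0\<^sup>\<dagger> \<odot> v0 \<odot> x = 0" by (simp add: v0(2) blinfun_compose_assoc)
      hence 1: "v0 \<odot> (v0\<^sup>\<dagger> \<odot> v0) \<odot> x = 0" by (simp add: blinfun_compose_assoc)
      have "is_pisom v0" using pr_central[OF z r] v0(2) by (simp add: is_pisom_iff pr_def)
      from 1 show ?thesis unfolding is_pisomD(1)[OF \<open>is_pisom v0\<close>] .
    qed
    have xv0: "x\<^sup>\<dagger> \<odot> v0\<^sup>\<dagger> = 0" if "x \<in> W" for x using arg_cong[OF v0x[OF that], of hadj] by simp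
    have 1: "v0 \<odot> (x \<odot> z) = 0" if "x \<in> W" for x
      using v0x[OF that] by (simp flip: blinfun_compose_assoc)
    have 2: "x\<^sup>\<dagger> \<odot> (y \<odot> z) = 0" if "x \<in> W" "y \<in> W" "x \<noteq> y" for x y
      using orth[OF that] by (simp flip: blinfun_compose_assoc)
    show ?thesis
      using ij by (auto simp: q_def blinfun_compose_assoc xv0 prD(4)[OF prz] 1)
        (metis 2 blinfun_compose_algebra(9))
  qed
  define V where "V = (\<lambda>b. (\<lambda>i. g i b \<odot> q i) ` ?I)"
  have gq: "(g i b \<odot> q i)\<^sup>\<dagger> \<odot> (g j c \<odot> q j) = (if i = j \<and> b = c then (q i)\<^sup>\<dagger> \<odot> q i else 0)"
    if ij: "i \<in> ?I" "j \<in> ?I" for i j b c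
  proof (cases "i = j \<and> b = c")
    case True
    have "(g i b \<odot> q i)\<^sup>\<dagger> \<odot> (g i b \<odot> q i) = (q i)\<^sup>\<dagger> \<odot> ((g i b)\<^sup>\<dagger> \<odot> g i b) \<odot> q i" by (simp add: blinfun_compose_assoc)
    also have "\<dots> = (q i)\<^sup>\<dagger> \<odot> q i" by (simp add: W(2)[OF g(1)[OF ij(1)]] blinfun_compose_assoc Fq[OF ij(1)])
    finally show ?thesis using True by simp
  next
    case False
    hence "g i b \<noteq> g j c" using g(2)[OF ij] by blast
    from orth[OF g(1)[OF ij(1)] g(1)[OF ij(2)] this]
    have "(q i)\<^sup>\<dagger> \<odot> ((g i b)\<^sup>\<dagger> \<odot> g j c) \<odot> q j = 0" by simp
    thus ?thesis unfolding if_not_P[OF False] by (simp add: blinfun_compose_assoc)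
  qed
  have oV: "orth_pisoms (V b)" for b
    unfolding orth_pisoms_def
  proof (intro conjI ballI impI)
    fix x assume "x \<in> V b"
    then obtain i where i: "i \<in> ?I" "x = g i b \<odot> q i" unfolding V_def by blast
    have "x\<^sup>\<dagger> \<odot> x = (q i)\<^sup>\<dagger> \<odot> q i" unfolding i(2) using gq[OF i(1) i(1), of b b] by simp
    thus "is_pisom x" using qq[OF i(1)] by (simp add: is_pisom_iff)
  next
    fix x x' assume "x \<in> V b" "x' \<in> V b" "x \<noteq> x'"
    then obtain i j where ij: "i \<in> ?I" "x = g i b \<odot> q i" "j \<in> ?I" "x' = g j b \<odot> q j" "i \<noteq> j"
      unfolding V_def by blast
    show "x\<^sup>\<dagger> \<odot> x' = 0" unfolding ij(2,4) using gq[OF ij(1,3), of b b] ij(5) by simp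
    have "x \<odot> x'\<^sup>\<dagger> = g i b \<odot> (q i \<odot> (q j)\<^sup>\<dagger>) \<odot> (g j b)\<^sup>\<dagger>" by (simp add: ij(2,4) blinfun_compose_assoc)
    thus "x \<odot> x'\<^sup>\<dagger> = 0" using qo[OF ij(1,3,5)] by simp
  qed
  have gM: "g i b \<in> M" if "i \<in> ?I" for i b using W(1) g(1)[OF that] by blast
  define s where "s = (\<lambda>b. osum (V b))"
  have sM: "s b \<in> M" for b
    unfolding s_def by (rule M_osum[OF oV]) (auto simp: V_def simp del: image_insert intro!: M_compose gM qM)
  have zs: "z \<odot> s b = s b" for b
  proof -
    have "(z - id_blinfun) \<odot> s b = 0"
      unfolding s_def
    proof (rule osum_annihilate[OF oV])
      fix x assume "x \<in> V b"
      then obtain i where i: "i \<in> ?I" "x = g i b \<odot> q i" unfolding V_def by blast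
      have "z \<odot> x = g i b \<odot> (z \<odot> q i)" unfolding i(2) by (simp only: central_left_commute[OF z gM[OF i(1)]])
      thus "(z - id_blinfun) \<odot> x = 0" by (simp add: blinfun_compose_algebra zq[OF i(1)] i(2))
    qed
    thus ?thesis by (simp add: op_simps)
  qed
  have ss: "(s b)\<^sup>\<dagger> \<odot> s b = z" for b
  proof -
    let ?P = "(s b)\<^sup>\<dagger> \<odot> s b"
    have P: "is_proj ?P" unfolding s_def by (rule is_pisom_projs(1)[OF is_pisom_osum[OF oV]])
    have "s b \<odot> z = s b" using centralD(2)[OF z sM] zs by simp
    hence Pz: "?P \<odot> z = ?P" by (simp add: blinfun_compose_assoc)
    have Pq: "?P \<odot> ((q i)\<^sup>\<dagger> \<odot> q i) = (q i)\<^sup>\<dagger> \<odot> q i" if i: "i \<in> ?I" for i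
    proof -
      have "g i b \<odot> q i \<in> V b" using i unfolding V_def by blast
      from osum_projs(1)[OF oV this] show ?thesis using gq[OF i i, of b b] by (simp only: s_def) simp
    qed
    \<comment> \<open>The initial projection is tested on the copies, gathered in \<open>S\<close>,
      and on the remainder \<open>r\<close>; together they make up \<open>w\<close>.\<close>
    have "((?P - id_blinfun) \<odot> z) \<odot> S = 0"
    proof (rule Gann)
      fix x assume x: "x \<in> W"
      have "(q (Some x))\<^sup>\<dagger> \<odot> q (Some x) = z \<odot> (x \<odot> x\<^sup>\<dagger>)"
        by (simp add: q_def blinfun_compose_assoc prD[OF prz] central_left_commute[OF z W(1)[OF x]])
      thus "(?P - id_blinfun) \<odot> z \<odot> (x \<odot> x\<^sup>\<dagger>) = 0"
        using Pq[of "Some x"] x by (simp add: blinfun_compose_algebra blinfun_compose_assoc)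
    qed
    moreover have "((?P - id_blinfun) \<odot> z) \<odot> r = 0"
      using Pq[of None] by (simp add: q_def v0 blinfun_compose_algebra blinfun_compose_assoc)
    ultimately have "((?P - id_blinfun) \<odot> z) \<odot> (S + r) = 0" by (simp add: blinfun_compose_algebra(2))
    hence "(?P - id_blinfun) \<odot> (z \<odot> w) = 0" by (simp add: r_def blinfun_compose_assoc)
    moreover have "z \<odot> w = z" using centralD(2)[OF w(1) prD(1)[OF prz]] wz by simp
    ultimately show ?thesis using Pz by (simp add: blinfun_compose_algebra)
  qed
  have st: "(s True)\<^sup>\<dagger> \<odot> s False = 0"
  proof -
    have "(s True)\<^sup>\<dagger> \<odot> x = 0" if "x \<in> V False" for x
    proof -
      obtain j where j: "j \<in> ?I" "x = g j False \<odot> q j" using \<open>x \<in> V False\<close> unfolding V_def by blast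
      have "x\<^sup>\<dagger> \<odot> s True = 0" unfolding s_def
      proof (rule osum_annihilate[OF oV])
        fix x' assume "x' \<in> V True"
        then obtain i where i: "i \<in> ?I" "x' = g i True \<odot> q i" unfolding V_def by blast
        show "x\<^sup>\<dagger> \<odot> x' = 0" unfolding i(2) j(2) using gq[OF j(1) i(1), of False True] by simp
      qed
      from arg_cong[OF this, of hadj] show ?thesis by simp
    qed
    from osum_annihilate[OF oV this] show ?thesis by (simp only: s_def)
  qed
  show ?thesis by (rule that[OF z z0 wz sM ss st zs])
qed

text \<open>Two isometries with orthogonal ranges, glued from a maximal orthogonal family of central
  pieces that \<open>ex_halving_piece\<close> halves.\<close>

lemma ex_halving:
  obtains s :: "bool \<Rightarrow> 'a \<Rightarrow>\<^sub>L 'a" where "\<And>b. s b \<in> M" "\<And>b. (s b)\<^sup>\<dagger> \<odot> s b = id_blinfun" "(s True)\<^sup>\<dagger> \<odot> s False = 0"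
proof -
  define H where "H = (\<lambda>z (s :: bool \<Rightarrow> 'a \<Rightarrow>\<^sub>L 'a). central z \<and> (\<forall>b. s b \<in> M \<and> (s b)\<^sup>\<dagger> \<odot> s b = z \<and> z \<odot> s b = s b) \<and>
    (s True)\<^sup>\<dagger> \<odot> s False = 0)"
  define A where "A = {z. \<exists>s. H z s}"
  obtain Z where Z: "Z \<subseteq> A" "pairwise (\<lambda>x y. x \<odot> y = 0) Z"
    "\<And>a. a \<in> A \<Longrightarrow> (\<And>y. y \<in> Z \<Longrightarrow> a \<odot> y = 0 \<and> y \<odot> a = 0) \<Longrightarrow> a \<in> Z"
    by (rule ex_maximal_pairwise[of A "\<lambda>x y. x \<odot> y = 0"]) blast
  have "\<forall>z\<in>Z. \<exists>s. H z s" using Z(1) by (auto simp: A_def)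
  then obtain t where t: "\<And>z. z \<in> Z \<Longrightarrow> H z (t z)" by metis
  have Zp: "central z" "pr z" if "z \<in> Z" for z using t[OF that] by (auto simp: H_def central_def)
  have Zo: "x \<odot> y = 0" if "x \<in> Z" "y \<in> Z" "x \<noteq> y" for x y using Z(2) that by (auto simp: pairwise_def)
  have oZ: "orth_pisoms Z"
    unfolding orth_pisoms_def
  proof (intro conjI ballI impI)
    show "is_pisom x" if "x \<in> Z" for x by (rule is_pisom_proj[OF prD(2)[OF Zp(2)[OF that]]])
    fix x y assume "x \<in> Z" "y \<in> Z" "x \<noteq> y"
    thus "x\<^sup>\<dagger> \<odot> y = 0" "x \<odot> y\<^sup>\<dagger> = 0" using Zo prD(4)[OF Zp(2)] by simp_all
  qed
  define C where "C = osum Z"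
  have CM: "C \<in> M" unfolding C_def by (rule M_osum[OF oZ]) (use Zp in \<open>auto simp: pr_def\<close>)
  have Ch: "C\<^sup>\<dagger> = C"
  proof -
    have "x\<^sup>\<dagger> = x" if "x \<in> Z" for x by (rule prD(4)[OF Zp(2)[OF that]])
    hence "hadj ` Z = Z" by (force simp: image_iff)
    thus ?thesis unfolding C_def osum_hadj[OF oZ] by simp
  qed
  have Cz: "C \<odot> z = z" if "z \<in> Z" for z
    using osum_hadj_compose[OF oZ that] Ch prD[OF Zp(2)[OF that]] by (simp add: C_def)
  have "(C - id_blinfun) \<odot> C = 0"
    using osum_annihilate[OF oZ, of "C - id_blinfun"] Cz by (simp add: C_def blinfun_compose_algebra)
  hence prC: "pr C" using CM Ch by (simp add: pr_def is_proj_def op_simps)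
  have "T \<odot> C = C \<odot> T" if "T \<in> M" for T
    unfolding C_def by (rule osum_commute[OF oZ]) (rule centralD(2)[OF Zp(1) that])
  hence cC: "central C" using prC by (simp add: central_def)
  \<comment> \<open>Otherwise a piece below the complement of \<open>C\<close> could be halved and
    added to the family.\<close>
  have C1: "C = id_blinfun"
  proof (rule ccontr)
    assume "C \<noteq> id_blinfun"
    hence "id_blinfun - C \<noteq> 0" by simp
    then obtain z s where z: "central z" "z \<noteq> 0" "(id_blinfun - C) \<odot> z = z" "\<And>b. s b \<in> M"
      "\<And>b. (s b)\<^sup>\<dagger> \<odot> s b = z" "(s True)\<^sup>\<dagger> \<odot> s False = 0" "\<And>b. z \<odot> s b = s b"
      by (rule ex_halving_piece[OF central_compl[OF cC]]) blast
    have Cz0: "C \<odot> z = 0" using z(3) by (simp add: op_simps)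
    have prz: "pr z" by (rule centralD(1)[OF z(1)])
    have "z \<in> Z"
    proof (rule Z(3))
      have "H z s" using z by (simp add: H_def)
      thus "z \<in> A" unfolding A_def by blast
      fix y assume y: "y \<in> Z"
      have "y \<odot> C = y" using Cz[OF y] pr_le_sym[OF Zp(2)[OF y] prC] by simp
      hence "y \<odot> z = y \<odot> (C \<odot> z)" by (simp flip: blinfun_compose_assoc)
      hence 1: "y \<odot> z = 0" by (simp add: Cz0)
      thus "z \<odot> y = 0 \<and> y \<odot> z = 0" using pr_orth_sym[OF prz Zp(2)[OF y]] by simp
    qed
    thus False using Cz Cz0 z(2) by simp
  qed
  define V where "V = (\<lambda>b. (\<lambda>z. t z b) ` Z)"
  have tz: "(t z b)\<^sup>\<dagger> \<odot> t z b = z" "z \<odot> t z b = t z b" "t z b \<in> M" "(t z True)\<^sup>\<dagger> \<odot> t z False = 0" if "z \<in> Z" for z b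
    using t[OF that] by (auto simp: H_def)
  have to: "(t y b)\<^sup>\<dagger> \<odot> t z c = 0" "t y b \<odot> (t z c)\<^sup>\<dagger> = 0" if yz: "y \<in> Z" "z \<in> Z" "y \<noteq> z" for y z b c
  proof -
    have h: "(t x d)\<^sup>\<dagger> \<odot> x = (t x d)\<^sup>\<dagger>" if "x \<in> Z" for x d
      using arg_cong[OF tz(2)[OF that], of hadj] by (simp add: prD(4)[OF Zp(2)[OF that]])
    have "(t y b)\<^sup>\<dagger> \<odot> t z c = (t y b)\<^sup>\<dagger> \<odot> (y \<odot> z) \<odot> t z c" using h[OF yz(1)] tz(2)[OF yz(2)] by (metis blinfun_compose_assoc)
    thus "(t y b)\<^sup>\<dagger> \<odot> t z c = 0" using Zo[OF yz] by simp
    have e: "t x d \<odot> x = t x d" if "x \<in> Z" for x d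
      using centralD(2)[OF Zp(1)[OF that] tz(3)[OF that]] tz(2)[OF that] by simp
    have e': "z \<odot> (t z c)\<^sup>\<dagger> = (t z c)\<^sup>\<dagger>"
      using arg_cong[OF e[OF yz(2)], of hadj] by (simp add: prD(4)[OF Zp(2)[OF yz(2)]])
    have "t y b \<odot> (t z c)\<^sup>\<dagger> = t y b \<odot> (y \<odot> z) \<odot> (t z c)\<^sup>\<dagger>" using e[OF yz(1)] e' by (metis blinfun_compose_assoc)
    thus "t y b \<odot> (t z c)\<^sup>\<dagger> = 0" using Zo[OF yz] by simp
  qed
  have oV: "orth_pisoms (V b)" for b
    unfolding orth_pisoms_def V_def
  proof (intro conjI ballI impI)
    fix x assume "x \<in> (\<lambda>z. t z b) ` Z"
    thus "is_pisom x" using tz(1) prD(2)[OF Zp(2)] by (auto simp: is_pisom_iff)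
  next
    fix x y assume "x \<in> (\<lambda>z. t z b) ` Z" "y \<in> (\<lambda>z. t z b) ` Z" "x \<noteq> y"
    then obtain z z' where "x = t z b" "y = t z' b" "z \<in> Z" "z' \<in> Z" "z \<noteq> z'" by blast
    thus "x\<^sup>\<dagger> \<odot> y = 0" "x \<odot> y\<^sup>\<dagger> = 0" using to by auto
  qed
  define s where "s = (\<lambda>b. osum (V b))"
  show ?thesis
  proof (rule that[of s])
    fix b
    show "s b \<in> M" unfolding s_def by (rule M_osum[OF oV]) (auto simp: V_def tz)
    have "((s b)\<^sup>\<dagger> \<odot> s b - id_blinfun) \<odot> C = 0" unfolding C_def
    proof (rule osum_annihilate[OF oZ])
      fix z assume z: "z \<in> Z"
      hence "t z b \<in> V b" by (auto simp: V_def)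
      from osum_projs(1)[OF oV this] show "((s b)\<^sup>\<dagger> \<odot> s b - id_blinfun) \<odot> z = 0"
        by (simp add: tz(1)[OF z] s_def blinfun_compose_algebra)
    qed
    thus "(s b)\<^sup>\<dagger> \<odot> s b = id_blinfun" by (simp add: C1 op_simps)
  next
    have "(s True)\<^sup>\<dagger> \<odot> x = 0" if x: "x \<in> V False" for x
    proof -
      obtain z where z: "z \<in> Z" "x = t z False" using x by (auto simp: V_def)
      have "x\<^sup>\<dagger> \<odot> s True = 0" unfolding s_def
      proof (rule osum_annihilate[OF oV])
        fix y assume "y \<in> V True"
        then obtain z' where z': "z' \<in> Z" "y = t z' True" by (auto simp: V_def)
        show "x\<^sup>\<dagger> \<odot> y = 0"
        proof (cases "z = z'")
          case True
          thus ?thesis using arg_cong[OF tz(4)[OF z(1)], of hadj] by (simp add: z z')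
        qed (simp add: z z' to)
      qed
      from arg_cong[OF this, of hadj] show ?thesis by simp
    qed
    from osum_annihilate[OF oV this] show "(s True)\<^sup>\<dagger> \<odot> s False = 0" by (simp only: s_def)
  qed
qed

end

section \<open>Bisection towards the center\<close>

context properly_infinite_vna
begin

definition cen :: "('a \<Rightarrow>\<^sub>L 'a) \<Rightarrow> bool" where
  "cen c \<longleftrightarrow> c \<in> M \<and> c\<^sup>\<dagger> = c \<and> (\<forall>T\<in>M. T \<odot> c = c \<odot> T)"

lemma cenD: "cen c \<Longrightarrow> c \<in> M" "cen c \<Longrightarrow> c\<^sup>\<dagger> = c" "cen c \<Longrightarrow> T \<in> M \<Longrightarrow> T \<odot> c = c \<odot> T"
  by (auto simp: cen_def)

lemma cen_simps [simp]: "cen 0" "central z \<Longrightarrow> cen z"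
  by (auto simp: cen_def central_def prD)

lemma cen_add: "cen c \<Longrightarrow> cen d \<Longrightarrow> cen (c + d)"
  and cen_diff: "cen c \<Longrightarrow> cen d \<Longrightarrow> cen (c - d)"
  and cen_scaleR: "cen c \<Longrightarrow> cen (r *\<^sub>R c)"
  by (auto simp: cen_def blinfun_compose_algebra intro: M_intros)

text \<open>One bisection step: cut \<open>e\<close> by the sign of \<open>a - c\<close>. On a central piece the positive half, and on its
  complement the other half, is still equivalent to \<open>1\<close>; there move \<open>c\<close> up or down by \<open>\<delta> / 2\<close>.\<close>

lemma bisect_step:
  assumes a: "a \<in> M" "a\<^sup>\<dagger> = a" and e: "pr e" "id_blinfun \<preceq> e" "a \<odot> e = e \<odot> a" and c: "cen c"
    and \<delta>: "\<delta> > 0" "norm ((a - c) \<odot> e) \<le> \<delta>"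
  obtains e' c' where "pr e'" "id_blinfun \<preceq> e'" "e \<odot> e' = e'"
    "\<And>S. S \<in> M \<Longrightarrow> S \<odot> a = a \<odot> S \<Longrightarrow> S \<odot> e = e \<odot> S \<Longrightarrow> S \<odot> e' = e' \<odot> S"
    "cen c'" "norm ((a - c') \<odot> e') \<le> \<delta> / 2"
proof -
  define x where "x = a - c"
  define r where "r = norm x + 1"
  have x: "x \<in> M" "x\<^sup>\<dagger> = x" "norm x \<le> r" "r > 0"
    unfolding x_def r_def using a cenD[OF c] by (auto intro: M_intros add_nonneg_pos)
  define p where "p = pos_proj r x"
  have p: "pr p" unfolding p_def pr_def using M_pos_proj[OF x(1,3,4)] is_proj_pos_proj[OF x(2-4)] by simp
  have Sx: "S \<odot> x = x \<odot> S" if "S \<in> M" "S \<odot> a = a \<odot> S" for S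
    using that cenD(3)[OF c that(1)] by (simp add: x_def blinfun_compose_algebra)
  have Sp: "S \<odot> p = p \<odot> S" if "S \<in> M" "S \<odot> a = a \<odot> S" for S
    unfolding p_def by (rule pos_proj_commute[OF x(2-4) Sx[OF that]])
  have ep: "e \<odot> p = p \<odot> e" by (rule Sp[OF prD(1)[OF e(1)] e(3)[symmetric]])
  obtain w where w: "w \<in> M" "w\<^sup>\<dagger> \<odot> w = id_blinfun" "w \<odot> w\<^sup>\<dagger> = e" by (rule eqv_id_of_sube[OF e(1,2)])
  have ew: "e \<odot> w = w" by (simp add: w(2) op_simps flip: w(3))
  have wa: "w\<^sup>\<dagger> \<odot> (w \<odot> T) = T" "w \<odot> (w\<^sup>\<dagger> \<odot> T) = e \<odot> T" "e \<odot> (w \<odot> T) = w \<odot> T" for T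
    by (simp_all add: w ew op_simps flip: blinfun_compose_assoc)
  \<comment> \<open>\<open>p\<close> cut down to \<open>e\<close> and transported to the whole space
    by \<open>w\<close>, because \<open>ex_central_split\<close> compares with
    \<open>id_blinfun\<close>.\<close>
  define E where "E = w\<^sup>\<dagger> \<odot> p \<odot> w"
  have E: "pr E"
  proof -
    have "E \<odot> E = w\<^sup>\<dagger> \<odot> (p \<odot> (e \<odot> (p \<odot> w)))" by (simp add: E_def blinfun_compose_assoc wa)
    also have "e \<odot> (p \<odot> w) = p \<odot> w" using ep ew by (metis blinfun_compose_assoc)
    finally have "E \<odot> E = E" by (simp add: E_def prD[OF p] blinfun_compose_assoc)
    moreover have "E\<^sup>\<dagger> = E" by (simp add: E_def prD[OF p] blinfun_compose_assoc)
    ultimately show ?thesis unfolding pr_def is_proj_def by (auto simp: E_def intro!: M_intros w prD(1)[OF p])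
  qed
  obtain s where s: "\<And>b :: bool. s b \<in> M" "\<And>b. (s b)\<^sup>\<dagger> \<odot> s b = id_blinfun" "(s True)\<^sup>\<dagger> \<odot> s False = 0"
    by (rule ex_halving) blast
  \<comment> \<open>A projection that halves the identity, as comparison partner of
    \<open>E\<close>.\<close>
  define g where "g = s True \<odot> (s True)\<^sup>\<dagger>"
  have g: "pr g" using pr_pisom[OF s(1)] s(2) by (simp add: g_def is_pisom_iff)
  have h1: "id_blinfun \<preceq> g" by (rule subeI[OF s(1)[of True] s(2)]) (simp add: g_def s(2) op_simps)
  have h2: "id_blinfun \<preceq> id_blinfun - g"
    by (rule subeI[OF s(1)[of False] s(2)]) (simp add: g_def s(3) op_simps)
  obtain z where z: "central z" "id_blinfun \<preceq> z \<odot> E + (id_blinfun - z) \<odot> (id_blinfun - E)"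
    by (rule ex_central_split[OF E g h1 h2])
  have prz: "pr z" by (rule centralD(1)[OF z(1)])
  define y where "y = z \<odot> p + (id_blinfun - z) \<odot> (id_blinfun - p)"
  have y: "pr y" unfolding y_def
  proof (rule pr_add)
    show "pr (z \<odot> p)" "pr ((id_blinfun - z) \<odot> (id_blinfun - p))"
      by (intro pr_central z central_compl pr_compl p)+
    thus "(id_blinfun - z) \<odot> (id_blinfun - p) \<odot> (z \<odot> p) = 0"
      using central_orth[OF z(1) prD(1)[OF p], of "id_blinfun - p"] pr_orth_sym by blast
  qed
  have Sy: "S \<odot> y = y \<odot> S" if "S \<in> M" "S \<odot> a = a \<odot> S" for S
    using Sp[OF that] centralD(2)[OF z(1) that(1)]
    by (simp add: y_def op_simps central_left_commute[OF z(1) that(1)])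
  have ye: "y \<odot> e = e \<odot> y" by (rule Sy[OF prD(1)[OF e(1)] e(3)[symmetric], symmetric])
  define e' where "e' = e \<odot> y"
  have e': "pr e'" unfolding e'_def pr_def
    using is_proj_prod[OF prD(2)[OF e(1)] prD(2)[OF y] ye[symmetric]]
    by (simp add: M_compose[OF prD(1)[OF e(1)] prD(1)[OF y]])
  have le: "id_blinfun \<preceq> e'"
  proof -
    obtain v where v: "v \<in> M" "v\<^sup>\<dagger> \<odot> v = id_blinfun" "(z \<odot> E + (id_blinfun - z) \<odot> (id_blinfun - E)) \<odot> v = v"
      using z(2) by (auto simp: sube_def)
    have "w \<odot> (z \<odot> E + (id_blinfun - z) \<odot> (id_blinfun - E)) = e' \<odot> w"
    proof -
      have "w \<odot> E = e \<odot> (p \<odot> w)" by (simp add: E_def blinfun_compose_assoc wa)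
      hence 1: "w \<odot> (z \<odot> E) = e \<odot> (z \<odot> (p \<odot> w))"
        by (simp add: central_left_commute[OF z(1) w(1)] central_left_commute[OF z(1) prD(1)[OF e(1)]])
      have "w \<odot> (id_blinfun - E) = e \<odot> ((id_blinfun - p) \<odot> w)"
        by (simp add: blinfun_compose_algebra \<open>w \<odot> E = e \<odot> (p \<odot> w)\<close> ew)
      hence 2: "w \<odot> ((id_blinfun - z) \<odot> (id_blinfun - E)) = e \<odot> ((id_blinfun - z) \<odot> ((id_blinfun - p) \<odot> w))"
        by (simp only: central_left_commute[OF central_compl[OF z(1)] w(1)]
            central_left_commute[OF central_compl[OF z(1)] prD(1)[OF e(1)]])
      show ?thesis
        by (simp only: e'_def y_def blinfun_compose_algebra(1,2) 1 2 blinfun_compose_assoc)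
    qed
    hence "e' \<odot> (w \<odot> v) = w \<odot> ((z \<odot> E + (id_blinfun - z) \<odot> (id_blinfun - E)) \<odot> v)"
      by (simp only: blinfun_compose_assoc[symmetric])
    hence "e' \<odot> (w \<odot> v) = w \<odot> v" by (simp only: v(3))
    moreover have "(w \<odot> v)\<^sup>\<dagger> \<odot> (w \<odot> v) = id_blinfun" by (simp add: blinfun_compose_assoc wa v(2))
    ultimately show ?thesis using w(1) v(1) by (intro subeI[of "w \<odot> v"] M_compose)
  qed
  define c' where "c' = c + (\<delta> / 2) *\<^sub>R (z - (id_blinfun - z))"
  have c': "cen c'" unfolding c'_def
    by (intro cen_add c cen_scaleR cen_diff cen_simps z central_compl)
  have Se': "S \<odot> e' = e' \<odot> S" if "S \<in> M" "S \<odot> a = a \<odot> S" "S \<odot> e = e \<odot> S" for S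
    using Sy[OF that(1,2)] that(3) unfolding e'_def by (metis blinfun_compose_assoc)
  define t where "t = (a - c') \<odot> e'"
  have comm: "(a - c') \<odot> e' = e' \<odot> (a - c')"
    using Se'[OF a(1) refl e(3)] cenD(3)[OF c' prD(1)[OF e']] by (simp add: blinfun_compose_algebra)
  \<comment> \<open>The form is estimated separately over \<open>z\<close>, where on
    \<open>e'\<close> that of \<open>a - c\<close> lies between 0 and \<open>\<delta>\<close>, and
    over its complement, where it lies between \<open>- \<delta>\<close> and 0; shifting by half of
    \<open>\<delta>\<close> centers both.\<close>
  have nt: "norm t \<le> \<delta> / 2"
  proof (rule norm_selfadj_le_form)
    have "t\<^sup>\<dagger> = e' \<odot> (a - c')" by (simp add: t_def prD(4)[OF e'] a(2) cenD(2)[OF c'])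
    thus "t\<^sup>\<dagger> = t" using comm by (simp add: t_def)
    show "0 \<le> \<delta> / 2" using \<delta> by simp
    fix \<xi>
    define u where "u = e' \<xi>"
    define u1 where "u1 = z u"
    define u2 where "u2 = (id_blinfun - z) u"
    have u12: "u = u1 + u2" by (simp add: u1_def u2_def blinfun.diff_left)
    have "t = e' \<odot> t" by (simp only: t_def comm prD(5)[OF e'])
    hence "t \<xi> \<bullet> \<xi> = e' (t \<xi>) \<bullet> \<xi>" by (metis blinfun_apply_blinfun_compose)
    also have "\<dots> = t \<xi> \<bullet> e' \<xi>" by (metis inner_hadj prD(4)[OF e'])
    also have "\<dots> = (a - c') u \<bullet> u" by (simp add: t_def u_def)
    finally have form: "t \<xi> \<bullet> \<xi> = (a - c') u \<bullet> u" .
    have zz: "z (z v) = z v" for v by (rule is_projD(3)[OF prD(2)[OF prz]])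
    have zu: "z u1 = u1" "z u2 = 0" by (simp_all add: u1_def u2_def blinfun.bilinear_simps zz)
    have za: "z ((a - c') v) = (a - c') (z v)" for v
      using centralD(2)[OF z(1), of "a - c'"] a(1) cenD(1)[OF c'] by (metis M_diff blinfun_apply_blinfun_compose)
    have cross: "(a - c') u1 \<bullet> u2 = 0" "(a - c') u2 \<bullet> u1 = 0"
    proof -
      have "(a - c') u1 \<bullet> u2 = z ((a - c') u1) \<bullet> u2" by (simp add: za zu)
      also have "\<dots> = (a - c') u1 \<bullet> z u2" by (metis inner_hadj prD(4)[OF prz])
      finally show "(a - c') u1 \<bullet> u2 = 0" by (simp add: zu)
      have "(a - c') u2 \<bullet> u1 = (a - c') u2 \<bullet> z u1" by (simp add: zu)
      also have "\<dots> = z ((a - c') u2) \<bullet> u1" by (metis inner_hadj prD(4)[OF prz])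
      finally show "(a - c') u2 \<bullet> u1 = 0" by (simp add: za zu)
    qed
    have e'1: "e' u = u" by (simp add: u_def is_projD(3)[OF prD(2)[OF e']])
    have eu: "e u = u"
    proof -
      have "e \<odot> e' = e'" by (simp add: e'_def prD[OF e(1)])
      thus ?thesis using e'1 by (metis blinfun_apply_blinfun_compose)
    qed
    have yu: "y u = u"
    proof -
      have "y \<odot> e' = e'" unfolding e'_def ye[symmetric] by (simp add: prD[OF y])
      thus ?thesis using e'1 by (metis blinfun_apply_blinfun_compose)
    qed
    have "z \<odot> e = e \<odot> z" using centralD(2)[OF z(1) prD(1)[OF e(1)]] by simp
    hence eu1: "e u1 = u1" unfolding u1_def using eu by (metis blinfun_apply_blinfun_compose)
    have eu2: "e u2 = u2" using eu eu1 u12 by (simp add: blinfun.add_right)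
    have pz: "p \<odot> z = z \<odot> p" using centralD(2)[OF z(1) prD(1)[OF p]] .
    have py: "p \<odot> (z \<odot> y) = z \<odot> y" "p \<odot> ((id_blinfun - z) \<odot> y) = 0"
      by (simp_all add: y_def op_simps prD[OF prz] prD[OF p] pz central_left_commute[OF z(1) prD(1)[OF p]])
    have pu1: "p u1 = u1" using py(1) yu unfolding u1_def by (metis blinfun_apply_blinfun_compose)
    have pu2: "p u2 = 0" using py(2) yu unfolding u2_def by (metis blinfun_apply_blinfun_compose blinfun.zero_left)
    have b: "\<bar>x v \<bullet> v\<bar> \<le> \<delta> * (norm v)\<^sup>2" if "e v = v" for v
    proof -
      have "norm (((a - c) \<odot> e) v) \<le> \<delta> * norm v"
        by (rule order_trans[OF norm_blinfun mult_right_mono[OF \<delta>(2)]]) simp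
      hence xv: "norm (x v) \<le> \<delta> * norm v" using that by (simp add: x_def)
      have "\<bar>x v \<bullet> v\<bar> \<le> norm (x v) * norm v" by (rule Cauchy_Schwarz_ineq2)
      also have "\<dots> \<le> (\<delta> * norm v) * norm v" by (rule mult_right_mono[OF xv]) simp
      finally show ?thesis by (simp add: power2_eq_square mult.assoc)
    qed
    have "x u1 \<bullet> u1 \<ge> 0" using pos_proj_nonneg[OF x(2-4), of u1] pu1 by (simp add: p_def)
    moreover have "(a - c') u1 \<bullet> u1 = x u1 \<bullet> u1 - \<delta> / 2 * (norm u1)\<^sup>2"
      by (simp add: c'_def x_def blinfun.bilinear_simps zu inner_diff_left inner_add_left power2_norm_eq_inner)
    ultimately have 1: "\<bar>(a - c') u1 \<bullet> u1\<bar> \<le> \<delta> / 2 * (norm u1)\<^sup>2" using b[OF eu1] unfolding abs_le_iff by linarith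
    have "x u2 \<bullet> u2 \<le> 0" by (rule pos_proj_nonpos[OF x(2-4)]) (use pu2 in \<open>simp add: p_def\<close>)
    moreover have "(a - c') u2 \<bullet> u2 = x u2 \<bullet> u2 + \<delta> / 2 * (norm u2)\<^sup>2"
      by (simp add: c'_def x_def blinfun.bilinear_simps zu inner_diff_left inner_add_left power2_norm_eq_inner)
    ultimately have 2: "\<bar>(a - c') u2 \<bullet> u2\<bar> \<le> \<delta> / 2 * (norm u2)\<^sup>2" using b[OF eu2] unfolding abs_le_iff by linarith
    have "(a - c') u \<bullet> u = (a - c') u1 \<bullet> u1 + (a - c') u2 \<bullet> u2"
      using cross unfolding u12 by (simp add: blinfun.add_right inner_add_left inner_add_right)
    hence "\<bar>t \<xi> \<bullet> \<xi>\<bar> \<le> \<delta> / 2 * ((norm u1)\<^sup>2 + (norm u2)\<^sup>2)"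
      unfolding form using 1 2 by (simp add: distrib_left)
    also have "(norm u1)\<^sup>2 + (norm u2)\<^sup>2 = (norm u)\<^sup>2"
      unfolding u1_def u2_def by (rule proj_pythagoras[OF prD(2)[OF prz], symmetric])
    also have "\<delta> / 2 * (norm u)\<^sup>2 \<le> \<delta> / 2 * (norm \<xi>)\<^sup>2"
      unfolding u_def using \<delta> norm_proj_le[OF prD(2)[OF e'], of \<xi>] by (intro mult_left_mono power_mono) auto
    finally show "\<bar>t \<xi> \<bullet> \<xi>\<bar> \<le> \<delta> / 2 * (norm \<xi>)\<^sup>2" .
  qed
  have "e \<odot> e' = e'" by (simp add: e'_def prD[OF e(1)])
  thus ?thesis by (rule that[OF e' le _ Se' c' nt[unfolded t_def]])
qed

lemma norm_compose_le_proj: "is_proj e' \<Longrightarrow> e \<odot> e' = e' \<Longrightarrow> norm (T \<odot> e') \<le> norm (T \<odot> e)"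
proof -
  assume e: "is_proj e'" "e \<odot> e' = e'"
  have "norm (T \<odot> e') = norm (T \<odot> e \<odot> e')" by (simp add: blinfun_compose_assoc e(2))
  also have "\<dots> \<le> norm (T \<odot> e) * norm e'" by (rule norm_blinfun_compose)
  also have "\<dots> \<le> norm (T \<odot> e) * 1" by (intro mult_left_mono norm_is_proj e) simp
  finally show ?thesis by simp
qed

text \<open>An isometry of \<open>M\<close> maps the whole space into \<open>e\<close> and commutes
  with \<open>c\<close>, so compression to \<open>e\<close> does not shrink a central
  element.\<close>

lemma norm_cen_le:
  assumes c: "cen c" and e: "id_blinfun \<preceq> e" shows "norm c \<le> norm (c \<odot> e)"
proof -
  obtain v where v: "v \<in> M" "v\<^sup>\<dagger> \<odot> v = id_blinfun" "e \<odot> v = v" using e by (auto simp: sube_def)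
  have vu: "norm (v x) = norm x" for x
  proof -
    have "(norm (v x))\<^sup>2 = (norm x)\<^sup>2" unfolding norm_apply_sq v(2) by (simp add: power2_norm_eq_inner)
    thus ?thesis by simp
  qed
  show ?thesis
  proof (rule norm_blinfun_bound)
    fix x
    have "norm (c x) = norm (v (c x))" by (simp add: vu)
    also have "v (c x) = (c \<odot> e) (v x)" using cenD(3)[OF c v(1)] v(3)
      by (metis blinfun_apply_blinfun_compose)
    also have "norm \<dots> \<le> norm (c \<odot> e) * norm (v x)" by (rule norm_blinfun)
    finally show "norm (c x) \<le> norm (c \<odot> e) * norm x" by (simp add: vu)
  qed simp
qed

text \<open>\<open>c m\<close> and \<open>c n\<close> both approximate \<open>a\<close> on the
  smaller projection, where by \<open>norm_cen_le\<close> their difference keeps its full norm; so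
  \<open>c\<close> is Cauchy. The 3 adds the error of \<open>c n\<close> and twice as much for its
  distance from the limit.\<close>

lemma nested_center_limit:
  assumes e: "\<And>n. pr (e n)" "\<And>n. id_blinfun \<preceq> e n" "\<And>n. e n \<odot> e (Suc n) = e (Suc n)"
    and c: "\<And>n. cen (c n)" and b: "\<And>n. norm ((a - c n) \<odot> e n) \<le> K / 2 ^ n" and K: "K \<ge> 0"
  obtains d where "cen d" "\<And>n. norm ((a - d) \<odot> e n) \<le> 3 * K / 2 ^ n"
proof -
  have dec: "e n \<odot> e m = e m" if "n \<le> m" for n m
    using that
  proof (induction m rule: dec_induct)
    case base show ?case using prD[OF e(1)] by simp
  next
    case (step m)
    have "e n \<odot> e (Suc m) = e n \<odot> (e m \<odot> e (Suc m))" by (simp only: e(3))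
    also have "\<dots> = (e n \<odot> e m) \<odot> e (Suc m)" by (simp only: blinfun_compose_assoc)
    also have "\<dots> = e (Suc m)" by (simp only: step.IH e(3))
    finally show ?case .
  qed
  have pw: "K / 2 ^ m \<le> K / 2 ^ n" if "n \<le> m" for n m :: nat
    using that K by (intro divide_left_mono power_increasing) auto
  have d: "norm (c m - c n) \<le> 2 * K / 2 ^ n" if "n \<le> m" for n m
  proof -
    have "norm (c m - c n) \<le> norm ((c m - c n) \<odot> e m)" by (rule norm_cen_le[OF cen_diff[OF c c] e(2)])
    also have "(c m - c n) \<odot> e m = (a - c n) \<odot> e m - (a - c m) \<odot> e m" by (simp add: blinfun_compose_algebra)
    also have "norm \<dots> \<le> norm ((a - c n) \<odot> e m) + norm ((a - c m) \<odot> e m)" by (rule norm_triangle_ineq4)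
    also have "norm ((a - c n) \<odot> e m) \<le> norm ((a - c n) \<odot> e n)"
      by (rule norm_compose_le_proj[OF prD(2)[OF e(1)] dec[OF that]])
    finally show ?thesis using b[of n] b[of m] pw[OF that] by linarith
  qed
  have lim0: "(\<lambda>n. 2 * K / 2 ^ n) \<longlonglongrightarrow> 0"
    using tendsto_mult_right_zero[OF LIMSEQ_inverse_realpow_zero[of 2], of "2 * K"] by (simp add: divide_inverse)
  have "Cauchy c"
  proof (rule metric_CauchyI)
    fix \<epsilon> :: real assume "\<epsilon> > 0"
    then obtain N where N: "\<And>n. n \<ge> N \<Longrightarrow> 2 * K / 2 ^ n < \<epsilon>"
      using order_tendstoD(2)[OF lim0] unfolding eventually_sequentially by blast
    have le: "dist (c m) (c n) < \<epsilon>" if "n \<ge> N" "n \<le> m" for m n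
      using d[OF that(2)] N[OF that(1)] by (simp add: dist_norm)
    show "\<exists>N. \<forall>m\<ge>N. \<forall>n\<ge>N. dist (c m) (c n) < \<epsilon>"
      by (metis le dist_commute linear)
  qed
  then obtain l where l: "c \<longlonglongrightarrow> l" using Cauchy_convergent convergent_def by blast
  have lS: "stends c l sequentially" unfolding stends_def
    by (rule allI) (rule bounded_linear.tendsto[OF blinfun.bounded_linear_left l])
  have "cen l" unfolding cen_def
  proof (intro conjI ballI)
    show "l \<in> M" by (rule M_stends[OF lS]) (use cenD(1)[OF c] in auto)
    have "(\<lambda>n. (c n)\<^sup>\<dagger>) \<longlonglongrightarrow> l\<^sup>\<dagger>" by (rule bounded_linear.tendsto[OF bounded_linear_hadj l])
    hence "c \<longlonglongrightarrow> l\<^sup>\<dagger>" by (simp add: cenD(2)[OF c])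
    thus "l\<^sup>\<dagger> = l" by (rule LIMSEQ_unique[OF _ l])
    fix T assume T: "T \<in> M"
    have "(\<lambda>n. T \<odot> c n) \<longlonglongrightarrow> T \<odot> l" "(\<lambda>n. c n \<odot> T) \<longlonglongrightarrow> l \<odot> T"
      by (intro bounded_bilinear.tendsto[OF bounded_bilinear_blinfun_compose] tendsto_const l)+
    thus "T \<odot> l = l \<odot> T" unfolding cenD(3)[OF c T] by (rule LIMSEQ_unique)
  qed
  moreover have "norm ((a - l) \<odot> e n) \<le> 3 * K / 2 ^ n" for n
  proof -
    have "(\<lambda>m. norm (c m - c n)) \<longlonglongrightarrow> norm (l - c n)" by (intro tendsto_intros l)
    hence dl: "norm (l - c n) \<le> 2 * K / 2 ^ n"
      by (rule LIMSEQ_le_const2) (use d in blast)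
    have "(a - l) \<odot> e n = (a - c n) \<odot> e n - (l - c n) \<odot> e n" by (simp add: blinfun_compose_algebra)
    also have "norm \<dots> \<le> norm ((a - c n) \<odot> e n) + norm ((l - c n) \<odot> e n)" by (rule norm_triangle_ineq4)
    also have "norm ((l - c n) \<odot> e n) \<le> norm (l - c n) * 1"
      using norm_blinfun_compose[of "l - c n" "e n"] norm_is_proj[OF prD(2)[OF e(1)], of n]
      by (meson mult_left_mono norm_ge_zero order_trans)
    finally show ?thesis using dl b[of n] by (simp add: add_divide_distrib[symmetric])
  qed
  ultimately show ?thesis using that by blast
qed

text \<open>\<open>w\<close> moves the complement of the range of \<open>f\<close> into
  \<open>e\<close>. For a unitary, the rest of the space must then match the range of
  \<open>f\<close>; it is large enough because \<open>w \<odot> f\<close> embeds the identity into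
  it.\<close>

lemma ex_unitary_compressing:
  assumes e: "pr e" "id_blinfun \<preceq> e" and f: "f \<in> M" "f\<^sup>\<dagger> \<odot> f = id_blinfun"
  obtains u where "u \<in> M" "is_uni u"
    "e \<odot> (u\<^sup>\<dagger> \<odot> (id_blinfun - f \<odot> f\<^sup>\<dagger>)) = u\<^sup>\<dagger> \<odot> (id_blinfun - f \<odot> f\<^sup>\<dagger>)"
proof -
  define g where "g = f \<odot> f\<^sup>\<dagger>"
  define q where "q = id_blinfun - g"
  have g: "pr g" using pr_pisom[OF f(1)] f(2) by (simp add: g_def is_pisom_iff)
  have q: "pr q" unfolding q_def by (rule pr_compl[OF g])
  have qf: "q \<odot> f = 0" by (simp add: q_def g_def op_simps f(2))
  have fq: "f\<^sup>\<dagger> \<odot> q = 0" using arg_cong[OF qf, of hadj] by (simp add: prD(4)[OF q])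
  obtain w where w: "w \<in> M" "w\<^sup>\<dagger> \<odot> w = id_blinfun" "w \<odot> w\<^sup>\<dagger> = e" by (rule eqv_id_of_sube[OF e])
  have wa: "w\<^sup>\<dagger> \<odot> (w \<odot> T) = T" "f\<^sup>\<dagger> \<odot> (f \<odot> T) = T" for T by (simp_all add: w f op_simps flip: blinfun_compose_assoc)
  define p where "p = w \<odot> q \<odot> w\<^sup>\<dagger>"
  have p: "pr p" unfolding pr_def is_proj_def p_def
    by (auto intro!: M_intros w prD(1)[OF q] simp: blinfun_compose_assoc prD[OF q] wa)
  have "id_blinfun \<preceq> id_blinfun - p"
  proof (rule subeI[of "w \<odot> f"])
    show "w \<odot> f \<in> M" by (intro M_intros w f)
    show "(w \<odot> f)\<^sup>\<dagger> \<odot> (w \<odot> f) = id_blinfun" by (simp add: blinfun_compose_assoc wa f(2))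
    show "(id_blinfun - p) \<odot> (w \<odot> f) = w \<odot> f" by (simp add: p_def op_simps wa qf)
  qed
  then obtain y where y: "y \<in> M" "y\<^sup>\<dagger> \<odot> y = id_blinfun" "y \<odot> y\<^sup>\<dagger> = id_blinfun - p"
    by (rule eqv_id_of_sube[OF pr_compl[OF p]])
  have ya: "y\<^sup>\<dagger> \<odot> (y \<odot> T) = T" for T by (simp add: y op_simps flip: blinfun_compose_assoc)
  have py: "p \<odot> y = 0"
  proof -
    have "(id_blinfun - p) \<odot> y = y" by (simp add: blinfun_compose_assoc y(2) op_simps flip: y(3))
    thus ?thesis by (simp add: op_simps)
  qed
  have qwy: "q \<odot> (w\<^sup>\<dagger> \<odot> y) = 0"
  proof -
    have "w\<^sup>\<dagger> \<odot> (p \<odot> y) = q \<odot> (w\<^sup>\<dagger> \<odot> y)" by (simp add: p_def blinfun_compose_assoc wa)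
    thus ?thesis by (simp add: py)
  qed
  have ywq: "y\<^sup>\<dagger> \<odot> (w \<odot> q) = 0" using arg_cong[OF qwy, of hadj] by (simp add: prD(4)[OF q] blinfun_compose_assoc)
  define u where "u = q \<odot> w\<^sup>\<dagger> + f \<odot> y\<^sup>\<dagger>"
  have uh: "u\<^sup>\<dagger> = w \<odot> q + y \<odot> f\<^sup>\<dagger>" by (simp add: u_def prD(4)[OF q])
  have z: "q \<odot> (f \<odot> T) = 0" "f\<^sup>\<dagger> \<odot> (q \<odot> T) = 0" "q \<odot> (w\<^sup>\<dagger> \<odot> (y \<odot> T)) = 0" "y\<^sup>\<dagger> \<odot> (w \<odot> (q \<odot> T)) = 0" for T
    using qf fq qwy ywq by (metis blinfun_compose_assoc blinfun_compose_algebra(10))+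
  show ?thesis
  proof (rule that[of u])
    show "u \<in> M" unfolding u_def by (intro M_intros w f y prD(1)[OF q])
    have "u\<^sup>\<dagger> \<odot> u = w \<odot> (q \<odot> w\<^sup>\<dagger>) + y \<odot> y\<^sup>\<dagger>"
      by (simp add: uh u_def blinfun_compose_algebra(1,2) blinfun_compose_assoc prD[OF q] z wa blinfun_compose_algebra(9))
    hence 1: "u\<^sup>\<dagger> \<odot> u = id_blinfun" by (simp add: y(3) p_def blinfun_compose_assoc)
    have "u \<odot> u\<^sup>\<dagger> = q + f \<odot> f\<^sup>\<dagger>"
      by (simp add: uh) (simp add: u_def blinfun_compose_algebra(1,2) blinfun_compose_assoc prD[OF q] z wa ya ywq blinfun_compose_algebra(9))
    hence 2: "u \<odot> u\<^sup>\<dagger> = id_blinfun" by (simp add: q_def g_def)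
    show "is_uni u" using 1 2 by (simp add: is_uni_def)
    have uq: "u\<^sup>\<dagger> \<odot> q = w \<odot> q" by (simp add: uh blinfun_compose_algebra(1,9) blinfun_compose_assoc prD[OF q] fq)
    have "e \<odot> (w \<odot> q) = w \<odot> q" by (simp add: blinfun_compose_assoc wa flip: w(3))
    thus "e \<odot> (u\<^sup>\<dagger> \<odot> (id_blinfun - f \<odot> f\<^sup>\<dagger>)) = u\<^sup>\<dagger> \<odot> (id_blinfun - f \<odot> f\<^sup>\<dagger>)"
      using uq by (simp add: q_def g_def)
  qed
qed

theorem conjugates_tend_to_center:
  assumes a: "a \<in> M" "a\<^sup>\<dagger> = a" and b: "b \<in> M" "b\<^sup>\<dagger> = b" and ab: "a \<odot> b = b \<odot> a"
  obtains u c d where "\<And>n :: nat. u n \<in> M" "\<And>n. is_uni (u n)" "cen c" "cen d"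
    "stends (\<lambda>n. u n \<odot> a \<odot> (u n)\<^sup>\<dagger>) c sequentially" "stends (\<lambda>n. u n \<odot> b \<odot> (u n)\<^sup>\<dagger>) d sequentially"
proof -
  \<comment> \<open>Bounds the initial errors for \<open>e = id_blinfun\<close> and
    \<open>c = d = 0\<close>; adding 1 keeps it positive.\<close>
  define K where "K = norm a + norm b + 1"
  have K: "K > 0" unfolding K_def by (intro add_nonneg_pos) auto
  define P where "P = (\<lambda>(n::nat) (e, c, d). pr e \<and> id_blinfun \<preceq> e \<and> a \<odot> e = e \<odot> a \<and> b \<odot> e = e \<odot> b \<and>
    cen c \<and> cen d \<and> norm ((a - c) \<odot> e) \<le> K / 2 ^ n \<and> norm ((b - d) \<odot> e) \<le> K / 2 ^ n)"
  define Q where "Q = (\<lambda>(n::nat) (e :: 'a \<Rightarrow>\<^sub>L 'a, c :: 'a \<Rightarrow>\<^sub>L 'a, d :: 'a \<Rightarrow>\<^sub>L 'a) (e' :: 'a \<Rightarrow>\<^sub>L 'a, c' :: 'a \<Rightarrow>\<^sub>L 'a, d' :: 'a \<Rightarrow>\<^sub>L 'a). e \<odot> e' = e')"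
  have "\<exists>f. \<forall>n. P n (f n) \<and> Q n (f n) (f (Suc n))"
  proof (rule dependent_nat_choice)
    have "P 0 (id_blinfun, 0, 0)" using sube_refl[of id_blinfun] by (simp add: P_def K_def blinfun_compose_algebra)
    thus "\<exists>x. P 0 x" by blast
    fix x n assume Px: "P n x"
    obtain e c d where x: "x = (e, c, d)" by (cases x)
    have h: "pr e" "id_blinfun \<preceq> e" "a \<odot> e = e \<odot> a" "b \<odot> e = e \<odot> b" "cen c" "cen d"
      "norm ((a - c) \<odot> e) \<le> K / 2 ^ n" "norm ((b - d) \<odot> e) \<le> K / 2 ^ n" using Px by (auto simp: P_def x)
    have Kn: "K / 2 ^ n > 0" using K by simp
    \<comment> \<open>First bisect for \<open>a\<close>, then refine for \<open>b\<close>; the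
      estimate for \<open>a\<close> persists on the smaller projection.\<close>
    obtain e1 c1 where 1: "pr e1" "id_blinfun \<preceq> e1" "e \<odot> e1 = e1"
      "\<And>S. S \<in> M \<Longrightarrow> S \<odot> a = a \<odot> S \<Longrightarrow> S \<odot> e = e \<odot> S \<Longrightarrow> S \<odot> e1 = e1 \<odot> S"
      "cen c1" "norm ((a - c1) \<odot> e1) \<le> K / 2 ^ n / 2"
      by (rule bisect_step[OF a h(1-3,5) Kn h(7)]) blast
    have a1: "a \<odot> e1 = e1 \<odot> a" by (rule 1(4)[OF a(1) refl h(3)])
    have b1: "b \<odot> e1 = e1 \<odot> b" by (rule 1(4)[OF b(1) ab[symmetric] h(4)])
    have "norm ((b - d) \<odot> e1) \<le> K / 2 ^ n"
      using norm_compose_le_proj[OF prD(2)[OF 1(1)] 1(3), of "b - d"] h(8) by linarith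
    from bisect_step[OF b 1(1,2) b1 h(6) Kn this] obtain e2 d2 where
      2: "pr e2" "id_blinfun \<preceq> e2" "e1 \<odot> e2 = e2"
      "\<And>S. S \<in> M \<Longrightarrow> S \<odot> b = b \<odot> S \<Longrightarrow> S \<odot> e1 = e1 \<odot> S \<Longrightarrow> S \<odot> e2 = e2 \<odot> S"
      "cen d2" "norm ((b - d2) \<odot> e2) \<le> K / 2 ^ n / 2" by blast
    have "a \<odot> e2 = e2 \<odot> a" by (rule 2(4)[OF a(1) ab a1])
    moreover have "b \<odot> e2 = e2 \<odot> b" by (rule 2(4)[OF b(1) refl b1])
    moreover have "norm ((a - c1) \<odot> e2) \<le> K / 2 ^ n / 2"
      using norm_compose_le_proj[OF prD(2)[OF 2(1)] 2(3), of "a - c1"] 1(6) by linarith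
    moreover have "e \<odot> e2 = e2" using 1(3) 2(3) by (metis blinfun_compose_assoc)
    ultimately have "P (Suc n) (e2, c1, d2) \<and> Q n x (e2, c1, d2)"
      using 1 2 by (simp add: P_def Q_def x field_simps)
    thus "\<exists>y. P (Suc n) y \<and> Q n x y" by blast
  qed
  then obtain F where F: "\<And>n. P n (F n)" "\<And>n. Q n (F n) (F (Suc n))" by blast
  define e where "e = (\<lambda>n. fst (F n))"
  define c where "c = (\<lambda>n. fst (snd (F n)))"
  define d where "d = (\<lambda>n. snd (snd (F n)))"
  have e: "pr (e n)" "id_blinfun \<preceq> e n" "e n \<odot> e (Suc n) = e (Suc n)" "cen (c n)" "cen (d n)"
    "norm ((a - c n) \<odot> e n) \<le> K / 2 ^ n" "norm ((b - d n) \<odot> e n) \<le> K / 2 ^ n" for n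
    using F(1)[of n] F(2)[of n] by (auto simp: P_def Q_def e_def c_def d_def split: prod.splits)
  obtain C where C: "cen C" "\<And>n. norm ((a - C) \<odot> e n) \<le> 3 * K / 2 ^ n"
    using nested_center_limit[OF e(1-4) e(6)] K by (metis less_imp_le)
  obtain D where D: "cen D" "\<And>n. norm ((b - D) \<odot> e n) \<le> 3 * K / 2 ^ n"
    using nested_center_limit[OF e(1-3,5,7)] K by (metis less_imp_le)
  obtain s where s: "\<And>b :: bool. s b \<in> M" "\<And>b. (s b)\<^sup>\<dagger> \<odot> s b = id_blinfun" "(s True)\<^sup>\<dagger> \<odot> s False = 0"
    by (rule ex_halving) blast
  \<comment> \<open>Isometries with mutually orthogonal ranges: the range of \<open>f n\<close> is
    the part that the n-th unitary need not compress, and its projection tends to 0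
    strongly.\<close>
  define f where "f = shift_seq (s True) (s False)"
  have f: "(f n)\<^sup>\<dagger> \<odot> f n = id_blinfun" "m \<noteq> n \<Longrightarrow> (f m)\<^sup>\<dagger> \<odot> f n = 0" for m n
    unfolding f_def using shift_seq[of "s True" id_blinfun "s False", OF s(2) _ _ s(3)] s(2)[of False]
    by (auto simp: blinfun_compose_algebra)
  have fM: "f n \<in> M" for n unfolding f_def by (induction n) (auto intro: M_intros s)
  have "\<forall>n. \<exists>u. u \<in> M \<and> is_uni u \<and>
      e n \<odot> (u\<^sup>\<dagger> \<odot> (id_blinfun - f n \<odot> (f n)\<^sup>\<dagger>)) = u\<^sup>\<dagger> \<odot> (id_blinfun - f n \<odot> (f n)\<^sup>\<dagger>)"
    using ex_unitary_compressing[OF e(1,2) fM f(1)] by metis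
  then obtain u where u: "\<And>n. u n \<in> M" "\<And>n. is_uni (u n)"
    "\<And>n. e n \<odot> ((u n)\<^sup>\<dagger> \<odot> (id_blinfun - f n \<odot> (f n)\<^sup>\<dagger>)) = (u n)\<^sup>\<dagger> \<odot> (id_blinfun - f n \<odot> (f n)\<^sup>\<dagger>)" by metis
  have lim: "stends (\<lambda>n. u n \<odot> x \<odot> (u n)\<^sup>\<dagger>) c sequentially"
    if c: "cen c" and b: "\<And>n. norm ((x - c) \<odot> e n) \<le> 3 * K / 2 ^ n" for x c
    unfolding stends_def
  proof
    fix \<xi>
    let ?g = "\<lambda>n. (f n \<odot> (f n)\<^sup>\<dagger>) \<xi>"
    have fi: "is_pisom (f n)" for n by (simp add: is_pisom_iff f(1))
    have g0: "(\<lambda>n. norm (?g n)) \<longlonglongrightarrow> 0" by (rule orth_ranges_tendsto_0[OF fi f(2)])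
    have "(\<lambda>n. 3 * K / 2 ^ n) \<longlonglongrightarrow> 0"
      using tendsto_mult_right_zero[OF LIMSEQ_inverse_realpow_zero[of 2], of "3 * K"] by (simp add: divide_inverse)
    hence "(\<lambda>n. 3 * K / 2 ^ n * (2 * norm \<xi>) + norm (x - c) * norm (?g n)) \<longlonglongrightarrow> 0 * (2 * norm \<xi>) + norm (x - c) * 0"
      by (intro tendsto_intros g0)
    hence l: "(\<lambda>n. 3 * K / 2 ^ n * (2 * norm \<xi>) + norm (x - c) * norm (?g n)) \<longlonglongrightarrow> 0" by simp
    \<comment> \<open>Outside the range of \<open>f n\<close>, the adjoint of \<open>u n\<close>
      carries vectors into \<open>e n\<close>, where \<open>x\<close> is close to \<open>c\<close>;
      the component in that range is small.\<close>
    have bound: "norm ((u n \<odot> x \<odot> (u n)\<^sup>\<dagger>) \<xi> - c \<xi>) \<le> 3 * K / 2 ^ n * (2 * norm \<xi>) + norm (x - c) * norm (?g n)" for n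
    proof -
      let ?q = "\<xi> - ?g n"
      have "u n \<odot> c \<odot> (u n)\<^sup>\<dagger> = c"
        using cenD(3)[OF c u(1)] by (simp add: blinfun_compose_assoc is_uniD[OF u(2)] op_simps)
      hence "c \<xi> = (u n \<odot> c \<odot> (u n)\<^sup>\<dagger>) \<xi>" by simp
      hence "(u n \<odot> x \<odot> (u n)\<^sup>\<dagger>) \<xi> - c \<xi> = u n ((x - c) ((u n)\<^sup>\<dagger> \<xi>))" by (simp add: blinfun.bilinear_simps)
      hence "norm ((u n \<odot> x \<odot> (u n)\<^sup>\<dagger>) \<xi> - c \<xi>) = norm ((x - c) ((u n)\<^sup>\<dagger> \<xi>))" by (simp add: norm_uni_apply[OF u(2)])
      also have "(u n)\<^sup>\<dagger> \<xi> = (u n)\<^sup>\<dagger> ?q + (u n)\<^sup>\<dagger> (?g n)" by (simp add: blinfun.diff_right)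
      also have "(u n)\<^sup>\<dagger> ?q = e n ((u n)\<^sup>\<dagger> ?q)"
        using arg_cong[OF u(3)[of n], of "\<lambda>T. blinfun_apply T \<xi>"] by (simp add: blinfun.diff_left)
      also have "norm ((x - c) (e n ((u n)\<^sup>\<dagger> ?q) + (u n)\<^sup>\<dagger> (?g n)))
          \<le> norm (((x - c) \<odot> e n) ((u n)\<^sup>\<dagger> ?q)) + norm ((x - c) ((u n)\<^sup>\<dagger> (?g n)))"
        by (simp add: blinfun.add_right norm_triangle_ineq)
      also have "norm (((x - c) \<odot> e n) ((u n)\<^sup>\<dagger> ?q)) \<le> 3 * K / 2 ^ n * (2 * norm \<xi>)"
      proof -
        have "norm (?g n) \<le> norm \<xi>" by (rule norm_proj_le[OF is_pisom_projs(2)[OF fi]])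
        hence "norm ?q \<le> 2 * norm \<xi>" using norm_triangle_ineq4[of \<xi> "?g n"] by linarith
        hence "norm ((u n)\<^sup>\<dagger> ?q) \<le> 2 * norm \<xi>" by (simp add: norm_uni_apply[OF is_uni_hadj[OF u(2)]])
        thus ?thesis using norm_blinfun[of "(x - c) \<odot> e n" "(u n)\<^sup>\<dagger> ?q"] b[of n] K
          by (meson mult_mono norm_ge_zero order_trans divide_nonneg_pos)
      qed
      also have "norm ((x - c) ((u n)\<^sup>\<dagger> (?g n))) \<le> norm (x - c) * norm (?g n)"
        using norm_blinfun[of "x - c" "(u n)\<^sup>\<dagger> (?g n)"] norm_uni_apply[OF is_uni_hadj[OF u(2)], of n "?g n"] by simp
      finally show ?thesis by simp
    qed
    have "(\<lambda>n. (u n \<odot> x \<odot> (u n)\<^sup>\<dagger>) \<xi> - c \<xi>) \<longlonglongrightarrow> 0"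
      by (rule Lim_null_comparison[OF always_eventually l]) (rule allI, rule bound)
    thus "(\<lambda>n. (u n \<odot> x \<odot> (u n)\<^sup>\<dagger>) \<xi>) \<longlonglongrightarrow> c \<xi>" by (rule LIM_zero_cancel)
  qed
  show ?thesis by (rule that[OF u(1,2) C(1) D(1) lim[OF C] lim[OF D]])
qed

end

subsection \<open>Complex structure\<close>

lemma cinner_scaleC_right: "cinner x (c *\<^sub>C y) = cnj c * cinner x y"
proof -
  have "cinner x (c *\<^sub>C y) = cnj (cinner (c *\<^sub>C y) x)" by (rule cinner_commute)
  also have "\<dots> = cnj c * cnj (cinner y x)" by (simp add: cinner_scaleC_left)
  also have "cnj (cinner y x) = cinner x y" by (rule cinner_commute[symmetric])
  finally show ?thesis .
qed

definition imul :: "'a::complex_hilbert_space \<Rightarrow>\<^sub>L 'a" where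
  "imul = Blinfun (\<lambda>x. \<i> *\<^sub>C x)"

lemma imul_apply [simp]: "imul x = \<i> *\<^sub>C (x :: 'a::complex_hilbert_space)"
proof -
  have "bounded_linear (\<lambda>x :: 'a. \<i> *\<^sub>C x)"
  proof (rule bounded_linear_intro)
    fix x y :: 'a and r
    show "\<i> *\<^sub>C (x + y) = \<i> *\<^sub>C x + \<i> *\<^sub>C y" by (rule scaleC_add_right)
    show "\<i> *\<^sub>C (r *\<^sub>R x) = r *\<^sub>R (\<i> *\<^sub>C x)"
      by (simp add: scaleC_scaleC mult.commute flip: scaleC_of_real)
    have "(\<i> *\<^sub>C x) \<bullet> (\<i> *\<^sub>C x) = x \<bullet> x"
      by (simp add: inner_eq_Re_cinner cinner_scaleC_left cinner_scaleC_right)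
    thus "norm (\<i> *\<^sub>C x) \<le> norm x * 1" by (simp add: norm_eq_sqrt_inner)
  qed
  thus ?thesis unfolding imul_def by (simp add: bounded_linear_Blinfun_apply)
qed

lemma scaleC_eq: "c *\<^sub>C x = Re c *\<^sub>R x + Im c *\<^sub>R imul x"
proof -
  have "c *\<^sub>C x = (complex_of_real (Re c) + complex_of_real (Im c) * \<i>) *\<^sub>C x"
    using complex_eq[of c] by (simp only: mult.commute)
  thus ?thesis by (simp only: scaleC_add_left scaleC_of_real imul_apply flip: scaleC_scaleC)
qed

lemma imul_imul: "imul \<odot> imul = - id_blinfun"
proof (rule blinfun_eqI)
  fix x :: 'a
  have "(imul \<odot> imul) x = (- 1 :: complex) *\<^sub>C x" by (simp add: scaleC_scaleC)
  also have "\<dots> = complex_of_real (- 1) *\<^sub>C x" by simp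
  also have "\<dots> = - x" unfolding scaleC_of_real by simp
  finally show "(imul \<odot> imul) x = (- id_blinfun) x" by (simp add: blinfun.minus_left)
qed

lemma imul_hadj: "imul\<^sup>\<dagger> = - imul"
  by (rule hadj_eqI)
    (simp add: inner_eq_Re_cinner[of "\<i> *\<^sub>C _"] cinner_scaleC_left blinfun.minus_left,
     simp add: inner_eq_Re_cinner cinner_scaleC_right)

lemma norm_imul_le: "norm imul \<le> 1"
  by (rule norm_blinfun_bound)
    (simp_all add: norm_eq_sqrt_inner inner_eq_Re_cinner cinner_scaleC_left cinner_scaleC_right)

lemma bounded_operators_iff: "T \<in> bounded_operators \<longleftrightarrow> T \<odot> imul = imul \<odot> T"
proof
  assume "T \<in> bounded_operators"
  thus "T \<odot> imul = imul \<odot> T" by (intro blinfun_eqI) (simp add: bounded_operators_def)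
next
  assume c: "T \<odot> imul = imul \<odot> T"
  have "blinfun_apply T (imul x) = imul (blinfun_apply T x)" for x using c by (metis blinfun_apply_blinfun_compose)
  thus "T \<in> bounded_operators"
    unfolding bounded_operators_def by (simp only: scaleC_eq blinfun.bilinear_simps mem_Collect_eq simp_thms)
qed

lemma hadj_bounded_operators: "T \<in> bounded_operators \<Longrightarrow> T\<^sup>\<dagger> \<in> bounded_operators"
proof -
  assume "T \<in> bounded_operators"
  hence "(T \<odot> imul)\<^sup>\<dagger> = (imul \<odot> T)\<^sup>\<dagger>" by (simp only: bounded_operators_iff)
  thus ?thesis by (simp add: bounded_operators_iff imul_hadj blinfun_compose_algebra)
qed

lemma Im_cinner: "Im (cinner x y) = x \<bullet> imul y"
  by (simp add: inner_eq_Re_cinner cinner_scaleC_right)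

text \<open>The imaginary part of \<open>cinner x y\<close> is the real inner product with
  \<open>imul y\<close>, so a real adjoint that commutes with \<open>imul\<close> serves the complex
  inner product as well.\<close>

lemma adj_eq_hadj:
  assumes "T \<in> bounded_operators" shows "adj T = T\<^sup>\<dagger>"
  unfolding adj_def
proof (rule the_equality)
  have "T\<^sup>\<dagger> (imul y) = imul (T\<^sup>\<dagger> y)" for y
    using hadj_bounded_operators[OF assms] unfolding bounded_operators_iff by (metis blinfun_apply_blinfun_compose)
  hence "Im (cinner (blinfun_apply T x) y) = Im (cinner x (T\<^sup>\<dagger> y))" for x y
    unfolding Im_cinner inner_hadj by simp
  moreover have "Re (cinner (blinfun_apply T x) y) = Re (cinner x (T\<^sup>\<dagger> y))" for x y
    by (simp only: inner_eq_Re_cinner[symmetric] inner_hadj)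
  ultimately show "\<forall>x y. cinner (blinfun_apply T x) y = cinner x (blinfun_apply (T\<^sup>\<dagger>) y)"
    by (intro allI complex_eqI)
  fix S assume "\<forall>x y. cinner (blinfun_apply T x) y = cinner x (blinfun_apply S y)"
  hence "T\<^sup>\<dagger> = S" by (intro hadj_eqI) (simp add: inner_eq_Re_cinner)
  thus "S = T\<^sup>\<dagger>" by simp
qed

context
  fixes M :: "('a::complex_hilbert_space \<Rightarrow>\<^sub>L 'a) set"
  assumes M: "von_neumann_algebra M"
begin

lemma M_bounded: "T \<in> M \<Longrightarrow> T \<in> bounded_operators"
  using M by (auto simp: von_neumann_algebra_def)

lemma imul_M: "imul \<in> M"
proof -
  have "imul \<in> commutant (commutant M)"
    by (auto simp: commutant_def bounded_operators_iff)
  thus ?thesis using M by (simp add: von_neumann_algebra_def)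
qed

lemma comm_eq_commutant: "comm M = commutant M"
  using imul_M by (auto simp: comm_def commutant_def bounded_operators_iff)

lemma vna_M: "vna M"
proof
  show "T\<^sup>\<dagger> \<in> M" if "T \<in> M" for T
    using M that adj_eq_hadj[OF M_bounded[OF that]] by (auto simp: von_neumann_algebra_def)
  fix T assume T: "\<And>S. S \<in> comm M \<Longrightarrow> S \<odot> T = T \<odot> S"
  \<comment> \<open>\<open>imul\<close> commutes with \<open>M\<close>, so testing \<open>T\<close>
    against it yields complex linearity.\<close>
  have "imul \<in> comm M" using M_bounded by (auto simp: comm_def bounded_operators_iff)
  from T[OF this] T have "T \<in> commutant (commutant M)"
    unfolding comm_eq_commutant commutant_def[of "commutant M"] by (auto simp: bounded_operators_iff)
  thus "T \<in> M" using M by (simp add: von_neumann_algebra_def)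
qed

interpretation vna M by (rule vna_M)

lemma adj_M: "T \<in> M \<Longrightarrow> adj T = T\<^sup>\<dagger>"
  by (rule adj_eq_hadj[OF M_bounded])

lemma unitaries_eq: "unitaries M = {u \<in> M. is_uni u}"
  by (auto simp: unitaries_def is_uni_def adj_M)

lemma unitary_orbit_eq: "unitary_orbit M h = {u \<odot> h \<odot> u\<^sup>\<dagger> | u. u \<in> M \<and> is_uni u}"
  unfolding unitary_orbit_def unitaries_eq by (metis (mono_tags, lifting) mem_Collect_eq adj_M)

lemma projections_eq: "projections M = {p. pr p}"
  by (auto simp: projections_def pr_def is_proj_def adj_M)

lemma mvn_equivalent_eq: "mvn_equivalent M p q \<longleftrightarrow> p \<asymp> q"
  unfolding mvn_equivalent_def eqv_def by (intro bex_cong refl) (simp add: adj_M)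

lemma center_eq: "center M = {c \<in> M. \<forall>T\<in>M. T \<odot> c = c \<odot> T}"
  unfolding center_def comm_eq_commutant[symmetric] by (auto simp: comm_def)

lemma finite_vna_M:
  assumes "finite_algebra M" shows "finite_vna M"
proof
  fix v assume v: "v \<in> M" "v\<^sup>\<dagger> \<odot> v = id_blinfun"
  have "pr (v \<odot> v\<^sup>\<dagger>)" using pr_pisom[OF v(1)] v(2) by (simp add: is_pisom_iff)
  moreover have "v \<odot> v\<^sup>\<dagger> \<asymp> id_blinfun" by (rule eqvI[OF M_hadj[OF v(1)]]) (simp_all add: v)
  ultimately show "v \<odot> v\<^sup>\<dagger> = id_blinfun"
    using assms unfolding finite_algebra_def finite_projection_def projections_eq mvn_equivalent_eq
    by (simp add: blinfun_compose_algebra)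
qed

lemma properly_infinite_vna_M:
  assumes "properly_infinite_algebra M" shows "properly_infinite_vna M"
proof
  fix z assume z: "central z" "z \<noteq> 0"
  have "z \<in> projections M \<inter> center M" using z(1) by (auto simp: projections_eq center_eq central_def pr_def)
  hence "infinite_projection M z" using assms z(2) by (auto simp: properly_infinite_algebra_def)
  then obtain q where q: "pr q" "z \<odot> q = q" "q \<asymp> z" "q \<noteq> z"
    unfolding infinite_projection_def finite_projection_def projections_eq mvn_equivalent_eq by auto
  obtain v where v: "v \<in> M" "v\<^sup>\<dagger> \<odot> v = z" "v \<odot> v\<^sup>\<dagger> = q" using eqv_sym[OF q(3)] by (auto simp: eqv_def)
  have "q \<odot> v = v" by (rule pisom_final(1)[OF v(2,3) prD(2)[OF centralD(1)[OF z(1)]]])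
  hence "z \<odot> v = v" using q(2) by (metis blinfun_compose_assoc)
  thus "\<exists>v\<in>M. v\<^sup>\<dagger> \<odot> v = z \<and> z \<odot> v = v \<and> v \<odot> v\<^sup>\<dagger> \<noteq> z" using v q(4) by blast
qed

end

subsection \<open>Closures in the operator topologies\<close>

text \<open>The net is indexed by a finite set of vectors together with a precision.\<close>

lemma sot_closure_approx:
  fixes x :: "'a::real_normed_vector \<Rightarrow>\<^sub>L 'b::real_normed_vector"
  assumes "x \<in> strong_operator_topology closure_of S"
  obtains f :: "'a set \<times> nat \<Rightarrow> 'a \<Rightarrow>\<^sub>L 'b" where "\<And>i. f i \<in> S"
    "stends f x (finite_subsets_at_top UNIV \<times>\<^sub>F sequentially)"
proof -
  have "\<exists>T\<in>S. finite (fst i) \<longrightarrow> (\<forall>\<xi>\<in>fst i. dist (blinfun_apply T \<xi>) (x \<xi>) < inverse (real (Suc (snd i))))"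
    for i :: "'a set \<times> nat"
  proof -
    \<comment> \<open>Infinite sets are eventually excluded by the filter; for them no closeness is
      required and any element of \<open>S\<close> serves.\<close>
    define X where "X = (if finite (fst i) then fst i else {})"
    have "openin strong_operator_topology
      {g :: 'a \<Rightarrow>\<^sub>L 'b. \<forall>\<xi>\<in>X. blinfun_apply g \<xi> \<in> ball (x \<xi>) (inverse (real (Suc (snd i))))}"
      by (rule strong_operator_topology_basis) (auto simp: X_def)
    moreover have "x \<in> {g. \<forall>\<xi>\<in>X. blinfun_apply g \<xi> \<in> ball (x \<xi>) (inverse (real (Suc (snd i))))}" by simp
    ultimately obtain T where "T \<in> S" "\<forall>\<xi>\<in>X. blinfun_apply T \<xi> \<in> ball (x \<xi>) (inverse (real (Suc (snd i))))"
      using assms unfolding in_closure_of by (metis (no_types, lifting) mem_Collect_eq)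
    thus ?thesis by (intro bexI[of _ T]) (auto simp: X_def dist_commute)
  qed
  then obtain f where f: "\<And>i. f i \<in> S"
    "\<And>i \<xi>. finite (fst i) \<Longrightarrow> \<xi> \<in> fst i \<Longrightarrow> dist (blinfun_apply (f i) \<xi>) (x \<xi>) < inverse (real (Suc (snd i)))"
    by metis
  have "stends f x (finite_subsets_at_top UNIV \<times>\<^sub>F sequentially)"
    unfolding stends_def tendsto_iff
  proof (intro allI impI)
    fix \<xi> :: 'a and e :: real assume "e > 0"
    have 1: "\<forall>\<^sub>F X in finite_subsets_at_top UNIV. finite X \<and> \<xi> \<in> X"
      unfolding eventually_finite_subsets_at_top by (intro exI[of _ "{\<xi>}"]) auto
    have 2: "\<forall>\<^sub>F n in sequentially. inverse (real (Suc n)) < e"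
      by (rule order_tendstoD(2)[OF LIMSEQ_inverse_real_of_nat \<open>e > 0\<close>])
    have "\<forall>\<^sub>F i in finite_subsets_at_top UNIV \<times>\<^sub>F sequentially.
        (finite (fst i) \<and> \<xi> \<in> fst i) \<and> inverse (real (Suc (snd i))) < e"
      by (rule eventually_prodI[OF 1 2])
    thus "\<forall>\<^sub>F i in finite_subsets_at_top UNIV \<times>\<^sub>F sequentially. dist (f i \<xi>) (x \<xi>) < e"
      by eventually_elim (use f(2) in \<open>blast intro: less_trans\<close>)
  qed
  with f(1) show ?thesis by (rule that)
qed

lemma closure_subset_sot_closure: "closure S \<subseteq> strong_operator_topology closure_of S"
proof (rule closure_minimal)
  show "S \<subseteq> strong_operator_topology closure_of S"
    by (rule closure_of_subset) (simp add: strong_operator_topology_topspace)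
  have "closedin euclidean {x \<in> topspace euclidean. x \<in> strong_operator_topology closure_of S}"
    by (rule closedin_continuous_map_preimage[OF strong_operator_topology_weaker_than_euclidean closedin_closure_of])
  thus "closed (strong_operator_topology closure_of S)"
    by (simp only: topspace_euclidean UNIV_I simp_thms Collect_mem_eq closed_closedin)
qed

lemma strong_star_closure_subset: "strong_star_topology closure_of S \<subseteq> strong_operator_topology closure_of S"
proof
  fix x assume x: "x \<in> strong_star_topology closure_of S"
  hence xB: "x \<in> bounded_operators"
    by (auto simp: in_closure_of strong_star_topology_def topspace_pullback_topology)
  show "x \<in> strong_operator_topology closure_of S"
    unfolding in_closure_of
  proof (intro conjI allI impI)
    show "x \<in> topspace strong_operator_topology" by (simp add: strong_operator_topology_topspace)
    fix V assume V: "x \<in> V \<and> openin strong_operator_topology V"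
    then obtain O' where O': "open O'" "V = blinfun_apply -` O'"
      by (auto simp: strong_operator_topology_def openin_pullback_topology)
    have "openin strong_star_topology (V \<inter> bounded_operators)"
      unfolding strong_star_topology_def openin_pullback_topology
      by (intro exI[of _ "O' \<times> UNIV"]) (auto simp: O' open_Times)
    thus "\<exists>y. y \<in> S \<and> y \<in> V" using x V xB unfolding in_closure_of by blast
  qed
qed

lemma tendsto_funI:
  fixes f :: "'i \<Rightarrow> 'b \<Rightarrow> 'c::topological_space"
  assumes "\<And>x. ((\<lambda>i. f i x) \<longlongrightarrow> g x) F" shows "(f \<longlongrightarrow> g) F"
proof -
  have "limitin (product_topology (\<lambda>_. euclidean) UNIV) f g F"
    using assms by (simp add: limitin_componentwise)
  thus ?thesis by (simp add: euclidean_product_topology)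
qed

lemma strong_star_closureI:
  fixes f :: "nat \<Rightarrow> 'a::complex_hilbert_space \<Rightarrow>\<^sub>L 'a"
  assumes S: "\<And>n. f n \<in> S" "\<And>n. f n \<in> bounded_operators" and x: "x \<in> bounded_operators"
    and l: "stends f x sequentially" "stends (\<lambda>n. (f n)\<^sup>\<dagger>) (x\<^sup>\<dagger>) sequentially"
  shows "x \<in> strong_star_topology closure_of S"
  unfolding in_closure_of
proof (intro conjI allI impI)
  show "x \<in> topspace strong_star_topology"
    using x by (simp add: strong_star_topology_def topspace_pullback_topology)
  fix V assume "x \<in> V \<and> openin strong_star_topology V"
  then obtain O' where O': "open O'" "V = (\<lambda>T. (blinfun_apply T, blinfun_apply (adj T))) -` O' \<inter> bounded_operators" "x \<in> V"
    by (auto simp: strong_star_topology_def openin_pullback_topology)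
  have "((\<lambda>n. (blinfun_apply (f n), blinfun_apply ((f n)\<^sup>\<dagger>))) \<longlongrightarrow> (blinfun_apply x, blinfun_apply (x\<^sup>\<dagger>))) sequentially"
    using l by (intro tendsto_Pair tendsto_funI) (auto simp: stends_def)
  moreover have "(blinfun_apply x, blinfun_apply (x\<^sup>\<dagger>)) \<in> O'" using O'(2,3) by (auto simp: adj_eq_hadj[OF x])
  ultimately have "\<forall>\<^sub>F n in sequentially. (blinfun_apply (f n), blinfun_apply ((f n)\<^sup>\<dagger>)) \<in> O'"
    using O'(1) by (intro topological_tendstoD)
  then obtain n where "(blinfun_apply (f n), blinfun_apply ((f n)\<^sup>\<dagger>)) \<in> O'"
    unfolding eventually_sequentially by blast
  hence "f n \<in> V" using S(2)[of n] by (simp add: O'(2) adj_eq_hadj[OF S(2)])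
  thus "\<exists>y. y \<in> S \<and> y \<in> V" using S(1) by blast
qed

lemma closed_bounded_operators: "closed (bounded_operators :: ('a::complex_hilbert_space \<Rightarrow>\<^sub>L 'a) set)"
proof -
  have "continuous_on UNIV (\<lambda>T :: 'a \<Rightarrow>\<^sub>L 'a. T \<odot> imul)" "continuous_on UNIV (\<lambda>T :: 'a \<Rightarrow>\<^sub>L 'a. imul \<odot> T)"
    by (intro bounded_bilinear.continuous_on[OF bounded_bilinear_blinfun_compose] continuous_intros)+
  hence "closed {T :: 'a \<Rightarrow>\<^sub>L 'a. T \<odot> imul = imul \<odot> T}" by (rule closed_Collect_eq)
  thus ?thesis by (simp add: bounded_operators_iff[symmetric])
qed

lemma closure_subset_strong_star_closure:
  assumes S: "S \<subseteq> bounded_operators"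
  shows "closure S \<subseteq> strong_star_topology closure_of S"
proof
  fix x assume "x \<in> closure S"
  then obtain f where f: "\<And>n. f n \<in> S" "f \<longlonglongrightarrow> x" unfolding closure_sequential by blast
  have "(\<lambda>n. (f n)\<^sup>\<dagger>) \<longlonglongrightarrow> x\<^sup>\<dagger>" by (rule bounded_linear.tendsto[OF bounded_linear_hadj f(2)])
  moreover have "stends g y sequentially" if "g \<longlonglongrightarrow> y" for g and y :: "'a \<Rightarrow>\<^sub>L 'a"
    unfolding stends_def by (rule allI) (rule bounded_linear.tendsto[OF blinfun.bounded_linear_left that])
  moreover have "x \<in> bounded_operators"
    by (rule closed_sequentially[OF closed_bounded_operators _ f(2)]) (use f(1) S in blast)
  ultimately show "x \<in> strong_star_topology closure_of S"
    using f S by (intro strong_star_closureI[of f]) auto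
qed

section \<open>Closures of the unitary orbit\<close>

context
  fixes M :: "('a::complex_hilbert_space \<Rightarrow>\<^sub>L 'a) set" and h :: "'a \<Rightarrow>\<^sub>L 'a"
  assumes M: "von_neumann_algebra M" and h: "h \<in> M" and normal: "normal_operator h"
begin

interpretation vna M by (rule vna_M[OF M])

text \<open>The formulas for \<open>a\<close> and \<open>b\<close> are exported because convergence
  of conjugates of \<open>h\<close> and of their adjoints is transferred to the parts through
  them.\<close>

lemma cartesian:
  obtains a b where "a \<in> M" "a\<^sup>\<dagger> = a" "b \<in> M" "b\<^sup>\<dagger> = b" "a \<odot> b = b \<odot> a" "h = a + imul \<odot> b"
    "a = (1/2) *\<^sub>R (h + h\<^sup>\<dagger>)" "b = - ((1/2) *\<^sub>R (imul \<odot> (h - h\<^sup>\<dagger>)))"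
proof -
  define a where "a = (1/2) *\<^sub>R (h + h\<^sup>\<dagger>)"
  define b where "b = - ((1/2) *\<^sub>R (imul \<odot> (h - h\<^sup>\<dagger>)))"
  have hJ: "h \<odot> imul = imul \<odot> h" "h\<^sup>\<dagger> \<odot> imul = imul \<odot> h\<^sup>\<dagger>"
    using M_bounded[OF M h] M_bounded[OF M M_hadj[OF h]] by (auto simp: bounded_operators_iff)
  have hJa: "h \<odot> (imul \<odot> T) = imul \<odot> (h \<odot> T)" "h\<^sup>\<dagger> \<odot> (imul \<odot> T) = imul \<odot> (h\<^sup>\<dagger> \<odot> T)" for T
    using hJ by (metis blinfun_compose_assoc)+
  have JJ: "imul \<odot> (imul \<odot> T) = - T" for T :: "'a \<Rightarrow>\<^sub>L 'a"
    by (simp add: imul_imul blinfun_compose_algebra flip: blinfun_compose_assoc)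
  have n: "h\<^sup>\<dagger> \<odot> h = h \<odot> h\<^sup>\<dagger>"
    using normal M_bounded[OF M h] by (simp add: normal_operator_def adj_eq_hadj)
  show ?thesis
  proof (rule that[OF _ _ _ _ _ _ a_def b_def])
    show "a \<in> M" unfolding a_def by (intro M_intros h)
    have "b = (- 1/2) *\<^sub>R (imul \<odot> (h - h\<^sup>\<dagger>))" by (simp add: b_def)
    thus "b \<in> M" by (simp only:) (intro M_intros h imul_M[OF M])
    show "a\<^sup>\<dagger> = a" by (simp add: a_def add.commute)
    show "b\<^sup>\<dagger> = b" by (simp add: b_def imul_hadj op_simps hJ algebra_simps)
    show "a \<odot> b = b \<odot> a" by (simp add: a_def b_def op_simps hJa n algebra_simps)
    show "h = a + imul \<odot> b" by (simp add: a_def b_def op_simps JJ algebra_simps flip: scaleR_add_left)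
  qed
qed

lemma orbit_sot_closure_center:
  assumes "h \<in> center M"
  shows "unitary_orbit M h = {h}" "strong_operator_topology closure_of unitary_orbit M h = {h}"
proof -
  have c: "T \<odot> h = h \<odot> T" if "T \<in> M" for T using assms that by (auto simp: center_eq[OF M])
  have "u \<odot> h \<odot> u\<^sup>\<dagger> = h" if "u \<in> M" "is_uni u" for u
    using c[OF that(1)] by (simp add: blinfun_compose_assoc is_uniD[OF that(2)] op_simps)
  moreover have "id_blinfun \<odot> h \<odot> id_blinfun\<^sup>\<dagger> = h" by (simp add: op_simps)
  moreover have "is_uni (id_blinfun :: 'a \<Rightarrow>\<^sub>L 'a)" by (simp add: is_uni_def op_simps)
  ultimately show 1: "unitary_orbit M h = {h}"
    unfolding unitary_orbit_eq[OF M] using M_id by (auto intro!: exI[of _ id_blinfun])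
  show "strong_operator_topology closure_of unitary_orbit M h = {h}"
  proof
    show "{h} \<subseteq> strong_operator_topology closure_of unitary_orbit M h"
      using closure_of_subset[of "{h}"] unfolding 1 by (auto simp: strong_operator_topology_topspace)
    show "strong_operator_topology closure_of unitary_orbit M h \<subseteq> {h}"
    proof
      fix x assume "x \<in> strong_operator_topology closure_of unitary_orbit M h"
      then obtain f :: "'a set \<times> nat \<Rightarrow> 'a \<Rightarrow>\<^sub>L 'a" where f: "\<And>i. f i \<in> {h}"
        "stends f x (finite_subsets_at_top UNIV \<times>\<^sub>F sequentially)" unfolding 1 by (rule sot_closure_approx) blast
      have "f = (\<lambda>_. h)" using f(1) by auto
      with f(2) have "stends (\<lambda>_ :: 'a set \<times> nat. h) x (finite_subsets_at_top UNIV \<times>\<^sub>F sequentially)" by (simp only:)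
      from stends_unique[OF this stends_const] have "x = h" by (simp add: prod_filter_eq_bot)
      thus "x \<in> {h}" by simp
    qed
  qed
qed

text \<open>Conjugating back fixes a central \<open>c\<close> and does not increase norms, so
  \<open>h\<close> is as close to \<open>c\<close> as its conjugates are.\<close>

lemma center_of_closure_meets_center:
  assumes "closure (unitary_orbit M h) \<inter> center M \<noteq> {}" shows "h \<in> center M"
proof -
  obtain c where c: "c \<in> closure (unitary_orbit M h)" "c \<in> center M" using assms by blast
  have "norm (h - c) < e" if e: "e > 0" for e
  proof -
    obtain u where u: "u \<in> M" "is_uni u" "dist (u \<odot> h \<odot> u\<^sup>\<dagger>) c < e"
      using c(1) e unfolding closure_approachable unitary_orbit_eq[OF M] by blast
    have "c \<odot> u = u \<odot> c" using c(2) u(1) by (simp add: center_eq[OF M])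
    hence uc: "u\<^sup>\<dagger> \<odot> (c \<odot> u) = c" by (simp add: is_uniD[OF u(2)])
    have "h - c = u\<^sup>\<dagger> \<odot> (u \<odot> h \<odot> u\<^sup>\<dagger> - c) \<odot> (u\<^sup>\<dagger>)\<^sup>\<dagger>"
      by (simp add: op_simps is_uniD[OF u(2)] uc)
    hence "norm (h - c) \<le> norm (u \<odot> h \<odot> u\<^sup>\<dagger> - c)" using norm_uni_conj_le[OF is_uni_hadj[OF u(2)]] by metis
    thus ?thesis using u(3) by (simp add: dist_norm)
  qed
  hence "h = c" by (metis less_irrefl right_minus_eq zero_less_norm_iff)
  thus ?thesis using c(2) by simp
qed

lemma finite_closure_closed:
  assumes fin: "finite_algebra M"
  shows "strong_operator_topology closure_of unitary_orbit M h \<subseteq> closure (unitary_orbit M h)"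
proof
  interpret finite_vna M by (rule finite_vna_M[OF M fin])
  fix x assume "x \<in> strong_operator_topology closure_of unitary_orbit M h"
  then obtain f :: "'a set \<times> nat \<Rightarrow> 'a \<Rightarrow>\<^sub>L 'a" where f: "\<And>i. f i \<in> unitary_orbit M h"
    "stends f x (finite_subsets_at_top UNIV \<times>\<^sub>F sequentially)" by (rule sot_closure_approx) blast
  let ?F = "finite_subsets_at_top (UNIV :: 'a set) \<times>\<^sub>F sequentially"
  have F: "?F \<noteq> bot" by (simp add: prod_filter_eq_bot)
  have "\<forall>i. \<exists>u. f i = u \<odot> h \<odot> u\<^sup>\<dagger> \<and> u \<in> M \<and> is_uni u" using f(1) by (auto simp: unitary_orbit_eq[OF M])
  then obtain u where u: "\<And>i. f i = u i \<odot> h \<odot> (u i)\<^sup>\<dagger>" "\<And>i. u i \<in> M" "\<And>i. is_uni (u i)" by metis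
  have fM: "f i \<in> M" for i unfolding u(1) by (intro M_intros u h)
  have xM: "x \<in> M" by (rule M_stends[OF f(2) F fM])
  have nf: "norm (f i) \<le> norm h" for i unfolding u(1) by (rule norm_uni_conj_le[OF u(3)])
  \<comment> \<open>With the adjoints also converging, the real and imaginary parts of the net
    converge separately.\<close>
  have fh: "stends (\<lambda>i. (f i)\<^sup>\<dagger>) (x\<^sup>\<dagger>) ?F" by (rule stends_hadj[OF f(2) fM nf xM])
  obtain a b where ab: "a \<in> M" "a\<^sup>\<dagger> = a" "b \<in> M" "b\<^sup>\<dagger> = b" "a \<odot> b = b \<odot> a" "h = a + imul \<odot> b"
    "a = (1/2) *\<^sub>R (h + h\<^sup>\<dagger>)" "b = - ((1/2) *\<^sub>R (imul \<odot> (h - h\<^sup>\<dagger>)))" by (rule cartesian)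
  define a' where "a' = (1/2) *\<^sub>R (x + x\<^sup>\<dagger>)"
  define b' where "b' = (- 1/2) *\<^sub>R (imul \<odot> (x - x\<^sup>\<dagger>))"
  have xJ: "x \<odot> imul = imul \<odot> x" "x\<^sup>\<dagger> \<odot> imul = imul \<odot> x\<^sup>\<dagger>"
    using M_bounded[OF M xM] M_bounded[OF M M_hadj[OF xM]] by (auto simp: bounded_operators_iff)
  have JJ: "imul \<odot> (imul \<odot> T) = - T" for T :: "'a \<Rightarrow>\<^sub>L 'a"
    by (simp add: imul_imul blinfun_compose_algebra flip: blinfun_compose_assoc)
  have a': "a' \<in> M" "a'\<^sup>\<dagger> = a'" by (auto simp: a'_def add.commute intro!: M_intros xM)
  have b'M: "b' \<in> M" unfolding b'_def by (intro M_intros xM imul_M[OF M])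
  have b'h: "b'\<^sup>\<dagger> = b'" by (simp add: b'_def imul_hadj op_simps xJ algebra_simps)
  have x: "x = a' + imul \<odot> b'" by (simp add: a'_def b'_def op_simps JJ algebra_simps flip: scaleR_add_left)
  have uJ: "u i \<odot> (imul \<odot> T) = imul \<odot> (u i \<odot> T)" for i T
    using M_bounded[OF M u(2)] unfolding bounded_operators_iff by (metis blinfun_compose_assoc)
  have fh': "(f i)\<^sup>\<dagger> = u i \<odot> h\<^sup>\<dagger> \<odot> (u i)\<^sup>\<dagger>" for i by (simp add: u(1) blinfun_compose_assoc)
  have la: "stends (\<lambda>i. u i \<odot> a \<odot> (u i)\<^sup>\<dagger>) a' ?F"
    using stends_scaleR[OF stends_add[OF f(2) fh], of "1/2"] unfolding ab(7) a'_def fh'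
    by (simp add: u(1) blinfun_compose_algebra)
  have "stends (\<lambda>i. imul \<odot> (f i - (f i)\<^sup>\<dagger>)) (imul \<odot> (x - x\<^sup>\<dagger>)) ?F"
    by (rule stends_compose[OF stends_const stends_diff[OF f(2) fh] norm_imul_le])
  from stends_scaleR[OF this, of "- 1/2"]
  have lb: "stends (\<lambda>i. u i \<odot> b \<odot> (u i)\<^sup>\<dagger>) b' ?F"
    unfolding ab(8) b'_def fh' by (simp add: u(1) op_simps uJ)
  show "x \<in> closure (unitary_orbit M h)"
    unfolding closure_approachable
  proof (intro allI impI)
    fix e :: real assume e: "e > 0"
    \<comment> \<open>A third for each of the two parts leaves the final inequality strict.\<close>
    obtain w where w: "w \<in> M" "is_uni w" "norm (w \<odot> a - a' \<odot> w) \<le> e / 3" "norm (w \<odot> b - b' \<odot> w) \<le> e / 3"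
      by (rule finite_unitary_approx[OF u(2,3) ab(1-5) a' b'M b'h la lb F, of "e / 3"]) (use e in auto)
    have wJ: "w \<odot> (imul \<odot> T) = imul \<odot> (w \<odot> T)" for T
      using M_bounded[OF M w(1)] unfolding bounded_operators_iff by (metis blinfun_compose_assoc)
    have "w \<odot> h - x \<odot> w = (w \<odot> a - a' \<odot> w) + imul \<odot> (w \<odot> b - b' \<odot> w)"
      unfolding ab(6) x by (simp add: op_simps wJ)
    also have "norm \<dots> \<le> norm (w \<odot> a - a' \<odot> w) + norm (imul \<odot> (w \<odot> b - b' \<odot> w))" by (rule norm_triangle_ineq)
    also have "norm (imul \<odot> (w \<odot> b - b' \<odot> w)) \<le> 1 * norm (w \<odot> b - b' \<odot> w)"
      by (rule order_trans[OF norm_blinfun_compose mult_right_mono[OF norm_imul_le]]) simp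
    finally have 1: "norm (w \<odot> h - x \<odot> w) \<le> e / 3 + e / 3" using w(3,4) by linarith
    have "w \<odot> h \<odot> w\<^sup>\<dagger> - x = (w \<odot> h - x \<odot> w) \<odot> w\<^sup>\<dagger>" by (simp add: op_simps is_uniD[OF w(2)])
    also have "norm \<dots> \<le> norm (w \<odot> h - x \<odot> w) * 1"
      by (rule order_trans[OF norm_blinfun_compose mult_left_mono[OF norm_uni_le[OF is_uni_hadj[OF w(2)]]]]) simp
    finally have "dist (w \<odot> h \<odot> w\<^sup>\<dagger>) x < e" using 1 e by (simp add: dist_norm)
    thus "\<exists>y\<in>unitary_orbit M h. dist y x < e" using w(1,2) unfolding unitary_orbit_eq[OF M] by blast
  qed
qed

text \<open>Both self-adjoint parts converge strongly along the same unitaries, and \<open>h\<close>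
  and its adjoint are built from these parts, so the convergence is strong* as well.\<close>

lemma strong_star_closure_meets_center:
  assumes "properly_infinite_algebra M"
  shows "strong_star_topology closure_of unitary_orbit M h \<inter> center M \<noteq> {}"
proof -
  interpret properly_infinite_vna M by (rule properly_infinite_vna_M[OF M assms])
  obtain a b where ab: "a \<in> M" "a\<^sup>\<dagger> = a" "b \<in> M" "b\<^sup>\<dagger> = b" "a \<odot> b = b \<odot> a" "h = a + imul \<odot> b"
    "a = (1/2) *\<^sub>R (h + h\<^sup>\<dagger>)" "b = - ((1/2) *\<^sub>R (imul \<odot> (h - h\<^sup>\<dagger>)))" by (rule cartesian)
  obtain u c d where u: "\<And>n :: nat. u n \<in> M" "\<And>n. is_uni (u n)" and cd: "cen c" "cen d"
    and l: "stends (\<lambda>n. u n \<odot> a \<odot> (u n)\<^sup>\<dagger>) c sequentially" "stends (\<lambda>n. u n \<odot> b \<odot> (u n)\<^sup>\<dagger>) d sequentially"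
    by (rule conjugates_tend_to_center[OF ab(1-5)]) blast
  have J: "T \<odot> imul = imul \<odot> T" "T \<odot> (imul \<odot> S) = imul \<odot> (T \<odot> S)" if "T \<in> M" for T S :: "'a \<Rightarrow>\<^sub>L 'a"
    using M_bounded[OF M that] unfolding bounded_operators_iff by (auto, metis blinfun_compose_assoc)
  define x where "x = c + imul \<odot> d"
  have xM: "x \<in> M" unfolding x_def by (intro M_intros cenD cd imul_M[OF M])
  have "T \<odot> x = x \<odot> T" if "T \<in> M" for T
    using cenD(3)[OF cd(1) that] cenD(3)[OF cd(2) that] by (simp add: x_def op_simps J(2)[OF that])
  hence xc: "x \<in> center M" using xM by (simp add: center_eq[OF M])
  have J': "(imul \<odot> T)\<^sup>\<dagger> = - (imul \<odot> T)" if "T \<in> M" "T\<^sup>\<dagger> = T" for T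
    using that by (simp add: imul_hadj J(1) blinfun_compose_algebra)
  have lJ: "stends (\<lambda>n. imul \<odot> (u n \<odot> b \<odot> (u n)\<^sup>\<dagger>)) (imul \<odot> d) sequentially"
    by (rule stends_compose[OF stends_const l(2) norm_imul_le])
  have 1: "stends (\<lambda>n. u n \<odot> h \<odot> (u n)\<^sup>\<dagger>) x sequentially"
    using stends_add[OF l(1) lJ] unfolding ab(6) x_def by (simp add: op_simps J(2)[OF u(1)])
  have xh: "x\<^sup>\<dagger> = c - imul \<odot> d" by (simp add: x_def cenD(2)[OF cd(1)] J'[OF cenD(1,2)[OF cd(2)]] del: hadj_simps(1))
  have hh: "h\<^sup>\<dagger> = a - imul \<odot> b" by (simp add: ab(6) ab(2) J'[OF ab(3,4)] del: hadj_simps(1))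
  have 2: "stends (\<lambda>n. (u n \<odot> h \<odot> (u n)\<^sup>\<dagger>)\<^sup>\<dagger>) (x\<^sup>\<dagger>) sequentially"
    using stends_diff[OF l(1) lJ] unfolding xh by (simp add: hh op_simps J(2)[OF u(1)])
  have "x \<in> strong_star_topology closure_of unitary_orbit M h"
  proof (rule strong_star_closureI[OF _ _ _ 1 2])
    show "u n \<odot> h \<odot> (u n)\<^sup>\<dagger> \<in> unitary_orbit M h" for n unfolding unitary_orbit_eq[OF M] using u by blast
    show "u n \<odot> h \<odot> (u n)\<^sup>\<dagger> \<in> bounded_operators" for n by (intro M_bounded[OF M] M_intros u h)
    show "x \<in> bounded_operators" by (rule M_bounded[OF M xM])
  qed
  thus ?thesis using xc by blast
qed

end

theorem theorem8p2:
  fixes M :: "('a::complex_hilbert_space \<Rightarrow>\<^sub>L 'a) set" and h :: "'a \<Rightarrow>\<^sub>L 'a"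
  assumes "von_neumann_algebra M"
    and "h \<in> M"
    and "normal_operator h"
  shows "(finite_algebra M \<longrightarrow>
            closedin strong_operator_topology (closure (unitary_orbit M h)))
       \<and> (properly_infinite_algebra M \<longrightarrow>
            (closure (unitary_orbit M h) \<inter> center M \<noteq> {} \<longleftrightarrow> h \<in> center M)
          \<and> (h \<in> center M \<longleftrightarrow>
               closure (unitary_orbit M h) = strong_operator_topology closure_of unitary_orbit M h)
          \<and> (closure (unitary_orbit M h) = strong_operator_topology closure_of unitary_orbit M h \<longleftrightarrow>
               closure (unitary_orbit M h) = strong_star_topology closure_of unitary_orbit M h))"
proof (intro conjI impI)
  let ?U = "unitary_orbit M h"
  let ?N = "closure ?U" and ?S = "strong_operator_topology closure_of ?U" and ?T = "strong_star_topology closure_of ?U"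
  interpret vna M by (rule vna_M[OF assms(1)])
  assume "finite_algebra M"
  from finite_closure_closed[OF assms this] closure_subset_sot_closure[of ?U]
  have "?N = ?S" by blast
  thus "closedin strong_operator_topology ?N" by simp
next
  let ?U = "unitary_orbit M h"
  let ?N = "closure ?U" and ?S = "strong_operator_topology closure_of ?U" and ?T = "strong_star_topology closure_of ?U"
  interpret vna M by (rule vna_M[OF assms(1)])
  assume inf: "properly_infinite_algebra M"
  have central: "?N \<inter> center M \<noteq> {} \<and> ?N = ?S" if "h \<in> center M"
    using orbit_sot_closure_center[OF assms that] that by simp
  have "?U \<subseteq> bounded_operators"
    unfolding unitary_orbit_eq[OF assms(1)] using assms(2) by (auto intro!: M_bounded[OF assms(1)] M_intros)
  \<comment> \<open>If the outer closures agree, so does the middle one; \<open>conv\<close> and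
    \<open>central\<close> then close the circle of equivalences.\<close>
  hence sandwich: "?N \<subseteq> ?T" "?T \<subseteq> ?S"
    using closure_subset_strong_star_closure strong_star_closure_subset by blast+
  have conv: "h \<in> center M" if "?N = ?T"
    using center_of_closure_meets_center[OF assms] strong_star_closure_meets_center[OF assms inf] that by simp
  show "?N \<inter> center M \<noteq> {} \<longleftrightarrow> h \<in> center M"
    using center_of_closure_meets_center[OF assms] central by blast
  show "h \<in> center M \<longleftrightarrow> ?N = ?S" "?N = ?S \<longleftrightarrow> ?N = ?T"
    using central conv sandwich by blast+
qed

end
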